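(* Assume (A1)–(A3) from the context, and let $\mathbb{Z}_s(f)=\mathbb{Z}(s,f)$ be a Kiefer–Müller process indexed by $(0,1]\times\mathcal{F}$. Write $\dot\phi\,\mathbb{Z}_s$ for $\dot\phi$ evaluated at the map $f\mapsto \mathbb{Z}_s(f)$. Then the following hold. (1) Let $N_\varepsilon=\sup\{n:\|\phi(P_n)-\phi(P)\|_{\mathcal{E}}>\varepsilon\}$. Then, as $\varepsilon\to0^+$, $$\varepsilon^2N_\varepsilon\ \text{ converges weakly (Hoffmann-J\o rgensen sense) to }\ \|\dot\phi\,\mathbb{Z}_s\|_{(0,1]\times\mathcal{E}}^2 .$$ (2) Let $\hat\theta_n$ be a sequence of estimators with values in $l^\infty(\mathcal{E})$ which converges outer almost surely to $\theta\in l^\infty(\mathcal{E})$, and let $N_\varepsilon=\sup\{n:\|\hat\theta_n-\theta\|_{\mathcal{E}}>\varepsilon\}$. Assume that $\hat\theta_n=\phi(P_n)+R_n$, where $\sqrt{m}\,\sup_{n\ge m}\|R_n\|_{\mathcal{E}}=o_{P^*}(1)$ as $m\to\infty$. Then, as $\varepsilon\to0^+$, $$\varepsilon^2N_\varepsilon\ \text{ converges weakly (Hoffmann-J\o rgensen sense) to }\ \|\dot\phi\,\mathbb{Z}_s\|_{(0,1]\times\mathcal{E}}^2 .$$ In both cases, $(s,e)\mapsto\dot\phi\,\mathbb{Z}_s(e)$ is a zero mean Gaussian process. If $\mathbb{D}_0$ is a linear space, then its covariance function has the product structure $$\mathbb{E}\,\big[\dot\phi\,\mathbb{Z}_{s_1}(e_1)\,\dot\phi\,\mathbb{Z}_{s_2}(e_2)\big]=(s_1\wedge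 s_2)\,\mathbb{E}\,\big[\dot\phi W^\circ(e_1)\,\dot\phi W^\circ(e_2)\big],$$ where $W^\circ$ is a $P$-Brownian bridge on $\mathcal{F}$.
   Context: For a set $T$, $l^\infty(T)$ is the space of bounded real functions on $T$ with the uniform norm $\|z\|_T=\sup_{t\in T}|z(t)|$; in particular $\|\dot\phi\,\mathbb{Z}_s\|_{(0,1]\times\mathcal{E}}=\sup_{s\in(0,1],e\in\mathcal{E}}|\dot\phi(\mathbb{Z}_s)(e)|$. Standing assumptions: (A1) $X_1,X_2,\ldots$ is an i.i.d. sequence with distribution $P$ on a metric space $\mathcal{X}$, and $\mathcal{F}$ is a class of measurable, square-integrable functions $\mathcal{X}\to\mathbb{R}$. $P_n=\frac1n\sum_{i=1}^n\delta_{X_i}$ is the empirical distribution; $P_n$ and $P$ are viewed as elements of $l^\infty(\mathcal{F})$ via $P_n(f)=\frac1n\sum_{i\le n}f(X_i)$ and $P(f)=\int f\,dP$. (A2) $\mathcal{F}$ is $P$-Donsker (that is, $\sqrt n(P_n-P)$ converges weakly in $l^\infty(\mathcal{F})$, in the Hoffmann-Jørgensen sense, to a tight $P$-Brownian bridge), and $\sup_{x\in\mathcal{X}}\sup_{f\in\mathcal{F}}|f(x)-Pf|<\infty$. (A3) $\mathcal{E}$ is a set and $\phi:\mathbb{D}_\phi\subseteq\mathbb{D}=l^\infty(\mathcal{F})\to l^\infty(\mathcal{E})$ is Hadamard-differentiable at $P$ tangentially to $\mathbb{D}_0\subseteq\mathbb{D}$: there is a continuous linear map $\dot\phi:\mathbb{D}_0\to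 l^\infty(\mathcal{E})$ such that $\lim_{n\to\infty}\|t_n^{-1}(\phi(P+t_nh_n)-\phi(P))-\dot\phi(h)\|_{\mathcal{E}}=0$ for all nonzero real sequences $t_n\to0$ and all $h_n\to h$ in $\mathbb{D}$ with $h\in\mathbb{D}_0$ and $P+t_nh_n\in\mathbb{D}_\phi$ for every $n$. It is implicit that $P$ and all $P_n$ lie in $\mathbb{D}_\phi$ and that the processes to which $\dot\phi$ is applied have paths in $\mathbb{D}_0$. A $P$-Brownian bridge on $\mathcal{F}$ is a tight mean zero Gaussian process $W^\circ$ in $l^\infty(\mathcal{F})$ with covariance $\mathrm{Cov}(W^\circ(f),W^\circ(g))=P(fg)-Pf\,Pg$. A Kiefer–Müller process on $(0,1]\times\mathcal{F}$ is a tight mean zero Gaussian process $\mathbb{Z}$ with $\mathrm{Cov}(\mathbb{Z}(s,f),\mathbb{Z}(t,g))=(s\wedge t)(P(fg)-Pf\,Pg)$. $P^*$ denotes outer probability, $P^*(B)=\inf\{P(A):A\supset B,\ A\text{ measurable}\}$, and $o_{P^*}(1)$ denotes convergence to zero in outer probability. Measurability of $\phi(P_n)$, $\hat\theta_n$ or $N_\varepsilon$ is not assumed.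
   Formalization: The tangent set D_0 is assumed to contain 0 (automatic if D_0 is a linear space; the claim can fail otherwise), and for non-linear D_0 a continuous linear map on D_0 means the restriction of a continuous linear map on the linear span of D_0. *)

theory Defs
  imports "HOL-Probability.Probability"
begin

section \<open>The space of bounded functions on a set\<close>

text \<open>
  Bounded continuous functions on a discrete space are just bounded functions, so
  \<open>'t discrete \<Rightarrow>\<^sub>C real\<close> is the Banach space of all bounded real functions on
  the type \<open>'t\<close> with the uniform norm. The space of bounded functions on a set \<open>T\<close> is its closed
  subspace of functions that vanish off \<open>T\<close>; the norm is then the supremum over \<open>T\<close>
  (see \<open>norm_linf\<close>).
\<close>

type_synonym 't bfun = "'t discrete \<Rightarrow>\<^sub>C real"

abbreviation bapp :: "'t bfun \<Rightarrow> 't \<Rightarrow> real" where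
  "bapp z t \<equiv> apply_bcontfun z (discrete t)"

definition linf :: "'t set \<Rightarrow> 't bfun set" where
  "linf T = {z. \<forall>t. t \<notin> T \<longrightarrow> bapp z t = 0}"

text \<open>The element of \<open>linf T\<close> given by a function \<open>g\<close>; meaningful if \<open>g\<close> is bounded on \<open>T\<close>.\<close>

definition to_linf :: "'t set \<Rightarrow> ('t \<Rightarrow> real) \<Rightarrow> 't bfun" where
  "to_linf T g = Bcontfun (\<lambda>d. if of_discrete d \<in> T then g (of_discrete d) else 0)"

lemma bapp_to_linf:
  assumes "bounded (g ` T)"
  shows "bapp (to_linf T g) t = (if t \<in> T then g t else 0)"
proof -
  let ?G = "\<lambda>d. if of_discrete d \<in> T then g (of_discrete d) else (0::real)"
  have "range ?G \<subseteq> insert 0 (g ` T)"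
    by auto
  then have "bounded (range ?G)"
    using assms bounded_subset bounded_insert by metis
  moreover have "continuous_on UNIV ?G"
    by (rule continuous_on_open_vimage[THEN iffD2]) (auto simp: open_discrete)
  ultimately have "?G \<in> bcontfun"
    by (simp add: bcontfun_def)
  then show ?thesis
    by (simp add: to_linf_def Bcontfun_inverse discrete_inverse)
qed

lemma to_linf_in_linf: "bounded (g ` T) \<Longrightarrow> to_linf T g \<in> linf T"
  by (simp add: linf_def bapp_to_linf)

lemma subspace_linf: "subspace (linf T)"
  by (auto simp: linf_def subspace_def)

lemma norm_linf:
  fixes T :: "'t set"
  assumes "z \<in> linf T" "T \<noteq> {}"
  shows "norm z = (SUP t\<in>T. \<bar>bapp z t\<bar>)"
proof (rule antisym)
  have bdd: "bdd_above ((\<lambda>t. \<bar>bapp z t\<bar>) ` T)"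
    using norm_bounded[of z] by (auto intro!: bdd_aboveI[of _ "norm z"])
  obtain t0 where t0: "t0 \<in> T"
    using assms(2) by blast
  have pos: "0 \<le> (SUP t\<in>T. \<bar>bapp z t\<bar>)"
    by (rule order_trans[OF abs_ge_zero cSUP_upper[OF t0 bdd]])
  show "norm z \<le> (SUP t\<in>T. \<bar>bapp z t\<bar>)"
  proof (rule norm_bound)
    fix d :: "'t discrete"
    obtain t where d: "d = discrete t"
      by (metis of_discrete_inverse)
    show "norm (apply_bcontfun z d) \<le> (SUP t\<in>T. \<bar>bapp z t\<bar>)"
    proof (cases "t \<in> T")
      case True
      then show ?thesis
        using cSUP_upper[OF True bdd] d by simp
    next
      case False
      then show ?thesis
        using assms(1) d pos by (simp add: linf_def)
    qed
  qed
  show "(SUP t\<in>T. \<bar>bapp z t\<bar>) \<le> norm z"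
    using norm_bounded[of z] assms(2) by (auto intro!: cSUP_least)
qed

section \<open>Hoffmann-Jorgensen weak convergence and outer modes of convergence\<close>

text \<open>
  Only applied to bounded \<open>f\<close>. For these, truncating an extended-real majorant at an upper bound
  of \<open>f\<close> shows that real integrable majorants suffice.
\<close>

definition outer_expectation :: "'w measure \<Rightarrow> ('w \<Rightarrow> real) \<Rightarrow> real" where
  "outer_expectation M f =
     Inf {(\<integral>\<omega>. U \<omega> \<partial>M) | U. integrable M U \<and> (\<forall>\<omega>\<in>space M. f \<omega> \<le> U \<omega>)}"

text \<open>
  Weak convergence, along the filter \<open>G\<close>, of arbitrary (possibly nonmeasurable) maps \<open>Y i\<close> from
  the probability space \<open>M\<close> into the topological subspace \<open>S\<close> to a Borel measurable random element
  \<open>L\<close> of \<open>S\<close> that lives on a probability space \<open>N\<close>.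
\<close>

definition weak_conv_HJ ::
  "'b::topological_space set \<Rightarrow> 'w measure \<Rightarrow> ('i \<Rightarrow> 'w \<Rightarrow> 'b) \<Rightarrow> 'i filter
     \<Rightarrow> 'v measure \<Rightarrow> ('v \<Rightarrow> 'b) \<Rightarrow> bool" where
  "weak_conv_HJ S M Y G N L \<longleftrightarrow>
     (\<forall>i. \<forall>\<omega>\<in>space M. Y i \<omega> \<in> S) \<and>
     L \<in> measurable N (restrict_space borel S) \<and>
     (\<forall>g :: 'b \<Rightarrow> real. continuous_on S g \<and> bounded (g ` S) \<longrightarrow>
        ((\<lambda>i. outer_expectation M (\<lambda>\<omega>. g (Y i \<omega>))) \<longlongrightarrow> (\<integral>x. g (L x) \<partial>N)) G)"

definition measurable_cover :: "'w measure \<Rightarrow> ('w \<Rightarrow> ennreal) \<Rightarrow> ('w \<Rightarrow> ennreal) \<Rightarrow> bool" where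
  "measurable_cover M Y U \<longleftrightarrow>
     U \<in> borel_measurable M \<and> (\<forall>\<omega>\<in>space M. Y \<omega> \<le> U \<omega>) \<and>
     (\<forall>V\<in>borel_measurable M. (AE \<omega> in M. Y \<omega> \<le> V \<omega>) \<longrightarrow> (AE \<omega> in M. U \<omega> \<le> V \<omega>))"

definition outer_as_tendsto ::
  "'w measure \<Rightarrow> (nat \<Rightarrow> 'w \<Rightarrow> 'b::metric_space) \<Rightarrow> 'b \<Rightarrow> bool" where
  "outer_as_tendsto M Y y \<longleftrightarrow>
     (\<exists>\<Delta>. (\<forall>n. measurable_cover M (\<lambda>\<omega>. ennreal (dist (Y n \<omega>) y)) (\<Delta> n)) \<and>
          (AE \<omega> in M. (\<lambda>n. \<Delta> n \<omega>) \<longlonglongrightarrow> 0))"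

definition outer_prob_tendsto_0 :: "'w measure \<Rightarrow> (nat \<Rightarrow> 'w \<Rightarrow> ennreal) \<Rightarrow> bool" where
  "outer_prob_tendsto_0 M Y \<longleftrightarrow>
     (\<forall>\<delta>>0. (\<lambda>n. outer_measure_of M {\<omega> \<in> space M. Y n \<omega> > ennreal \<delta>}) \<longlonglongrightarrow> 0)"

section \<open>Gaussian processes, Brownian bridges and Kiefer-Mueller processes\<close>

text \<open>Degenerate (constant) normal variables are allowed.\<close>

definition gaussian_rv :: "'v measure \<Rightarrow> ('v \<Rightarrow> real) \<Rightarrow> bool" where
  "gaussian_rv N Y \<longleftrightarrow> Y \<in> borel_measurable N \<and>
     (\<exists>m. (AE x in N. Y x = m) \<or> (\<exists>\<sigma>>0. distributed N lborel Y (normal_density m \<sigma>)))"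

definition gaussian_process :: "'t set \<Rightarrow> 'v measure \<Rightarrow> ('t \<Rightarrow> 'v \<Rightarrow> real) \<Rightarrow> bool" where
  "gaussian_process T N X \<longleftrightarrow>
     (\<forall>I c. finite I \<and> I \<subseteq> T \<longrightarrow> gaussian_rv N (\<lambda>x. \<Sum>t\<in>I. c t * X t x))"

definition zero_mean_gaussian_process :: "'t set \<Rightarrow> 'v measure \<Rightarrow> ('t \<Rightarrow> 'v \<Rightarrow> real) \<Rightarrow> bool" where
  "zero_mean_gaussian_process T N X \<longleftrightarrow>
     gaussian_process T N X \<and> (\<forall>t\<in>T. (\<integral>x. X t x \<partial>N) = 0)"

definition tight_element :: "'b::topological_space set \<Rightarrow> 'v measure \<Rightarrow> ('v \<Rightarrow> 'b) \<Rightarrow> bool" where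
  "tight_element S N W \<longleftrightarrow>
     W \<in> measurable N borel \<and> (\<forall>x\<in>space N. W x \<in> S) \<and>
     (\<forall>\<epsilon>>0. \<exists>K. compact K \<and> K \<subseteq> S \<and> measure N {x \<in> space N. W x \<in> K} \<ge> 1 - \<epsilon>)"

definition brownian_bridge ::
  "'x measure \<Rightarrow> ('x \<Rightarrow> real) set \<Rightarrow> 'v measure \<Rightarrow> ('v \<Rightarrow> ('x \<Rightarrow> real) bfun) \<Rightarrow> bool" where
  "brownian_bridge P F N W \<longleftrightarrow>
     prob_space N \<and> tight_element (linf F) N W \<and>
     zero_mean_gaussian_process F N (\<lambda>f x. bapp (W x) f) \<and>
     (\<forall>f\<in>F. \<forall>g\<in>F. (\<integral>x. bapp (W x) f * bapp (W x) g \<partial>N) =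
        (\<integral>y. f y * g y \<partial>P) - (\<integral>y. f y \<partial>P) * (\<integral>y. g y \<partial>P))"

definition kiefer_mueller ::
  "'x measure \<Rightarrow> ('x \<Rightarrow> real) set \<Rightarrow> 'v measure \<Rightarrow> ('v \<Rightarrow> (real \<times> ('x \<Rightarrow> real)) bfun) \<Rightarrow> bool" where
  "kiefer_mueller P F N Z \<longleftrightarrow>
     prob_space N \<and> tight_element (linf ({0<..1} \<times> F)) N Z \<and>
     zero_mean_gaussian_process ({0<..1} \<times> F) N (\<lambda>sf x. bapp (Z x) sf) \<and>
     (\<forall>s\<in>{0<..1}. \<forall>t\<in>{0<..1}. \<forall>f\<in>F. \<forall>g\<in>F.
        (\<integral>x. bapp (Z x) (s, f) * bapp (Z x) (t, g) \<partial>N) =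
        min s t * ((\<integral>y. f y * g y \<partial>P) - (\<integral>y. f y \<partial>P) * (\<integral>y. g y \<partial>P)))"

text \<open>The section \<open>f \<mapsto> z (s, f)\<close> of an element \<open>z\<close> of \<open>linf ({0<..1} \<times> F)\<close>.\<close>

definition slice :: "('x \<Rightarrow> real) set \<Rightarrow> (real \<times> ('x \<Rightarrow> real)) bfun \<Rightarrow> real \<Rightarrow> ('x \<Rightarrow> real) bfun" where
  "slice F z s = to_linf F (\<lambda>f. bapp z (s, f))"

section \<open>Empirical distributions and Donsker classes\<close>

definition true_dist :: "('x \<Rightarrow> real) set \<Rightarrow> 'x measure \<Rightarrow> ('x \<Rightarrow> real) bfun" where
  "true_dist F P = to_linf F (\<lambda>f. \<integral>y. f y \<partial>P)"

text \<open>Empirical distribution of the first \<open>n\<close> terms \<open>x 0, \<dots>, x (n - 1)\<close> of the sequence \<open>x\<close>.\<close>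

definition emp_dist :: "('x \<Rightarrow> real) set \<Rightarrow> (nat \<Rightarrow> 'x) \<Rightarrow> nat \<Rightarrow> ('x \<Rightarrow> real) bfun" where
  "emp_dist F x n = to_linf F (\<lambda>f. (\<Sum>i<n. f (x i)) / real n)"

text \<open>
  Being \<open>P\<close>-Donsker is a property of the class \<open>F\<close> and the law \<open>P\<close>: as usual in empirical process
  theory, the outer expectations in its definition are taken on the infinite product space, the
  observations being the coordinate projections. The limit may be taken to live on a probability
  space over the type of \<open>linf F\<close> itself, namely its own law.
\<close>

definition donsker :: "'x measure \<Rightarrow> ('x \<Rightarrow> real) set \<Rightarrow> bool" where
  "donsker P F \<longleftrightarrow>
     (\<exists>(N :: ('x \<Rightarrow> real) bfun measure) W. brownian_bridge P F N W \<and>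
        weak_conv_HJ (linf F) (PiM UNIV (\<lambda>_::nat. P))
          (\<lambda>n x. sqrt (real n) *\<^sub>R (emp_dist F x n - true_dist F P)) sequentially N W)"

section \<open>Hadamard differentiability\<close>

text \<open>
  The tangent set \<open>D0\<close> need not be a linear space. A continuous linear map on \<open>D0\<close> is then the
  restriction of a continuous linear map on the linear span of \<open>D0\<close>; if \<open>D0\<close> is a subspace the
  span is \<open>D0\<close> itself. Outside the span the values of \<open>L\<close> are irrelevant: every linear map on a
  subspace has a (not necessarily continuous) linear extension.
\<close>

definition continuous_linear_on ::
  "'a::real_normed_vector set \<Rightarrow> ('a \<Rightarrow> 'b::real_normed_vector) \<Rightarrow> bool" where
  "continuous_linear_on D0 T \<longleftrightarrow>
     (\<exists>L. linear L \<and> continuous_on (span D0) L \<and> (\<forall>h\<in>D0. L h = T h))"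

definition hadamard_differentiable ::
  "'a::real_normed_vector set \<Rightarrow> 'b::real_normed_vector set \<Rightarrow> 'a set \<Rightarrow> ('a \<Rightarrow> 'b) \<Rightarrow> 'a
     \<Rightarrow> 'a set \<Rightarrow> ('a \<Rightarrow> 'b) \<Rightarrow> bool" where
  "hadamard_differentiable D E D\<phi> \<phi> p D0 \<phi>' \<longleftrightarrow>
     D\<phi> \<subseteq> D \<and> \<phi> ` D\<phi> \<subseteq> E \<and> p \<in> D\<phi> \<and> D0 \<subseteq> D \<and> \<phi>' ` D0 \<subseteq> E \<and>
     continuous_linear_on D0 \<phi>' \<and>
     (\<forall>(t :: nat \<Rightarrow> real) h h0.
        (\<forall>n. t n \<noteq> 0) \<and> t \<longlonglongrightarrow> 0 \<and> (\<forall>n. h n \<in> D) \<and> h \<longlonglongrightarrow> h0 \<and> h0 \<in> D0 \<and>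
        (\<forall>n. p + t n *\<^sub>R h n \<in> D\<phi>) \<longrightarrow>
        (\<lambda>n. norm ((1 / t n) *\<^sub>R (\<phi> (p + t n *\<^sub>R h n) - \<phi> p) - \<phi>' h0)) \<longlonglongrightarrow> 0)"

section \<open>The last time an estimator is off by more than epsilon\<close>

text \<open>
  The supremum is taken in \<open>[0, \<infinity>]\<close>, with value 0 if the set of times is empty and \<open>\<infinity>\<close> if it
  is unbounded. The topology of \<open>[0, \<infinity>)\<close> is its subspace topology in \<open>ennreal\<close>.
\<close>

definition last_time :: "(nat \<Rightarrow> 'b::real_normed_vector) \<Rightarrow> 'b \<Rightarrow> real \<Rightarrow> ennreal" where
  "last_time est \<theta> \<epsilon> = (SUP n\<in>{n. 1 \<le> n \<and> norm (est n - \<theta>) > \<epsilon>}. of_nat n)"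

definition sq_sup ::
  "('x \<Rightarrow> real) set \<Rightarrow> 'e set \<Rightarrow> (('x \<Rightarrow> real) bfun \<Rightarrow> 'e bfun)
     \<Rightarrow> (real \<times> ('x \<Rightarrow> real)) bfun \<Rightarrow> ennreal" where
  "sq_sup F E \<phi>' z = (SUP (s, e)\<in>{0<..1} \<times> E. ennreal \<bar>bapp (\<phi>' (slice F z s)) e\<bar>)\<^sup>2"

end

theory Submission
  imports Defs
begin

text \<open>
  The last time \<open>N\<^sub>\<epsilon>\<close> is at least \<open>m\<close> iff the deviation exceeds \<open>\<epsilon>\<close> at some \<open>n \<ge> m\<close>. With \<open>m\<close> of order
  \<open>y / \<epsilon>\<^sup>2\<close>, the event \<open>\<epsilon>\<^sup>2 N\<^sub>\<epsilon> \<ge> y\<close> thus says that \<open>sqrt m\<close> times the supremum over \<open>n \<ge> m\<close> of the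
  deviations is at least \<open>sqrt y\<close>. Indexed by \<open>s = m / n\<close>, the process \<open>sqrt m (P\<^sub>n - P)\<close>, \<open>n \<ge> m\<close>, has the
  covariance of a Kiefer-Mueller process in the limit. Its finite-dimensional distributions
  converge by the central limit theorem, and the maximal inequalities of Ottaviani and Hoffmann-Jorgensen
  turn the asymptotic equicontinuity of \<open>sqrt n (P\<^sub>n - P)\<close> into that of the whole process.
  Hadamard differentiability, uniform in \<open>s\<close> along regular limit paths, then gives the limit of the
  rescaled deviations by an extended continuous mapping argument, first for the tails of the
  supremum and hence for \<open>\<epsilon>\<^sup>2 N\<^sub>\<epsilon>\<close>.

  Gaussianity of a continuous linear image is not immediate, because nonseparability rules out an
  argument by finite linear combinations: it follows from the rotation invariance of the law of two
  independent copies of the process, read off from the functional equation of the characteristic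
  function.
\<close>

section \<open>Outer probability bounds\<close>

text \<open>Suprema over \<open>F\<close> are not measurable, nor are the first passage times of the
  sums, so stopping-time arguments do not apply directly. Every estimate is therefore an upper bound
  witnessed by one measurable superset, and first passage is replaced by the first time at which the
  conditional probability of such a superset, given the coordinates seen so far, reaches 1/2; this
  is a genuine stopping time. Iterated, the maximal inequality gives tails
  \<open>(1 / 2) ^ (2 ^ i)\<close> at level \<open>3 ^ i\<close>. They beat the order
  \<open>9 ^ i\<close> of time blocks on which increments must be controlled, and they are summable
  over the blocks \<open>9 ^ j\<close>, which handles all large \<open>n\<close>, that is
  \<open>s\<close> near 0, at once. There the limit path tends to 0, and \<open>0 \<in> D0\<close>
  enters because a sequence of times \<open>s\<close> may converge to 0. The same estimates, passed
  to the limit, yield the regularity of the paths of the Kiefer-Mueller process in \<open>s\<close>.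
  The scaled last time lives in \<open>[0, \<infinity>]\<close>, and its weak convergence is reduced
  to outer bounds for closed upper and closed lower rays at positive levels.\<close>

definition ocover :: "'a measure \<Rightarrow> 'a set \<Rightarrow> real \<Rightarrow> bool" where
  "ocover M A p \<longleftrightarrow> (\<exists>B\<in>sets M. A \<inter> space M \<subseteq> B \<and> measure M B \<le> p)"

lemma ocoverI: "B \<in> sets M \<Longrightarrow> A \<inter> space M \<subseteq> B \<Longrightarrow> measure M B \<le> p \<Longrightarrow> ocover M A p"
  by (auto simp: ocover_def)

lemma ocover_mono: "ocover M A p \<Longrightarrow> A' \<inter> space M \<subseteq> A \<Longrightarrow> p \<le> p' \<Longrightarrow> ocover M A' p'"
  unfolding ocover_def by (meson Int_lower2 Int_subset_iff dual_order.trans)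

lemma ocover_empty: "0 \<le> p \<Longrightarrow> ocover M {} p"
  by (rule ocoverI[of "{}"]) auto

text \<open>A cover of mass below 1 cannot be the whole space. This turns bounds on several bad
  events into one sample point that avoids them all.\<close>

lemma ocover_nonfull:
  assumes "ocover M A p" "p < 1" "prob_space M"
  shows "\<exists>x\<in>space M. x \<notin> A"
proof -
  interpret prob_space M by fact
  obtain B where B: "B \<in> sets M" "A \<inter> space M \<subseteq> B" "measure M B \<le> p"
    using assms(1) by (auto simp: ocover_def)
  have "B \<noteq> space M"
    using B(3) assms(2) prob_space by auto
  then show ?thesis
    using B sets.sets_into_space by fastforce
qed

lemma ocover_UN_finite:
  assumes "prob_space M" "finite I" "\<And>i. i \<in> I \<Longrightarrow> ocover M (A i) (p i)"
  shows "ocover M (\<Union>i\<in>I. A i) (\<Sum>i\<in>I. p i)"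
proof -
  interpret prob_space M by fact
  have "\<exists>B. B \<in> sets M \<and> A i \<inter> space M \<subseteq> B \<and> measure M B \<le> p i" if "i \<in> I" for i
    using assms(3)[OF that] by (auto simp: ocover_def)
  then obtain B where B: "\<And>i. i \<in> I \<Longrightarrow> B i \<in> sets M"
    "\<And>i. i \<in> I \<Longrightarrow> A i \<inter> space M \<subseteq> B i" "\<And>i. i \<in> I \<Longrightarrow> measure M (B i) \<le> p i"
    by metis
  have "measure M (\<Union>i\<in>I. B i) \<le> (\<Sum>i\<in>I. measure M (B i))"
    using assms(2) B(1) by (intro finite_measure_subadditive_finite) auto
  also have "\<dots> \<le> (\<Sum>i\<in>I. p i)"
    by (intro sum_mono B)
  finally show ?thesis
    using assms(2) B by (intro ocoverI[of "\<Union>i\<in>I. B i"]) auto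
qed

lemma ocover_Un:
  assumes "prob_space M" "ocover M A p" "ocover M B q"
  shows "ocover M (A \<union> B) (p + q)"
  using ocover_UN_finite[OF assms(1), of "{True, False}" "\<lambda>b. if b then A else B" "\<lambda>b. if b then p else q"]
    assms(2,3) by (simp add: Un_commute)

lemma ocover_UN_suminf:
  assumes "prob_space M" "\<And>i::nat. ocover M (A i) (p i)" "summable p"
  shows "ocover M (\<Union>i. A i) (\<Sum>i. p i)"
proof -
  interpret prob_space M by fact
  obtain B where B: "\<And>i. B i \<in> sets M" "\<And>i. A i \<inter> space M \<subseteq> B i" "\<And>i. measure M (B i) \<le> p i"
    using assms(2) unfolding ocover_def by metis
  have s: "summable (\<lambda>i. measure M (B i))"
    by (rule summable_comparison_test'[OF assms(3), of 0]) (simp add: B)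
  have "measure M (\<Union>i. B i) \<le> (\<Sum>i. measure M (B i))"
    using B(1) s by (intro finite_measure_subadditive_countably) auto
  also have "\<dots> \<le> (\<Sum>i. p i)"
    by (intro suminf_le B s assms)
  finally show ?thesis
    using B by (intro ocoverI[of "\<Union>i. B i"]) auto
qed

text \<open>The preimage of a measurable cover is a measurable cover of the preimage with the same
  mass. Outer probability itself may drop under such a pullback, but upper bounds survive, and so
  estimates on the product space pass to the given sample.\<close>

lemma ocover_vimage:
  assumes "f \<in> measurable M N" "distr M N f = N" "ocover N A p" "prob_space M"
  shows "ocover M {x. f x \<in> A} p"
proof -
  obtain B where B: "B \<in> sets N" "A \<inter> space N \<subseteq> B" "measure N B \<le> p"
    using assms(3) by (auto simp: ocover_def)
  have "measure M (f -` B \<inter> space M) = measure N B"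
    using measure_distr[OF assms(1) B(1)] assms(2) by simp
  then show ?thesis
    using B measurable_space[OF assms(1)] measurable_sets[OF assms(1) B(1)]
    by (intro ocoverI[of "f -` B \<inter> space M"]) auto
qed

lemma ocover_measurable:
  assumes "prob_space M" "A \<in> sets M" "ocover M A p"
  shows "measure M A \<le> p"
proof -
  interpret prob_space M by fact
  obtain B where B: "B \<in> sets M" "A \<inter> space M \<subseteq> B" "measure M B \<le> p"
    using assms(3) by (auto simp: ocover_def)
  have "A \<subseteq> B"
    using B(2) sets.sets_into_space[OF assms(2)] by blast
  then show ?thesis
    using finite_measure_mono[OF \<open>A \<subseteq> B\<close> B(1)] B(3) by linarith
qed

text \<open>Markov's inequality for a nearly optimal integrable majorant. The upper bound
  \<open>b\<close> makes the set of majorants nonempty, so that the infimum is approached.\<close>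

lemma ocover_outer_expectation:
  assumes "prob_space M" "outer_expectation M f < c" "\<And>x. x \<in> space M \<Longrightarrow> 0 \<le> f x"
    "\<And>x. x \<in> space M \<Longrightarrow> f x \<le> b"
  shows "ocover M {x. 1 \<le> f x} c"
proof -
  interpret prob_space M by fact
  let ?A = "{(\<integral>\<omega>. U \<omega> \<partial>M) | U. integrable M U \<and> (\<forall>\<omega>\<in>space M. f \<omega> \<le> U \<omega>)}"
  have "(\<integral>\<omega>. b \<partial>M) \<in> ?A"
    using assms(4) by (auto intro!: exI[of _ "\<lambda>_. b"])
  then have "\<exists>a\<in>?A. a < c"
    using assms(2) unfolding outer_expectation_def by (intro cInf_lessD) auto
  then obtain U where U: "integrable M U" "\<And>\<omega>. \<omega> \<in> space M \<Longrightarrow> f \<omega> \<le> U \<omega>" "(\<integral>\<omega>. U \<omega> \<partial>M) < c"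
    by blast
  have pos: "\<And>\<omega>. \<omega> \<in> space M \<Longrightarrow> 0 \<le> U \<omega>"
    using U(2) assms(3) order_trans by blast
  have "measure M {\<omega>\<in>space M. U \<omega> \<ge> 1} \<le> (\<integral>\<omega>. U \<omega> \<partial>M) / 1"
    using U(1) pos by (intro integral_Markov_inequality_measure[where A="{}"]) auto
  then show ?thesis
    using U by (intro ocoverI[of "{\<omega>\<in>space M. U \<omega> \<ge> 1}"]) (auto intro: order_trans)
qed

section \<open>Maximal inequalities for sums of independent terms\<close>

definition partial_sum :: "('x \<Rightarrow> 'b::real_normed_vector) \<Rightarrow> (nat \<Rightarrow> 'x) \<Rightarrow> nat \<Rightarrow> 'b" where
  "partial_sum g x n = (\<Sum>i<n. g (x i))"

definition shift_seq :: "nat \<Rightarrow> (nat \<Rightarrow> 'x) \<Rightarrow> nat \<Rightarrow> 'x" where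
  "shift_seq k x i = x (k + i)"

lemma shift_comb_seq [simp]: "shift_seq k (comb_seq k x y) = y"
  by (auto simp: shift_seq_def comb_seq_def)

lemma comb_seq_comb_seq: "j \<le> k \<Longrightarrow> comb_seq j (comb_seq k x y) z = comb_seq j x z"
  by (auto simp: comb_seq_def)

lemma partial_sum_0 [simp]: "partial_sum g x 0 = 0"
  by (simp add: partial_sum_def)

lemma partial_sum_add: "partial_sum g x (k + m) = partial_sum g x k + partial_sum g (shift_seq k x) m"
  by (induction m) (simp_all add: partial_sum_def shift_seq_def)

lemma partial_sum_diff: "k \<le> n \<Longrightarrow> partial_sum g x n - partial_sum g x k = partial_sum g (shift_seq k x) (n - k)"
  using partial_sum_add[of g x k "n - k"] by simp

lemma partial_sum_comb_seq_le: "j \<le> k \<Longrightarrow> partial_sum g (comb_seq k x y) j = partial_sum g x j"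
  unfolding partial_sum_def by (intro sum.cong) (auto simp: comb_seq_less)

lemma partial_sum_comb_seq:
  "k \<le> n \<Longrightarrow> partial_sum g (comb_seq k x y) n = partial_sum g x k + partial_sum g y (n - k)"
  using partial_sum_add[of g "comb_seq k x y" k "n - k"] by (simp add: partial_sum_comb_seq_le)

lemma norm_partial_sum_le:
  assumes "\<And>x. norm (g x) \<le> B"
  shows "norm (partial_sum g x n) \<le> n * B"
proof -
  have "norm (partial_sum g x n) \<le> (\<Sum>i<n. B)"
    unfolding partial_sum_def by (rule sum_norm_le) (simp add: assms)
  then show ?thesis by simp
qed

section \<open>Heads and tails of an independent sequence; maximal inequalities\<close>

locale iid_space = prob_space P for P :: "'x measure" +
  assumes space_eq_UNIV: "space P = UNIV"
begin

sublocale sequence_space P ..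

lemma space_S: "space S = UNIV"
  by (simp add: space_PiM space_eq_UNIV)

sublocale SS: pair_prob_space S S ..

lemma measurable_shift_seq [measurable]: "shift_seq k \<in> measurable S S"
  by (rule measurable_PiM_single') (auto simp: shift_seq_def space_eq_UNIV)

text \<open>A version of the conditional probability of \<open>D\<close> given the first
  \<open>k\<close> coordinates: the head is kept from \<open>x\<close>, the tail is integrated
  out.\<close>

definition head_cond :: "nat \<Rightarrow> (nat \<Rightarrow> 'x) set \<Rightarrow> (nat \<Rightarrow> 'x) \<Rightarrow> real" where
  "head_cond k D x = measure S {y. comb_seq k x y \<in> D}"

lemma sets_comb_seq_section [measurable]: "D \<in> sets S \<Longrightarrow> {y. comb_seq k x y \<in> D} \<in> sets S"
proof -
  assume D: "D \<in> sets S"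
  have "(\<lambda>y. comb_seq k x y) \<in> measurable S S"
    by (rule measurable_comb_seq') (auto simp: space_S)
  from measurable_sets[OF this D] show ?thesis
    by (simp add: space_S vimage_def)
qed

lemma sets_comb_seq_vimage: "D \<in> sets S \<Longrightarrow> {z. comb_seq k (fst z) (snd z) \<in> D} \<in> sets (S \<Otimes>\<^sub>M S)"
  using measurable_sets[OF measurable_comb_seq[of k P], of D]
  by (simp add: space_pair_measure space_S vimage_def case_prod_unfold)

lemma head_cond_measurable [measurable]: "D \<in> sets S \<Longrightarrow> head_cond k D \<in> borel_measurable S"
proof -
  assume "D \<in> sets S"
  then have "(\<lambda>x. measure S (Pair x -` {z. comb_seq k (fst z) (snd z) \<in> D})) \<in> borel_measurable S"
    using P.measurable_emeasure_Pair[OF sets_comb_seq_vimage]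
    unfolding measure_def by measurable
  then show ?thesis
    by (simp add: head_cond_def[abs_def] vimage_def)
qed

lemma emeasure_comb_seq:
  "D \<in> sets S \<Longrightarrow> emeasure S D = (\<integral>\<^sup>+ x. emeasure S {y. comb_seq k x y \<in> D} \<partial>S)"
proof -
  assume D: "D \<in> sets S"
  have "emeasure S D = emeasure (distr (S \<Otimes>\<^sub>M S) S (\<lambda>(\<omega>, \<omega>'). comb_seq k \<omega> \<omega>')) D"
    by (simp add: PiM_comb_seq)
  also have "\<dots> = emeasure (S \<Otimes>\<^sub>M S) {z. comb_seq k (fst z) (snd z) \<in> D}"
    using D measurable_comb_seq[of k P]
    by (subst emeasure_distr) (auto simp: space_pair_measure space_S vimage_def case_prod_unfold)
  also have "\<dots> = (\<integral>\<^sup>+ x. emeasure S (Pair x -` {z. comb_seq k (fst z) (snd z) \<in> D}) \<partial>S)"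
    using D by (intro P.emeasure_pair_measure_alt sets_comb_seq_vimage)
  finally show ?thesis
    by (simp add: vimage_def)
qed

text \<open>Membership depends on the first \<open>k\<close> coordinates only, which replaces
  measurability with respect to the sigma-algebra they generate.\<close>

definition head_set :: "nat \<Rightarrow> (nat \<Rightarrow> 'x) set \<Rightarrow> bool" where
  "head_set k A \<longleftrightarrow> (\<forall>x y. comb_seq k x y \<in> A \<longleftrightarrow> x \<in> A)"

text \<open>Independence of head and tail, by Fubini for the splitting of the sequence at
  \<open>k\<close>: after replacing the tail by \<open>y\<close>, the event \<open>A\<close> sees
  only \<open>x\<close> and the shifted sequence is \<open>y\<close>.\<close>

lemma prob_head_shift:
  assumes A: "A \<in> sets S" "head_set k A" and D: "D \<in> sets S"
  shows "measure S (A \<inter> {x. shift_seq k x \<in> D}) = measure S A * measure S D"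
proof -
  have sD: "{x. shift_seq k x \<in> D} \<in> sets S"
    using measurable_sets[OF measurable_shift_seq D] by (simp add: space_S vimage_def)
  have "emeasure S (A \<inter> {x. shift_seq k x \<in> D}) =
      (\<integral>\<^sup>+ x. emeasure S {y. comb_seq k x y \<in> A \<inter> {x. shift_seq k x \<in> D}} \<partial>S)"
    using A sD by (intro emeasure_comb_seq) auto
  also have "\<dots> = (\<integral>\<^sup>+ x. emeasure S D * indicator A x \<partial>S)"
    using A(2) by (intro nn_integral_cong) (auto simp: head_set_def indicator_def)
  also have "\<dots> = emeasure S D * emeasure S A"
    using A(1) by (simp add: nn_integral_cmult_indicator)
  finally show ?thesis
    by (simp add: measure_def enn2real_mult mult.commute)
qed

text \<open>Integrate over the tail first: for a head in \<open>A\<close> at least half of all tails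
  lead into \<open>D\<close>, and none of them leaves \<open>A\<close>.\<close>

lemma head_set_prob_le:
  assumes A: "A \<in> sets S" "head_set k A" and D: "D \<in> sets S"
    and h: "\<And>x. x \<in> A \<Longrightarrow> 1 / 2 \<le> head_cond k D x"
  shows "measure S A \<le> 2 * measure S (A \<inter> D)"
proof -
  have "emeasure S (A \<inter> D) = (\<integral>\<^sup>+ x. emeasure S {y. comb_seq k x y \<in> A \<inter> D} \<partial>S)"
    using A D by (intro emeasure_comb_seq) auto
  also have "\<dots> \<ge> (\<integral>\<^sup>+ x. ennreal (1 / 2) * indicator A x \<partial>S)"
  proof (intro nn_integral_mono)
    fix x
    show "ennreal (1 / 2) * indicator A x \<le> emeasure S {y. comb_seq k x y \<in> A \<inter> D}"
    proof (cases "x \<in> A")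
      case True
      then have "{y. comb_seq k x y \<in> A \<inter> D} = {y. comb_seq k x y \<in> D}"
        using A(2) by (auto simp: head_set_def)
      with True h[OF True] show ?thesis
        by (simp add: head_cond_def emeasure_eq_measure ennreal_leI del: ennreal_half)
    qed auto
  qed
  finally have "ennreal (1 / 2) * emeasure S A \<le> emeasure S (A \<inter> D)"
    using A(1) by (simp add: nn_integral_cmult_indicator)
  then have "ennreal (1 / 2 * measure S A) \<le> ennreal (measure S (A \<inter> D))"
    by (subst ennreal_mult) (auto simp: emeasure_eq_measure simp del: ennreal_half)
  then show ?thesis
    by (subst (asm) ennreal_le_iff) auto
qed

text \<open>The event that \<open>k\<close> is the first time at which the conditional probability
  of \<open>D\<close> reaches 1/2. It substitutes for the first passage of the partial sums over a
  level, which need not be measurable, and it is decided by the first \<open>k\<close>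
  coordinates.\<close>

definition crossing :: "(nat \<Rightarrow> 'x) set \<Rightarrow> nat \<Rightarrow> (nat \<Rightarrow> 'x) set" where
  "crossing D k = {x. 1 / 2 \<le> head_cond k D x \<and> (\<forall>j<k. head_cond j D x < 1 / 2)}"

lemma sets_crossing: "D \<in> sets S \<Longrightarrow> crossing D k \<in> sets S"
proof -
  assume [measurable]: "D \<in> sets S"
  have "{x \<in> space S. 1 / 2 \<le> head_cond k D x \<and> (\<forall>j\<in>{..<k}. head_cond j D x < 1 / 2)} \<in> sets S"
    by measurable
  then show ?thesis
    by (simp add: crossing_def space_S Ball_def)
qed

lemma head_set_crossing: "head_set k (crossing D k)"
  by (auto simp: head_set_def crossing_def head_cond_def comb_seq_comb_seq)

lemma disjoint_crossing: "disjoint_family (crossing D)"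
  unfolding disjoint_family_on_def crossing_def by (auto simp: not_less) (metis linorder_neqE_nat not_less)

lemma crossing_exists:
  "1 / 2 \<le> head_cond k D x \<Longrightarrow> \<exists>j\<le>k. x \<in> crossing D j"
proof -
  assume h: "1 / 2 \<le> head_cond k D x"
  define j where "j = (LEAST j. 1 / 2 \<le> head_cond j D x)"
  have "1 / 2 \<le> head_cond j D x" "j \<le> k"
    unfolding j_def by (rule LeastI[of "\<lambda>j. 1 / 2 \<le> head_cond j D x", OF h], rule Least_le[of "\<lambda>j. 1 / 2 \<le> head_cond j D x", OF h])
  moreover have "head_cond i D x < 1 / 2" if "i < j" for i
    using not_less_Least[of i "\<lambda>j. 1 / 2 \<le> head_cond j D x"] that by (simp add: j_def not_le)
  ultimately show ?thesis
    by (auto simp: crossing_def)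
qed

text \<open>Doob's inequality for the conditional probabilities of \<open>D\<close> given the first coordinates.\<close>

lemma sum_crossing_le:
  assumes "D \<in> sets S"
  shows "(\<Sum>k\<le>n. measure S (crossing D k)) \<le> 2 * measure S D"
proof -
  have "(\<Sum>k\<le>n. measure S (crossing D k)) \<le> (\<Sum>k\<le>n. 2 * measure S (crossing D k \<inter> D))"
    using assms by (intro sum_mono head_set_prob_le[OF sets_crossing head_set_crossing])
      (auto simp: crossing_def)
  also have "\<dots> = 2 * measure S (\<Union>k\<in>{..n}. crossing D k \<inter> D)"
    using assms disjoint_crossing[of D] unfolding sum_distrib_left[symmetric]
    by (subst measure_finite_Union[where A = "\<lambda>k. crossing D k \<inter> D"]) 
      (auto simp: disjoint_family_on_def emeasure_eq_measure intro!: sets.Int sets_crossing)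
  also have "\<dots> \<le> 2 * measure S D"
    using assms by (intro mult_left_mono finite_measure_mono) auto
  finally show ?thesis .
qed

text \<open>If the sum at time \<open>k\<close> exceeds \<open>a + b\<close>, then with probability
  at least 1/2 the independent remainder stays within \<open>b\<close> and the sum at time
  \<open>n\<close> exceeds \<open>a\<close>. So the conditional probability of a cover
  \<open>D\<close> of the event at time \<open>n\<close> has reached 1/2 by time \<open>k\<close>,
  and Doob's inequality bounds the chance of such a crossing by \<open>2 * p\<close>.\<close>

lemma ottaviani:
  fixes g :: "'x \<Rightarrow> 'b::real_normed_vector" and q :: "'b \<Rightarrow> real"
  assumes q: "\<And>x y. q (x + y) \<le> q x + q y" "\<And>x. q (- x) = q x"
    and n: "ocover S {x. q (partial_sum g x n) > a} p"
    and k: "\<And>k. k \<le> n \<Longrightarrow> ocover S {x. q (partial_sum g x k) > b} (1 / 2)"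
  shows "ocover S {x. \<exists>k\<le>n. q (partial_sum g x k) > a + b} (2 * p)"
proof -
  obtain D where D: "D \<in> sets S" "{x. q (partial_sum g x n) > a} \<subseteq> D" "measure S D \<le> p"
    using n by (auto simp: ocover_def space_S)
  have "\<exists>j\<le>n. x \<in> crossing D j" if "k \<le> n" "q (partial_sum g x k) > a + b" for x k
  proof -
    \<comment> \<open>The remainder consists of \<open>n - k\<close> fresh terms, so the hypothesis
      is used for the index \<open>n - k\<close> in place of \<open>k\<close>.\<close>
    obtain B where B: "B \<in> sets S" "{x. q (partial_sum g x (n - k)) > b} \<subseteq> B" "measure S B \<le> 1 / 2"
      using k[of "n - k"] by (auto simp: ocover_def space_S)
    have "space S - B \<subseteq> {y. comb_seq k x y \<in> D}"
    proof
      fix y assume "y \<in> space S - B"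
      then have "q (partial_sum g y (n - k)) \<le> b"
        using B(2) by (meson DiffD2 mem_Collect_eq not_less subsetD)
      moreover have "q (partial_sum g x k) \<le> q (partial_sum g (comb_seq k x y) n) + q (partial_sum g y (n - k))"
        using q(1)[of "partial_sum g (comb_seq k x y) n" "- partial_sum g y (n - k)"] q(2) that(1)
        by (simp add: partial_sum_comb_seq)
      ultimately have "q (partial_sum g (comb_seq k x y) n) > a"
        using that(2) by linarith
      then show "y \<in> {y. comb_seq k x y \<in> D}"
        using D(2) by auto
    qed
    then have "1 - measure S B \<le> head_cond k D x"
      unfolding head_cond_def prob_compl[OF B(1), symmetric]
      using D by (intro finite_measure_mono) auto
    then have "1 / 2 \<le> head_cond k D x"
      using B(3) by linarith
    then show ?thesis
      using crossing_exists that(1) order_trans by metis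
  qed
  moreover have "measure S (\<Union>j\<in>{..n}. crossing D j) \<le> (\<Sum>j\<le>n. measure S (crossing D j))"
    using D by (intro finite_measure_subadditive_finite) (auto simp: sets_crossing)
  ultimately show ?thesis
    using sum_crossing_le[OF D(1), of n] D
    by (intro ocoverI[of "\<Union>j\<in>{..n}. crossing D j"]) (fastforce intro!: sets.finite_UN sets_crossing)+
qed

text \<open>At the crossing time \<open>j\<close> of a cover \<open>D\<close> the sum is still at
  most \<open>t + B\<close>, since the level \<open>t\<close> has been passed by at most one term.
  To exceed \<open>2 * t + B\<close> later, the terms after \<open>j\<close> must build up more than
  \<open>t\<close> on their own. That is again an event inside \<open>D\<close>, for the shifted
  sequence, and it is independent of the crossing: the crossings cost \<open>2 * p\<close>, the new
  event \<open>p\<close>.\<close>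

lemma hoffmann_jorgensen:
  fixes g :: "'x \<Rightarrow> 'b::real_normed_vector"
  assumes B: "\<And>x. norm (g x) \<le> B" and t: "0 \<le> t"
    and n: "ocover S {x. \<exists>k\<le>n. norm (partial_sum g x k) > t} p"
  shows "ocover S {x. \<exists>k\<le>n. norm (partial_sum g x k) > 2 * t + B} (2 * p\<^sup>2)"
proof -
  obtain D where D: "D \<in> sets S" "{x. \<exists>k\<le>n. norm (partial_sum g x k) > t} \<subseteq> D" "measure S D \<le> p"
    using n by (auto simp: ocover_def space_S)
  define T where "T = (\<lambda>j. crossing D j \<inter> {x. shift_seq j x \<in> D})"
  have sT: "T j \<in> sets S" for j
    using measurable_sets[OF measurable_shift_seq D(1), of j] sets_crossing[OF D(1), of j]
    by (simp add: T_def space_S vimage_def)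
  have "x \<in> (\<Union>j\<in>{..n}. T j)" if i: "i \<le> n" "norm (partial_sum g x i) > 2 * t + B" for x i
  proof -
    have B0: "0 \<le> B"
      using B[of undefined] norm_ge_zero order_trans by blast
    define k where "k = (LEAST k. norm (partial_sum g x k) > t)"
    have ex: "norm (partial_sum g x i) > t"
      using i t B0 by linarith
    have k: "norm (partial_sum g x k) > t" and ki: "k \<le> i"
      unfolding k_def using ex by (auto intro: LeastI Least_le)
    have lt: "norm (partial_sum g x l) \<le> t" if "l < k" for l
      using not_less_Least[of l "\<lambda>k. norm (partial_sum g x k) > t"] that by (simp add: k_def not_less)
    have k0: "k \<noteq> 0"
      using k t by (cases "k = 0") auto
    have "norm (partial_sum g x k) \<le> norm (partial_sum g x (k - 1)) + norm (g (x (k - 1)))"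
      using k0 norm_triangle_ineq by (cases k) (auto simp: partial_sum_def)
    then have kB: "norm (partial_sum g x k) \<le> t + B"
      using lt[of "k - 1"] k0 B[of "x (k - 1)"] by auto
    \<comment> \<open>The first \<open>k\<close> terms alone already put the sequence into
      \<open>D\<close>, so the conditional probability is 1 and a crossing has happened at or before
      the first passage.\<close>
    have "comb_seq k x y \<in> D" for y
      using D(2) k ki i(1) by (auto simp: partial_sum_comb_seq_le intro!: subsetD[OF D(2)] exI[of _ k])
    then have "head_cond k D x = 1"
      using P.prob_space by (simp add: head_cond_def space_S)
    then obtain j where j: "j \<le> k" "x \<in> crossing D j"
      using crossing_exists[of k D x] by auto
    have jB: "norm (partial_sum g x j) \<le> t + B"
      using lt[of j] kB j(1) B0 by (cases "j = k") auto
    have ji: "j \<le> i"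
      using j ki by simp
    have "norm (partial_sum g x i - partial_sum g x j) > t"
      using i(2) jB norm_triangle_ineq2[of "partial_sum g x i" "partial_sum g x j"] by linarith
    then have "shift_seq j x \<in> D"
      using i(1) ji D(2) by (auto simp: partial_sum_diff intro!: subsetD[OF D(2)] exI[of _ "i - j"])
    then show ?thesis
      using j ji i(1) by (auto simp: T_def intro!: bexI[of _ j])
  qed
  moreover have "measure S (\<Union>j\<in>{..n}. T j) \<le> 2 * p\<^sup>2"
  proof -
    have p: "0 \<le> p"
      using D(3) measure_nonneg order_trans by blast
    have "measure S (\<Union>j\<in>{..n}. T j) \<le> (\<Sum>j\<le>n. measure S (T j))"
      by (intro finite_measure_subadditive_finite) (auto simp: sT)
    also have "\<dots> = (\<Sum>j\<le>n. measure S (crossing D j) * measure S D)"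
      unfolding T_def using D by (intro sum.cong refl prob_head_shift sets_crossing head_set_crossing) auto
    also have "\<dots> = (\<Sum>j\<le>n. measure S (crossing D j)) * measure S D"
      by (simp add: sum_distrib_right)
    also have "\<dots> \<le> (2 * measure S D) * measure S D"
      by (intro mult_right_mono sum_crossing_le D) auto
    also have "\<dots> \<le> (2 * p) * p"
      using D(3) p by (intro mult_mono) auto
    finally show ?thesis
      by (simp add: power2_eq_square)
  qed
  ultimately show ?thesis
    by (intro ocoverI[of "\<Union>j\<in>{..n}. T j"]) (auto intro!: sets.finite_UN sT)
qed

end

section \<open>Growth and decay estimates; reversal of time\<close>

lemma eventually_le_mult_sqrt:
  assumes "0 < (e::real)"
  shows "\<forall>\<^sub>F n in sequentially. c \<le> e * sqrt (real n)"
proof -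
  have "filterlim (\<lambda>n. e * sqrt (real n)) at_top sequentially"
    by (rule filterlim_tendsto_pos_mult_at_top[OF tendsto_const assms])
       (rule filterlim_compose[OF sqrt_at_top filterlim_real_sequentially])
  then show ?thesis
    by (simp add: filterlim_at_top)
qed

lemma eventually_le_mult_nat:
  assumes "0 < (e::real)"
  shows "\<forall>\<^sub>F n in sequentially. c \<le> e * real n"
proof -
  have "filterlim (\<lambda>n. e * real n) at_top sequentially"
    by (rule filterlim_tendsto_pos_mult_at_top[OF tendsto_const assms filterlim_real_sequentially])
  then show ?thesis
    by (simp add: filterlim_at_top)
qed

lemma half_power_double_exp_le: "(1 / 2 :: real) ^ (2 ^ k) \<le> (1 / 2) ^ Suc k"
proof (rule power_decreasing)
  show "Suc k \<le> 2 ^ k"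
    by (induction k) auto
qed auto

text \<open>From \<open>i = 5\<close> on, \<open>2 ^ i\<close> is at least \<open>5 * i\<close>, so
  the second factor is at most \<open>(1 / 32) ^ i\<close>, and \<open>9 / 32 < 1\<close>. The
  factor \<open>9 ^ i\<close> is the order of the number of blocks in
  \<open>increment_bound\<close>.\<close>

lemma double_exp_decay:
  assumes "0 < (\<eta>::real)" "0 \<le> A"
  shows "\<exists>i. (A * 9 ^ i + 1) * (1 / 2) ^ (2 ^ i) < \<eta>"
proof -
  have le: "5 * i \<le> 2 ^ i" if "5 \<le> i" for i :: nat
    using that by (induction i rule: dec_induct) auto
  have "(\<lambda>i. (A + 1) * (9 / 32 :: real) ^ i) \<longlonglongrightarrow> (A + 1) * 0"
    by (intro tendsto_intros LIMSEQ_realpow_zero) auto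
  then have "\<forall>\<^sub>F i in sequentially. (A + 1) * (9 / 32 :: real) ^ i < \<eta>"
    using assms(1) by (intro order_tendstoD) auto
  then have "\<forall>\<^sub>F i in sequentially. 5 \<le> i \<and> (A + 1) * (9 / 32 :: real) ^ i < \<eta>"
    by (intro eventually_conj eventually_ge_at_top)
  then obtain i where i: "5 \<le> i" "(A + 1) * (9 / 32 :: real) ^ i < \<eta>"
    using eventually_happens[of _ sequentially] by auto
  have "A * 9 ^ i + 1 \<le> (A + 1) * (9::real) ^ i"
    using one_le_power[of "9::real" i] by (simp add: algebra_simps)
  then have "(A * 9 ^ i + 1) * (1 / 2) ^ (2 ^ i) \<le> ((A + 1) * 9 ^ i) * (1 / 2) ^ (5 * i)"
    using le[OF i(1)] assms(2) by (intro mult_mono power_decreasing) auto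
  also have "\<dots> = (A + 1) * (9 / 32) ^ i"
    by (simp add: power_mult power_divide)
  finally show ?thesis
    using i(2) by (intro exI[of _ i]) linarith
qed

text \<open>
  With \<open>n = \<lceil>m / s\<rceil>\<close>, the indices \<open>n \<ge> m\<close> correspond to \<open>s \<in> (0, 1]\<close>. Time runs backwards, which is
  why the limit is a Kiefer-Mueller process again.
\<close>

definition rev_index :: "nat \<Rightarrow> real \<Rightarrow> nat" where
  "rev_index m s = nat \<lceil>real m / s\<rceil>"

text \<open>For \<open>g\<close> the centred point mass at \<open>x\<close> this is
  \<open>sqrt m\<close> times the deviation of the empirical distribution at sample size
  \<open>rev_index m s\<close>.\<close>

definition rev_mean :: "('x \<Rightarrow> 'b::real_normed_vector) \<Rightarrow> nat \<Rightarrow> real \<Rightarrow> (nat \<Rightarrow> 'x) \<Rightarrow> 'b" where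
  "rev_mean g m s x = (sqrt (real m) / real (rev_index m s)) *\<^sub>R partial_sum g x (rev_index m s)"

lemma rev_index_ge: "0 < s \<Longrightarrow> real m / s \<le> real (rev_index m s)"
  unfolding rev_index_def by (metis of_nat_nat real_nat_ceiling_ge)

lemma rev_index_less: "0 < s \<Longrightarrow> real (rev_index m s) < real m / s + 1"
proof -
  assume "0 < s"
  then have "0 \<le> \<lceil>real m / s\<rceil>"
    by (simp add: ceiling_le_iff order_less_le_trans[of "-1" 0])
  then show ?thesis
    unfolding rev_index_def by (simp add: ceiling_correct) linarith
qed

lemma rev_index_ge_self: "0 < s \<Longrightarrow> s \<le> 1 \<Longrightarrow> m \<le> rev_index m s"
proof -
  assume s: "0 < s" "s \<le> 1"
  have "real m * s \<le> real m * 1"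
    using s by (intro mult_left_mono) auto
  then have "real m \<le> real m / s"
    using s by (simp add: field_simps)
  then show ?thesis
    using rev_index_ge[OF s(1), of m] by linarith
qed

lemma rev_index_mono: "0 < s \<Longrightarrow> s \<le> t \<Longrightarrow> rev_index m t \<le> rev_index m s"
  unfolding rev_index_def by (intro nat_mono ceiling_mono divide_left_mono) auto

lemma rev_index_surj: "1 \<le> m \<Longrightarrow> m \<le> n \<Longrightarrow> \<exists>s\<in>{0<..1}. rev_index m s = n"
  by (rule bexI[of _ "real m / real n"]) (auto simp: rev_index_def)

section \<open>Tails and increments of partial sums\<close>

context iid_space
begin

text \<open>The shift preserves the product law; this is the independence of head and tail for the
  trivial head event \<open>UNIV\<close>.\<close>

lemma ocover_shift: "ocover S A p \<Longrightarrow> ocover S {x. shift_seq k x \<in> A} p"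
proof -
  assume "ocover S A p"
  then obtain B where B: "B \<in> sets S" "A \<subseteq> B" "measure S B \<le> p"
    by (auto simp: ocover_def space_S)
  have "measure S {x. shift_seq k x \<in> B} = measure S B"
    using prob_head_shift[of UNIV k B] B(1) P.prob_space sets.top[of S]
    by (simp add: head_set_def space_S)
  then show ?thesis
    using B measurable_sets[OF measurable_shift_seq B(1), of k]
    by (intro ocoverI[of "{x. shift_seq k x \<in> B}"]) (auto simp: space_S vimage_def)
qed

text \<open>Ottaviani's inequality with both levels equal to \<open>\<epsilon> * sqrt n\<close>. Its
  second hypothesis holds for large \<open>k\<close> because \<open>sqrt k \<le> sqrt n\<close> and
  \<open>\<eta> \<le> 1 / 2\<close>; for the finitely many small \<open>k\<close> the sums are
  bounded, hence eventually below \<open>\<epsilon> * sqrt n\<close>. A general \<open>q\<close> is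
  kept since both the norm and an oscillation seminorm will be inserted.\<close>

lemma max_partial_sum_bound:
  fixes g :: "'x \<Rightarrow> 'b::real_normed_vector" and q :: "'b \<Rightarrow> real"
  assumes q: "\<And>x y. q (x + y) \<le> q x + q y" "\<And>x. q (- x) = q x" "\<And>z. q z \<le> C * norm z" "0 \<le> C"
    and B: "\<And>x. norm (g x) \<le> B" and \<epsilon>: "0 < \<epsilon>" "\<eta> \<le> 1 / 2"
    and n: "\<forall>\<^sub>F n in sequentially. ocover S {x. q (partial_sum g x n) > \<epsilon> * sqrt n} \<eta>"
  shows "\<forall>\<^sub>F n in sequentially. ocover S {x. \<exists>k\<le>n. q (partial_sum g x k) > 2 * \<epsilon> * sqrt n} (2 * \<eta>)"
proof -
  have B0: "0 \<le> B"
    using B[of undefined] norm_ge_zero order_trans by blast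
  obtain n0 where n0: "\<And>n. n \<ge> n0 \<Longrightarrow> ocover S {x. q (partial_sum g x n) > \<epsilon> * sqrt n} \<eta>"
    using n by (auto simp: eventually_sequentially)
  have "\<forall>\<^sub>F n in sequentially. n0 \<le> n \<and> C * (n0 * B) \<le> \<epsilon> * sqrt n"
    by (intro eventually_conj eventually_ge_at_top eventually_le_mult_sqrt \<epsilon>)
  then show ?thesis
  proof eventually_elim
    case (elim n)
    have "ocover S {x. \<exists>k\<le>n. q (partial_sum g x k) > \<epsilon> * sqrt n + \<epsilon> * sqrt n} (2 * \<eta>)"
    proof (rule ottaviani[OF q(1,2) n0])
      fix k assume "k \<le> n"
      show "ocover S {x. q (partial_sum g x k) > \<epsilon> * sqrt n} (1 / 2)"
      proof (cases "n0 \<le> k")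
        case True
        have "\<epsilon> * sqrt k \<le> \<epsilon> * sqrt n"
          using \<open>k \<le> n\<close> \<epsilon> by simp
        then show ?thesis
          using \<epsilon>(2) by (intro ocover_mono[OF n0[OF True]]) (auto dest: le_less_trans)
      next
        case False
        have "q (partial_sum g x k) \<le> \<epsilon> * sqrt n" for x
        proof -
          have "norm (partial_sum g x k) \<le> real k * B"
            by (rule norm_partial_sum_le[OF B])
          also have "\<dots> \<le> real n0 * B"
            using False B0 by (intro mult_right_mono) auto
          finally have "norm (partial_sum g x k) \<le> real n0 * B" .
          then have "C * norm (partial_sum g x k) \<le> C * (real n0 * B)"
            using q(4) by (rule mult_left_mono)
          then show ?thesis
            using q(3)[of "partial_sum g x k"] elim by linarith
        qed
        then have "{x. q (partial_sum g x k) > \<epsilon> * sqrt n} = {}"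
          by (auto simp: not_less)
        then show ?thesis
          by (simp add: ocover_empty)
      qed
    qed (use elim in auto)
    then show ?case
      by (simp add: mult.assoc)
  qed
qed

text \<open>Iteration of the Hoffmann-Jorgensen inequality. Once the level \<open>t\<close> exceeds
  the size \<open>B\<close> of a single term, \<open>2 * t + B \<le> 3 * t\<close>: the level
  triples while the probability is essentially squared.\<close>

lemma max_partial_sum_tail:
  fixes g :: "'x \<Rightarrow> 'b::real_normed_vector"
  assumes B: "\<And>x. norm (g x) \<le> B" and c: "0 < c"
    and n: "\<forall>\<^sub>F n in sequentially. ocover S {x. norm (partial_sum g x n) > c * sqrt n} (1 / 8)"
  shows "\<exists>c'>0. \<forall>\<^sub>F n in sequentially. \<forall>i.
    ocover S {x. \<exists>k\<le>n. norm (partial_sum g x k) > 3 ^ i * c' * sqrt n} ((1 / 2) ^ (2 ^ i))"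
proof (intro exI[of _ "2 * c"] conjI)
  have "\<forall>\<^sub>F n in sequentially. ocover S {x. \<exists>k\<le>n. norm (partial_sum g x k) > 2 * c * sqrt n} (2 * (1 / 8))"
    by (rule max_partial_sum_bound[where q=norm and C=1, OF _ _ _ _ B c _ n]) (auto simp: norm_triangle_ineq)
  moreover have "\<forall>\<^sub>F n in sequentially. B \<le> (2 * c) * sqrt n"
    using c by (intro eventually_le_mult_sqrt) auto
  ultimately show "\<forall>\<^sub>F n in sequentially. \<forall>i.
    ocover S {x. \<exists>k\<le>n. norm (partial_sum g x k) > 3 ^ i * (2 * c) * sqrt n} ((1 / 2) ^ (2 ^ i))"
  proof eventually_elim
    case (elim n)
    \<comment> \<open>The additional factor 1/2 makes the recursion
      \<open>p \<mapsto> 2 * p\<^sup>2\<close> exact. For \<open>i = 0\<close> the value is 1/4,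
      which is twice the assumed 1/8.\<close>
    have "ocover S {x. \<exists>k\<le>n. norm (partial_sum g x k) > 3 ^ i * (2 * c) * sqrt n} (1 / 2 * (1 / 2) ^ (2 ^ i))" for i
    proof (induction i)
      case 0
      then show ?case
        using elim(1) by simp
    next
      case (Suc i)
      let ?t = "3 ^ i * (2 * c) * sqrt n"
      have t: "0 \<le> ?t"
        using c by simp
      have "1 * ((2 * c) * sqrt n) \<le> 3 ^ i * ((2 * c) * sqrt n)"
        using c by (intro mult_right_mono) auto
      then have Bt: "B \<le> ?t"
        using elim(2) by (simp add: mult.assoc)
      have p: "2 * (1 / 2 * (1 / 2 :: real) ^ (2 ^ i))\<^sup>2 = 1 / 2 * (1 / 2) ^ (2 ^ Suc i)"
      proof -
        have "(2::nat) ^ Suc i = 2 ^ i + 2 ^ i"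
          by simp
        then have "(1 / 2 :: real) ^ (2 ^ Suc i) = (1 / 2) ^ (2 ^ i) * (1 / 2) ^ (2 ^ i)"
          by (simp only: power_add)
        then show ?thesis
          by (simp only: power2_eq_square)
      qed
      show ?case
      proof (rule ocover_mono[OF hoffmann_jorgensen[OF B t Suc]])
        have "2 * ?t + B \<le> 3 ^ Suc i * (2 * c) * sqrt n"
          using Bt by (simp add: mult_ac)
        then show "{x. \<exists>k\<le>n. norm (partial_sum g x k) > 3 ^ Suc i * (2 * c) * sqrt n} \<inter> space S
          \<subseteq> {x. \<exists>k\<le>n. norm (partial_sum g x k) > 2 * ?t + B}"
          using le_less_trans by blast
      qed (use p in simp)
    qed
    from ocover_mono[OF this Int_lower1] show ?case
      by simp
  qed
qed (use c in auto)

end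

text \<open>The assumption \<open>tail\<close> is the conclusion of
  \<open>max_partial_sum_tail\<close>. These tails and the stationarity of the sequence are all that
  the estimates on late times and on increments rest on.\<close>

locale iid_sums = iid_space P for P :: "'x measure" +
  fixes g :: "'x \<Rightarrow> 'b::real_normed_vector" and c :: real and n0 :: nat
  assumes c: "0 < c"
    and tail: "n0 \<le> n \<Longrightarrow>
      ocover (PiM UNIV (\<lambda>_. P)) {x. \<exists>k\<le>n. norm (partial_sum g x k) > 3 ^ i * c * sqrt n} ((1 / 2) ^ (2 ^ i))"
begin

text \<open>Peeling: the times \<open>n \<ge> a\<close>, with \<open>a\<close> the least integer
  above \<open>m / \<delta>\<close>, are cut into blocks from \<open>9 ^ j * a\<close> to
  \<open>9 ^ Suc j * a\<close>. On block \<open>j\<close> a large weighted sum exceeds the level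
  \<open>3 ^ (j + i) * c\<close> relative to the square root of the right end of the block, and
  these probabilities sum to at most \<open>(1 / 2) ^ i\<close>.\<close>

lemma late_partial_sum_bound:
  assumes "0 < \<epsilon>" "0 < \<eta>"
  shows "\<exists>\<delta>>0. \<forall>\<^sub>F m in sequentially.
    ocover S {x. \<exists>n. real m / \<delta> \<le> real n \<and> sqrt m / n * norm (partial_sum g x n) > \<epsilon>} \<eta>"
proof -
  obtain i where i: "(1 / 2 :: real) ^ i < \<eta>"
    using real_arch_pow_inv[OF assms(2), of "1 / 2"] by auto
  \<comment> \<open>This makes \<open>sqrt a\<close> at least
    \<open>sqrt m * 3 ^ Suc i * c / \<epsilon>\<close>. One factor 3 in \<open>3 ^ Suc i\<close>
    pays for comparing with the right end of a block instead of its left end.\<close>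
  define \<delta> where "\<delta> = (\<epsilon> / (3 ^ Suc i * c))\<^sup>2"
  have \<delta>: "0 < \<delta>"
    using assms c by (simp add: \<delta>_def)
  have "\<forall>\<^sub>F m in sequentially. 1 \<le> m \<and> real n0 \<le> 1 / \<delta> * real m"
    using \<delta> by (intro eventually_conj eventually_ge_at_top eventually_le_mult_nat) auto
  then have "\<forall>\<^sub>F m in sequentially.
    ocover S {x. \<exists>n. real m / \<delta> \<le> real n \<and> sqrt m / n * norm (partial_sum g x n) > \<epsilon>} \<eta>"
  proof eventually_elim
    case (elim m)
    define a where "a = nat \<lceil>real m / \<delta>\<rceil>"
    have am: "real m / \<delta> \<le> real a"
      unfolding a_def by (simp add: of_nat_ceiling)
    have "0 < real m / \<delta>"
      using elim \<delta> by simp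
    then have a: "1 \<le> a" "n0 \<le> a"
      using elim am by auto
    define A where "A = (\<lambda>j. {x. \<exists>k\<le>9 ^ Suc j * a. norm (partial_sum g x k) > 3 ^ (j + i) * c * sqrt (real (9 ^ Suc j * a))})"
    have ocA: "ocover S (A j) ((1 / 2) ^ Suc i * (1 / 2) ^ j)" for j
    proof -
      have "1 * a \<le> 9 ^ Suc j * a"
        by (intro mult_right_mono) auto
      then have "n0 \<le> 9 ^ Suc j * a"
        using a by linarith
      from tail[OF this, of "j + i"] show ?thesis
        unfolding A_def
      proof (rule ocover_mono)
        show "(1 / 2 :: real) ^ 2 ^ (j + i) \<le> (1 / 2) ^ Suc i * (1 / 2) ^ j"
          using half_power_double_exp_le[of "j + i"] by (simp add: power_add mult_ac)
      qed auto
    qed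
    have sum: "summable (\<lambda>j. (1 / 2 :: real) ^ Suc i * (1 / 2) ^ j)"
      by (intro summable_mult summable_geometric) auto
    have val: "(\<Sum>j. (1 / 2 :: real) ^ Suc i * (1 / 2) ^ j) = (1 / 2) ^ i"
      by (subst suminf_mult) (auto simp: suminf_geometric summable_geometric)
    have "x \<in> (\<Union>j. A j)" if n: "real m / \<delta> \<le> real n" "sqrt m / n * norm (partial_sum g x n) > \<epsilon>" for x n
    proof -
      have an: "a \<le> n"
        using n(1) unfolding a_def by (simp add: nat_le_iff ceiling_le_iff)
      have ex: "n < 9 ^ Suc n * a"
      proof -
        have "n < 9 ^ Suc n"
          by (rule less_le_trans[OF power_gt_expt[of 9]]) auto
        also have "\<dots> \<le> 9 ^ Suc n * a"
          using a by simp
        finally show ?thesis .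
      qed
      \<comment> \<open>The block that contains \<open>n\<close>.\<close>
      define j where "j = (LEAST j. n < 9 ^ Suc j * a)"
      have j1: "n < 9 ^ Suc j * a"
        unfolding j_def by (rule LeastI[of "\<lambda>j. n < 9 ^ Suc j * a", OF ex])
      have j2: "9 ^ j * a \<le> n"
      proof (cases j)
        case 0
        then show ?thesis using an by simp
      next
        case (Suc j')
        then show ?thesis
          using not_less_Least[of j' "\<lambda>j. n < 9 ^ Suc j * a"] unfolding j_def[symmetric] by (simp add: not_less)
      qed
      have n1: "0 < real n"
        using an a by simp
      have m0: "0 < sqrt m"
        using elim by simp
      have "sqrt (real m / \<delta>) \<le> sqrt a"
        using am by simp
      then have "sqrt m * (3 ^ Suc i * c / \<epsilon>) \<le> sqrt a"
        using assms c by (simp add: real_sqrt_divide \<delta>_def)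
      then have "sqrt m * (3 ^ Suc i * c) \<le> \<epsilon> * sqrt a"
        using assms by (simp add: field_simps)
      then have "9 ^ j * sqrt a * (sqrt m * (3 ^ Suc i * c)) \<le> 9 ^ j * sqrt a * (\<epsilon> * sqrt a)"
        by (intro mult_left_mono) auto
      also have "\<dots> = \<epsilon> * (9 ^ j * real a)"
        by (simp add: algebra_simps)
      also have "\<dots> \<le> \<epsilon> * real n"
        using j2 assms of_nat_le_iff[of "9 ^ j * a" n, where 'a=real] by (intro mult_left_mono) auto
      also have "\<dots> < sqrt m * norm (partial_sum g x n)"
        using n(2) n1 by (simp add: field_simps)
      finally have "sqrt m * (9 ^ j * sqrt a * (3 ^ Suc i * c)) < sqrt m * norm (partial_sum g x n)"
        by (simp add: mult_ac)
      then have "9 ^ j * sqrt a * (3 ^ Suc i * c) < norm (partial_sum g x n)"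
        using m0 by (simp only: mult_less_cancel_left_pos)
      moreover have "sqrt (real (9 ^ Suc j * a)) = 3 ^ Suc j * sqrt a"
      proof -
        have "(9::real) ^ Suc j = (3 ^ Suc j)\<^sup>2"
          by (simp flip: power_mult) (simp add: power_mult mult.commute[of _ 2])
        then show ?thesis
          by (simp only: of_nat_mult of_nat_power of_nat_numeral real_sqrt_mult real_sqrt_abs) simp
      qed
      moreover have "(9::real) ^ j = 3 ^ j * 3 ^ j"
        by (simp flip: power_mult_distrib)
      ultimately have "3 ^ (j + i) * c * sqrt (real (9 ^ Suc j * a)) < norm (partial_sum g x n)"
        by (simp add: power_add mult_ac)
      then have "x \<in> A j"
        using j1 unfolding A_def by (auto intro!: exI[of _ n])
      then show ?thesis
        by blast
    qed
    then show ?case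
      using i val by (intro ocover_mono[OF ocover_UN_suminf[OF P.prob_space_axioms ocA sum]]) auto
  qed
  then show ?thesis
    using \<delta> by blast
qed

text \<open>The times up to \<open>K * m\<close> are covered by blocks of length \<open>b\<close>,
  comparable to \<open>\<kappa> * m\<close>. A short increment starting in one block ends within
  \<open>2 * b\<close> of the start of that block, so it is a difference of two early partial sums
  of the shifted sequence. The number of blocks is of order \<open>9 ^ i\<close>, against the
  probability \<open>(1 / 2) ^ (2 ^ i)\<close> for each.\<close>

lemma increment_bound:
  assumes "0 < \<epsilon>" "0 < \<eta>"
  shows "\<exists>\<kappa>>(0::real). \<forall>\<^sub>F m in sequentially.
    ocover S {x. \<exists>n n'. n \<le> n' \<and> n' \<le> K * m \<and> real (n' - n) \<le> \<kappa> * m \<and>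
      norm (partial_sum g x n' - partial_sum g x n) > \<epsilon> * sqrt m} \<eta>"
proof -
  obtain i where i: "(real K * 16 * c\<^sup>2 / \<epsilon>\<^sup>2 * 9 ^ i + 1) * (1 / 2) ^ (2 ^ i) < \<eta>"
    using double_exp_decay[OF assms(2), of "real K * 16 * c\<^sup>2 / \<epsilon>\<^sup>2"] by auto
  define y where "y = 3 ^ i * c"
  have y: "0 < y"
    using c by (simp add: y_def)
  \<comment> \<open>Since \<open>b \<le> 2 * \<kappa> * m\<close>, the level
    \<open>y * sqrt (2 * b)\<close> is at most \<open>2 * y * sqrt \<kappa> * sqrt m\<close>, which
    this choice turns into \<open>\<epsilon> / 2 * sqrt m\<close>, one half for each of the two
    sums.\<close>
  define \<kappa> where "\<kappa> = (\<epsilon> / (4 * y))\<^sup>2"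
  have \<kappa>: "0 < \<kappa>"
    using assms y by (simp add: \<kappa>_def)
  have y2: "y\<^sup>2 = 9 ^ i * c\<^sup>2"
    by (simp add: y_def power_mult_distrib power2_eq_square flip: power_mult_distrib)
  have sk: "sqrt \<kappa> = \<epsilon> / (4 * y)"
    using assms y by (simp add: \<kappa>_def)
  have Kk: "real K / \<kappa> = real K * 16 * c\<^sup>2 / \<epsilon>\<^sup>2 * 9 ^ i"
    using y y2 by (simp add: \<kappa>_def power_divide power_mult_distrib)
  have "\<forall>\<^sub>F m in sequentially. n0 \<le> \<kappa> * real m \<and> 1 \<le> \<kappa> * real m"
    using \<kappa> by (intro eventually_conj eventually_le_mult_nat) auto
  then have "\<forall>\<^sub>F m in sequentially.
    ocover S {x. \<exists>n n'. n \<le> n' \<and> n' \<le> K * m \<and> real (n' - n) \<le> \<kappa> * m \<and>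
      norm (partial_sum g x n' - partial_sum g x n) > \<epsilon> * sqrt m} \<eta>"
  proof eventually_elim
    case (elim m)
    define b where "b = nat \<lceil>\<kappa> * m\<rceil>"
    have b1: "\<kappa> * m \<le> b"
      unfolding b_def by (simp add: of_nat_ceiling)
    have b2: "b \<le> 2 * (\<kappa> * m)"
      using elim unfolding b_def by linarith
    have b0: "0 < b" "n0 \<le> b"
      using b1 elim by auto
    define L where "L = (K * m) div b"
    have "real L \<le> real (K * m) / real b"
      unfolding L_def by (rule of_nat_div_le_of_nat)
    also have "\<dots> \<le> real (K * m) / (\<kappa> * m)"
      using b1 elim by (intro divide_left_mono) auto
    also have "\<dots> = real K / \<kappa>"
      using elim by (cases "m = 0") auto
    finally have L: "real L \<le> real K / \<kappa>" .
    define A where "A = {x. \<exists>k\<le>2 * b. norm (partial_sum g x k) > 3 ^ i * c * sqrt (real (2 * b))}"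
    have "ocover S A ((1 / 2) ^ (2 ^ i))"
      unfolding A_def using b0 by (intro tail) auto
    then have oc: "ocover S (\<Union>l\<in>{..L}. {x. shift_seq (l * b) x \<in> A}) (\<Sum>l\<in>{..L}. (1 / 2) ^ (2 ^ i))"
      by (intro ocover_UN_finite P.prob_space_axioms ocover_shift) auto
    have "y * sqrt (2 * b) \<le> y * sqrt (4 * (\<kappa> * m))"
      using b2 y by (intro mult_left_mono real_sqrt_le_mono) auto
    also have "\<dots> = \<epsilon> / 2 * sqrt m"
      using y by (simp add: real_sqrt_mult sk)
    finally have yb: "3 ^ i * c * sqrt (real (2 * b)) \<le> \<epsilon> / 2 * sqrt m"
      by (simp add: y_def)
    show ?case
    proof (rule ocover_mono[OF oc])
      show "(\<Sum>l\<in>{..L}. (1 / 2 :: real) ^ (2 ^ i)) \<le> \<eta>"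
      proof -
        have "(\<Sum>l\<in>{..L}. (1 / 2 :: real) ^ (2 ^ i)) = (real L + 1) * (1 / 2) ^ (2 ^ i)"
          by simp
        also have "\<dots> \<le> (real K / \<kappa> + 1) * (1 / 2) ^ (2 ^ i)"
          using L by (intro mult_right_mono) auto
        finally show ?thesis
          using i unfolding Kk by linarith
      qed
      show "{x. \<exists>n n'. n \<le> n' \<and> n' \<le> K * m \<and> real (n' - n) \<le> \<kappa> * m \<and>
        norm (partial_sum g x n' - partial_sum g x n) > \<epsilon> * sqrt m} \<inter> space S
        \<subseteq> (\<Union>l\<in>{..L}. {x. shift_seq (l * b) x \<in> A})"
      proof safe
        fix x n n'
        assume n: "n \<le> n'" "n' \<le> K * m" "real (n' - n) \<le> \<kappa> * m"
          "norm (partial_sum g x n' - partial_sum g x n) > \<epsilon> * sqrt m"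
        define l where "l = n div b"
        have lL: "l \<le> L"
          unfolding l_def L_def using n by (intro div_le_mono) auto
        have ln: "l * b \<le> n" "n < l * b + b"
          using b0 mod_less_divisor[of b n] div_mult_mod_eq[of n b] unfolding l_def by linarith+
        have "n' - n \<le> b"
          using n(3) b1 by linarith
        then have k: "n - l * b \<le> 2 * b" "n' - l * b \<le> 2 * b"
          using ln n(1) by auto
        have "partial_sum g x n' - partial_sum g x n =
            partial_sum g (shift_seq (l * b) x) (n' - l * b) - partial_sum g (shift_seq (l * b) x) (n - l * b)"
          using ln n(1) by (simp flip: partial_sum_diff)
        then have "norm (partial_sum g x n' - partial_sum g x n) \<le>
            norm (partial_sum g (shift_seq (l * b) x) (n' - l * b)) + norm (partial_sum g (shift_seq (l * b) x) (n - l * b))"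
          by (simp add: norm_triangle_ineq4)
        then have "norm (partial_sum g (shift_seq (l * b) x) (n' - l * b)) > \<epsilon> / 2 * sqrt m \<or>
            norm (partial_sum g (shift_seq (l * b) x) (n - l * b)) > \<epsilon> / 2 * sqrt m"
          using n(4) by (auto simp: field_simps)
        then have "shift_seq (l * b) x \<in> A"
          using yb k unfolding A_def by (auto intro: le_less_trans)
        then show "x \<in> (\<Union>l\<in>{..L}. {x. shift_seq (l * b) x \<in> A})"
          using lL by auto
      qed
    qed
  qed
  then show ?thesis
    using \<kappa> by blast
qed

lemma max_bound:
  assumes "0 < \<eta>"
  shows "\<exists>y>0. \<forall>\<^sub>F n in sequentially. ocover S {x. \<exists>k\<le>n. norm (partial_sum g x k) > y * sqrt n} \<eta>"
proof -
  obtain i where i: "(1 / 2 :: real) ^ i < \<eta>"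
    using real_arch_pow_inv[OF assms, of "1 / 2"] by auto
  have "(1 / 2 :: real) ^ 2 ^ i \<le> (1 / 2) ^ i"
    by (intro power_decreasing less_imp_le[OF less_exp]) auto
  then have le: "(1 / 2 :: real) ^ 2 ^ i \<le> \<eta>"
    using i by linarith
  have "\<forall>\<^sub>F n in sequentially. n0 \<le> n"
    by (rule eventually_ge_at_top)
  then have "\<forall>\<^sub>F n in sequentially. ocover S {x. \<exists>k\<le>n. norm (partial_sum g x k) > (3 ^ i * c) * sqrt n} \<eta>"
    by eventually_elim (rule ocover_mono[OF tail[of _ i] _ le], auto)
  then show ?thesis
    using c by (intro exI[of _ "3 ^ i * c"]) auto
qed

text \<open>Times \<open>s \<le> \<delta>\<close> correspond to indices of at least
  \<open>m / \<delta>\<close>, the range of \<open>late_partial_sum_bound\<close>.\<close>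

lemma rev_mean_near_zero:
  assumes "0 < \<epsilon>" "0 < \<eta>"
  shows "\<exists>\<delta>>0. \<delta> \<le> 1 \<and> (\<forall>\<^sub>F m in sequentially.
    ocover S {x. \<exists>s\<in>{0<..\<delta>}. norm (rev_mean g m s x) > \<epsilon>} \<eta>)"
proof -
  obtain \<delta> where \<delta>: "0 < \<delta>" and ev: "\<forall>\<^sub>F m in sequentially.
    ocover S {x. \<exists>n. real m / \<delta> \<le> real n \<and> sqrt m / n * norm (partial_sum g x n) > \<epsilon>} \<eta>"
    using late_partial_sum_bound[OF assms] by blast
  have "\<forall>\<^sub>F m in sequentially. ocover S {x. \<exists>s\<in>{0<..min \<delta> 1}. norm (rev_mean g m s x) > \<epsilon>} \<eta>"
    using ev
  proof eventually_elim
    case (elim m)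
    show ?case
    proof (rule ocover_mono[OF elim])
      show "{x. \<exists>s\<in>{0<..min \<delta> 1}. norm (rev_mean g m s x) > \<epsilon>} \<inter> space S \<subseteq>
        {x. \<exists>n. real m / \<delta> \<le> real n \<and> sqrt m / n * norm (partial_sum g x n) > \<epsilon>}"
      proof clarsimp
        fix x s assume s: "\<epsilon> < norm (rev_mean g m s x)" "0 < s" "s \<le> \<delta>" "s \<le> 1"
        have "real m / \<delta> \<le> real m / s"
          using s \<delta> by (intro divide_left_mono) auto
        then have "real m / \<delta> \<le> rev_index m s"
          using rev_index_ge[OF s(2), of m] by linarith
        then show "\<exists>n. real m / \<delta> \<le> real n \<and> \<epsilon> < sqrt m * norm (partial_sum g x n) / n"
          using s(1) by (intro exI[of _ "rev_index m s"]) (simp add: rev_mean_def)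
      qed
    qed auto
  qed
  then show ?thesis
    using \<delta> by (intro exI[of _ "min \<delta> 1"]) auto
qed

text \<open>If \<open>t\<close> is below the threshold from \<open>rev_mean_near_zero\<close>, both
  values are small. Otherwise the indices are comparable to \<open>m\<close> and close to each
  other, and the difference splits into an increment of the sum and a change of its weight.\<close>

lemma rev_mean_modulus:
  assumes "0 < \<epsilon>" "0 < \<eta>"
  shows "\<exists>\<kappa>>(0::real). \<forall>\<^sub>F m in sequentially.
    ocover S {x. \<exists>s t. 0 < s \<and> s \<le> t \<and> t \<le> 1 \<and> t - s \<le> \<kappa> \<and>
      norm (rev_mean g m s x - rev_mean g m t x) > \<epsilon>} \<eta>"
proof -
  obtain \<delta> where \<delta>: "0 < \<delta>" "\<delta> \<le> 1" and ev1: "\<forall>\<^sub>F m in sequentially.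
    ocover S {x. \<exists>s\<in>{0<..\<delta>}. norm (rev_mean g m s x) > \<epsilon> / 2} (\<eta> / 3)"
    using rev_mean_near_zero[of "\<epsilon> / 2" "\<eta> / 3"] assms by auto
  \<comment> \<open>All indices belonging to \<open>s \<ge> \<delta> / 2\<close> are then at most
    \<open>K * m\<close>; the summand 1 covers rounding.\<close>
  define K where "K = Suc (nat \<lceil>2 / \<delta>\<rceil>)"
  have K: "2 / \<delta> + 1 \<le> real K"
    unfolding K_def using of_nat_ceiling[of "2 / \<delta>"] by simp
  obtain y where y: "0 < y" and ev2: "\<forall>\<^sub>F n in sequentially.
      ocover S {x. \<exists>k\<le>n. norm (partial_sum g x k) > y * sqrt n} (\<eta> / 3)"
    using max_bound[of "\<eta> / 3"] assms by auto
  obtain \<kappa>1 where \<kappa>1: "(0::real) < \<kappa>1" and ev3: "\<forall>\<^sub>F m in sequentially.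
    ocover S {x. \<exists>n n'. n \<le> n' \<and> n' \<le> K * m \<and> real (n' - n) \<le> \<kappa>1 * m \<and>
      norm (partial_sum g x n' - partial_sum g x n) > \<epsilon> / 2 * sqrt m} (\<eta> / 3)"
    using increment_bound[of "\<epsilon> / 2" "\<eta> / 3" K] assms by auto
  \<comment> \<open>The bound on the index gap relative to \<open>m\<close>. The second entry makes
    the change of weight times the maximal sum \<open>y * sqrt (K * m)\<close> at most
    \<open>\<epsilon> / 2\<close>.\<close>
  define \<kappa>2 where "\<kappa>2 = min \<kappa>1 (\<epsilon> / (2 * y * sqrt K))"
  have \<kappa>2: "0 < \<kappa>2" "\<kappa>2 \<le> \<kappa>1" "\<kappa>2 \<le> \<epsilon> / (2 * y * sqrt K)"
    using \<kappa>1 assms y by (auto simp: \<kappa>2_def K_def)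
  \<comment> \<open>The first entry keeps \<open>s \<ge> \<delta> / 2\<close> when
    \<open>t > \<delta>\<close>. The second makes \<open>m / s - m / t\<close> at most
    \<open>\<kappa>2 * m / 2\<close>; the other half absorbs the rounding error 1, because
    \<open>2 \<le> \<kappa>2 * m\<close>.\<close>
  define \<kappa> where "\<kappa> = min (\<delta> / 2) (\<kappa>2 * \<delta>\<^sup>2 / 4)"
  have \<kappa>: "0 < \<kappa>" "\<kappa> \<le> \<delta> / 2" "\<kappa> \<le> \<kappa>2 * \<delta>\<^sup>2 / 4"
    using \<delta> \<kappa>2 by (auto simp: \<kappa>_def)
  obtain n1 where n1: "\<And>n. n \<ge> n1 \<Longrightarrow> ocover S {x. \<exists>k\<le>n. norm (partial_sum g x k) > y * sqrt n} (\<eta> / 3)"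
    using ev2 by (auto simp: eventually_sequentially)
  have "\<forall>\<^sub>F m in sequentially. n1 \<le> m \<and> 1 \<le> m \<and> 2 \<le> \<kappa>2 * real m"
    using \<kappa>2 by (intro eventually_conj eventually_le_mult_nat eventually_ge_at_top) auto
  with ev1 ev3 have "\<forall>\<^sub>F m in sequentially.
    ocover S {x. \<exists>s t. 0 < s \<and> s \<le> t \<and> t \<le> 1 \<and> t - s \<le> \<kappa> \<and>
      norm (rev_mean g m s x - rev_mean g m t x) > \<epsilon>} \<eta>"
  proof eventually_elim
    case (elim m)
    let ?A1 = "{x. \<exists>s\<in>{0<..\<delta>}. norm (rev_mean g m s x) > \<epsilon> / 2}"
    let ?A2 = "{x. \<exists>n n'. n \<le> n' \<and> n' \<le> K * m \<and> real (n' - n) \<le> \<kappa>1 * m \<and>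
      norm (partial_sum g x n' - partial_sum g x n) > \<epsilon> / 2 * sqrt m}"
    let ?A3 = "{x. \<exists>k\<le>K * m. norm (partial_sum g x k) > y * sqrt (real (K * m))}"
    have "n1 \<le> K * m"
      using elim(3) by (simp add: K_def)
    then have "ocover S (?A1 \<union> ?A2 \<union> ?A3) (\<eta> / 3 + \<eta> / 3 + \<eta> / 3)"
      by (intro ocover_Un P.prob_space_axioms elim n1)
    then show ?case
    proof (rule ocover_mono)
      show "{x. \<exists>s t. 0 < s \<and> s \<le> t \<and> t \<le> 1 \<and> t - s \<le> \<kappa> \<and>
        norm (rev_mean g m s x - rev_mean g m t x) > \<epsilon>} \<inter> space S \<subseteq> ?A1 \<union> ?A2 \<union> ?A3"
      proof (rule ccontr)
        assume "\<not> ?thesis"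
        then obtain x s t where st: "0 < s" "s \<le> t" "t \<le> 1" "t - s \<le> \<kappa>"
            "norm (rev_mean g m s x - rev_mean g m t x) > \<epsilon>" and x: "x \<notin> ?A1" "x \<notin> ?A2" "x \<notin> ?A3"
          by blast
        have small: "norm (rev_mean g m u x) \<le> \<epsilon> / 2" if "0 < u" "u \<le> \<delta>" for u
          using x(1) that by (auto simp: not_less)
        have "\<delta> < t"
        proof (rule ccontr)
          assume "\<not> \<delta> < t"
          then have "norm (rev_mean g m s x) \<le> \<epsilon> / 2" "norm (rev_mean g m t x) \<le> \<epsilon> / 2"
            using st by (intro small; linarith)+
          then show False
            using st(5) norm_triangle_ineq4[of "rev_mean g m s x" "rev_mean g m t x"] by linarith
        qed
        then have s2: "\<delta> / 2 \<le> s"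
          using st(4) \<kappa>(2) by linarith
        let ?n = "rev_index m t" and ?n' = "rev_index m s"
        have m0: "0 < real m"
          using elim(3) by auto
        have nn: "?n \<le> ?n'"
          using st by (intro rev_index_mono)
        have mn: "m \<le> ?n" "m \<le> ?n'"
          using st by (auto intro!: rev_index_ge_self)
        have "real m / s \<le> real m / (\<delta> / 2)"
          using s2 \<delta> st by (intro divide_left_mono) auto
        then have "real ?n' < real m * (2 / \<delta>) + 1"
          using rev_index_less[OF st(1), of m] by simp
        also have "\<dots> \<le> real m * (2 / \<delta> + 1)"
          using elim(3) by (simp add: algebra_simps)
        also have "\<dots> \<le> real m * real K"
          using K by (intro mult_left_mono) auto
        finally have nK: "?n' \<le> K * m"
          by (simp add: mult.commute flip: of_nat_mult)
        have "real (?n' - ?n) < real m / s - real m / t + 1"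
          using rev_index_less[OF st(1), of m] rev_index_ge[of t m] st nn by (simp add: of_nat_diff)
        also have "real m / s - real m / t = real m * (t - s) / (s * t)"
          using st by (simp add: field_simps)
        also have "\<dots> \<le> real m * \<kappa> / (\<delta> / 2 * \<delta>)"
          using st s2 \<open>\<delta> < t\<close> \<delta> \<kappa> by (intro frac_le mult_left_mono mult_mono) auto
        also have "\<dots> \<le> real m * (\<kappa>2 * \<delta>\<^sup>2 / 4) / (\<delta> / 2 * \<delta>)"
          using \<kappa> \<delta> by (intro divide_right_mono mult_left_mono) auto
        also have "\<dots> = \<kappa>2 * m / 2"
          using \<delta> by (simp add: field_simps power2_eq_square)
        finally have dn: "real (?n' - ?n) \<le> \<kappa>2 * m"
          using elim(3) by linarith
        also have "\<dots> \<le> \<kappa>1 * m"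
          using \<kappa>2 by (intro mult_right_mono) auto
        finally have i1: "norm (partial_sum g x ?n' - partial_sum g x ?n) \<le> \<epsilon> / 2 * sqrt m"
          using x(2) nn nK by (auto simp: not_less)
        have i2: "norm (partial_sum g x ?n) \<le> y * sqrt (real (K * m))"
          using x(3) nn nK by (auto simp: not_less)
        \<comment> \<open>Summation by parts with two terms: the new observations at the new weight,
          and the old sum at the difference of the weights.\<close>
        have "rev_mean g m s x - rev_mean g m t x =
            (sqrt m / ?n') *\<^sub>R (partial_sum g x ?n' - partial_sum g x ?n)
            - (sqrt m / ?n - sqrt m / ?n') *\<^sub>R partial_sum g x ?n"
          by (simp add: rev_mean_def algebra_simps)
        then have "norm (rev_mean g m s x - rev_mean g m t x) \<le>
            norm ((sqrt m / ?n') *\<^sub>R (partial_sum g x ?n' - partial_sum g x ?n))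
            + norm ((sqrt m / ?n - sqrt m / ?n') *\<^sub>R partial_sum g x ?n)"
          by (metis norm_triangle_ineq4)
        also have "norm ((sqrt m / ?n') *\<^sub>R (partial_sum g x ?n' - partial_sum g x ?n))
            \<le> (sqrt m / m) * (\<epsilon> / 2 * sqrt m)"
          using i1 mn m0 assms unfolding norm_scaleR
          by (intro mult_mono) (auto intro!: divide_left_mono mult_pos_pos)
        also have "(sqrt m / m) * (\<epsilon> / 2 * sqrt m) = \<epsilon> / 2"
          using m0 by (simp add: field_simps)
        also have "norm ((sqrt m / ?n - sqrt m / ?n') *\<^sub>R partial_sum g x ?n)
            \<le> (sqrt m * (\<kappa>2 * m) / (m * m)) * (y * sqrt (real (K * m)))"
        proof -
          have "sqrt m / ?n - sqrt m / ?n' = sqrt m * real (?n' - ?n) / (real ?n * real ?n')"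
            using m0 mn nn by (simp add: of_nat_diff field_simps)
          moreover have "real m * real m \<le> real ?n * real ?n'"
            using mn by (intro mult_mono) auto
          then have "sqrt m * real (?n' - ?n) / (real ?n * real ?n') \<le> sqrt m * (\<kappa>2 * m) / (m * m)"
            using dn m0 \<kappa>2 by (intro frac_le mult_left_mono) auto
          ultimately have "\<bar>sqrt m / ?n - sqrt m / ?n'\<bar> \<le> sqrt m * (\<kappa>2 * m) / (m * m)"
            by (simp only: abs_of_nonneg divide_nonneg_nonneg mult_nonneg_nonneg of_nat_0_le_iff real_sqrt_ge_0_iff)
          then show ?thesis
            unfolding norm_scaleR real_norm_def using i2 \<kappa>2 by (intro mult_mono) auto
        qed
        also have "(sqrt m * (\<kappa>2 * m) / (m * m)) * (y * sqrt (real (K * m))) = \<kappa>2 * (y * sqrt K)"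
          using m0 by (simp add: real_sqrt_mult field_simps)
        also have "\<dots> \<le> \<epsilon> / (2 * y * sqrt K) * (y * sqrt K)"
          using \<kappa>2 y by (intro mult_right_mono) auto
        also have "\<dots> = \<epsilon> / 2"
          using y by (simp add: K_def)
        finally show False
          using st(5) by simp
      qed
    qed (simp)
  qed
  then show ?thesis
    using \<kappa> by blast
qed

end

text \<open>For \<open>s \<ge> \<delta>\<close> the index lies between \<open>m\<close> and
  \<open>N = rev_index m \<delta>\<close>, so a single maximal inequality at time \<open>N\<close>
  suffices. It doubles \<open>\<epsilon> * sqrt \<delta> / 4\<close>, and
  \<open>\<delta> * N \<le> 4 * m\<close> converts \<open>sqrt N\<close> back into
  \<open>sqrt m\<close>.\<close>

lemma (in iid_space) rev_mean_seminorm_bound: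
  fixes g :: "'x \<Rightarrow> 'b::real_normed_vector" and q :: "'b \<Rightarrow> real"
  assumes q: "\<And>x y. q (x + y) \<le> q x + q y" "\<And>x. q (- x) = q x" "\<And>z. q z \<le> C * norm z" "0 \<le> C"
    and qs: "\<And>a z. 0 \<le> a \<Longrightarrow> q (a *\<^sub>R z) = a * q z"
    and B: "\<And>x. norm (g x) \<le> B" and \<epsilon>: "0 < \<epsilon>" "\<eta> \<le> 1" and \<delta>: "0 < \<delta>" "\<delta> \<le> 1"
    and n: "\<forall>\<^sub>F n in sequentially. ocover S {x. q (partial_sum g x n) > \<epsilon> * sqrt \<delta> / 4 * sqrt n} (\<eta> / 2)"
  shows "\<forall>\<^sub>F m in sequentially. ocover S {x. \<exists>s\<in>{\<delta>..1}. q (rev_mean g m s x) > \<epsilon>} \<eta>"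
proof -
  have "\<forall>\<^sub>F n in sequentially. ocover S {x. \<exists>k\<le>n. q (partial_sum g x k) > 2 * (\<epsilon> * sqrt \<delta> / 4) * sqrt n} (2 * (\<eta> / 2))"
    using \<epsilon> \<delta> by (intro max_partial_sum_bound[OF q B _ _ n]) auto
  then obtain n1 where n1: "\<And>n. n \<ge> n1 \<Longrightarrow> ocover S {x. \<exists>k\<le>n. q (partial_sum g x k) > \<epsilon> * sqrt \<delta> / 2 * sqrt n} \<eta>"
    by (auto simp: eventually_sequentially)
  have "\<forall>\<^sub>F m in sequentially. n1 \<le> m \<and> 1 \<le> m"
    by (intro eventually_conj eventually_ge_at_top)
  then show ?thesis
  proof eventually_elim
    case (elim m)
    define N where "N = rev_index m \<delta>"
    have mN: "m \<le> N"
      unfolding N_def using \<delta> by (intro rev_index_ge_self)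
    have m0: "0 < real m"
      using elim by auto
    have "real N < real m / \<delta> + 1"
      unfolding N_def using \<delta> by (intro rev_index_less)
    also have "1 \<le> real m / \<delta>"
      using elim \<delta> by (simp add: field_simps)
    finally have "real N \<le> 2 * (real m / \<delta>)"
      by simp
    then have "\<delta> * real N \<le> 4 * m"
      using \<delta> m0 by (simp add: field_simps)
    then have "sqrt (\<delta> * N) \<le> sqrt (4 * m)"
      by (rule real_sqrt_le_mono)
    then have "\<epsilon> / 2 * sqrt (\<delta> * N) \<le> \<epsilon> / 2 * sqrt (4 * m)"
      using \<epsilon> by (intro mult_left_mono) auto
    then have thr: "\<epsilon> * sqrt \<delta> / 2 * sqrt N \<le> \<epsilon> * sqrt m"
      by (simp add: real_sqrt_mult)
    show ?case
    proof (rule ocover_mono[OF n1[of N]])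
      show "{x. \<exists>s\<in>{\<delta>..1}. q (rev_mean g m s x) > \<epsilon>} \<inter> space S \<subseteq>
        {x. \<exists>k\<le>N. q (partial_sum g x k) > \<epsilon> * sqrt \<delta> / 2 * sqrt N}"
      proof clarify
        fix x s assume s: "s \<in> {\<delta>..1}" "q (rev_mean g m s x) > \<epsilon>"
        let ?n = "rev_index m s"
        have mn: "m \<le> ?n" "?n \<le> N"
          using s \<delta> unfolding N_def by (auto intro!: rev_index_ge_self rev_index_mono)
        have "\<epsilon> < sqrt m / ?n * q (partial_sum g x ?n)"
          using s(2) qs[of "sqrt m / ?n"] by (simp add: rev_mean_def)
        then have "\<epsilon> * ?n < sqrt m * q (partial_sum g x ?n)"
          using m0 mn by (simp add: field_simps)
        moreover have "\<epsilon> * m \<le> \<epsilon> * ?n"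
          using mn \<epsilon> by (intro mult_left_mono) auto
        moreover have "sqrt m * (\<epsilon> * sqrt m) = \<epsilon> * m"
          by (simp add: mult_ac)
        ultimately have "sqrt m * (\<epsilon> * sqrt m) < sqrt m * q (partial_sum g x ?n)"
          by linarith
        then have "\<epsilon> * sqrt m < q (partial_sum g x ?n)"
          using m0 by (simp only: mult_less_cancel_left_pos real_sqrt_gt_0_iff)
        then show "\<exists>k\<le>N. q (partial_sum g x k) > \<epsilon> * sqrt \<delta> / 2 * sqrt N"
          using thr mn by (intro exI[of _ ?n]) auto
      qed
    qed (use elim mN in auto)
  qed
qed

section \<open>Convergence of finite-dimensional distributions\<close>

inductive_set coord_ring :: "'t set \<Rightarrow> (('t \<Rightarrow> real) \<Rightarrow> real) set" for I where
  const: "(\<lambda>_. c) \<in> coord_ring I"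
| coord: "t \<in> I \<Longrightarrow> (\<lambda>u. u t) \<in> coord_ring I"
| add: "f \<in> coord_ring I \<Longrightarrow> g \<in> coord_ring I \<Longrightarrow> (\<lambda>u. f u + g u) \<in> coord_ring I"
| mult: "f \<in> coord_ring I \<Longrightarrow> g \<in> coord_ring I \<Longrightarrow> (\<lambda>u. f u * g u) \<in> coord_ring I"

text \<open>The free phase \<open>b\<close> admits sines and makes sums of cosines closed under
  products, by the product-to-sum formula, so that complex exponentials are avoided.\<close>

inductive_set trig_poly :: "'t set \<Rightarrow> (('t \<Rightarrow> real) \<Rightarrow> real) set" for I where
  cos: "(\<lambda>u. a * cos ((\<Sum>t\<in>I. c t * u t) + b)) \<in> trig_poly I"
| add: "f \<in> trig_poly I \<Longrightarrow> g \<in> trig_poly I \<Longrightarrow> (\<lambda>u. f u + g u) \<in> trig_poly I"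

lemma trig_poly_cos_mult:
  assumes "g \<in> trig_poly I"
  shows "(\<lambda>u. a * cos ((\<Sum>t\<in>I. c t * u t) + b) * g u) \<in> trig_poly I"
  using assms
proof induction
  case (cos a' c' b')
  have "a * cos ((\<Sum>t\<in>I. c t * u t) + b) * (a' * cos ((\<Sum>t\<in>I. c' t * u t) + b')) =
      (a * a' / 2) * cos ((\<Sum>t\<in>I. (c t - c' t) * u t) + (b - b')) +
      (a * a' / 2) * cos ((\<Sum>t\<in>I. (c t + c' t) * u t) + (b + b'))" for u
    using cos_times_cos[of "(\<Sum>t\<in>I. c t * u t) + b" "(\<Sum>t\<in>I. c' t * u t) + b'"]
    by (simp add: sum_subtractf sum.distrib algebra_simps add_divide_distrib)
  then show ?case
    by (simp only:) (intro trig_poly.intros)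
next
  case (add f g)
  then show ?case
    by (simp only: distrib_left) (intro trig_poly.intros)
qed

lemma trig_poly_mult:
  assumes "f \<in> trig_poly I" "g \<in> trig_poly I"
  shows "(\<lambda>u. f u * g u) \<in> trig_poly I"
  using assms(1)
proof induction
  case (cos a c b)
  show ?case
    by (rule trig_poly_cos_mult[OF assms(2)])
next
  case (add f g)
  then show ?case
    by (simp only: distrib_right) (intro trig_poly.intros)
qed

text \<open>A coordinate \<open>sin (u t / r)\<close> is a cosine with phase
  \<open>- (pi / 2)\<close>, and trigonometric polynomials form a ring.\<close>

lemma coord_ring_sin_trig_poly:
  assumes "p \<in> coord_ring I" "finite I"
  shows "(\<lambda>u. p (\<lambda>t. sin (u t / r))) \<in> trig_poly I"
  using assms(1)
proof induction
  case (const c)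
  show ?case
    using trig_poly.cos[of c "\<lambda>_. 0" I 0] by simp
next
  case (coord t)
  have "(\<Sum>s\<in>I. (if s = t then 1 / r else 0) * u s) = u t / r" for u :: "'a \<Rightarrow> real"
    using assms(2) coord by (simp add: if_distrib[of "\<lambda>x. x * _"] sum.delta cong: if_cong)
  then show ?case
    using trig_poly.cos[of 1 "\<lambda>s. if s = t then 1 / r else 0" I "- (pi / 2)"]
    by (simp add: cos_diff)
next
  case (add f g)
  then show ?case by (intro trig_poly.intros)
next
  case (mult f g)
  then show ?case by (intro trig_poly_mult)
qed

text \<open>Coordinates off \<open>I\<close> are frozen at 0, which makes the cube a product of
  compact sets over the whole index type, compact by Tychonoff's theorem.\<close>

definition coord_cube :: "'t set \<Rightarrow> ('t \<Rightarrow> real) set" where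
  "coord_cube I = PiE UNIV (\<lambda>t. if t \<in> I then {-1..1} else {0})"

lemma compact_coord_cube: "compact (coord_cube I)"
proof -
  have "compactin (product_topology (\<lambda>_. euclidean) UNIV) (coord_cube I)"
    unfolding coord_cube_def by (subst compactin_PiE) auto
  then show ?thesis
    by (simp add: euclidean_product_topology)
qed

lemma continuous_on_coord_lipschitz:
  fixes G :: "('t \<Rightarrow> real) \<Rightarrow> 'b::real_normed_vector" and v :: "'a::topological_space \<Rightarrow> 't \<Rightarrow> real"
  assumes G: "\<And>u v. norm (G u - G v) \<le> L * (\<Sum>t\<in>I. \<bar>u t - v t\<bar>)"
    and v: "\<And>t. t \<in> I \<Longrightarrow> continuous_on A (\<lambda>z. v z t)"
  shows "continuous_on A (\<lambda>z. G (v z))"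
  unfolding continuous_on_def
proof (intro ballI)
  fix x assume "x \<in> A"
  then have c: "((\<lambda>z. v z t) \<longlongrightarrow> v x t) (at x within A)" if "t \<in> I" for t
    using v[OF that] by (auto simp: continuous_on_def)
  have "((\<lambda>z. L * (\<Sum>t\<in>I. \<bar>v z t - v x t\<bar>)) \<longlongrightarrow> L * (\<Sum>t\<in>I. \<bar>v x t - v x t\<bar>)) (at x within A)"
    by (intro tendsto_intros c)
  then have *: "((\<lambda>z. L * (\<Sum>t\<in>I. \<bar>v z t - v x t\<bar>)) \<longlongrightarrow> 0) (at x within A)"
    by simp
  have "((\<lambda>z. G (v z) - G (v x)) \<longlongrightarrow> 0) (at x within A)"
    by (rule Lim_null_comparison[OF _ *]) (simp add: G)
  then show "((\<lambda>z. G (v z)) \<longlongrightarrow> G (v x)) (at x within A)"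
    by (simp add: LIM_zero_iff)
qed

lemma abs_bapp_le_norm: "\<bar>bapp z t\<bar> \<le> norm z"
  using norm_bounded[of z "discrete t"] by simp

lemma abs_bapp_diff_le: "\<bar>bapp z t - bapp w t\<bar> \<le> norm (z - w)"
  using abs_bapp_le_norm[of "z - w" t] by simp

lemma continuous_on_bapp: "continuous_on A (\<lambda>z. bapp z t)"
proof (rule continuous_onI)
  fix x e assume "0 < (e::real)"
  then show "\<exists>d>0. \<forall>y\<in>A. dist y x < d \<longrightarrow> dist (bapp y t) (bapp x t) \<le> e"
    using abs_bapp_diff_le[of _ t x] by (intro exI[of _ e]) (fastforce simp: dist_norm intro: order_trans[of _ "norm (_ - x)"])
qed

lemma norm_le_sum_bapp:
  assumes "finite I" "z \<in> linf I"
  shows "norm z \<le> (\<Sum>t\<in>I. \<bar>bapp z t\<bar>)"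
proof (rule norm_bound)
  fix d :: "'a discrete"
  have "\<bar>bapp z (of_discrete d)\<bar> \<le> (\<Sum>t\<in>I. \<bar>bapp z t\<bar>)"
    using member_le_sum[OF _ _ assms(1), of "of_discrete d" "\<lambda>t. \<bar>bapp z t\<bar>"] assms(2)
    by (cases "of_discrete d \<in> I") (auto simp: linf_def intro: sum_nonneg)
  then show "norm (apply_bcontfun z d) \<le> (\<Sum>t\<in>I. \<bar>bapp z t\<bar>)"
    by (simp add: of_discrete_inverse)
qed

lemma bounded_image_finite: "finite I \<Longrightarrow> bounded (f ` I)"
  by (simp add: finite_imp_bounded)

lemma to_linf_finite:
  assumes "finite I"
  shows "bapp (to_linf I u) t = (if t \<in> I then u t else 0)" "to_linf I u \<in> linf I"
  using bapp_to_linf[OF bounded_image_finite[OF assms, of u]] to_linf_in_linf[OF bounded_image_finite[OF assms, of u]]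
  by auto

text \<open>The Stone-Weierstrass theorem on the image of the cube in \<open>linf I\<close>. The
  scale \<open>r\<close> enters only through the rescaled Lipschitz function, so one unit cube
  serves for all \<open>r\<close>.\<close>

lemma coord_ring_approx:
  fixes G :: "('t \<Rightarrow> real) \<Rightarrow> real"
  assumes I: "finite I" and G: "\<And>u v. \<bar>G u - G v\<bar> \<le> L * (\<Sum>t\<in>I. \<bar>u t - v t\<bar>)" and "0 < e"
  shows "\<exists>p\<in>coord_ring I. \<forall>u. (\<forall>t\<in>I. \<bar>u t\<bar> \<le> 1) \<longrightarrow> \<bar>G (\<lambda>t. r * u t) - p u\<bar> < e"
proof -
  \<comment> \<open>Elements of the ring ignore coordinates outside \<open>I\<close>, so an
    arbitrary \<open>u\<close> may be replaced by its truncation, which lies in the cube.\<close>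
  have ext: "p \<in> coord_ring I \<Longrightarrow> p u = p (\<lambda>t. if t \<in> I then u t else 0)" for p and u :: "'t \<Rightarrow> real"
    by (induction rule: coord_ring.induct) auto
  define S where "S = to_linf I ` coord_cube I"
  have cont: "continuous_on A (\<lambda>z. p (bapp z))" if "p \<in> coord_ring I" for p and A :: "'t bfun set"
    using that
    by (induction rule: coord_ring.induct) (auto intro!: continuous_intros continuous_on_bapp)
  interpret function_ring_on "(\<lambda>p (z :: 't bfun). p (bapp z)) ` coord_ring I" S
  proof
    have "norm (to_linf I u - to_linf I v) \<le> 1 * (\<Sum>t\<in>I. \<bar>u t - v t\<bar>)" for u v
      using norm_le_sum_bapp[OF I, of "to_linf I u - to_linf I v"] subspace_linf[of I]
      by (auto simp: to_linf_finite[OF I] subspace_diff cong: sum.cong)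
    from continuous_on_coord_lipschitz[OF this, of "coord_cube I" "\<lambda>u. u"]
    have "continuous_on (coord_cube I) (to_linf I)"
      by (auto intro: continuous_on_subset[OF continuous_on_product_coordinates])
    then show "compact S"
      unfolding S_def by (rule compact_continuous_image[OF _ compact_coord_cube])
    fix x y :: "'t bfun"
    assume "x \<in> S" "y \<in> S" "x \<noteq> y"
    then obtain u v where uv: "x = to_linf I u" "y = to_linf I v"
      by (auto simp: S_def)
    have "\<exists>t\<in>I. u t \<noteq> v t"
    proof (rule ccontr)
      assume "\<not> ?thesis"
      then have "bapp x t = bapp y t" for t
        using uv by (simp add: to_linf_finite[OF I])
      then have "apply_bcontfun x d = apply_bcontfun y d" for d
        by (metis of_discrete_inverse)
      then show False
        using \<open>x \<noteq> y\<close> by (metis bcontfun_eqI)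
    qed
    then obtain t where "u t \<noteq> v t" "t \<in> I" by blast
    then show "\<exists>f\<in>(\<lambda>p (z :: 't bfun). p (bapp z)) ` coord_ring I. f x \<noteq> f y"
      using uv by (intro bexI[of _ "\<lambda>z. bapp z t"]) (auto simp: to_linf_finite[OF I] intro: coord_ring.coord
        intro!: image_eqI[of _ _ "\<lambda>u. u t"])
  next
    fix f g :: "'t bfun \<Rightarrow> real"
    assume "f \<in> (\<lambda>p z. p (bapp z)) ` coord_ring I" "g \<in> (\<lambda>p z. p (bapp z)) ` coord_ring I"
    then obtain p q where "p \<in> coord_ring I" "q \<in> coord_ring I" "f = (\<lambda>z. p (bapp z))" "g = (\<lambda>z. q (bapp z))"
      by blast
    then show "(\<lambda>x. f x + g x) \<in> (\<lambda>p z. p (bapp z)) ` coord_ring I"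
      "(\<lambda>x. f x * g x) \<in> (\<lambda>p z. p (bapp z)) ` coord_ring I"
      using coord_ring.add[of p I q] coord_ring.mult[of p I q]
      by (auto intro!: image_eqI[of _ _ "\<lambda>u. p u + q u"] image_eqI[of _ _ "\<lambda>u. p u * q u"])
  next
    show "(\<lambda>_. c) \<in> (\<lambda>p (z :: 't bfun). p (bapp z)) ` coord_ring I" for c
      by (rule image_eqI[of _ _ "\<lambda>_. c"]) (auto intro: coord_ring.const)
  qed (use cont in auto)
  have "norm (G (\<lambda>t. r * u t) - G (\<lambda>t. r * v t)) \<le> (L * \<bar>r\<bar>) * (\<Sum>t\<in>I. \<bar>u t - v t\<bar>)" for u v
  proof -
    have "norm (G (\<lambda>t. r * u t) - G (\<lambda>t. r * v t)) \<le> L * (\<Sum>t\<in>I. \<bar>r * u t - r * v t\<bar>)"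
      using G by simp
    also have "(\<Sum>t\<in>I. \<bar>r * u t - r * v t\<bar>) = \<bar>r\<bar> * (\<Sum>t\<in>I. \<bar>u t - v t\<bar>)"
      by (simp add: sum_distrib_left right_diff_distrib[symmetric] abs_mult)
    finally show ?thesis by (simp add: mult.assoc)
  qed
  from continuous_on_coord_lipschitz[where G="\<lambda>u. G (\<lambda>t. r * u t)", OF this continuous_on_bapp]
  have "continuous_on S (\<lambda>z. G (\<lambda>t. r * bapp z t))" .
  then obtain p where p: "p \<in> coord_ring I" "\<forall>z\<in>S. \<bar>G (\<lambda>t. r * bapp z t) - p (bapp z)\<bar> < e"
    using Stone_Weierstrass_basic[OF _ \<open>0 < e\<close>] by blast
  have "\<bar>G (\<lambda>t. r * u t) - p u\<bar> < e" if u: "\<forall>t\<in>I. \<bar>u t\<bar> \<le> 1" for u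
  proof -
    let ?u = "\<lambda>t. if t \<in> I then u t else 0"
    have "?u \<in> coord_cube I"
      using u by (auto simp: coord_cube_def PiE_iff abs_le_iff minus_le_iff)
    then have "\<bar>G (\<lambda>t. r * bapp (to_linf I ?u) t) - p (bapp (to_linf I ?u))\<bar> < e"
      using p(2) by (auto simp: S_def)
    moreover have "bapp (to_linf I ?u) t = ?u t" for t
      by (simp add: to_linf_finite[OF I])
    ultimately have "\<bar>G (\<lambda>t. r * ?u t) - p ?u\<bar> < e"
      by (simp only:)
    moreover have "\<bar>G (\<lambda>t. r * ?u t) - G (\<lambda>t. r * u t)\<bar> \<le> L * (\<Sum>t\<in>I. \<bar>r * ?u t - r * u t\<bar>)"
      by (rule G)
    moreover have "(\<Sum>t\<in>I. \<bar>r * ?u t - r * u t\<bar>) = 0"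
      by (intro sum.neutral) auto
    ultimately show ?thesis
      using ext[OF p(1), of u] by simp
  qed
  then show ?thesis
    using p(1) by blast
qed

text \<open>The imaginary part of the first-order Taylor estimate for the complex exponential. The
  error is quadratic in \<open>x\<close>, so second moments control it in mean.\<close>

lemma abs_diff_sin_le: "0 < r \<Longrightarrow> \<bar>x - r * sin (x / r)\<bar> \<le> x\<^sup>2 / r" for x r :: real
proof -
  assume r: "0 < r"
  have *: "\<bar>y - sin y\<bar> \<le> y\<^sup>2" for y :: real
  proof -
    have "cmod (iexp y - (1 + \<i> * y)) \<le> y\<^sup>2 / 2"
      using iexp_approx1[of y 1] by (simp add: power2_eq_square)
    then have "\<bar>Im (iexp y - (1 + \<i> * y))\<bar> \<le> y\<^sup>2 / 2"
      using abs_Im_le_cmod order_trans by blast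
    moreover have "Im (iexp y - (1 + \<i> * y)) = sin y - y"
      by (simp add: Im_exp)
    ultimately have "\<bar>sin y - y\<bar> \<le> y\<^sup>2 / 2"
      by simp
    then show ?thesis
      using zero_le_power2[of y] by linarith
  qed
  have "x - r * sin (x / r) = r * (x / r - sin (x / r))"
    using r by (simp add: field_simps)
  then have "\<bar>x - r * sin (x / r)\<bar> = r * \<bar>x / r - sin (x / r)\<bar>"
    using r by (simp only: abs_mult abs_of_pos)
  also have "\<dots> \<le> r * (x / r)\<^sup>2"
    using r * by (intro mult_left_mono) auto
  also have "\<dots> = x\<^sup>2 / r"
    using r by (simp add: power2_eq_square)
  finally show ?thesis .
qed

text \<open>Convergence of all characteristic functions, in real form.\<close>

definition fidi_conv :: "'t set \<Rightarrow> 'w measure \<Rightarrow> (nat \<Rightarrow> 'w \<Rightarrow> 't \<Rightarrow> real) \<Rightarrow> 'v measure \<Rightarrow> ('v \<Rightarrow> 't \<Rightarrow> real) \<Rightarrow> bool" where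
  "fidi_conv T M Y N Z \<longleftrightarrow>
     (\<forall>I c b. finite I \<and> I \<subseteq> T \<longrightarrow>
        (\<lambda>m. \<integral>\<omega>. cos ((\<Sum>t\<in>I. c t * Y m \<omega> t) + b) \<partial>M) \<longlonglongrightarrow> (\<integral>x. cos ((\<Sum>t\<in>I. c t * Z x t) + b) \<partial>N))"

text \<open>Bounded second moments take the place of tightness of the finite-dimensional
  distributions when arguments are truncated by the sine.\<close>

definition l2_bounded :: "'t set \<Rightarrow> 'w measure \<Rightarrow> (nat \<Rightarrow> 'w \<Rightarrow> 't \<Rightarrow> real) \<Rightarrow> bool" where
  "l2_bounded T M Y \<longleftrightarrow>
     (\<forall>t\<in>T. (\<forall>m. (\<lambda>\<omega>. Y m \<omega> t) \<in> borel_measurable M \<and> integrable M (\<lambda>\<omega>. (Y m \<omega> t)\<^sup>2)) \<and>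
       (\<exists>C. \<forall>m. (\<integral>\<omega>. (Y m \<omega> t)\<^sup>2 \<partial>M) \<le> C))"

lemma trig_poly_measurable:
  assumes "p \<in> trig_poly I" "finite I" "\<And>t. t \<in> I \<Longrightarrow> (\<lambda>\<omega>. Y \<omega> t) \<in> borel_measurable M"
  shows "(\<lambda>\<omega>. p (Y \<omega>)) \<in> borel_measurable M \<and> (\<exists>C. \<forall>u. \<bar>p u\<bar> \<le> C)"
  using assms(1)
proof induction
  case (cos a c b)
  have "\<bar>a * cos ((\<Sum>t\<in>I. c t * u t) + b)\<bar> \<le> \<bar>a\<bar>" for u
    using mult_left_mono[OF abs_cos_le_one, of "\<bar>a\<bar>"] by (simp add: abs_mult)
  then show ?case
    using assms(2,3) by (auto intro!: borel_measurable_times borel_measurable_add borel_measurable_sum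
        measurable_compose[OF _ borel_measurable_continuous_onI[OF continuous_on_cos[OF continuous_on_id]]])
next
  case (add f g)
  then obtain C D where "\<And>u. \<bar>f u\<bar> \<le> C" "\<And>u. \<bar>g u\<bar> \<le> D" by blast
  then have "\<bar>f u + g u\<bar> \<le> C + D" for u
    using abs_triangle_ineq[of "f u" "g u"] by (smt (verit))
  then show ?case
    using add by (auto intro!: borel_measurable_add)
qed

lemma trig_poly_conv:
  assumes "p \<in> trig_poly I" "finite I" "I \<subseteq> T" "prob_space M" "prob_space N"
    "l2_bounded T M Y" "l2_bounded T N (\<lambda>_. Z)" "fidi_conv T M Y N Z"
  shows "(\<lambda>m. \<integral>\<omega>. p (Y m \<omega>) \<partial>M) \<longlonglongrightarrow> (\<integral>x. p (Z x) \<partial>N)"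
  using assms(1)
proof induction
  case (cos a c b)
  then show ?case
    using assms(8,2,3) by (auto simp: fidi_conv_def intro!: tendsto_mult_left)
next
  case (add f g)
  have mY: "(\<lambda>\<omega>. Y m \<omega> t) \<in> borel_measurable M" if "t \<in> I" for m t
    using assms(3,6) that by (auto simp: l2_bounded_def)
  have mZ: "(\<lambda>\<omega>. Z \<omega> t) \<in> borel_measurable N" if "t \<in> I" for t
    using assms(3,7) that by (auto simp: l2_bounded_def)
  interpret M: prob_space M by fact
  interpret N: prob_space N by fact
  have iY: "integrable M (\<lambda>\<omega>. p (Y m \<omega>))" if p: "p \<in> trig_poly I" for p m
  proof -
    have "(\<lambda>\<omega>. p (Y m \<omega>)) \<in> borel_measurable M \<and> (\<exists>C. \<forall>u. \<bar>p u\<bar> \<le> C)"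
      by (rule trig_poly_measurable[OF p assms(2) mY])
    then obtain C where "(\<lambda>\<omega>. p (Y m \<omega>)) \<in> borel_measurable M" "\<And>u. \<bar>p u\<bar> \<le> C"
      by blast
    then show ?thesis
      by (intro M.integrable_const_bound[of _ C]) auto
  qed
  have iZ: "integrable N (\<lambda>\<omega>. p (Z \<omega>))" if p: "p \<in> trig_poly I" for p
  proof -
    have "(\<lambda>\<omega>. p (Z \<omega>)) \<in> borel_measurable N \<and> (\<exists>C. \<forall>u. \<bar>p u\<bar> \<le> C)"
      by (rule trig_poly_measurable[OF p assms(2) mZ])
    then obtain C where "(\<lambda>\<omega>. p (Z \<omega>)) \<in> borel_measurable N" "\<And>u. \<bar>p u\<bar> \<le> C"
      by blast
    then show ?thesis
      by (intro N.integrable_const_bound[of _ C]) auto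
  qed
  show ?case
    using add by (simp add: iY iZ) (intro tendsto_intros)
qed

text \<open>
  The argument is replaced by \<open>r sin (u / r)\<close>, which is bounded and close to \<open>u\<close> in mean for large \<open>r\<close>;
  on bounded arguments the Stone-Weierstrass theorem reduces the claim to trigonometric polynomials.
\<close>

lemma lipschitz_conv:
  fixes G :: "('t \<Rightarrow> real) \<Rightarrow> real"
  assumes I: "finite I" "I \<subseteq> T" and M: "prob_space M" and N: "prob_space N"
    and Y: "l2_bounded T M Y" and Z: "l2_bounded T N (\<lambda>_. Z)" and conv: "fidi_conv T M Y N Z"
    and G: "\<And>u v. \<bar>G u - G v\<bar> \<le> L * (\<Sum>t\<in>I. \<bar>u t - v t\<bar>)" and L: "0 \<le> L" and bd: "\<And>u. \<bar>G u\<bar> \<le> 1"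
  shows "(\<lambda>\<omega>. G (Y m \<omega>)) \<in> borel_measurable M" "(\<lambda>\<omega>. G (Z \<omega>)) \<in> borel_measurable N"
    and "(\<lambda>m. \<integral>\<omega>. G (Y m \<omega>) \<partial>M) \<longlonglongrightarrow> (\<integral>x. G (Z x) \<partial>N)"
proof -
  interpret M: prob_space M by fact
  interpret N: prob_space N by fact
  have mY: "(\<lambda>\<omega>. Y m \<omega> t) \<in> borel_measurable M" if "t \<in> I" for m t
    using I(2) Y that by (auto simp: l2_bounded_def)
  have mZ: "(\<lambda>\<omega>. Z \<omega> t) \<in> borel_measurable N" if "t \<in> I" for t
    using I(2) Z that by (auto simp: l2_bounded_def)
  have appr: "\<exists>p\<in>trig_poly I. \<forall>u. \<bar>G (\<lambda>t. r * sin (u t / r)) - p u\<bar> < e" if "0 < e" for e r :: real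
  proof -
    obtain p where p: "p \<in> coord_ring I" "\<And>u. (\<forall>t\<in>I. \<bar>u t\<bar> \<le> 1) \<Longrightarrow> \<bar>G (\<lambda>t. r * u t) - p u\<bar> < e"
      using coord_ring_approx[OF I(1) G \<open>0 < e\<close>, of r] by blast
    show ?thesis
      using p coord_ring_sin_trig_poly[OF p(1) I(1), of r] 
      by (intro bexI[of _ "\<lambda>u. p (\<lambda>t. sin (u t / r))"]) auto
  qed
  have diff: "\<bar>G u - G (\<lambda>t. r * sin (u t / r))\<bar> \<le> L / r * (\<Sum>t\<in>I. (u t)\<^sup>2)" if "0 < r" for u r
  proof -
    have "\<bar>G u - G (\<lambda>t. r * sin (u t / r))\<bar> \<le> L * (\<Sum>t\<in>I. \<bar>u t - r * sin (u t / r)\<bar>)"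
      by (rule G)
    also have "\<dots> \<le> L * (\<Sum>t\<in>I. (u t)\<^sup>2 / r)"
      using that L by (intro mult_left_mono sum_mono abs_diff_sin_le)
    finally show ?thesis
      by (simp add: sum_divide_distrib[symmetric])
  qed
  \<comment> \<open>Truncation at scale \<open>r = Suc k\<close> and uniform approximation up to
    \<open>1 / Suc k\<close>, so that both errors vanish as \<open>k\<close> grows.\<close>
  define p where "p = (\<lambda>k::nat. SOME p. p \<in> trig_poly I \<and>
      (\<forall>u. \<bar>G (\<lambda>t. Suc k * sin (u t / Suc k)) - p u\<bar> < 1 / Suc k))"
  have p: "p k \<in> trig_poly I" "\<And>u. \<bar>G (\<lambda>t. Suc k * sin (u t / Suc k)) - p k u\<bar> < 1 / Suc k" for k
  proof -
    have "\<exists>q. q \<in> trig_poly I \<and> (\<forall>u. \<bar>G (\<lambda>t. Suc k * sin (u t / Suc k)) - q u\<bar> < 1 / Suc k)"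
      using appr[of "1 / Suc k" "Suc k"] by auto
    from someI_ex[OF this] show "p k \<in> trig_poly I"
      "\<And>u. \<bar>G (\<lambda>t. Suc k * sin (u t / Suc k)) - p k u\<bar> < 1 / Suc k"
      unfolding p_def by auto
  qed
  have pG: "\<bar>G u - p k u\<bar> \<le> L / Suc k * (\<Sum>t\<in>I. (u t)\<^sup>2) + 1 / Suc k" for k u
    using diff[of "Suc k" u] p(2)[of k u] by linarith
  have inv0: "(\<lambda>k. c / Suc k) \<longlonglongrightarrow> 0" for c :: real
    by (rule LIMSEQ_Suc[OF lim_const_over_n])
  \<comment> \<open>This pointwise convergence yields the measurability of \<open>G\<close> along
    the processes: \<open>G\<close> is a function on the whole function space and is assumed
    Lipschitz, not measurable.\<close>
  have lim: "(\<lambda>k. p k u) \<longlonglongrightarrow> G u" for u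
  proof -
    have "(\<lambda>k. L / Suc k * (\<Sum>t\<in>I. (u t)\<^sup>2) + 1 / Suc k) \<longlonglongrightarrow> 0 * (\<Sum>t\<in>I. (u t)\<^sup>2) + 0"
      by (intro tendsto_intros inv0)
    then have "(\<lambda>k. L / Suc k * (\<Sum>t\<in>I. (u t)\<^sup>2) + 1 / Suc k) \<longlonglongrightarrow> 0"
      by simp
    then have "(\<lambda>k. p k u - G u) \<longlonglongrightarrow> 0"
      by (rule Lim_null_comparison[rotated]) (use pG in \<open>auto simp: abs_minus_commute intro!: always_eventually\<close>)
    then show ?thesis
      by (simp add: LIM_zero_iff)
  qed
  show mG: "(\<lambda>\<omega>. G (Y m \<omega>)) \<in> borel_measurable M" for m
    by (rule borel_measurable_LIMSEQ_real[where u="\<lambda>k \<omega>. p k (Y m \<omega>)"])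
      (use lim trig_poly_measurable[OF p(1) I(1) mY] in auto)
  show mGZ: "(\<lambda>\<omega>. G (Z \<omega>)) \<in> borel_measurable N"
    by (rule borel_measurable_LIMSEQ_real[where u="\<lambda>k \<omega>. p k (Z \<omega>)"])
      (use lim trig_poly_measurable[OF p(1) I(1) mZ] in auto)
  have "\<exists>C. \<forall>t\<in>I. (\<forall>m. (\<integral>\<omega>. (Y m \<omega> t)\<^sup>2 \<partial>M) \<le> C) \<and> (\<integral>\<omega>. (Z \<omega> t)\<^sup>2 \<partial>N) \<le> C"
  proof -
    have "\<forall>t\<in>I. \<exists>C. (\<forall>m. (\<integral>\<omega>. (Y m \<omega> t)\<^sup>2 \<partial>M) \<le> C)"
      using I(2) Y by (auto simp: l2_bounded_def)
    then obtain C where C: "\<And>t m. t \<in> I \<Longrightarrow> (\<integral>\<omega>. (Y m \<omega> t)\<^sup>2 \<partial>M) \<le> C t"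
      by metis
    have "C t \<le> (\<Sum>t\<in>I. \<bar>C t\<bar> + (\<integral>\<omega>. (Z \<omega> t)\<^sup>2 \<partial>N))" "(\<integral>\<omega>. (Z \<omega> t)\<^sup>2 \<partial>N) \<le> (\<Sum>t\<in>I. \<bar>C t\<bar> + (\<integral>\<omega>. (Z \<omega> t)\<^sup>2 \<partial>N))"
      if "t \<in> I" for t
    proof -
      have 0: "0 \<le> (\<integral>\<omega>. (Z \<omega> t)\<^sup>2 \<partial>N)" for t
        by simp
      then have "\<bar>C t\<bar> + (\<integral>\<omega>. (Z \<omega> t)\<^sup>2 \<partial>N) \<le> (\<Sum>t\<in>I. \<bar>C t\<bar> + (\<integral>\<omega>. (Z \<omega> t)\<^sup>2 \<partial>N))"
        using that I(1) by (intro member_le_sum[of t I "\<lambda>t. \<bar>C t\<bar> + (\<integral>\<omega>. (Z \<omega> t)\<^sup>2 \<partial>N)"] add_nonneg_nonneg) auto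
      then show "C t \<le> (\<Sum>t\<in>I. \<bar>C t\<bar> + (\<integral>\<omega>. (Z \<omega> t)\<^sup>2 \<partial>N))" "(\<integral>\<omega>. (Z \<omega> t)\<^sup>2 \<partial>N) \<le> (\<Sum>t\<in>I. \<bar>C t\<bar> + (\<integral>\<omega>. (Z \<omega> t)\<^sup>2 \<partial>N))"
        using 0[of t] by linarith+
    qed
    then show ?thesis
      using order_trans[OF C] by (intro exI[of _ "\<Sum>t\<in>I. \<bar>C t\<bar> + (\<integral>\<omega>. (Z \<omega> t)\<^sup>2 \<partial>N)"]) blast
  qed
  then obtain C where C: "\<And>t m. t \<in> I \<Longrightarrow> (\<integral>\<omega>. (Y m \<omega> t)\<^sup>2 \<partial>M) \<le> C" "\<And>t. t \<in> I \<Longrightarrow> (\<integral>\<omega>. (Z \<omega> t)\<^sup>2 \<partial>N) \<le> C"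
    by blast
  \<comment> \<open>Stated for an arbitrary probability space, since it is applied both to
    \<open>M\<close> and to \<open>N\<close>, uniformly in \<open>m\<close>.\<close>
  have near: "\<bar>(\<integral>\<omega>. G (V \<omega>) \<partial>Q) - (\<integral>\<omega>. p k (V \<omega>) \<partial>Q)\<bar> \<le> (L * (card I * C) + 1) / Suc k"
    if Q: "prob_space Q" and V: "\<And>t. t \<in> I \<Longrightarrow> (\<lambda>\<omega>. V \<omega> t) \<in> borel_measurable Q"
      "\<And>t. t \<in> I \<Longrightarrow> integrable Q (\<lambda>\<omega>. (V \<omega> t)\<^sup>2)" "\<And>t. t \<in> I \<Longrightarrow> (\<integral>\<omega>. (V \<omega> t)\<^sup>2 \<partial>Q) \<le> C"
      and GV: "(\<lambda>\<omega>. G (V \<omega>)) \<in> borel_measurable Q"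
    for Q :: "'z measure" and V k
  proof -
    interpret Q: prob_space Q by fact
    have iG: "integrable Q (\<lambda>\<omega>. G (V \<omega>))"
      using bd GV by (intro Q.integrable_const_bound[where B=1]) auto
    have "(\<lambda>\<omega>. p k (V \<omega>)) \<in> borel_measurable Q \<and> (\<exists>C. \<forall>u. \<bar>p k u\<bar> \<le> C)"
      by (rule trig_poly_measurable[OF p(1) I(1) V(1)])
    then obtain D where "(\<lambda>\<omega>. p k (V \<omega>)) \<in> borel_measurable Q" "\<And>u. \<bar>p k u\<bar> \<le> D"
      by blast
    then have ip: "integrable Q (\<lambda>\<omega>. p k (V \<omega>))"
      by (intro Q.integrable_const_bound[of _ D]) auto
    have "\<bar>(\<integral>\<omega>. G (V \<omega>) \<partial>Q) - (\<integral>\<omega>. p k (V \<omega>) \<partial>Q)\<bar> = \<bar>\<integral>\<omega>. G (V \<omega>) - p k (V \<omega>) \<partial>Q\<bar>"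
      using iG ip by simp
    also have "\<dots> \<le> (\<integral>\<omega>. \<bar>G (V \<omega>) - p k (V \<omega>)\<bar> \<partial>Q)"
      by (rule integral_abs_bound)
    also have "\<dots> \<le> (\<integral>\<omega>. L / Suc k * (\<Sum>t\<in>I. (V \<omega> t)\<^sup>2) + 1 / Suc k \<partial>Q)"
      using iG ip V by (intro integral_mono pG) auto
    also have "\<dots> = L / Suc k * (\<Sum>t\<in>I. (\<integral>\<omega>. (V \<omega> t)\<^sup>2 \<partial>Q)) + 1 / Suc k"
      using V Q.prob_space by (simp add: Bochner_Integration.integral_add)
    also have "\<dots> \<le> L / Suc k * (\<Sum>t\<in>I. C) + 1 / Suc k"
      using V L by (intro add_mono mult_left_mono sum_mono) auto
    finally show ?thesis
      by (simp add: add_divide_distrib)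
  qed
  have "\<forall>\<^sub>F m in sequentially. \<bar>(\<integral>\<omega>. G (Y m \<omega>) \<partial>M) - (\<integral>x. G (Z x) \<partial>N)\<bar> < e" if "0 < e" for e
  proof -
    let ?D = "L * (card I * C) + 1"
    have "\<forall>\<^sub>F k in sequentially. ?D / Suc k < e / 3"
      using that by (intro order_tendstoD(2)[OF inv0]) auto
    then obtain k where k: "?D / Suc k < e / 3"
      using eventually_happens[of _ sequentially] by (auto simp del: of_nat_Suc)
    have "\<forall>\<^sub>F m in sequentially. \<bar>(\<integral>\<omega>. p k (Y m \<omega>) \<partial>M) - (\<integral>x. p k (Z x) \<partial>N)\<bar> < e / 3"
      using tendstoD[OF trig_poly_conv[OF p(1) I M N Y Z conv], of "e / 3"] that by (simp add: dist_real_def)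
    then show ?thesis
    proof eventually_elim
      case (elim m)
      have "\<bar>(\<integral>\<omega>. G (Y m \<omega>) \<partial>M) - (\<integral>\<omega>. p k (Y m \<omega>) \<partial>M)\<bar> \<le> ?D / Suc k"
        using Y I(2) by (intro near M mY C mG) (auto simp: l2_bounded_def)
      moreover have "\<bar>(\<integral>\<omega>. G (Z \<omega>) \<partial>N) - (\<integral>\<omega>. p k (Z \<omega>) \<partial>N)\<bar> \<le> ?D / Suc k"
        using Z I(2) by (intro near N mZ C mGZ) (auto simp: l2_bounded_def)
      ultimately show ?case
        using elim k by linarith
    qed
  qed
  then show "(\<lambda>m. \<integral>\<omega>. G (Y m \<omega>) \<partial>M) \<longlonglongrightarrow> (\<integral>x. G (Z x) \<partial>N)"
    by (intro tendstoI) (simp add: dist_real_def)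
qed

section \<open>The portmanteau theorem for bounded processes\<close>

text \<open>One representative is chosen from every nonempty fibre of \<open>f\<close>; the fibres
  are the cells of a finite partition.\<close>

lemma finite_retract:
  assumes "finite (f ` T)"
  shows "\<exists>I \<pi>. finite I \<and> I \<subseteq> T \<and> \<pi> ` T \<subseteq> I \<and> (\<forall>t\<in>T. f (\<pi> t) = f t)"
proof (intro exI conjI)
  let ?\<pi> = "\<lambda>t. inv_into T f (f t)"
  show "finite (?\<pi> ` T)"
    using finite_imageI[OF assms, of "inv_into T f"] by (simp add: image_image)
  show "?\<pi> ` T \<subseteq> T"
    by (auto intro: inv_into_into)
  show "\<forall>t\<in>T. f (?\<pi> t) = f t"
    by (auto intro: f_inv_into_f)
qed auto

text \<open>Take a finite \<open>e / 3\<close>-net of \<open>K\<close> and code each index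
  \<open>t\<close> by the values of the net functions at \<open>t\<close>, rounded to a grid of mesh
  \<open>e / 3\<close>. There are finitely many codes, and indices with the same code are
  indistinguishable up to \<open>e / 3\<close> for the net, hence up to \<open>e\<close> for
  \<open>K\<close>.\<close>

lemma compact_retract:
  assumes K: "compact K" and e: "0 < e"
  shows "\<exists>I \<pi>. finite I \<and> I \<subseteq> T \<and> \<pi> ` T \<subseteq> I \<and> (\<forall>z\<in>K. \<forall>t\<in>T. \<bar>bapp z t - bapp z (\<pi> t)\<bar> \<le> e)"
proof -
  have e3: "0 < e / 3"
    using e by simp
  obtain k where k: "finite k" "K \<subseteq> (\<Union>z\<in>k. ball z (e / 3))"
    using K e3 unfolding compact_eq_totally_bounded by meson
  define f where "f = (\<lambda>t. restrict (\<lambda>z. \<lfloor>bapp z t / (e / 3)\<rfloor>) k)"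
  have "f ` T \<subseteq> PiE k (\<lambda>z. {\<lfloor>- norm z / (e / 3)\<rfloor>..\<lfloor>norm z / (e / 3)\<rfloor>})"
  proof (clarsimp simp: f_def)
    fix z t
    show "\<lfloor>- (norm z * 3 / e)\<rfloor> \<le> \<lfloor>bapp z t * 3 / e\<rfloor> \<and> \<lfloor>bapp z t * 3 / e\<rfloor> \<le> \<lfloor>norm z * 3 / e\<rfloor>"
      using abs_bapp_le_norm[of z t] e
      by (intro conjI floor_mono) (simp_all add: field_simps abs_le_iff)
  qed
  then have "finite (f ` T)"
    by (rule finite_subset) (intro finite_PiE k, simp)
  from finite_retract[OF this] obtain I \<pi> where I: "finite I" "I \<subseteq> T" "\<pi> ` T \<subseteq> I" "\<And>t. t \<in> T \<Longrightarrow> f (\<pi> t) = f t"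
    by blast
  have "\<bar>bapp z t - bapp z (\<pi> t)\<bar> \<le> e" if z: "z \<in> K" and t: "t \<in> T" for z t
  proof -
    obtain y where y: "y \<in> k" "dist y z < e / 3"
      using k(2) z by auto
    have "\<lfloor>bapp y t / (e / 3)\<rfloor> = \<lfloor>bapp y (\<pi> t) / (e / 3)\<rfloor>"
      using I(4)[OF t] y(1) by (auto simp: f_def restrict_def fun_eq_iff split: if_splits)
    then have "\<bar>bapp y t / (e / 3) - bapp y (\<pi> t) / (e / 3)\<bar> \<le> 1"
      by linarith
    then have "\<bar>bapp y t - bapp y (\<pi> t)\<bar> / (e / 3) \<le> 1"
      using e by (simp only: diff_divide_distrib[symmetric] abs_divide abs_of_pos[OF e3])
    then have "\<bar>bapp y t - bapp y (\<pi> t)\<bar> \<le> e / 3"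
      using e by (simp add: divide_le_eq)
    moreover have "\<bar>bapp y t - bapp z t\<bar> \<le> e / 3" "\<bar>bapp y (\<pi> t) - bapp z (\<pi> t)\<bar> \<le> e / 3"
      using abs_bapp_diff_le[of y t z] abs_bapp_diff_le[of y "\<pi> t" z] y(2) by (simp_all add: dist_norm)
    ultimately show ?thesis
      by linarith
  qed
  then show ?thesis
    using I by blast
qed

text \<open>
  A finite partition of the index set is encoded by the map \<open>\<pi>\<close> to representatives of its cells.
\<close>

definition asymp_equicont :: "'t set \<Rightarrow> 'w measure \<Rightarrow> (nat \<Rightarrow> 'w \<Rightarrow> 't \<Rightarrow> real) \<Rightarrow> bool" where
  "asymp_equicont T M Y \<longleftrightarrow>
     (\<forall>\<epsilon>>0. \<forall>\<eta>>0. \<exists>I \<pi>. finite I \<and> I \<subseteq> T \<and> \<pi> ` T \<subseteq> I \<and>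
        (\<forall>\<^sub>F m in sequentially. ocover M {\<omega>. \<exists>t\<in>T. \<bar>Y m \<omega> t - Y m \<omega> (\<pi> t)\<bar> > \<epsilon>} \<eta>))"

lemma asymp_equicontD:
  assumes "asymp_equicont T M Y" "0 < \<epsilon>" "0 < \<eta>"
  shows "\<exists>I \<pi>. finite I \<and> I \<subseteq> T \<and> \<pi> ` T \<subseteq> I \<and>
        (\<forall>\<^sub>F m in sequentially. ocover M {\<omega>. \<exists>t\<in>T. \<bar>Y m \<omega> t - Y m \<omega> (\<pi> t)\<bar> > \<epsilon>} \<eta>)"
  by (rule assms(1)[unfolded asymp_equicont_def, rule_format, OF assms(2,3)])

text \<open>The common refinement of two finite partitions: representatives are chosen for the pairs
  of cells.\<close>

lemma common_retract:
  assumes "finite I1" "\<pi>1 ` T \<subseteq> I1" "finite I2" "\<pi>2 ` T \<subseteq> I2"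
  shows "\<exists>I \<pi>. finite I \<and> I \<subseteq> T \<and> \<pi> ` T \<subseteq> I \<and> (\<forall>t\<in>T. \<pi>1 (\<pi> t) = \<pi>1 t \<and> \<pi>2 (\<pi> t) = \<pi>2 t)"
proof -
  have "finite ((\<lambda>t. (\<pi>1 t, \<pi>2 t)) ` T)"
    by (rule finite_subset[OF _ finite_cartesian_product[OF assms(1,3)]]) (use assms in auto)
  from finite_retract[OF this] show ?thesis
    by auto
qed

text \<open>Both \<open>t\<close> and \<open>\<pi> t\<close> lie in the same cell of
  \<open>\<rho>\<close>, so each is compared with their common representative. This is the factor 2
  paid for refining a partition.\<close>

lemma abs_diff_retract_le:
  fixes z :: "'t \<Rightarrow> real"
  assumes "\<forall>t\<in>T. \<bar>z t - z (\<rho> t)\<bar> \<le> e" "t \<in> T" "\<pi> t \<in> T" "\<rho> (\<pi> t) = \<rho> t"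
  shows "\<bar>z t - z (\<pi> t)\<bar> \<le> 2 * e"
proof -
  have a: "\<bar>z t - z (\<rho> t)\<bar> \<le> e" and b: "\<bar>z (\<pi> t) - z (\<rho> (\<pi> t))\<bar> \<le> e"
    using assms(1-3) by blast+
  have "z t - z (\<pi> t) = (z t - z (\<rho> t)) - (z (\<pi> t) - z (\<rho> (\<pi> t)))"
    by (simp add: assms(4))
  then show ?thesis
    using a b abs_triangle_ineq4[of "z t - z (\<rho> t)" "z (\<pi> t) - z (\<rho> (\<pi> t))"] by linarith
qed

text \<open>Constant on the cells of \<open>\<pi>\<close>, hence a function of finitely many
  coordinates of \<open>u\<close>.\<close>

definition step_fun :: "'t set \<Rightarrow> ('t \<Rightarrow> 't) \<Rightarrow> ('t \<Rightarrow> real) \<Rightarrow> 't bfun" where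
  "step_fun T \<pi> u = to_linf T (\<lambda>t. u (\<pi> t))"

lemma step_fun:
  assumes "finite I" "\<pi> ` T \<subseteq> I"
  shows "bapp (step_fun T \<pi> u) t = (if t \<in> T then u (\<pi> t) else 0)" "step_fun T \<pi> u \<in> linf T"
proof -
  have "bounded ((\<lambda>t. u (\<pi> t)) ` T)"
    by (rule finite_imp_bounded) (rule finite_subset[OF _ finite_imageI[OF assms(1), of u]], use assms in auto)
  then show "bapp (step_fun T \<pi> u) t = (if t \<in> T then u (\<pi> t) else 0)" "step_fun T \<pi> u \<in> linf T"
    by (auto simp: step_fun_def bapp_to_linf to_linf_in_linf)
qed

lemma norm_linf_le:
  assumes "z \<in> linf T" "\<And>t. t \<in> T \<Longrightarrow> \<bar>bapp z t\<bar> \<le> e" "0 \<le> e"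
  shows "norm z \<le> e"
proof (rule norm_bound)
  fix d :: "'a discrete"
  show "norm (apply_bcontfun z d) \<le> e"
    using assms(2)[of "of_discrete d"] assms(1,3) of_discrete_inverse[of d]
    by (cases "of_discrete d \<in> T") (auto simp: linf_def)
qed

lemma norm_step_fun_diff:
  assumes I: "finite I" "\<pi> ` T \<subseteq> I"
  shows "norm (step_fun T \<pi> u - step_fun T \<pi> v) \<le> (\<Sum>t\<in>I. \<bar>u t - v t\<bar>)"
proof (rule norm_linf_le)
  show "step_fun T \<pi> u - step_fun T \<pi> v \<in> linf T"
    by (intro subspace_diff subspace_linf step_fun[OF I])
  fix t assume "t \<in> T"
  then show "\<bar>bapp (step_fun T \<pi> u - step_fun T \<pi> v) t\<bar> \<le> (\<Sum>t\<in>I. \<bar>u t - v t\<bar>)"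
    using member_le_sum[of "\<pi> t" I "\<lambda>t. \<bar>u t - v t\<bar>"] I by (auto simp: step_fun[OF I])
qed (simp add: sum_nonneg)

lemma norm_diff_step_fun:
  assumes I: "finite I" "\<pi> ` T \<subseteq> I" and z: "z \<in> linf T" "\<forall>t\<in>T. \<bar>bapp z t - bapp z (\<pi> t)\<bar> \<le> e" and e: "0 \<le> e"
  shows "norm (z - step_fun T \<pi> (bapp z)) \<le> e"
proof (rule norm_linf_le[of _ T])
  show "z - step_fun T \<pi> (bapp z) \<in> linf T"
    by (intro subspace_diff subspace_linf z(1) step_fun(2)[OF I])
  fix t assume "t \<in> T"
  then show "\<bar>bapp (z - step_fun T \<pi> (bapp z)) t\<bar> \<le> e"
    using z(2)[rule_format, of t] by (simp add: step_fun(1)[OF I])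
qed (fact e)

text \<open>The closed neighbourhoods of a closed set decrease to the set, and the measure is
  continuous from above.\<close>

lemma infdist_level_measure:
  fixes Z :: "'v \<Rightarrow> 'b::metric_space"
  assumes N: "prob_space N" and Z: "Z \<in> borel_measurable N" and C: "closed C" "C \<noteq> {}" and \<eta>: "0 < \<eta>"
  shows "\<exists>d>0. measure N {x \<in> space N. infdist (Z x) C \<le> d} \<le> measure N {x \<in> space N. Z x \<in> C} + \<eta>"
proof -
  interpret N: prob_space N by fact
  define A where "A = (\<lambda>n::nat. {x \<in> space N. infdist (Z x) C \<le> 1 / Suc n})"
  have sets: "{x \<in> space N. infdist (Z x) C \<le> d} \<in> sets N" for d
  proof -
    have "(\<lambda>y. infdist y C) \<in> borel_measurable borel"
      by (intro borel_measurable_continuous_onI continuous_intros)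
    then have "(\<lambda>x. infdist (Z x) C) \<in> borel_measurable N"
      by (rule measurable_compose[OF Z])
    then show ?thesis by measurable
  qed
  have "(\<lambda>n. measure N (A n)) \<longlonglongrightarrow> measure N (\<Inter>n. A n)"
  proof (rule N.finite_Lim_measure_decseq)
    show "range A \<subseteq> sets N"
      using sets by (auto simp: A_def)
    show "decseq A"
      unfolding A_def by (intro antimonoI) (auto intro: order_trans simp: frac_le)
  qed
  also have "(\<Inter>n. A n) = {x \<in> space N. Z x \<in> C}"
  proof safe
    fix x assume x: "x \<in> (\<Inter>n. A n)"
    then have "infdist (Z x) C \<le> 1 / Suc n" for n
      by (auto simp: A_def)
    then have "infdist (Z x) C \<le> 0"
      by (intro LIMSEQ_le_const[OF LIMSEQ_Suc[OF lim_const_over_n[of 1]]]) auto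
    then have "infdist (Z x) C = 0"
      using infdist_nonneg[of "Z x" C] by linarith
    then show "Z x \<in> C"
      using C by (simp add: in_closed_iff_infdist_zero)
    show "x \<in> space N"
      using x by (auto simp: A_def)
  qed (auto simp: A_def)
  finally have "\<forall>\<^sub>F n in sequentially. measure N (A n) < measure N {x \<in> space N. Z x \<in> C} + \<eta>"
    using \<eta> by (intro order_tendstoD) auto
  then obtain n where "measure N (A n) < measure N {x \<in> space N. Z x \<in> C} + \<eta>"
    using eventually_happens[of _ sequentially] by auto
  then show ?thesis
    unfolding A_def by (intro exI[of _ "1 / Suc n"]) auto
qed

text \<open>Both processes are replaced by step functions on one finite partition, fine enough for
  \<open>Y m\<close> by asymptotic equicontinuity and for \<open>Z\<close> by a compact set
  \<open>K\<close>. A Lipschitz function of finitely many coordinates then separates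
  \<open>C\<close> from the points at distance more than \<open>d\<close>. Four errors of
  \<open>\<eta> / 4\<close> arise: enlarging \<open>C\<close>, leaving \<open>K\<close>, the
  oscillation of \<open>Y m\<close>, and the convergence of the means.\<close>

theorem portmanteau_closed:
  fixes Y :: "nat \<Rightarrow> 'w \<Rightarrow> 't bfun" and Z :: "'v \<Rightarrow> 't bfun"
  assumes M: "prob_space M" and N: "prob_space N"
    and Yin: "\<And>m \<omega>. \<omega> \<in> space M \<Longrightarrow> Y m \<omega> \<in> linf T" and tight: "tight_element (linf T) N Z"
    and Y: "l2_bounded T M (\<lambda>m \<omega>. bapp (Y m \<omega>))" and Z: "l2_bounded T N (\<lambda>_ x. bapp (Z x))"
    and conv: "fidi_conv T M (\<lambda>m \<omega>. bapp (Y m \<omega>)) N (\<lambda>x. bapp (Z x))"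
    and equi: "asymp_equicont T M (\<lambda>m \<omega>. bapp (Y m \<omega>))"
    and C: "closed C" and \<eta>: "0 < \<eta>"
  shows "\<forall>\<^sub>F m in sequentially. ocover M {\<omega>. Y m \<omega> \<in> C} (measure N {x \<in> space N. Z x \<in> C} + \<eta>)"
proof (cases "C = {}")
  case True
  then show ?thesis
    using \<eta> by (simp add: ocover_empty)
next
  case False
  interpret M: prob_space M by fact
  interpret N: prob_space N by fact
  have mZ: "Z \<in> borel_measurable N" and Zin: "\<And>x. x \<in> space N \<Longrightarrow> Z x \<in> linf T"
    using tight by (auto simp: tight_element_def)
  obtain d where d: "0 < d" "measure N {x \<in> space N. infdist (Z x) C \<le> d} \<le> measure N {x \<in> space N. Z x \<in> C} + \<eta> / 4"
    using infdist_level_measure[OF N mZ C False, of "\<eta> / 4"] \<eta> by auto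
  define \<epsilon> where "\<epsilon> = d / 6"
  have \<epsilon>: "0 < \<epsilon>"
    using d by (simp add: \<epsilon>_def)
  obtain I1 \<pi>1 where 1: "finite I1" "\<pi>1 ` T \<subseteq> I1" "\<forall>\<^sub>F m in sequentially.
      ocover M {\<omega>. \<exists>t\<in>T. \<bar>bapp (Y m \<omega>) t - bapp (Y m \<omega>) (\<pi>1 t)\<bar> > \<epsilon>} (\<eta> / 4)"
    using asymp_equicontD[OF equi \<epsilon>, of "\<eta> / 4"] \<eta> by auto
  obtain K where K: "compact K" "K \<subseteq> linf T" "1 - \<eta> / 4 \<le> measure N {x \<in> space N. Z x \<in> K}"
    using tight \<eta> unfolding tight_element_def by (metis divide_pos_pos zero_less_numeral)
  obtain I2 \<pi>2 where 2: "finite I2" "\<pi>2 ` T \<subseteq> I2" "\<forall>z\<in>K. \<forall>t\<in>T. \<bar>bapp z t - bapp z (\<pi>2 t)\<bar> \<le> \<epsilon>"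
    using compact_retract[OF K(1) \<epsilon>, of T] by blast
  obtain I \<pi> where I: "finite I" "I \<subseteq> T" "\<pi> ` T \<subseteq> I"
      "\<forall>t\<in>T. \<pi>1 (\<pi> t) = \<pi>1 t \<and> \<pi>2 (\<pi> t) = \<pi>2 t"
    using common_retract[OF 1(1,2) 2(1,2)] by blast
  have \<pi>T: "\<pi> t \<in> T" if "t \<in> T" for t
    using I that by blast
  \<comment> \<open>The value is 1 up to distance \<open>3 * \<epsilon>\<close> from
    \<open>C\<close> and 0 from \<open>4 * \<epsilon>\<close> on. The step functions err by at most
    \<open>2 * \<epsilon>\<close>, so \<open>Y m \<omega> \<in> C\<close> gives value 1, and
    \<open>Z x\<close> farther than \<open>d = 6 * \<epsilon>\<close> gives value 0.\<close>
  define G where "G = (\<lambda>u. max 0 (min 1 (4 - infdist (step_fun T \<pi> u) C / \<epsilon>)))"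
  have G01: "0 \<le> G u" "G u \<le> 1" for u
    by (auto simp: G_def)
  have Gl: "\<bar>G u - G v\<bar> \<le> 1 / \<epsilon> * (\<Sum>t\<in>I. \<bar>u t - v t\<bar>)" for u v
  proof -
    have "\<bar>infdist (step_fun T \<pi> u) C - infdist (step_fun T \<pi> v) C\<bar> \<le> norm (step_fun T \<pi> u - step_fun T \<pi> v)"
      using infdist_triangle_abs[of "step_fun T \<pi> u" C "step_fun T \<pi> v"] by (simp add: dist_norm)
    also have "\<dots> \<le> (\<Sum>t\<in>I. \<bar>u t - v t\<bar>)"
      by (rule norm_step_fun_diff[OF I(1,3)])
    finally have *: "\<bar>infdist (step_fun T \<pi> u) C - infdist (step_fun T \<pi> v) C\<bar> / \<epsilon> \<le> 1 / \<epsilon> * (\<Sum>t\<in>I. \<bar>u t - v t\<bar>)"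
      using \<epsilon> by (simp add: divide_right_mono)
    have clamp: "\<bar>max 0 (min 1 (4 - a)) - max 0 (min 1 (4 - b))\<bar> \<le> \<bar>a - b\<bar>" for a b :: real
      by linarith
    have "\<bar>G u - G v\<bar> \<le> \<bar>infdist (step_fun T \<pi> u) C / \<epsilon> - infdist (step_fun T \<pi> v) C / \<epsilon>\<bar>"
      unfolding G_def by (rule clamp)
    also have "\<dots> = \<bar>infdist (step_fun T \<pi> u) C - infdist (step_fun T \<pi> v) C\<bar> / \<epsilon>"
      using \<epsilon> unfolding diff_divide_distrib[symmetric] by simp
    finally show ?thesis
      using * by (rule order_trans)
  qed
  have Gb: "\<bar>G u\<bar> \<le> 1" for u
    using G01[of u] by simp
  note lc = lipschitz_conv[OF I(1,2) M N Y Z conv Gl _ Gb]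
  have e0: "0 \<le> 1 / \<epsilon>"
    using \<epsilon> by simp
  have limit: "(\<integral>x. G (bapp (Z x)) \<partial>N) \<le> measure N {x \<in> space N. Z x \<in> C} + \<eta> / 2"
  proof -
    let ?A = "{x \<in> space N. infdist (Z x) C \<le> d}" and ?B = "{x \<in> space N. Z x \<in> K}"
    have sA: "?A \<in> sets N"
    proof -
      have "(\<lambda>y. infdist y C) \<in> borel_measurable borel"
        by (intro borel_measurable_continuous_onI continuous_intros)
      then have "(\<lambda>x. infdist (Z x) C) \<in> borel_measurable N"
        by (rule measurable_compose[OF mZ])
      then show ?thesis by measurable
    qed
    have sB: "?B \<in> sets N"
      using measurable_sets[OF mZ borel_closed[OF compact_imp_closed[OF K(1)]]] by (simp add: vimage_def Int_def conj_commute)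
    have "G (bapp (Z x)) \<le> indicator (?A \<union> (space N - ?B)) x" if x: "x \<in> space N" for x
    proof (cases "x \<in> ?A \<union> (space N - ?B)")
      case True
      then show ?thesis using G01 by simp
    next
      case False
      then have ZK: "Z x \<in> K" and "infdist (Z x) C > d"
        using x by auto
      have "norm (Z x - step_fun T \<pi> (bapp (Z x))) \<le> 2 * \<epsilon>"
        using 2(3) ZK I \<epsilon> \<pi>T Zin[OF x]
        by (intro norm_diff_step_fun[OF I(1,3)] ballI abs_diff_retract_le[where \<rho>=\<pi>2]) auto
      then have "infdist (Z x) C \<le> infdist (step_fun T \<pi> (bapp (Z x))) C + 2 * \<epsilon>"
        using infdist_triangle[of "Z x" C "step_fun T \<pi> (bapp (Z x))"] by (simp add: dist_norm)
      then have "4 * \<epsilon> \<le> infdist (step_fun T \<pi> (bapp (Z x))) C"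
        using \<open>infdist (Z x) C > d\<close> by (simp add: \<epsilon>_def)
      then have "4 \<le> infdist (step_fun T \<pi> (bapp (Z x))) C / \<epsilon>"
        using \<epsilon> by (simp add: field_simps)
      then show ?thesis
        by (simp add: G_def)
    qed
    then have "(\<integral>x. G (bapp (Z x)) \<partial>N) \<le> (\<integral>x. indicator (?A \<union> (space N - ?B)) x \<partial>N)"
      using sA sB lc(2)[OF e0] Gb
      by (intro integral_mono N.integrable_const_bound[where B=1] integrable_real_indicator) 
         (auto simp: N.emeasure_eq_measure)
    also have "\<dots> = measure N (?A \<union> (space N - ?B))"
      using sA sB by (simp add: Int_absorb1 sets.sets_into_space)
    also have "\<dots> \<le> measure N ?A + measure N (space N - ?B)"
      using sA sB by (intro measure_Un_le) auto
    also have "measure N (space N - ?B) \<le> \<eta> / 4"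
      using N.prob_compl[OF sB] K(3) by simp
    finally show ?thesis
      using d(2) by simp
  qed
  have "\<forall>\<^sub>F m in sequentially. (\<integral>\<omega>. G (bapp (Y m \<omega>)) \<partial>M) < (\<integral>x. G (bapp (Z x)) \<partial>N) + \<eta> / 4"
    using \<eta> by (intro order_tendstoD(2)[OF lc(3)[OF e0]]) simp
  with 1(3) show ?thesis
  proof eventually_elim
    case (elim m)
    let ?S = "{\<omega> \<in> space M. 1 \<le> G (bapp (Y m \<omega>))}"
    have "measure M ?S \<le> (\<integral>\<omega>. G (bapp (Y m \<omega>)) \<partial>M) / 1"
      using lc(1)[OF e0] G01 by (intro integral_Markov_inequality_measure[where A="{}"])
        (auto intro!: M.integrable_const_bound[where B=1])
    then have "measure M ?S \<le> measure N {x \<in> space N. Z x \<in> C} + 3 * \<eta> / 4"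
      using elim(2) limit by simp
    then have "ocover M ?S (measure N {x \<in> space N. Z x \<in> C} + 3 * \<eta> / 4)"
      using lc(1)[OF e0, of m] by (intro ocoverI[of ?S]) auto
    from ocover_Un[OF M this elim(1)] show ?case
    proof (rule ocover_mono)
      show "{\<omega>. Y m \<omega> \<in> C} \<inter> space M \<subseteq> ?S \<union> {\<omega>. \<exists>t\<in>T. \<bar>bapp (Y m \<omega>) t - bapp (Y m \<omega>) (\<pi>1 t)\<bar> > \<epsilon>}"
      proof (rule ccontr)
        assume "\<not> ?thesis"
        then obtain \<omega> where \<omega>: "Y m \<omega> \<in> C" "\<omega> \<in> space M" "\<omega> \<notin> ?S"
          "\<not> (\<exists>t\<in>T. \<bar>bapp (Y m \<omega>) t - bapp (Y m \<omega>) (\<pi>1 t)\<bar> > \<epsilon>)"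
          by blast
        then have "\<not> 1 \<le> G (bapp (Y m \<omega>))" "\<forall>t\<in>T. \<bar>bapp (Y m \<omega>) t - bapp (Y m \<omega>) (\<pi>1 t)\<bar> \<le> \<epsilon>"
          by (simp_all add: not_less)
        note \<omega> = \<omega>(1,2) this
        have "norm (Y m \<omega> - step_fun T \<pi> (bapp (Y m \<omega>))) \<le> 2 * \<epsilon>"
          using \<omega> I \<epsilon> \<pi>T Yin
          by (intro norm_diff_step_fun[OF I(1,3)] ballI abs_diff_retract_le[where \<rho>=\<pi>1]) auto
        then have "infdist (step_fun T \<pi> (bapp (Y m \<omega>))) C \<le> 2 * \<epsilon>"
          using infdist_le2[OF \<omega>(1), of "step_fun T \<pi> (bapp (Y m \<omega>))"] by (simp add: dist_norm norm_minus_commute)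
        then have "infdist (step_fun T \<pi> (bapp (Y m \<omega>))) C / \<epsilon> \<le> 2"
          using \<epsilon> by (simp add: field_simps)
        then show False
          using \<omega>(3) by (simp add: G_def)
      qed
    qed simp
  qed
qed

section \<open>Gaussian processes\<close>

lemma gaussian_rv_moments:
  assumes "prob_space N" "gaussian_rv N Y" "(\<integral>x. Y x \<partial>N) = 0"
  shows "integrable N (\<lambda>x. (Y x)\<^sup>2)"
    and "(\<integral>x. iexp (Y x) \<partial>N) = complex_of_real (exp (- (\<integral>x. (Y x)\<^sup>2 \<partial>N) / 2))"
proof -
  interpret prob_space N by fact
  have meas [measurable]: "Y \<in> borel_measurable N"
    using assms(2) by (simp add: gaussian_rv_def)
  obtain m where "(AE x in N. Y x = m) \<or> (\<exists>\<sigma>>0. distributed N lborel Y (normal_density m \<sigma>))"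
    using assms(2) by (auto simp: gaussian_rv_def)
  then have "integrable N (\<lambda>x. (Y x)\<^sup>2) \<and>
    (\<integral>x. iexp (Y x) \<partial>N) = complex_of_real (exp (- (\<integral>x. (Y x)\<^sup>2 \<partial>N) / 2))"
  proof (elim disjE exE conjE)
    assume ae: "AE x in N. Y x = m"
    have "(\<integral>x. Y x \<partial>N) = (\<integral>x. m \<partial>N)"
      using ae by (intro integral_cong_AE) auto
    then have "m = 0"
      using assms(3) prob_space by simp
    then have "AE x in N. Y x = 0"
      using ae by simp
    then have *: "AE x in N. (Y x)\<^sup>2 = 0" "AE x in N. iexp (Y x) = 1"
      by auto
    have "integrable N (\<lambda>x. (Y x)\<^sup>2) \<longleftrightarrow> integrable N (\<lambda>x. 0 :: real)"
      using * by (intro integrable_cong_AE) auto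
    moreover have "(\<integral>x. (Y x)\<^sup>2 \<partial>N) = (\<integral>x. 0 \<partial>N)" "(\<integral>x. iexp (Y x) \<partial>N) = (\<integral>x. 1 \<partial>N)"
      using * by (intro integral_cong_AE; simp)+
    ultimately show ?thesis
      using prob_space by simp
  next
    fix \<sigma> :: real assume \<sigma>: "0 < \<sigma>" and D: "distributed N lborel Y (normal_density m \<sigma>)"
    have m: "m = 0"
      using normal_distributed_expectation[OF \<sigma> D] assms(3) by simp
    have int: "integrable N (\<lambda>x. (Y x)\<^sup>2)"
      using distributed_integrable[OF D, of "\<lambda>x. x\<^sup>2"] integrable_normal_moment[OF \<sigma>, of 0 2] m by simp
    have var: "(\<integral>x. (Y x)\<^sup>2 \<partial>N) = \<sigma>\<^sup>2"
      using normal_distributed_variance[OF \<sigma> D] assms(3) by simp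
    have V: "distributed N lborel (\<lambda>x. Y x / \<sigma>) std_normal_density"
      using D normal_standard_normal_convert[OF \<sigma>, of Y 0] m by simp
    have "(\<integral>x. iexp (Y x) \<partial>N) = (\<integral>x. iexp (\<sigma> * (Y x / \<sigma>)) \<partial>N)"
      using \<sigma> by simp
    also have "\<dots> = (\<integral>y. iexp (\<sigma> * y) \<partial>distr N lborel (\<lambda>x. Y x / \<sigma>))"
      by (subst integral_distr) auto
    also have "\<dots> = char std_normal_distribution \<sigma>"
      unfolding distributed_distr_eq_density[OF V] char_def by simp
    also have "\<dots> = complex_of_real (exp (- \<sigma>\<^sup>2 / 2))"
      by (simp add: char_std_normal_distribution)
    finally show ?thesis
      using int var by simp
  qed
  then show "integrable N (\<lambda>x. (Y x)\<^sup>2)"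
    "(\<integral>x. iexp (Y x) \<partial>N) = complex_of_real (exp (- (\<integral>x. (Y x)\<^sup>2 \<partial>N) / 2))"
    by auto
qed

lemma zero_mean_gaussian_process_moments:
  assumes N: "prob_space N" and X: "zero_mean_gaussian_process T N X"
  shows "t \<in> T \<Longrightarrow> X t \<in> borel_measurable N" "t \<in> T \<Longrightarrow> integrable N (\<lambda>x. (X t x)\<^sup>2)"
    "t \<in> T \<Longrightarrow> integrable N (X t)"
    "s \<in> T \<Longrightarrow> t \<in> T \<Longrightarrow> integrable N (\<lambda>x. X s x * X t x)"
proof -
  interpret prob_space N by fact
  have g: "gaussian_rv N (X t)" if "t \<in> T" for t
  proof -
    have "\<forall>I c. finite I \<and> I \<subseteq> T \<longrightarrow> gaussian_rv N (\<lambda>x. \<Sum>t\<in>I. c t * X t x)"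
      using X by (simp add: zero_mean_gaussian_process_def gaussian_process_def)
    from this[rule_format, of "{t}" "\<lambda>_. 1"] that have "gaussian_rv N (\<lambda>x. \<Sum>s\<in>{t}. 1 * X s x)"
      by simp
    then show ?thesis by simp
  qed
  have m: "X t \<in> borel_measurable N" if "t \<in> T" for t
    using g[OF that] by (simp add: gaussian_rv_def)
  have s: "integrable N (\<lambda>x. (X t x)\<^sup>2)" if "t \<in> T" for t
    using gaussian_rv_moments(1)[OF N g] X that by (simp add: zero_mean_gaussian_process_def)
  show "integrable N (\<lambda>x. X s x * X t x)" if "s \<in> T" "t \<in> T"
  proof (rule Bochner_Integration.integrable_bound)
    show "integrable N (\<lambda>x. (X s x)\<^sup>2 + (X t x)\<^sup>2)"
      using s that by simp
    have "\<bar>a * b\<bar> \<le> a\<^sup>2 + b\<^sup>2" for a b :: real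
    proof -
      have "2 * (\<bar>a\<bar> * \<bar>b\<bar>) \<le> a\<^sup>2 + b\<^sup>2" "0 \<le> \<bar>a\<bar> * \<bar>b\<bar>"
        using sum_squares_bound[of "\<bar>a\<bar>" "\<bar>b\<bar>"] by simp_all
      then show ?thesis
        unfolding abs_mult by linarith
    qed
    then show "AE x in N. norm (X s x * X t x) \<le> norm ((X s x)\<^sup>2 + (X t x)\<^sup>2)"
      by simp
    show "(\<lambda>x. X s x * X t x) \<in> borel_measurable N"
      using m that by simp
  qed
  show "t \<in> T \<Longrightarrow> integrable N (X t)"
    using square_integrable_imp_integrable[OF m s] by simp
  show "t \<in> T \<Longrightarrow> X t \<in> borel_measurable N" "t \<in> T \<Longrightarrow> integrable N (\<lambda>x. (X t x)\<^sup>2)"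
    by (fact m, fact s)
qed

lemma zero_mean_gaussian_process_charfun:
  assumes N: "prob_space N" and X: "zero_mean_gaussian_process T N X" and I: "finite I" "I \<subseteq> T"
  shows "(\<integral>x. iexp (\<Sum>t\<in>I. c t * X t x) \<partial>N) =
    complex_of_real (exp (- (\<Sum>s\<in>I. \<Sum>t\<in>I. c s * c t * (\<integral>x. X s x * X t x \<partial>N)) / 2))"
proof -
  interpret prob_space N by fact
  have in_T: "t \<in> T" if "t \<in> I" for t
    using I(2) that by auto
  note mom = zero_mean_gaussian_process_moments[OF N X]
  have "\<forall>I c. finite I \<and> I \<subseteq> T \<longrightarrow> gaussian_rv N (\<lambda>x. \<Sum>t\<in>I. c t * X t x)"
    using X by (simp add: zero_mean_gaussian_process_def gaussian_process_def)
  then have g: "gaussian_rv N (\<lambda>x. \<Sum>t\<in>I. c t * X t x)"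
    using I by simp
  have "(\<integral>x. (\<Sum>t\<in>I. c t * X t x) \<partial>N) = (\<Sum>t\<in>I. c t * (\<integral>x. X t x \<partial>N))"
    using mom(3) in_T by (subst Bochner_Integration.integral_sum) auto
  also have "\<dots> = 0"
    using X in_T by (intro sum.neutral) (auto simp: zero_mean_gaussian_process_def)
  finally have 0: "(\<integral>x. (\<Sum>t\<in>I. c t * X t x) \<partial>N) = 0" .
  have "(\<integral>x. (\<Sum>t\<in>I. c t * X t x)\<^sup>2 \<partial>N) = (\<integral>x. (\<Sum>s\<in>I. \<Sum>t\<in>I. c s * c t * (X s x * X t x)) \<partial>N)"
    by (intro Bochner_Integration.integral_cong refl) (simp add: power2_eq_square sum_product mult_ac)
  also have "\<dots> = (\<Sum>s\<in>I. \<integral>x. (\<Sum>t\<in>I. c s * c t * (X s x * X t x)) \<partial>N)"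
    by (intro Bochner_Integration.integral_sum Bochner_Integration.integrable_sum integrable_mult_right mom(4) in_T)
  also have "\<dots> = (\<Sum>s\<in>I. \<Sum>t\<in>I. \<integral>x. c s * c t * (X s x * X t x) \<partial>N)"
    by (intro sum.cong refl Bochner_Integration.integral_sum integrable_mult_right mom(4) in_T)
  also have "\<dots> = (\<Sum>s\<in>I. \<Sum>t\<in>I. c s * c t * (\<integral>x. X s x * X t x \<partial>N))"
    by simp
  finally have "(\<integral>x. (\<Sum>t\<in>I. c t * X t x)\<^sup>2 \<partial>N) = (\<Sum>s\<in>I. \<Sum>t\<in>I. c s * c t * (\<integral>x. X s x * X t x \<partial>N))" .
  then show ?thesis
    using gaussian_rv_moments(2)[OF N g 0] by simp
qed

text \<open>The link between \<open>fidi_conv\<close>, which is written with real cosines and a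
  phase, and complex characteristic functions: a shifted cosine is the real part of a rotated
  exponential.\<close>

lemma integral_cos_shift:
  assumes "prob_space N" "\<theta> \<in> borel_measurable N"
  shows "(\<integral>x. cos (\<theta> x + b) \<partial>N) = Re (iexp b * (\<integral>x. iexp (\<theta> x) \<partial>N))"
proof -
  interpret prob_space N by fact
  have int: "integrable N (\<lambda>x. iexp b * iexp (\<theta> x))"
    using assms(2) by (intro integrable_const_bound[where B=1]) (auto simp: norm_mult)
  have "iexp b * (\<integral>x. iexp (\<theta> x) \<partial>N) = (\<integral>x. iexp b * iexp (\<theta> x) \<partial>N)"
    by simp
  also have "Re \<dots> = (\<integral>x. Re (iexp b * iexp (\<theta> x)) \<partial>N)"
    by (rule integral_Re[OF int, symmetric])
  also have "\<dots> = (\<integral>x. cos (\<theta> x + b) \<partial>N)"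
    by (intro Bochner_Integration.integral_cong refl)
       (simp add: cis_conv_exp[symmetric] cos_add)
  finally show ?thesis by simp
qed

section \<open>The finite-dimensional distributions of the empirical process\<close>

lemma abs_exp_minus_le:
  assumes "0 \<le> (y::real)"
  shows "\<bar>exp (- y) - (1 - y)\<bar> \<le> y\<^sup>2"
proof -
  have "(1 + y) * exp (- y) \<le> exp y * exp (- y)"
    by (intro mult_right_mono exp_ge_add_one_self) auto
  also have "\<dots> = 1"
    by (simp flip: exp_add)
  also have "\<dots> \<le> (1 + y) * (1 - y + y\<^sup>2)"
    using assms by (simp add: algebra_simps power2_eq_square)
  finally have "exp (- y) \<le> 1 - y + y\<^sup>2"
    using assms by (subst (asm) mult_le_cancel_left_pos) auto
  moreover have "1 - y \<le> exp (- y)"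
    using exp_ge_add_one_self[of "- y"] by simp
  ultimately show ?thesis
    by simp
qed

section \<open>A central limit theorem for triangular arrays\<close>

context iid_space
begin

lemma prob_space_P: "prob_space P"
  using iid_space_axioms by (simp add: iid_space_def)

lemma measure_P_UNIV [simp]: "measure P UNIV = 1"
  using prob_space.prob_space[OF prob_space_P] by (simp add: space_eq_UNIV)

lemma integrable_P_bounded:
  fixes f :: "'x \<Rightarrow> 'c::{banach, second_countable_topology}"
  assumes "f \<in> borel_measurable P" "\<And>y. norm (f y) \<le> B"
  shows "integrable P f"
  by (rule finite_measure.integrable_const_bound[OF prob_space.finite_measure[OF prob_space_P] AE_I2 assms(1)])
     (rule assms(2))

lemma measurable_coord [measurable]: "(\<lambda>x. x k) \<in> measurable S P"
  by simp

lemma distr_coord: "distr S P (\<lambda>x. x k) = P"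
  by (rule PiM_component) simp

lemma indep_coord: "P.indep_vars (\<lambda>_. P) (\<lambda>i x. x i) (UNIV :: nat set)"
proof -
  have "distr S S (\<lambda>x. \<lambda>i\<in>UNIV. x i) = (\<Pi>\<^sub>M i\<in>UNIV. distr S P (\<lambda>x. x i))"
    by (simp add: distr_coord restrict_UNIV distr_id2)
  then show ?thesis
    using P.indep_vars_iff_distr_eq_PiM[where I="UNIV :: nat set" and M'="\<lambda>_. P" and X="\<lambda>i x. x i"] by simp
qed

lemma integral_coord:
  fixes f :: "'x \<Rightarrow> 'c::{banach, second_countable_topology}"
  assumes "f \<in> borel_measurable P"
  shows "(\<integral>x. f (x k) \<partial>S) = (\<integral>y. f y \<partial>P)"
proof -
  have "(\<integral>y. f y \<partial>P) = (\<integral>y. f y \<partial>distr S P (\<lambda>x. x k))"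
    by (simp only: distr_coord)
  then show ?thesis
    by (simp only: integral_distr[OF measurable_coord[of k] assms])
qed

lemma charfun_sum:
  assumes a: "\<And>k. a k \<in> borel_measurable P"
  shows "(\<integral>x. iexp (\<Sum>k<n. a k (x k)) \<partial>S) = (\<Prod>k<n. \<integral>y. iexp (a k y) \<partial>P)"
proof -
  have "(\<integral>x. iexp (\<Sum>k<n. a k (x k)) \<partial>S) = (\<integral>x. (\<Prod>k<n. iexp (a k (x k))) \<partial>S)"
    by (intro Bochner_Integration.integral_cong refl) (simp add: sum_distrib_left exp_sum)
  also have "\<dots> = (\<Prod>k<n. \<integral>x. iexp (a k (x k)) \<partial>S)"
  proof (rule P.indep_vars_lebesgue_integral)
    show "P.indep_vars (\<lambda>_. borel) (\<lambda>k x. iexp (a k (x k))) {..<n}"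
      using a by (intro P.indep_vars_compose2[OF P.indep_vars_subset[OF indep_coord]]) auto
    show "integrable S (\<lambda>x. iexp (a k (x k)))" for k
      using a by (intro P.integrable_const_bound[where B=1]) auto
  qed auto
  also have "\<dots> = (\<Prod>k<n. \<integral>y. iexp (a k y) \<partial>P)"
    using a by (intro prod.cong refl integral_coord) auto
  finally show ?thesis .
qed

lemma second_moment_sum:
  fixes \<xi> :: "'x \<Rightarrow> real"
  assumes \<xi>: "\<xi> \<in> borel_measurable P" "\<And>y. \<bar>\<xi> y\<bar> \<le> B" "(\<integral>y. \<xi> y \<partial>P) = 0"
  shows "integrable S (\<lambda>x. (\<Sum>i<n. \<xi> (x i))\<^sup>2)" "(\<integral>x. (\<Sum>i<n. \<xi> (x i))\<^sup>2 \<partial>S) = n * (\<integral>y. (\<xi> y)\<^sup>2 \<partial>P)"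
proof -
  have B: "0 \<le> B"
    using \<xi>(2)[of undefined] by linarith
  have int: "integrable S (\<lambda>x. \<xi> (x i))" for i
    using \<xi> by (intro P.integrable_const_bound[where B=B]) auto
  have int2: "integrable S (\<lambda>x. \<xi> (x i) * \<xi> (x j))" for i j
    using \<xi> B by (intro P.integrable_const_bound[where B="B * B"]) (auto simp: abs_mult intro!: mult_mono)
  have e: "(\<integral>x. \<xi> (x i) * \<xi> (x j) \<partial>S) = (if i = j then (\<integral>y. (\<xi> y)\<^sup>2 \<partial>P) else 0)" for i j
  proof (cases "i = j")
    case True
    then show ?thesis
      using integral_coord[of "\<lambda>y. (\<xi> y)\<^sup>2" i] \<xi>(1) by (simp add: power2_eq_square)
  next
    case False
    have "(\<integral>x. (\<Prod>k\<in>{i, j}. \<xi> (x k)) \<partial>S) = (\<Prod>k\<in>{i, j}. \<integral>x. \<xi> (x k) \<partial>S)"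
      using \<xi>(1) int by (intro P.indep_vars_lebesgue_integral P.indep_vars_compose2[OF P.indep_vars_subset[OF indep_coord]]) auto
    then show ?thesis
      using False \<xi>(1,3) by (simp add: integral_coord)
  qed
  have eq: "(\<Sum>i<n. \<xi> (x i))\<^sup>2 = (\<Sum>i<n. \<Sum>j<n. \<xi> (x i) * \<xi> (x j))" for x :: "nat \<Rightarrow> 'x"
    by (simp add: power2_eq_square sum_product)
  show "integrable S (\<lambda>x. (\<Sum>i<n. \<xi> (x i))\<^sup>2)"
    unfolding eq using int2 by (intro Bochner_Integration.integrable_sum)
  show "(\<integral>x. (\<Sum>i<n. \<xi> (x i))\<^sup>2 \<partial>S) = n * (\<integral>y. (\<xi> y)\<^sup>2 \<partial>P)"
    unfolding eq using int2 by (simp add: Bochner_Integration.integral_sum e sum.delta)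
qed

text \<open>Each factor of the characteristic function is compared with the Gaussian factor of the
  same variance. The terms are of size \<open>A / sqrt m\<close>, so the errors are of order
  \<open>1 / (m * sqrt m)\<close>; with at most \<open>K0 * m\<close> factors of modulus at most 1
  the total is of order \<open>1 / sqrt m\<close>.\<close>

lemma charfun_array_conv:
  fixes a :: "nat \<Rightarrow> nat \<Rightarrow> 'x \<Rightarrow> real" and K :: "nat \<Rightarrow> nat"
  assumes meas: "\<And>m k. a m k \<in> borel_measurable P" and mean: "\<And>m k. (\<integral>y. a m k y \<partial>P) = 0"
    and bound: "\<And>m k y. \<bar>a m k y\<bar> \<le> A / sqrt (real m)"
    and K: "\<And>m. K m \<le> K0 * m" and var: "(\<lambda>m. \<Sum>k<K m. \<integral>y. (a m k y)\<^sup>2 \<partial>P) \<longlonglongrightarrow> v"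
  shows "(\<lambda>m. \<integral>x. iexp (\<Sum>k<K m. a m k (x k)) \<partial>S) \<longlonglongrightarrow> complex_of_real (exp (- v / 2))"
proof -
  define \<phi> where "\<phi> = (\<lambda>m k. \<integral>y. iexp (a m k y) \<partial>P)"
  define w where "w = (\<lambda>m k. \<integral>y. (a m k y)\<^sup>2 \<partial>P)"
  define \<psi> where "\<psi> = (\<lambda>m k. complex_of_real (exp (- (w m k / 2))))"
  have A: "0 \<le> A"
    using bound[of 1 0 undefined] by simp
  \<comment> \<open>The first summand is the third-order Taylor remainder of the complex
    exponential, the second the square of half the variance, from \<open>exp (- y)\<close> against
    \<open>1 - y\<close>.\<close>
  define D where "D = A ^ 3 / 6 + A ^ 4 / 4"
  have int: "integrable P (\<lambda>y. a m k y)" "integrable P (\<lambda>y. (a m k y)\<^sup>2)" "integrable P (\<lambda>y. iexp (a m k y))"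
    "integrable P (\<lambda>y. \<bar>a m k y\<bar> ^ 3)" for m k
  proof -
    show "integrable P (\<lambda>y. a m k y)"
      using meas bound by (intro integrable_P_bounded[where B="A / sqrt m"]) auto
    show "integrable P (\<lambda>y. (a m k y)\<^sup>2)"
      using meas power_mono[OF bound[of m k], where n=2] by (intro integrable_P_bounded[where B="(A / sqrt m)\<^sup>2"]) auto
    show "integrable P (\<lambda>y. iexp (a m k y))"
      using meas by (intro integrable_P_bounded[where B=1]) auto
    show "integrable P (\<lambda>y. \<bar>a m k y\<bar> ^ 3)"
      using meas power_mono[OF bound[of m k], where n=3] by (intro integrable_P_bounded[where B="(A / sqrt m) ^ 3"]) auto
  qed
  have w: "0 \<le> w m k" "w m k \<le> (A / sqrt m)\<^sup>2" for m k
  proof -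
    show "0 \<le> w m k"
      by (simp add: w_def)
    have "w m k \<le> (\<integral>y. (A / sqrt m)\<^sup>2 \<partial>P)"
      unfolding w_def using int power_mono[OF bound[of m k], where n=2] by (intro integral_mono) auto
    then show "w m k \<le> (A / sqrt m)\<^sup>2"
      by (simp add: space_eq_UNIV)
  qed
  have diff: "norm (\<phi> m k - \<psi> m k) \<le> D / (m * sqrt m)" if m: "1 \<le> m" for m k
  proof -
    have "norm (\<phi> m k - (1 - complex_of_real (w m k / 2))) =
        norm (\<integral>y. iexp (a m k y) - (1 + \<i> * a m k y - complex_of_real ((a m k y)\<^sup>2 / 2)) \<partial>P)"
    proof -
      have "(\<integral>y. iexp (a m k y) - (1 + \<i> * a m k y - complex_of_real ((a m k y)\<^sup>2 / 2)) \<partial>P) =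
          \<phi> m k - ((\<integral>y. 1 \<partial>P) + \<i> * (\<integral>y. complex_of_real (a m k y) \<partial>P) - (\<integral>y. complex_of_real ((a m k y)\<^sup>2 / 2) \<partial>P))"
        unfolding \<phi>_def using int by (simp del: of_real_divide of_real_power)
      also have "(\<integral>y. complex_of_real (a m k y) \<partial>P) = 0"
        using mean by simp
      also have "(\<integral>y. complex_of_real ((a m k y)\<^sup>2 / 2) \<partial>P) = complex_of_real (w m k / 2)"
        by (simp add: w_def del: of_real_divide of_real_power)
      finally show ?thesis
        by (simp add: space_eq_UNIV)
    qed
    also have "\<dots> \<le> (\<integral>y. norm (iexp (a m k y) - (1 + \<i> * a m k y - complex_of_real ((a m k y)\<^sup>2 / 2))) \<partial>P)"
      by (rule integral_norm_bound)
    also have "\<dots> \<le> (\<integral>y. (A / sqrt m) ^ 3 / 6 \<partial>P)"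
    proof (rule integral_mono)
      show "integrable P (\<lambda>y. norm (iexp (a m k y) - (1 + \<i> * a m k y - complex_of_real ((a m k y)\<^sup>2 / 2))))"
        using int by (intro integrable_norm Bochner_Integration.integrable_diff Bochner_Integration.integrable_add
            integrable_of_real integrable_mult_right) auto
      fix y
      have "cmod (iexp (a m k y) - (\<Sum>j\<le>2. (\<i> * a m k y) ^ j / fact j)) \<le> \<bar>a m k y\<bar> ^ Suc 2 / fact (Suc 2)"
        by (rule iexp_approx1)
      also have "(\<Sum>j\<le>2. (\<i> * a m k y) ^ j / fact j) = 1 + \<i> * a m k y - complex_of_real ((a m k y)\<^sup>2 / 2)"
        by (simp add: numeral_2_eq_2 power2_eq_square algebra_simps)
      also have "\<bar>a m k y\<bar> ^ Suc 2 / fact (Suc 2) \<le> (A / sqrt m) ^ 3 / 6"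
        using power_mono[OF bound[of m k y], of 3] by (simp add: fact_numeral eval_nat_numeral)
      finally show "norm (iexp (a m k y) - (1 + \<i> * a m k y - complex_of_real ((a m k y)\<^sup>2 / 2))) \<le> (A / sqrt m) ^ 3 / 6" .
    qed auto
    also have "\<dots> = A ^ 3 / 6 / (m * sqrt m)"
      using m by (simp add: space_eq_UNIV power_divide power3_eq_cube)
    finally have 1: "norm (\<phi> m k - (1 - complex_of_real (w m k / 2))) \<le> A ^ 3 / 6 / (m * sqrt m)" .
    have "\<psi> m k - (1 - complex_of_real (w m k / 2)) = complex_of_real (exp (- (w m k / 2)) - (1 - w m k / 2))"
      unfolding \<psi>_def by (simp only: of_real_diff of_real_1)
    then have "norm (\<psi> m k - (1 - complex_of_real (w m k / 2))) = \<bar>exp (- (w m k / 2)) - (1 - w m k / 2)\<bar>"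
      by (simp only: norm_of_real)
    also have "\<dots> \<le> (w m k / 2)\<^sup>2"
      using w by (intro abs_exp_minus_le) auto
    also have "\<dots> \<le> ((A / sqrt m)\<^sup>2 / 2)\<^sup>2"
      using w[of m k] by (intro power_mono) auto
    also have "\<dots> = (A\<^sup>2 / m / 2)\<^sup>2"
      by (simp add: power_divide)
    also have "\<dots> = (A\<^sup>2)\<^sup>2 / 4 / (real m * real m)"
      by (simp add: power2_eq_square)
    also have "\<dots> = A ^ 4 / 4 / (real m * real m)"
      by simp
    also have "\<dots> \<le> A ^ 4 / 4 / (m * sqrt m)"
    proof (intro divide_left_mono mult_left_mono)
      show "sqrt m \<le> real m"
        using m by (intro real_le_lsqrt) (auto simp: power2_eq_square)
    qed (use m A in auto)
    finally have 2: "norm (\<psi> m k - (1 - complex_of_real (w m k / 2))) \<le> A ^ 4 / 4 / (m * sqrt m)" .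
    show ?thesis
      using norm_triangle_ineq4[of "\<phi> m k - (1 - complex_of_real (w m k / 2))" "\<psi> m k - (1 - complex_of_real (w m k / 2))"] 1 2
      by (simp add: D_def add_divide_distrib)
  qed
  have prod: "norm ((\<Prod>k<K m. \<phi> m k) - (\<Prod>k<K m. \<psi> m k)) \<le> (real K0 * D) / sqrt m" if m: "1 \<le> m" for m
  proof -
    have "norm ((\<Prod>k<K m. \<phi> m k) - (\<Prod>k<K m. \<psi> m k)) \<le> (\<Sum>k<K m. norm (\<phi> m k - \<psi> m k))"
    proof (rule norm_prod_diff)
      show "norm (\<psi> m k) \<le> 1" for k
        using w(1)[of m k] by (simp add: \<psi>_def)
      have "norm (\<phi> m k) \<le> (\<integral>y. norm (iexp (a m k y)) \<partial>P)" for k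
        unfolding \<phi>_def by (rule integral_norm_bound)
      then show "norm (\<phi> m k) \<le> 1" for k
        by (simp add: space_eq_UNIV)
    qed
    also have "\<dots> \<le> (\<Sum>k<K m. D / (m * sqrt m))"
      by (intro sum_mono diff m)
    also have "\<dots> = real (K m) * (D / (m * sqrt m))"
      by simp
    also have "\<dots> \<le> real (K0 * m) * (D / (m * sqrt m))"
      using K[of m] A by (intro mult_right_mono) (auto simp: D_def simp del: of_nat_mult)
    also have "\<dots> = (real K0 * D) / sqrt m"
      using m by simp
    finally show ?thesis .
  qed
  have "(\<lambda>m. (real K0 * D) / sqrt m) \<longlonglongrightarrow> 0"
    by (intro real_tendsto_divide_at_top[OF tendsto_const] filterlim_compose[OF sqrt_at_top filterlim_real_sequentially])
  then have "(\<lambda>m. (\<Prod>k<K m. \<phi> m k) - (\<Prod>k<K m. \<psi> m k)) \<longlonglongrightarrow> 0"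
    by (rule Lim_null_comparison[rotated]) (use prod in \<open>auto intro!: eventually_sequentiallyI[of 1]\<close>)
  moreover have "(\<lambda>m. \<Prod>k<K m. \<psi> m k) \<longlonglongrightarrow> complex_of_real (exp (- v / 2))"
  proof -
    have "(\<Prod>k<K m. \<psi> m k) = complex_of_real (exp (- (\<Sum>k<K m. w m k) / 2))" for m
      by (simp add: \<psi>_def exp_sum sum_negf[symmetric] sum_divide_distrib of_real_prod[symmetric] del: of_real_exp of_real_prod)
    then show ?thesis
      using var unfolding w_def by (auto intro!: tendsto_intros)
  qed
  ultimately have "(\<lambda>m. ((\<Prod>k<K m. \<phi> m k) - (\<Prod>k<K m. \<psi> m k)) + (\<Prod>k<K m. \<psi> m k)) \<longlonglongrightarrow> 0 + complex_of_real (exp (- v / 2))"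
    by (rule tendsto_add)
  then show ?thesis
    unfolding charfun_sum[OF meas] by (simp add: \<phi>_def)
qed

end

lemma bapp_sum: "bapp (\<Sum>i\<in>A. z i) t = (\<Sum>i\<in>A. bapp (z i) t)"
  by (induction A rule: infinite_finite_induct) auto

text \<open>The index lies between \<open>m / s\<close> and \<open>m / s + 1\<close>, and
  \<open>(s - s\<^sup>2 / m) * (m / s + 1) = m - s\<^sup>2 / m\<close>, which is where the lower
  bound comes from.\<close>

lemma rev_index_ratio_tendsto:
  assumes "0 < s"
  shows "(\<lambda>m. real m / real (rev_index m s)) \<longlonglongrightarrow> s"
proof (rule tendsto_sandwich)
  show "\<forall>\<^sub>F m in sequentially. s - s\<^sup>2 / real m \<le> real m / real (rev_index m s)"
  proof (rule eventually_sequentiallyI[of 1])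
    fix m :: nat assume m: "1 \<le> m"
    have "0 < real m / s"
      using m assms by simp
    then have n: "0 < real (rev_index m s)"
      using rev_index_ge[OF assms, of m] by linarith
    have "(s - s\<^sup>2 / real m) * (real m / s + 1) = real m - s\<^sup>2 / real m"
      using m assms by (simp add: field_simps power2_eq_square)
    also have "\<dots> \<le> real m"
      by simp
    finally have "(s - s\<^sup>2 / real m) * (real m / s + 1) \<le> real m" .
    moreover have "(s - s\<^sup>2 / real m) * real (rev_index m s) \<le> max 0 ((s - s\<^sup>2 / real m) * (real m / s + 1))"
    proof (cases "0 \<le> s - s\<^sup>2 / real m")
      case True
      then have "(s - s\<^sup>2 / real m) * real (rev_index m s) \<le> (s - s\<^sup>2 / real m) * (real m / s + 1)"
        using rev_index_less[OF assms, of m] by (intro mult_left_mono) auto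
      then show ?thesis by simp
    next
      case False
      then have "(s - s\<^sup>2 / real m) * real (rev_index m s) \<le> 0"
        using n by (intro mult_nonpos_nonneg) auto
      then show ?thesis by simp
    qed
    ultimately have "(s - s\<^sup>2 / real m) * real (rev_index m s) \<le> real m"
      using m by simp
    then show "s - s\<^sup>2 / real m \<le> real m / real (rev_index m s)"
      using n by (simp add: le_divide_eq)
  qed
  show "\<forall>\<^sub>F m in sequentially. real m / real (rev_index m s) \<le> s"
  proof (rule eventually_sequentiallyI[of 1])
    fix m :: nat assume m: "1 \<le> m"
    have "0 < real m / s"
      using m assms by simp
    then have n: "0 < real (rev_index m s)"
      using rev_index_ge[OF assms, of m] by linarith
    show "real m / real (rev_index m s) \<le> s"
      using rev_index_ge[OF assms, of m] assms n by (simp add: field_simps)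
  qed
  have "(\<lambda>m. s - s\<^sup>2 / real m) \<longlonglongrightarrow> s - 0"
    by (intro tendsto_diff tendsto_const lim_const_over_n)
  then show "(\<lambda>m. s - s\<^sup>2 / real m) \<longlonglongrightarrow> s"
    by simp
qed auto

lemma rev_index_le_mult:
  assumes "0 < s" "1 / s + 1 \<le> real K"
  shows "rev_index m s \<le> K * m"
proof (cases "m = 0")
  case True
  then show ?thesis
    by (simp add: rev_index_def)
next
  case False
  have "real (rev_index m s) < real m / s + 1"
    by (rule rev_index_less[OF assms(1)])
  also have "\<dots> \<le> real m * (1 / s + 1)"
    using False by (simp add: algebra_simps)
  also have "\<dots> \<le> real m * real K"
    using assms by (intro mult_left_mono) auto
  finally show ?thesis
    by (simp add: mult.commute flip: of_nat_mult)
qed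

lemma sqrt_div_rev_index_le:
  assumes "0 < s" "s \<le> 1"
  shows "sqrt m / real (rev_index m s) \<le> 1 / sqrt m"
proof (cases "m = 0")
  case False
  then have "sqrt m / real (rev_index m s) \<le> sqrt m / real m"
    using rev_index_ge_self[OF assms, of m] by (intro divide_left_mono) auto
  also have "\<dots> = 1 / sqrt m"
    using False by (simp add: field_simps)
  finally show ?thesis .
qed auto

section \<open>The empirical process in reversed time\<close>

locale empirical_process = iid_space P for P :: "'x measure" +
  fixes F :: "('x \<Rightarrow> real) set" and B :: real
  assumes F_measurable: "f \<in> F \<Longrightarrow> f \<in> borel_measurable P"
    and F_integrable: "f \<in> F \<Longrightarrow> integrable P f"
    and F_bound: "f \<in> F \<Longrightarrow> \<bar>f x - (\<integral>y. f y \<partial>P)\<bar> \<le> B"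
    and B_nonneg: "0 \<le> B"
begin

text \<open>The point mass at \<open>x\<close> minus \<open>P\<close>. It is bounded on
  \<open>F\<close> by assumption even where evaluation at \<open>x\<close> alone is not, and its
  partial sums are \<open>n\<close> times the deviation of the empirical distribution.\<close>

definition dev :: "'x \<Rightarrow> ('x \<Rightarrow> real) bfun" where
  "dev x = to_linf F (\<lambda>f. f x - (\<integral>y. f y \<partial>P))"

lemma bounded_dev: "bounded ((\<lambda>f. f x - (\<integral>y. f y \<partial>P)) ` F)"
  by (rule boundedI[of _ B]) (auto intro: F_bound)

lemma bapp_dev: "bapp (dev x) f = (if f \<in> F then f x - (\<integral>y. f y \<partial>P) else 0)"
  unfolding dev_def by (rule bapp_to_linf[OF bounded_dev])

lemma dev_in_linf: "dev x \<in> linf F"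
  unfolding dev_def by (rule to_linf_in_linf[OF bounded_dev])

lemma norm_dev: "norm (dev x) \<le> B"
proof (rule norm_linf_le[OF dev_in_linf _ B_nonneg])
  fix f assume "f \<in> F"
  then show "\<bar>bapp (dev x) f\<bar> \<le> B"
    using F_bound[of f x] by (simp add: bapp_dev)
qed

lemma partial_sum_in_linf: "partial_sum dev x n \<in> linf F"
  unfolding partial_sum_def by (intro subspace_sum subspace_linf dev_in_linf)

lemma rev_mean_in_linf: "rev_mean dev m s x \<in> linf F"
  unfolding rev_mean_def by (intro subspace_scale subspace_linf partial_sum_in_linf)

lemma norm_rev_mean: "norm (rev_mean dev m s x) \<le> sqrt m * B"
proof -
  have "norm (rev_mean dev m s x) = sqrt m / rev_index m s * norm (partial_sum dev x (rev_index m s))"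
    by (simp add: rev_mean_def)
  also have "\<dots> \<le> sqrt m / rev_index m s * (rev_index m s * B)"
    by (intro mult_left_mono norm_partial_sum_le norm_dev) auto
  also have "\<dots> \<le> sqrt m * B"
    using B_nonneg by simp
  finally show ?thesis .
qed

definition rev_process :: "nat \<Rightarrow> (nat \<Rightarrow> 'x) \<Rightarrow> (real \<times> ('x \<Rightarrow> real)) bfun" where
  "rev_process m x = to_linf ({0<..1} \<times> F) (\<lambda>(s, f). bapp (rev_mean dev m s x) f)"

lemma bounded_rev_process: "bounded ((\<lambda>(s, f). bapp (rev_mean dev m s x) f) ` ({0<..1} \<times> F))"
proof (rule boundedI)
  fix y assume "y \<in> (\<lambda>(s, f). bapp (rev_mean dev m s x) f) ` ({0<..1} \<times> F)"
  then obtain s f where y: "y = bapp (rev_mean dev m s x) f"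
    by auto
  then show "norm y \<le> sqrt m * B"
    using abs_bapp_le_norm[of "rev_mean dev m s x" f] norm_rev_mean[of m s x] by simp
qed

lemma bapp_rev_process:
  "bapp (rev_process m x) (s, f) = (if s \<in> {0<..1} \<and> f \<in> F then bapp (rev_mean dev m s x) f else 0)"
  unfolding rev_process_def using bapp_to_linf[OF bounded_rev_process, of m x "(s, f)"] by simp

lemma rev_process_in_linf: "rev_process m x \<in> linf ({0<..1} \<times> F)"
  unfolding rev_process_def by (rule to_linf_in_linf[OF bounded_rev_process])

lemma bapp_rev_mean:
  "f \<in> F \<Longrightarrow> bapp (rev_mean dev m s x) f =
     sqrt m / rev_index m s * (\<Sum>i<rev_index m s. f (x i) - (\<integral>y. f y \<partial>P))"
  by (simp add: rev_mean_def partial_sum_def bapp_sum bapp_dev)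

lemma centered:
  assumes "f \<in> F"
  shows "(\<lambda>x. f x - (\<integral>y. f y \<partial>P)) \<in> borel_measurable P" "(\<integral>x. f x - (\<integral>y. f y \<partial>P) \<partial>P) = 0"
  using F_measurable[OF assms] F_integrable[OF assms]
  by (auto simp: Bochner_Integration.integral_diff integrable_P_bounded[of "\<lambda>_. _"] space_eq_UNIV)

lemma centered_integrable:
  assumes "f \<in> F" "h \<in> F"
  shows "integrable P (\<lambda>x. (f x - (\<integral>y. f y \<partial>P)) * (h x - (\<integral>y. h y \<partial>P)))"
proof (rule integrable_P_bounded)
  show "(\<lambda>x. (f x - (\<integral>y. f y \<partial>P)) * (h x - (\<integral>y. h y \<partial>P))) \<in> borel_measurable P"
    using centered(1) assms by simp
  show "norm ((f x - (\<integral>y. f y \<partial>P)) * (h x - (\<integral>y. h y \<partial>P))) \<le> B * B" for x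
    unfolding norm_mult using F_bound[OF assms(1), of x] F_bound[OF assms(2), of x] B_nonneg
    by (intro mult_mono) auto
qed

lemma covariance_centered:
  assumes "f \<in> F" "h \<in> F"
  shows "(\<integral>x. (f x - (\<integral>y. f y \<partial>P)) * (h x - (\<integral>y. h y \<partial>P)) \<partial>P)
    = (\<integral>x. f x * h x \<partial>P) - (\<integral>y. f y \<partial>P) * (\<integral>y. h y \<partial>P)"
proof -
  let ?a = "\<integral>y. f y \<partial>P" and ?b = "\<integral>y. h y \<partial>P"
  note int = F_integrable[OF assms(1)] F_integrable[OF assms(2)]
  have c: "integrable P (\<lambda>x. c)" for c :: real
    by (rule integrable_P_bounded[of _ "\<bar>c\<bar>"]) auto
  have eq: "f x * h x = (f x - ?a) * (h x - ?b) + (?a * h x + (?b * f x - ?a * ?b))" for x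
    by (simp add: algebra_simps)
  have "(\<integral>x. f x * h x \<partial>P) = (\<integral>x. (f x - ?a) * (h x - ?b) \<partial>P) + (\<integral>x. ?a * h x + (?b * f x - ?a * ?b) \<partial>P)"
    unfolding eq using int c
    by (intro Bochner_Integration.integral_add centered_integrable assms Bochner_Integration.integrable_add
        Bochner_Integration.integrable_diff integrable_mult_right)
  also have "(\<integral>x. ?a * h x + (?b * f x - ?a * ?b) \<partial>P) = ?a * ?b"
    using int c by (simp add: space_eq_UNIV)
  finally show ?thesis
    by simp
qed

lemma rev_process_l2_bounded: "l2_bounded ({0<..1} \<times> F) S (\<lambda>m x. bapp (rev_process m x))"
  unfolding l2_bounded_def
proof (intro ballI conjI allI exI)
  fix t :: "real \<times> ('x \<Rightarrow> real)" and m assume t: "t \<in> {0<..1} \<times> F"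
  then obtain s f where sf: "t = (s, f)" "0 < s" "s \<le> 1" "f \<in> F"
    by auto
  let ?\<xi> = "\<lambda>x. f x - (\<integral>y. f y \<partial>P)" and ?n = "rev_index m s"
  have eq: "bapp (rev_process m x) t = sqrt m / ?n * (\<Sum>i<?n. ?\<xi> (x i))" for x
    using sf by (simp add: bapp_rev_process bapp_rev_mean)
  note c = centered[OF sf(4)]
  note sm = second_moment_sum[OF c(1) F_bound[OF sf(4)] c(2)]
  show "(\<lambda>x. bapp (rev_process m x) t) \<in> borel_measurable S"
    unfolding eq using c(1) by simp
  show "integrable S (\<lambda>x. (bapp (rev_process m x) t)\<^sup>2)"
    unfolding eq power_mult_distrib using sm(1) by simp
  have var: "(\<integral>y. (?\<xi> y)\<^sup>2 \<partial>P) \<le> B\<^sup>2"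
  proof -
    have "(?\<xi> y)\<^sup>2 \<le> B\<^sup>2" for y
      using power_mono[OF F_bound[OF sf(4), of y], where n=2] by simp
    then have "(\<integral>y. (?\<xi> y)\<^sup>2 \<partial>P) \<le> (\<integral>y. B\<^sup>2 \<partial>P)"
      using centered_integrable[OF sf(4,4)]
      by (intro integral_mono integrable_P_bounded[of _ "B\<^sup>2"]) (auto simp: power2_eq_square)
    then show ?thesis
      by (simp add: space_eq_UNIV)
  qed
  have "(\<integral>x. (bapp (rev_process m x) t)\<^sup>2 \<partial>S) = (sqrt m / ?n)\<^sup>2 * (?n * (\<integral>y. (?\<xi> y)\<^sup>2 \<partial>P))"
    unfolding eq power_mult_distrib using sm by simp
  also have "\<dots> = real m / ?n * (\<integral>y. (?\<xi> y)\<^sup>2 \<partial>P)"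
    by (cases "?n = 0") (auto simp: power_divide power2_eq_square)
  also have "\<dots> \<le> 1 * B\<^sup>2"
    using var rev_index_ge_self[OF sf(2,3), of m] by (intro mult_mono) (auto simp: divide_le_eq_1)
  finally show "(\<integral>x. (bapp (rev_process m x) t)\<^sup>2 \<partial>S) \<le> B\<^sup>2"
    by simp
qed

text \<open>Sorted by observations, a linear combination of values of the reversed process is a sum
  of independent bounded terms. The covariance becomes \<open>min s t\<close> because indices
  \<open>n\<close> and \<open>n'\<close> share \<open>min n n'\<close> observations with weights
  \<open>sqrt m / n\<close> and \<open>sqrt m / n'\<close>: the product is
  \<open>m / max n n'\<close>, which tends to the smaller of the two times.\<close>

lemma rev_process_fidi_conv:
  fixes X :: "real \<times> ('x \<Rightarrow> real) \<Rightarrow> 'v \<Rightarrow> real"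
  assumes N: "prob_space N" and X: "zero_mean_gaussian_process ({0<..1} \<times> F) N X"
    and cov: "\<And>s t f h. s \<in> {0<..1} \<Longrightarrow> t \<in> {0<..1} \<Longrightarrow> f \<in> F \<Longrightarrow> h \<in> F \<Longrightarrow>
      (\<integral>x. X (s, f) x * X (t, h) x \<partial>N) = min s t * ((\<integral>y. f y * h y \<partial>P) - (\<integral>y. f y \<partial>P) * (\<integral>y. h y \<partial>P))"
  shows "fidi_conv ({0<..1} \<times> F) S (\<lambda>m x. bapp (rev_process m x)) N (\<lambda>x t. X t x)"
  unfolding fidi_conv_def
proof (intro allI impI)
  fix I :: "(real \<times> ('x \<Rightarrow> real)) set" and c b
  assume "finite I \<and> I \<subseteq> {0<..1} \<times> F"
  then have I: "finite I" "I \<subseteq> {0<..1} \<times> F"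
    by auto
  have In: "0 < fst t" "fst t \<le> 1" "snd t \<in> F" if "t \<in> I" for t
    using I(2) that by auto
  define \<xi> where "\<xi> = (\<lambda>(t :: real \<times> ('x \<Rightarrow> real)) x. snd t x - (\<integral>y. snd t y \<partial>P) :: real)"
  define n where "n = (\<lambda>m (t :: real \<times> ('x \<Rightarrow> real)). rev_index m (fst t))"
  define d where "d = (\<lambda>m t. c t * (sqrt (real m) / real (n m t)))"
  \<comment> \<open>Observation \<open>k\<close> contributes to exactly those \<open>t\<close> whose
    index exceeds \<open>k\<close>.\<close>
  define a where "a = (\<lambda>m k y. \<Sum>t\<in>I. if k < n m t then d m t * \<xi> t y else 0)"
  define C where "C = (\<lambda>s t. \<integral>y. \<xi> s y * \<xi> t y \<partial>P)"
  define A where "A = (\<Sum>t\<in>I. \<bar>c t\<bar> * B)"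
  have "\<exists>K::nat. \<forall>t\<in>I. 1 / fst t + 1 \<le> real K"
  proof -
    obtain K :: nat where "(\<Sum>t\<in>I. 1 / fst t + 1) \<le> real K"
      using real_arch_simple by blast
    moreover have "1 / fst t + 1 \<le> (\<Sum>t\<in>I. 1 / fst t + 1)" if "t \<in> I" for t
      using In by (intro member_le_sum[OF that _ I(1)]) (auto simp: less_imp_le)
    ultimately show ?thesis
      by (intro exI[of _ K]) (auto intro: order_trans)
  qed
  then obtain K0 :: nat where K0: "\<And>t. t \<in> I \<Longrightarrow> 1 / fst t + 1 \<le> real K0"
    by blast
  have nK: "n m t \<le> K0 * m" if "t \<in> I" for m t
    unfolding n_def using In[OF that] K0[OF that] by (intro rev_index_le_mult)
  have \<xi>: "\<xi> t \<in> borel_measurable P" "(\<integral>y. \<xi> t y \<partial>P) = 0" "\<bar>\<xi> t y\<bar> \<le> B" if "t \<in> I" for t y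
    using centered[OF In(3)[OF that]] F_bound[OF In(3)[OF that]] by (auto simp: \<xi>_def)
  have d: "\<bar>d m t\<bar> \<le> \<bar>c t\<bar> / sqrt m" if "t \<in> I" for m t
    unfolding d_def abs_mult n_def
    using mult_left_mono[OF sqrt_div_rev_index_le[of "fst t" m] abs_ge_zero[of "c t"]] In[OF that] by simp
  have lin: "(\<Sum>t\<in>I. c t * bapp (rev_process m x) t) = (\<Sum>k<K0 * m. a m k (x k))" for m x
  proof -
    have "c t * bapp (rev_process m x) t = (\<Sum>k<K0 * m. if k < n m t then d m t * \<xi> t (x k) else 0)" if "t \<in> I" for t
    proof -
      have "c t * bapp (rev_process m x) t = d m t * (\<Sum>i<n m t. \<xi> t (x i))"
        using In[OF that] by (cases t) (simp add: bapp_rev_process bapp_rev_mean d_def n_def \<xi>_def)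
      also have "\<dots> = (\<Sum>k\<in>{k\<in>{..<K0 * m}. k < n m t}. d m t * \<xi> t (x k))"
        unfolding sum_distrib_left using nK[OF that, of m] by (intro sum.cong) auto
      also have "\<dots> = (\<Sum>k<K0 * m. if k < n m t then d m t * \<xi> t (x k) else 0)"
        by (rule sum.inter_filter) simp
      finally show ?thesis .
    qed
    then have "(\<Sum>t\<in>I. c t * bapp (rev_process m x) t) =
        (\<Sum>t\<in>I. \<Sum>k<K0 * m. if k < n m t then d m t * \<xi> t (x k) else 0)"
      by (intro sum.cong) auto
    then show ?thesis
      unfolding a_def by (subst (asm) sum.swap)
  qed
  have Cint: "integrable P (\<lambda>y. \<xi> s y * \<xi> t y)" if "s \<in> I" "t \<in> I" for s t
    unfolding \<xi>_def using In[OF that(1)] In[OF that(2)] by (intro centered_integrable)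
  have cc: "C s t * min (fst s) (fst t) = (\<integral>x. X s x * X t x \<partial>N)" if "s \<in> I" "t \<in> I" for s t
    using cov[of "fst s" "fst t" "snd s" "snd t"] In[OF that(1)] In[OF that(2)]
    by (simp add: C_def \<xi>_def covariance_centered)
  define v where "v = (\<Sum>s\<in>I. \<Sum>t\<in>I. c s * c t * (\<integral>x. X s x * X t x \<partial>N))"
  have "(\<lambda>m. \<integral>x. iexp (\<Sum>k<K0 * m. a m k (x k)) \<partial>S) \<longlonglongrightarrow> complex_of_real (exp (- v / 2))"
  proof (rule charfun_array_conv[where A=A])
    show "a m k \<in> borel_measurable P" for m k
      unfolding a_def using \<xi>(1) by (intro borel_measurable_sum) auto
    have iif: "integrable P (\<lambda>y. if Q then d * g y else 0)" if "integrable P g" for Q d and g :: "'x \<Rightarrow> real"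
      using that by (cases Q) auto
    have eif: "(\<integral>y. (if Q then d * g y else 0) \<partial>P) = (if Q then d * (\<integral>y. g y \<partial>P) else 0)" for Q d and g :: "'x \<Rightarrow> real"
      by (cases Q) auto
    have int\<xi>: "integrable P (\<xi> t)" if "t \<in> I" for t
      using \<xi>[OF that] by (intro integrable_P_bounded[of _ B]) auto
    show "(\<integral>y. a m k y \<partial>P) = 0" for m k
    proof -
      have "(\<integral>y. a m k y \<partial>P) = (\<Sum>t\<in>I. \<integral>y. (if k < n m t then d m t * \<xi> t y else 0) \<partial>P)"
        unfolding a_def by (intro Bochner_Integration.integral_sum iif int\<xi>)
      also have "\<dots> = 0"
        unfolding eif using \<xi>(2) by (intro sum.neutral) simp
      finally show ?thesis .
    qed
    show "\<bar>a m k y\<bar> \<le> A / sqrt (real m)" for m k y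
    proof -
      have "\<bar>a m k y\<bar> \<le> (\<Sum>t\<in>I. \<bar>if k < n m t then d m t * \<xi> t y else 0\<bar>)"
        unfolding a_def by (rule sum_abs)
      also have "\<dots> \<le> (\<Sum>t\<in>I. \<bar>c t\<bar> * B / sqrt m)"
      proof (intro sum_mono)
        fix t assume t: "t \<in> I"
        have "\<bar>d m t * \<xi> t y\<bar> \<le> \<bar>c t\<bar> / sqrt m * B"
          unfolding abs_mult using d[OF t] \<xi>(3)[OF t] by (intro mult_mono) auto
        then show "\<bar>if k < n m t then d m t * \<xi> t y else 0\<bar> \<le> \<bar>c t\<bar> * B / sqrt m"
          using B_nonneg by simp
      qed
      finally show ?thesis
        by (simp add: A_def sum_divide_distrib)
    qed
    have var: "(\<Sum>k<K0 * m. \<integral>y. (a m k y)\<^sup>2 \<partial>P) =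
        (\<Sum>s\<in>I. \<Sum>t\<in>I. c s * c t * (C s t * min (real m / n m s) (real m / n m t)))" for m
    proof -
      have "(\<integral>y. (a m k y)\<^sup>2 \<partial>P) = (\<Sum>s\<in>I. \<Sum>t\<in>I. if k < min (n m s) (n m t) then d m s * d m t * C s t else 0)" for k
      proof -
        have "(\<integral>y. (a m k y)\<^sup>2 \<partial>P) =
            (\<integral>y. (\<Sum>s\<in>I. \<Sum>t\<in>I. if k < min (n m s) (n m t) then d m s * d m t * (\<xi> s y * \<xi> t y) else 0) \<partial>P)"
          unfolding a_def power2_eq_square sum_product
          by (intro Bochner_Integration.integral_cong refl sum.cong) auto
        also have "\<dots> = (\<Sum>s\<in>I. \<integral>y. (\<Sum>t\<in>I. if k < min (n m s) (n m t) then d m s * d m t * (\<xi> s y * \<xi> t y) else 0) \<partial>P)"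
          by (intro Bochner_Integration.integral_sum Bochner_Integration.integrable_sum iif Cint)
        also have "\<dots> = (\<Sum>s\<in>I. \<Sum>t\<in>I. \<integral>y. (if k < min (n m s) (n m t) then d m s * d m t * (\<xi> s y * \<xi> t y) else 0) \<partial>P)"
          by (intro sum.cong refl Bochner_Integration.integral_sum iif Cint)
        also have "\<dots> = (\<Sum>s\<in>I. \<Sum>t\<in>I. if k < min (n m s) (n m t) then d m s * d m t * C s t else 0)"
          unfolding C_def eif ..
        finally show ?thesis .
      qed
      then have "(\<Sum>k<K0 * m. \<integral>y. (a m k y)\<^sup>2 \<partial>P) =
          (\<Sum>s\<in>I. \<Sum>t\<in>I. \<Sum>k<K0 * m. if k < min (n m s) (n m t) then d m s * d m t * C s t else 0)"
        by (simp only: sum.swap[of _ "{..<K0 * m}"])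
      also have "\<dots> = (\<Sum>s\<in>I. \<Sum>t\<in>I. c s * c t * (C s t * min (real m / n m s) (real m / n m t)))"
      proof (intro sum.cong refl)
        fix s t assume st: "s \<in> I" "t \<in> I"
        have "(\<Sum>k<K0 * m. if k < min (n m s) (n m t) then d m s * d m t * C s t else 0)
            = (\<Sum>k\<in>{k\<in>{..<K0 * m}. k < min (n m s) (n m t)}. d m s * d m t * C s t)"
          by (rule sum.inter_filter[symmetric]) simp
        also have "{k\<in>{..<K0 * m}. k < min (n m s) (n m t)} = {..<min (n m s) (n m t)}"
          using nK[OF st(1), of m] by auto
        also have "(\<Sum>k\<in>{..<min (n m s) (n m t)}. d m s * d m t * C s t) = real (min (n m s) (n m t)) * (d m s * d m t * C s t)"
          by simp
        also have "\<dots> = c s * c t * (C s t * (real (min (n m s) (n m t)) * (real m / (real (n m s) * real (n m t)))))"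
          by (simp add: d_def)
        \<comment> \<open>Dividing the smaller index by the product of both leaves the reciprocal of
          the larger one.\<close>
        also have "real (min (n m s) (n m t)) * (real m / (real (n m s) * real (n m t))) = min (real m / n m s) (real m / n m t)"
        proof (cases "n m s \<le> n m t")
          case True
          then have "real m / n m t \<le> real m / n m s" if "n m s \<noteq> 0"
            using that by (intro divide_left_mono) auto
          then show ?thesis
            using True by (cases "n m s = 0") (auto simp: min_def)
        next
          case False
          then have "real m / n m s \<le> real m / n m t" if "n m t \<noteq> 0"
            using that by (intro divide_left_mono) auto
          then show ?thesis
            using False by (cases "n m t = 0") (auto simp: min_def divide_le_0_iff)
        qed
        finally show "(\<Sum>k<K0 * m. if k < min (n m s) (n m t) then d m s * d m t * C s t else 0)
          = c s * c t * (C s t * min (real m / n m s) (real m / n m t))" .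
      qed
      finally show ?thesis .
    qed
    have "(\<lambda>m. \<Sum>s\<in>I. \<Sum>t\<in>I. c s * c t * (C s t * min (real m / n m s) (real m / n m t)))
        \<longlonglongrightarrow> (\<Sum>s\<in>I. \<Sum>t\<in>I. c s * c t * (C s t * min (fst s) (fst t)))"
      unfolding n_def using In(1) by (intro tendsto_intros rev_index_ratio_tendsto)
    also have "(\<Sum>s\<in>I. \<Sum>t\<in>I. c s * c t * (C s t * min (fst s) (fst t))) = v"
      unfolding v_def by (intro sum.cong refl) (simp add: cc)
    finally show "(\<lambda>m. \<Sum>k<K0 * m. \<integral>y. (a m k y)\<^sup>2 \<partial>P) \<longlonglongrightarrow> v"
      unfolding var .
  qed auto
  moreover have "(\<integral>x. iexp (\<Sum>t\<in>I. c t * X t x) \<partial>N) = complex_of_real (exp (- v / 2))"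
    unfolding v_def by (rule zero_mean_gaussian_process_charfun[OF N X I])
  ultimately have lim: "(\<lambda>m. \<integral>x. iexp (\<Sum>t\<in>I. c t * bapp (rev_process m x) t) \<partial>S) \<longlonglongrightarrow> (\<integral>x. iexp (\<Sum>t\<in>I. c t * X t x) \<partial>N)"
    unfolding lin by simp
  have mS: "(\<lambda>x. \<Sum>t\<in>I. c t * bapp (rev_process m x) t) \<in> borel_measurable S" for m
    using rev_process_l2_bounded I(2) by (auto simp: l2_bounded_def intro!: borel_measurable_sum borel_measurable_times)
  have mN: "(\<lambda>x. \<Sum>t\<in>I. c t * X t x) \<in> borel_measurable N"
    using zero_mean_gaussian_process_moments(1)[OF N X] I(2) by (intro borel_measurable_sum borel_measurable_times) auto
  show "(\<lambda>m. \<integral>x. cos ((\<Sum>t\<in>I. c t * bapp (rev_process m x) t) + b) \<partial>S)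
      \<longlonglongrightarrow> (\<integral>x. cos ((\<Sum>t\<in>I. c t * X t x) + b) \<partial>N)"
    unfolding integral_cos_shift[OF P.prob_space_axioms mS] integral_cos_shift[OF N mN]
    by (intro tendsto_Re tendsto_mult_left lim)
qed

end

section \<open>Consequences of the Donsker property\<close>

definition bounded_seminorm :: "('b::real_normed_vector \<Rightarrow> real) \<Rightarrow> real \<Rightarrow> bool" where
  "bounded_seminorm q C \<longleftrightarrow> (\<forall>x y. q (x + y) \<le> q x + q y) \<and>
     (\<forall>a z. 0 \<le> a \<longrightarrow> q (a *\<^sub>R z) = a * q z) \<and> (\<forall>z. \<bar>q z\<bar> \<le> C * norm z)"

context empirical_process
begin

lemma emp_dist_diff:
  assumes bnd: "bounded ((\<lambda>f. \<integral>y. f y \<partial>P) ` F)" and n: "1 \<le> n"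
  shows "emp_dist F x n - true_dist F P = (1 / real n) *\<^sub>R partial_sum dev x n"
proof -
  have bd: "bounded ((\<lambda>f. (\<Sum>i<n. f (x i)) / real n) ` F)"
  proof -
    obtain C where C: "\<And>f. f \<in> F \<Longrightarrow> \<bar>\<integral>y. f y \<partial>P\<bar> \<le> C"
      using bnd unfolding bounded_iff by auto
    have f: "\<bar>f y\<bar> \<le> B + C" if "f \<in> F" for f y
      using F_bound[OF that, of y] C[OF that] by linarith
    show ?thesis
    proof (rule boundedI)
      fix z assume "z \<in> (\<lambda>f. (\<Sum>i<n. f (x i)) / real n) ` F"
      then obtain f where z: "z = (\<Sum>i<n. f (x i)) / real n" "f \<in> F"
        by auto
      have "\<bar>\<Sum>i<n. f (x i)\<bar> \<le> (\<Sum>i<n. B + C)"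
        by (rule order_trans[OF sum_abs sum_mono]) (rule f[OF z(2)])
      then show "norm z \<le> B + C"
        using n by (simp add: z field_simps)
    qed
  qed
  have "bapp (emp_dist F x n - true_dist F P) f = bapp ((1 / real n) *\<^sub>R partial_sum dev x n) f" for f
    using bapp_to_linf[OF bd, of f] bapp_to_linf[OF bnd, of f] n
    by (simp add: emp_dist_def true_dist_def partial_sum_def bapp_sum bapp_dev sum_subtractf diff_divide_distrib)
  then have "apply_bcontfun (emp_dist F x n - true_dist F P) d = apply_bcontfun ((1 / real n) *\<^sub>R partial_sum dev x n) d" for d
    by (metis of_discrete_inverse)
  then show ?thesis
    by (metis bcontfun_eqI)
qed

end

locale donsker_process = empirical_process P F B
  for P :: "'x measure" and F :: "('x \<Rightarrow> real) set" and B :: real +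
  assumes bounded_mean: "bounded ((\<lambda>f. \<integral>y. f y \<partial>P) ` F)"
    and donsker: "donsker P F"
begin

text \<open>Weak convergence is tested on a continuous function that rises from 0 to 1 while the
  seminorm \<open>q\<close> goes from \<open>\<epsilon>\<close> to \<open>2 * \<epsilon>\<close>;
  this explains the factor 2. Sublinearity and the bound on \<open>q\<close> make it Lipschitz.
  Outer expectations then turn into covers by Markov's inequality.\<close>

lemma donsker_limit:
  "\<exists>(N :: ('x \<Rightarrow> real) bfun measure) W. prob_space N \<and> tight_element (linf F) N W \<and>
     (\<forall>q \<epsilon> \<eta> C. bounded_seminorm q C \<longrightarrow> 0 < \<epsilon> \<longrightarrow> measure N {x \<in> space N. q (W x) > \<epsilon>} < \<eta> \<longrightarrow>
        (\<forall>\<^sub>F n in sequentially. ocover S {x. q (partial_sum dev x n) > 2 * \<epsilon> * sqrt n} \<eta>))"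
proof -
  obtain N :: "('x \<Rightarrow> real) bfun measure" and W where W: "brownian_bridge P F N W"
    and conv: "weak_conv_HJ (linf F) S (\<lambda>n x. sqrt (real n) *\<^sub>R (emp_dist F x n - true_dist F P)) sequentially N W"
    using donsker unfolding donsker_def by blast
  have N: "prob_space N" and tight: "tight_element (linf F) N W"
    using W by (auto simp: brownian_bridge_def)
  interpret N: prob_space N by fact
  have mW: "W \<in> borel_measurable N"
    using tight by (simp add: tight_element_def)
  have main: "\<forall>\<^sub>F n in sequentially. ocover S {x. q (partial_sum dev x n) > 2 * \<epsilon> * sqrt n} \<eta>"
    if semi: "bounded_seminorm q C" and \<epsilon>: "0 < \<epsilon>" and p: "measure N {x \<in> space N. q (W x) > \<epsilon>} < \<eta>"
    for q :: "('x \<Rightarrow> real) bfun \<Rightarrow> real" and \<epsilon> \<eta> C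
  proof -
    have q: "\<forall>x y. q (x + y) \<le> q x + q y" and hom: "\<forall>a z. 0 \<le> a \<longrightarrow> q (a *\<^sub>R z) = a * q z"
      and qC: "\<forall>z. \<bar>q z\<bar> \<le> C * norm z"
      using semi by (simp_all add: bounded_seminorm_def)
    have lip: "\<bar>q x - q y\<bar> \<le> C * norm (x - y)" for x y
    proof -
      have "q x \<le> q y + q (x - y)" "q y \<le> q x + q (y - x)"
        using q[rule_format, of y "x - y"] q[rule_format, of x "y - x"] by simp_all
      then show ?thesis
        using qC[rule_format, of "x - y"] qC[rule_format, of "y - x"] by (simp add: norm_minus_commute abs_le_iff)
    qed
    have cq: "continuous_on A q" for A
      unfolding continuous_on_def
    proof (intro ballI)
      fix x assume "x \<in> A"
      have "((\<lambda>y. C * norm (y - x)) \<longlongrightarrow> C * norm (x - x)) (at x within A)"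
        by (intro tendsto_intros)
      then have *: "((\<lambda>y. C * norm (y - x)) \<longlongrightarrow> 0) (at x within A)"
        by simp
      have "((\<lambda>y. q y - q x) \<longlongrightarrow> 0) (at x within A)"
        by (rule Lim_null_comparison[OF _ *]) (simp add: lip)
      then show "(q \<longlongrightarrow> q x) (at x within A)"
        by (simp add: LIM_zero_iff)
    qed
    \<comment> \<open>At most the indicator of \<open>q z > \<epsilon>\<close>, and equal to 1 where
      \<open>q z \<ge> 2 * \<epsilon>\<close>.\<close>
    define h where "h = (\<lambda>z. max 0 (min 1 (q z / \<epsilon> - 1)))"
    have h01: "0 \<le> h z" "h z \<le> 1" for z
      by (auto simp: h_def)
    have ch: "continuous_on A h" for A
      unfolding h_def using \<epsilon> by (intro continuous_intros cq) auto
    have mh: "(\<lambda>x. h (W x)) \<in> borel_measurable N"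
      by (rule measurable_compose[OF mW borel_measurable_continuous_onI[OF ch]])
    have mq: "(\<lambda>x. q (W x)) \<in> borel_measurable N"
      by (rule measurable_compose[OF mW borel_measurable_continuous_onI[OF cq]])
    have sA: "{x \<in> space N. q (W x) > \<epsilon>} \<in> sets N"
      using mq by measurable
    have "(\<integral>x. h (W x) \<partial>N) \<le> (\<integral>x. indicator {x \<in> space N. q (W x) > \<epsilon>} x \<partial>N)"
    proof (rule integral_mono)
      show "integrable N (\<lambda>x. h (W x))"
        using mh h01 by (intro N.integrable_const_bound[where B=1]) auto
      show "integrable N (indicator {x \<in> space N. q (W x) > \<epsilon>} :: _ \<Rightarrow> real)"
        using sA by (intro integrable_real_indicator) (auto simp: N.emeasure_eq_measure)
      fix x assume x: "x \<in> space N"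
      show "h (W x) \<le> indicator {x \<in> space N. q (W x) > \<epsilon>} x"
      proof (cases "q (W x) > \<epsilon>")
        case True
        then show ?thesis using x h01 by simp
      next
        case False
        then have "q (W x) / \<epsilon> \<le> 1"
          using \<epsilon> by simp
        then show ?thesis by (simp add: h_def)
      qed
    qed
    also have "\<dots> = measure N {x \<in> space N. q (W x) > \<epsilon>}"
      using sA by (simp add: Int_absorb1 sets.sets_into_space)
    finally have "(\<integral>x. h (W x) \<partial>N) < \<eta>"
      using p by simp
    moreover have "((\<lambda>n. outer_expectation S (\<lambda>x. h (sqrt (real n) *\<^sub>R (emp_dist F x n - true_dist F P)))) \<longlongrightarrow> (\<integral>x. h (W x) \<partial>N)) sequentially"
    proof -
      have "bounded (h ` linf F)"
        by (rule boundedI[of _ 1]) (use h01 in auto)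
      then show ?thesis
        using conv ch[of "linf F"] unfolding weak_conv_HJ_def by auto
    qed
    ultimately have "\<forall>\<^sub>F n in sequentially. outer_expectation S (\<lambda>x. h (sqrt (real n) *\<^sub>R (emp_dist F x n - true_dist F P))) < \<eta>"
      by (intro order_tendstoD(2))
    then have "\<forall>\<^sub>F n in sequentially. 1 \<le> n \<and> outer_expectation S (\<lambda>x. h (sqrt (real n) *\<^sub>R (emp_dist F x n - true_dist F P))) < \<eta>"
      by (intro eventually_conj eventually_ge_at_top)
    then show ?thesis
    proof eventually_elim
      case (elim n)
      have "ocover S {x. 1 \<le> h (sqrt (real n) *\<^sub>R (emp_dist F x n - true_dist F P))} \<eta>"
        using elim h01 by (intro ocover_outer_expectation[where b=1] P.prob_space_axioms) auto
      then show ?case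
      proof (rule ocover_mono)
        show "{x. q (partial_sum dev x n) > 2 * \<epsilon> * sqrt n} \<inter> space S
          \<subseteq> {x. 1 \<le> h (sqrt (real n) *\<^sub>R (emp_dist F x n - true_dist F P))}"
        proof clarify
          fix x assume x: "q (partial_sum dev x n) > 2 * \<epsilon> * sqrt n"
          have "sqrt (real n) *\<^sub>R (emp_dist F x n - true_dist F P) = (sqrt n / n) *\<^sub>R partial_sum dev x n"
            using elim by (simp add: emp_dist_diff[OF bounded_mean])
          also have "sqrt n / n = 1 / sqrt n"
            using elim by (simp add: field_simps)
          finally have "q (sqrt (real n) *\<^sub>R (emp_dist F x n - true_dist F P)) = q (partial_sum dev x n) / sqrt n"
            using hom by simp
          also have "\<dots> \<ge> 2 * \<epsilon>"
            using x elim by (simp add: field_simps)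
          finally have "2 \<le> q (sqrt (real n) *\<^sub>R (emp_dist F x n - true_dist F P)) / \<epsilon>"
            using \<epsilon> by (simp add: field_simps)
          then show "1 \<le> h (sqrt (real n) *\<^sub>R (emp_dist F x n - true_dist F P))"
            by (simp add: h_def)
        qed
      qed simp
    qed
  qed
  show ?thesis
    by (intro exI[of _ N] exI[of _ W] conjI allI impI; (rule main)?) (fact N tight)+
qed

text \<open>The limit gives mass at least \<open>1 - \<eta> / 2\<close> to a compact
  \<open>K\<close>. This \<open>K\<close> is fixed before the seminorm, so a partition adapted to
  \<open>K\<close> can be built first and its oscillation seminorm inserted afterwards.\<close>

lemma seminorm_bound_compact:
  assumes \<eta>: "0 < \<eta>"
  shows "\<exists>K. compact K \<and> K \<subseteq> linf F \<and>
     (\<forall>q \<epsilon> C. bounded_seminorm q C \<longrightarrow> 0 < \<epsilon> \<longrightarrow> (\<forall>z\<in>K. q z \<le> \<epsilon>) \<longrightarrow>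
        (\<forall>\<^sub>F n in sequentially. ocover S {x. q (partial_sum dev x n) > 2 * \<epsilon> * sqrt n} \<eta>))"
proof -
  obtain N :: "('x \<Rightarrow> real) bfun measure" and W where N: "prob_space N" and W: "tight_element (linf F) N W"
    and main: "\<forall>q \<epsilon> \<eta> C. bounded_seminorm q C \<longrightarrow> 0 < \<epsilon> \<longrightarrow> measure N {x \<in> space N. q (W x) > \<epsilon>} < \<eta> \<longrightarrow>
        (\<forall>\<^sub>F n in sequentially. ocover S {x. q (partial_sum dev x n) > 2 * \<epsilon> * sqrt n} \<eta>)"
    using donsker_limit by (elim exE conjE) (rule that)
  interpret N: prob_space N by fact
  have mW: "W \<in> borel_measurable N"
    using W by (simp add: tight_element_def)
  have "\<forall>e>0. \<exists>K. compact K \<and> K \<subseteq> linf F \<and> measure N {x \<in> space N. W x \<in> K} \<ge> 1 - e"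
    using W by (simp add: tight_element_def)
  from this[rule_format, of "\<eta> / 2"] \<eta>
  obtain K where K: "compact K" "K \<subseteq> linf F" "measure N {x \<in> space N. W x \<in> K} \<ge> 1 - \<eta> / 2"
    by auto
  have sK: "{x \<in> space N. W x \<in> K} \<in> sets N"
    using measurable_sets[OF mW borel_closed[OF compact_imp_closed[OF K(1)]]] by (simp add: vimage_def Int_def conj_commute)
  have small: "measure N {x \<in> space N. q (W x) > \<epsilon>} < \<eta>" if q: "\<forall>z\<in>K. q z \<le> \<epsilon>" for q and \<epsilon> :: real
  proof -
    have "measure N {x \<in> space N. q (W x) > \<epsilon>} \<le> measure N (space N - {x \<in> space N. W x \<in> K})"
      using q sK by (intro N.finite_measure_mono) (auto simp: not_less[symmetric])
    also have "\<dots> \<le> \<eta> / 2"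
      using N.prob_compl[OF sK] K(3) by simp
    finally show ?thesis
      using \<eta> by simp
  qed
  show ?thesis
    by (intro exI[of _ K] conjI allI impI K(1,2)) (rule main[rule_format], assumption+, rule small)
qed

text \<open>A compact set is bounded, so the norm is tight at scale \<open>sqrt n\<close>. The
  probability 1/8 is what the iteration in \<open>max_partial_sum_tail\<close> starts from.\<close>

lemma iid_sums: "\<exists>c n0. iid_sums P dev c n0"
proof -
  have e8: "0 < (1 / 8 :: real)"
    by simp
  obtain K where K: "compact K" "K \<subseteq> linf F" and main:
    "\<forall>q \<epsilon> C. bounded_seminorm q C \<longrightarrow> 0 < \<epsilon> \<longrightarrow> (\<forall>z\<in>K. q z \<le> \<epsilon>) \<longrightarrow>
        (\<forall>\<^sub>F n in sequentially. ocover S {x. q (partial_sum dev x n) > 2 * \<epsilon> * sqrt n} (1 / 8))"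
    using seminorm_bound_compact[OF e8] by (elim exE conjE) (rule that)
  obtain b where b: "0 < b" "\<forall>z\<in>K. norm z \<le> b"
    using compact_imp_bounded[OF K(1)] by (auto simp: bounded_pos)
  have "\<forall>\<^sub>F n in sequentially. ocover S {x. norm (partial_sum dev x n) > 2 * b * sqrt n} (1 / 8)"
    using b by (intro main[rule_format, of norm 1]) (auto simp: norm_triangle_ineq bounded_seminorm_def)
  from max_partial_sum_tail[OF norm_dev _ this] have "\<exists>c'>0. \<forall>\<^sub>F n in sequentially. \<forall>i.
    ocover S {x. \<exists>k\<le>n. norm (partial_sum dev x k) > 3 ^ i * c' * sqrt n} ((1 / 2) ^ (2 ^ i))"
    using b by simp
  then obtain c n0 where c: "0 < c" "\<And>n i. n0 \<le> n \<Longrightarrow>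
    ocover S {x. \<exists>k\<le>n. norm (partial_sum dev x k) > 3 ^ i * c * sqrt n} ((1 / 2) ^ (2 ^ i))"
    by (auto simp: eventually_sequentially)
  have "iid_sums P dev c n0"
    by unfold_locales (use c in auto)
  then show ?thesis by blast
qed

text \<open>The oscillation within the cells of \<open>\<pi>\<close>, measured against
  representatives. Written as the norm of a linear image of \<open>z\<close> it is a seminorm, to
  which the maximal inequality applies.\<close>

definition osc :: "(('x \<Rightarrow> real) \<Rightarrow> ('x \<Rightarrow> real)) \<Rightarrow> ('x \<Rightarrow> real) bfun \<Rightarrow> real" where
  "osc \<pi> z = norm (z - step_fun F \<pi> (bapp z))"

lemma osc_seminorm:
  assumes I: "finite I" "\<pi> ` F \<subseteq> I"
  shows "osc \<pi> (x + y) \<le> osc \<pi> x + osc \<pi> y" "osc \<pi> (a *\<^sub>R z) = \<bar>a\<bar> * osc \<pi> z"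
    "osc \<pi> (- z) = osc \<pi> z" "\<bar>osc \<pi> z\<bar> \<le> 2 * norm z"
proof -
  have ext: "u = v" if "\<And>f. bapp u f = bapp v f" for u v :: "('x \<Rightarrow> real) bfun"
    using that by (metis bcontfun_eqI of_discrete_inverse)
  have add: "step_fun F \<pi> (bapp (x + y)) = step_fun F \<pi> (bapp x) + step_fun F \<pi> (bapp y)" for x y
    by (rule ext) (simp add: step_fun(1)[OF I])
  have scale: "step_fun F \<pi> (bapp (a *\<^sub>R z)) = a *\<^sub>R step_fun F \<pi> (bapp z)" for a z
    by (rule ext) (simp add: step_fun(1)[OF I])
  have "(x + y) - step_fun F \<pi> (bapp (x + y)) = (x - step_fun F \<pi> (bapp x)) + (y - step_fun F \<pi> (bapp y))"
    unfolding add by simp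
  then show "osc \<pi> (x + y) \<le> osc \<pi> x + osc \<pi> y"
    unfolding osc_def by (metis norm_triangle_ineq)
  have sc: "osc \<pi> (a *\<^sub>R z) = \<bar>a\<bar> * osc \<pi> z" for a z
    unfolding osc_def scale scaleR_diff_right[symmetric] by simp
  show "osc \<pi> (a *\<^sub>R z) = \<bar>a\<bar> * osc \<pi> z"
    by (rule sc)
  show "osc \<pi> (- z) = osc \<pi> z"
    using sc[of "-1" z] by simp
  have "norm (step_fun F \<pi> (bapp z)) \<le> norm z"
    by (rule norm_linf_le[OF step_fun(2)[OF I]]) (auto simp: step_fun(1)[OF I] abs_bapp_le_norm)
  then show "\<bar>osc \<pi> z\<bar> \<le> 2 * norm z"
    unfolding osc_def using norm_triangle_ineq4[of z "step_fun F \<pi> (bapp z)"] by simp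
qed

text \<open>Asymptotic equicontinuity of the ordinary empirical process: the partition comes from
  \<open>compact_retract\<close> for a compact set carrying most of the limit, on which its
  oscillation is then small.\<close>

lemma osc_partial_sum:
  assumes "0 < \<epsilon>" "0 < \<eta>"
  shows "\<exists>I \<pi>. finite I \<and> I \<subseteq> F \<and> \<pi> ` F \<subseteq> I \<and>
    (\<forall>\<^sub>F n in sequentially. ocover S {x. osc \<pi> (partial_sum dev x n) > \<epsilon> * sqrt n} \<eta>)"
proof -
  obtain K where K: "compact K" "K \<subseteq> linf F" and main:
    "\<forall>q \<epsilon> C. bounded_seminorm q C \<longrightarrow> 0 < \<epsilon> \<longrightarrow> (\<forall>z\<in>K. q z \<le> \<epsilon>) \<longrightarrow>
        (\<forall>\<^sub>F n in sequentially. ocover S {x. q (partial_sum dev x n) > 2 * \<epsilon> * sqrt n} \<eta>)"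
    using seminorm_bound_compact[OF assms(2)] by (elim exE conjE) (rule that)
  have e: "0 < \<epsilon> / 2"
    using assms by simp
  obtain I \<pi> where I: "finite I" "I \<subseteq> F" "\<pi> ` F \<subseteq> I" "\<forall>z\<in>K. \<forall>t\<in>F. \<bar>bapp z t - bapp z (\<pi> t)\<bar> \<le> \<epsilon> / 2"
    using compact_retract[OF K(1) e, of F] by blast
  have "osc \<pi> z \<le> \<epsilon> / 2" if "z \<in> K" for z
    unfolding osc_def using that K(2) I(4) e by (intro norm_diff_step_fun[OF I(1,3)]) auto
  moreover have "bounded_seminorm (osc \<pi>) 2"
    unfolding bounded_seminorm_def using osc_seminorm[OF I(1,3)] by simp
  ultimately have "\<forall>\<^sub>F n in sequentially. ocover S {x. osc \<pi> (partial_sum dev x n) > 2 * (\<epsilon> / 2) * sqrt n} \<eta>"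
    using e by (intro main[rule_format, of "osc \<pi>" 2]) auto
  then show ?thesis
    using I by (intro exI[of _ I] exI[of _ \<pi>]) auto
qed

lemma rev_mean_near_zero:
  assumes "0 < \<epsilon>" "0 < \<eta>"
  shows "\<exists>\<delta>>0. \<delta> \<le> 1 \<and> (\<forall>\<^sub>F m in sequentially.
    ocover S {x. \<exists>s\<in>{0<..\<delta>}. norm (rev_mean dev m s x) > \<epsilon>} \<eta>)"
proof -
  obtain c n0 where "iid_sums P dev c n0"
    using iid_sums by blast
  from iid_sums.rev_mean_near_zero[OF this assms] show ?thesis .
qed

lemma rev_mean_modulus:
  assumes "0 < \<epsilon>" "0 < \<eta>"
  shows "\<exists>\<kappa>>(0::real). \<forall>\<^sub>F m in sequentially.
    ocover S {x. \<exists>s t. 0 < s \<and> s \<le> t \<and> t \<le> 1 \<and> t - s \<le> \<kappa> \<and>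
      norm (rev_mean dev m s x - rev_mean dev m t x) > \<epsilon>} \<eta>"
proof -
  obtain c n0 where "iid_sums P dev c n0"
    using iid_sums by blast
  from iid_sums.rev_mean_modulus[OF this assms] show ?thesis .
qed

text \<open>The modulus in \<open>s\<close> and the oscillation in \<open>f\<close> are combined on
  a product partition. Since the oscillation bound is available for \<open>s \<ge> \<delta>\<close>,
  smaller times use that the whole mean is small there.\<close>

lemma rev_process_asymp_equicont:
  "asymp_equicont ({0<..1} \<times> F) S (\<lambda>m x. bapp (rev_process m x))"
  unfolding asymp_equicont_def
proof (intro allI impI)
  fix \<epsilon> \<eta>' :: real assume \<epsilon>: "0 < \<epsilon>" and \<eta>': "0 < \<eta>'"
  define \<eta> where "\<eta> = min \<eta>' 1"
  have \<eta>: "0 < \<eta>" "\<eta> \<le> 1" "\<eta> \<le> \<eta>'"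
    using \<eta>' by (auto simp: \<eta>_def)
  have e: "0 < \<epsilon> / 4" "0 < \<epsilon> / 2" "0 < \<eta> / 3"
    using \<epsilon> \<eta> by auto
  obtain \<delta> where \<delta>: "0 < \<delta>" "\<delta> \<le> 1" and near: "\<forall>\<^sub>F m in sequentially.
      ocover S {x. \<exists>s\<in>{0<..\<delta>}. norm (rev_mean dev m s x) > \<epsilon> / 4} (\<eta> / 3)"
    using rev_mean_near_zero[OF e(1,3)] by (elim exE conjE) (rule that)
  obtain \<kappa> :: real where \<kappa>: "0 < \<kappa>" and modu: "\<forall>\<^sub>F m in sequentially.
      ocover S {x. \<exists>s t. 0 < s \<and> s \<le> t \<and> t \<le> 1 \<and> t - s \<le> \<kappa> \<and>
      norm (rev_mean dev m s x - rev_mean dev m t x) > \<epsilon> / 2} (\<eta> / 3)"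
    using rev_mean_modulus[OF e(2,3)] by (elim exE conjE) (rule that)
  \<comment> \<open>The thresholds that \<open>rev_mean_seminorm_bound\<close> requires in order to
    end with \<open>\<epsilon> / 4\<close> and \<open>\<eta> / 3\<close>.\<close>
  have e2: "0 < \<epsilon> / 4 * sqrt \<delta> / 4" "0 < \<eta> / 3 / 2"
    using \<epsilon> \<delta> \<eta> by auto
  obtain I \<pi> where I: "finite I" "I \<subseteq> F" "\<pi> ` F \<subseteq> I" and oscn: "\<forall>\<^sub>F n in sequentially.
      ocover S {x. osc \<pi> (partial_sum dev x n) > \<epsilon> / 4 * sqrt \<delta> / 4 * sqrt n} (\<eta> / 3 / 2)"
    using osc_partial_sum[OF e2] by (elim exE conjE) (rule that)
  note os = osc_seminorm[OF I(1,3)]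
  have oscm: "\<forall>\<^sub>F m in sequentially. ocover S {x. \<exists>s\<in>{\<delta>..1}. osc \<pi> (rev_mean dev m s x) > \<epsilon> / 4} (\<eta> / 3)"
  proof (rule rev_mean_seminorm_bound[where q="osc \<pi>" and C=2])
    show "osc \<pi> z \<le> 2 * norm z" for z
      using os(4)[of z] by simp
    show "osc \<pi> (a *\<^sub>R z) = a * osc \<pi> z" if "0 \<le> a" for a z
      using os(2)[of a z] that by simp
  qed (use os(1,3) norm_dev \<epsilon> \<eta> \<delta> oscn in auto)
  \<comment> \<open>Cells are products of a time interval of length \<open>\<kappa>\<close> and a
    cell of \<open>\<pi>\<close>.\<close>
  define code where "code = (\<lambda>t::real \<times> ('x \<Rightarrow> real). (\<lceil>fst t / \<kappa>\<rceil>, \<pi> (snd t)))"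
  have "code ` ({0<..1} \<times> F) \<subseteq> {0..\<lceil>1 / \<kappa>\<rceil>} \<times> I"
  proof (rule image_subsetI)
    fix t :: "real \<times> ('x \<Rightarrow> real)" assume "t \<in> {0<..1} \<times> F"
    then obtain s f where sf: "t = (s, f)" "s \<in> {0<..1::real}" "f \<in> F"
      by auto
    then have "0 < s / \<kappa>" "s / \<kappa> \<le> 1 / \<kappa>"
      using \<kappa> by (simp_all add: divide_right_mono)
    then have "0 \<le> \<lceil>s / \<kappa>\<rceil>" "\<lceil>s / \<kappa>\<rceil> \<le> \<lceil>1 / \<kappa>\<rceil>"
      by (linarith, intro ceiling_mono)
    then show "code t \<in> {0..\<lceil>1 / \<kappa>\<rceil>} \<times> I"
      using I(3) sf by (auto simp: code_def)
  qed
  then have "finite (code ` ({0<..1} \<times> F))"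
    by (rule finite_subset) (use I in auto)
  from finite_retract[OF this] obtain J \<rho> where J: "finite J" "J \<subseteq> {0<..1} \<times> F" "\<rho> ` ({0<..1} \<times> F) \<subseteq> J"
      "\<forall>t\<in>{0<..1} \<times> F. code (\<rho> t) = code t"
    by blast
  have "\<forall>\<^sub>F m in sequentially. ocover S {x. \<exists>t\<in>{0<..1} \<times> F. \<bar>bapp (rev_process m x) t - bapp (rev_process m x) (\<rho> t)\<bar> > \<epsilon>} \<eta>'"
    using near modu oscm
  proof eventually_elim
    case (elim m)
    let ?A1 = "{x. \<exists>s\<in>{0<..\<delta>}. norm (rev_mean dev m s x) > \<epsilon> / 4}"
    let ?A2 = "{x. \<exists>s t. 0 < s \<and> s \<le> t \<and> t \<le> 1 \<and> t - s \<le> \<kappa> \<and> norm (rev_mean dev m s x - rev_mean dev m t x) > \<epsilon> / 2}"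
    let ?A3 = "{x. \<exists>s\<in>{\<delta>..1}. osc \<pi> (rev_mean dev m s x) > \<epsilon> / 4}"
    have "ocover S (?A1 \<union> ?A2 \<union> ?A3) (\<eta> / 3 + \<eta> / 3 + \<eta> / 3)"
      by (intro ocover_Un P.prob_space_axioms elim)
    then show ?case
    proof (rule ocover_mono)
      show "{x. \<exists>t\<in>{0<..1} \<times> F. \<bar>bapp (rev_process m x) t - bapp (rev_process m x) (\<rho> t)\<bar> > \<epsilon>} \<inter> space S \<subseteq> ?A1 \<union> ?A2 \<union> ?A3"
      proof (rule ccontr)
        assume "\<not> ?thesis"
        then obtain x t where x: "x \<notin> ?A1" "x \<notin> ?A2" "x \<notin> ?A3" and t: "t \<in> {0<..1} \<times> F"
          and big: "\<bar>bapp (rev_process m x) t - bapp (rev_process m x) (\<rho> t)\<bar> > \<epsilon>"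
          by blast
        obtain s f where sf: "t = (s, f)" "0 < s" "s \<le> 1" "f \<in> F"
          using t by auto
        have "\<rho> t \<in> {0<..1} \<times> F"
          using J t by blast
        then obtain s' f' where sf': "\<rho> t = (s', f')" "0 < s'" "s' \<le> 1" "f' \<in> F"
          by auto
        have ceq: "\<lceil>s' / \<kappa>\<rceil> = \<lceil>s / \<kappa>\<rceil>" "\<pi> f' = \<pi> f"
          using J(4)[rule_format, OF t] unfolding sf'(1) unfolding sf(1) code_def by simp_all
        have "\<bar>s / \<kappa> - s' / \<kappa>\<bar> \<le> 1"
          using ceq(1) by linarith
        then have "\<bar>s - s'\<bar> / \<kappa> \<le> 1"
          using \<kappa> unfolding diff_divide_distrib[symmetric] abs_divide by simp
        then have ss: "\<bar>s - s'\<bar> \<le> \<kappa>"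
          using \<kappa> by (simp add: divide_le_eq)
        have modx: "norm (rev_mean dev m u x - rev_mean dev m v x) \<le> \<epsilon> / 2"
          if "0 < u" "u \<le> v" "v \<le> 1" "v - u \<le> \<kappa>" for u v
          using x(2) that unfolding mem_Collect_eq not_ex de_Morgan_conj not_less by (metis not_less not_le)
        have 1: "norm (rev_mean dev m s x - rev_mean dev m s' x) \<le> \<epsilon> / 2"
        proof (cases "s \<le> s'")
          case True
          then show ?thesis
            using sf sf' ss by (intro modx) auto
        next
          case False
          then have "norm (rev_mean dev m s' x - rev_mean dev m s x) \<le> \<epsilon> / 2"
            using sf sf' ss by (intro modx) auto
          then show ?thesis
            by (simp add: norm_minus_commute)
        qed
        let ?z = "rev_mean dev m s' x"
        have 2: "\<bar>bapp ?z f - bapp ?z f'\<bar> \<le> \<epsilon> / 2"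
        proof (cases "s' \<le> \<delta>")
          case True
          then have "norm ?z \<le> \<epsilon> / 4"
            using x(1) sf' by (auto simp: not_less)
          then show ?thesis
            using abs_bapp_le_norm[of ?z f] abs_bapp_le_norm[of ?z f'] by linarith
        next
          case False
          then have o: "osc \<pi> ?z \<le> \<epsilon> / 4"
            using x(3) sf' by (auto simp: not_less)
          have dev_osc: "\<bar>bapp ?z h - bapp ?z (\<pi> h)\<bar> \<le> osc \<pi> ?z" if "h \<in> F" for h
            using abs_bapp_le_norm[of "?z - step_fun F \<pi> (bapp ?z)" h] that
            by (simp add: osc_def step_fun(1)[OF I(1,3)])
          show ?thesis
            using dev_osc[OF sf(4)] dev_osc[OF sf'(4)] o unfolding ceq(2) by linarith
        qed
        have "\<bar>bapp (rev_mean dev m s x) f - bapp ?z f\<bar> \<le> \<epsilon> / 2"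
          using abs_bapp_diff_le[of "rev_mean dev m s x" f ?z] 1 by linarith
        moreover have "\<bar>bapp (rev_mean dev m s x) f - bapp ?z f'\<bar> > \<epsilon>"
          using big sf(2-4) sf'(2-4) unfolding sf'(1) unfolding sf(1) bapp_rev_process by simp
        ultimately show False
          using 2 by linarith
      qed
    qed (use \<eta> in auto)
  qed
  then show "\<exists>I \<pi>. finite I \<and> I \<subseteq> {0<..1} \<times> F \<and> \<pi> ` ({0<..1} \<times> F) \<subseteq> I \<and>
      (\<forall>\<^sub>F m in sequentially. ocover S {x. \<exists>t\<in>{0<..1} \<times> F. \<bar>bapp (rev_process m x) t - bapp (rev_process m x) (\<pi> t)\<bar> > \<epsilon>} \<eta>')"
    using J(1,2,3) by (intro exI[of _ J] exI[of _ \<rho>] conjI) auto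
qed

theorem rev_process_portmanteau:
  assumes Z: "kiefer_mueller P F N Z" and C: "closed C" and \<eta>: "0 < \<eta>"
  shows "\<forall>\<^sub>F m in sequentially. ocover S {x. rev_process m x \<in> C} (measure N {y \<in> space N. Z y \<in> C} + \<eta>)"
proof (rule portmanteau_closed[OF P.prob_space_axioms _ rev_process_in_linf _ rev_process_l2_bounded _ _ rev_process_asymp_equicont C \<eta>])
  show N: "prob_space N" and "tight_element (linf ({0<..1} \<times> F)) N Z"
    using Z by (auto simp: kiefer_mueller_def)
  have X: "zero_mean_gaussian_process ({0<..1} \<times> F) N (\<lambda>t x. bapp (Z x) t)"
    using Z by (simp add: kiefer_mueller_def)
  show "l2_bounded ({0<..1} \<times> F) N (\<lambda>_ x. bapp (Z x))"
    using zero_mean_gaussian_process_moments[OF N X] by (auto simp: l2_bounded_def)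
  show "fidi_conv ({0<..1} \<times> F) S (\<lambda>m x. bapp (rev_process m x)) N (\<lambda>x. bapp (Z x))"
    using Z by (intro rev_process_fidi_conv[OF N X]) (simp add: kiefer_mueller_def)
qed

end

section \<open>Continuous linear functionals of tight Gaussian processes\<close>

lemma zero_mean_gaussian_process_scale:
  assumes N: "prob_space N" and X: "zero_mean_gaussian_process T N X"
  shows "zero_mean_gaussian_process T N (\<lambda>t x. a t * X t x)"
  unfolding zero_mean_gaussian_process_def gaussian_process_def
proof (intro conjI ballI allI impI)
  fix I c assume I: "finite I \<and> I \<subseteq> T"
  have "\<forall>I c. finite I \<and> I \<subseteq> T \<longrightarrow> gaussian_rv N (\<lambda>x. \<Sum>t\<in>I. c t * X t x)"
    using X by (simp add: zero_mean_gaussian_process_def gaussian_process_def)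
  from this[rule_format, OF I, of "\<lambda>t. c t * a t"]
  show "gaussian_rv N (\<lambda>x. \<Sum>t\<in>I. c t * (a t * X t x))"
    by (simp add: mult.assoc)
next
  fix t assume "t \<in> T"
  then show "(\<integral>x. a t * X t x \<partial>N) = 0"
    using X by (simp add: zero_mean_gaussian_process_def)
qed

lemma zero_mean_gaussian_process_reindex:
  assumes N: "prob_space N" and X: "zero_mean_gaussian_process T N X" and p: "p ` T' \<subseteq> T"
  shows "zero_mean_gaussian_process T' N (\<lambda>t x. X (p t) x)"
  unfolding zero_mean_gaussian_process_def gaussian_process_def
proof (intro conjI ballI allI impI)
  fix I c assume "finite I \<and> I \<subseteq> T'"
  then have I: "finite I" "I \<subseteq> T'"
    by auto
  have "\<forall>I c. finite I \<and> I \<subseteq> T \<longrightarrow> gaussian_rv N (\<lambda>x. \<Sum>t\<in>I. c t * X t x)"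
    using X by (simp add: zero_mean_gaussian_process_def gaussian_process_def)
  \<comment> \<open>The map \<open>p\<close> need not be injective, so the coefficients are
    collected over its fibres.\<close>
  from this[rule_format, of "p ` I" "\<lambda>u. \<Sum>t\<in>{t\<in>I. p t = u}. c t"]
  have "gaussian_rv N (\<lambda>x. \<Sum>u\<in>p ` I. (\<Sum>t\<in>{t\<in>I. p t = u}. c t) * X u x)"
    using I p by auto
  also have "(\<lambda>x. \<Sum>u\<in>p ` I. (\<Sum>t\<in>{t\<in>I. p t = u}. c t) * X u x) = (\<lambda>x. \<Sum>t\<in>I. c t * X (p t) x)"
  proof
    fix x
    have "(\<Sum>t\<in>I. c t * X (p t) x) = (\<Sum>u\<in>p ` I. \<Sum>t\<in>{t\<in>I. p t = u}. c t * X (p t) x)"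
      by (rule sum.image_gen[OF I(1)])
    also have "\<dots> = (\<Sum>u\<in>p ` I. (\<Sum>t\<in>{t\<in>I. p t = u}. c t) * X u x)"
      unfolding sum_distrib_right by (intro sum.cong refl) simp
    finally show "(\<Sum>u\<in>p ` I. (\<Sum>t\<in>{t\<in>I. p t = u}. c t) * X u x) = (\<Sum>t\<in>I. c t * X (p t) x)"
      by simp
  qed
  finally show "gaussian_rv N (\<lambda>x. \<Sum>t\<in>I. c t * X (p t) x)" .
next
  fix t assume "t \<in> T'"
  then show "(\<integral>x. X (p t) x \<partial>N) = 0"
    using X p by (auto simp: zero_mean_gaussian_process_def)
qed

lemma tight_element_image:
  fixes \<Phi> :: "'a::metric_space \<Rightarrow> 'b::metric_space"
  assumes W: "tight_element A N W" and c: "continuous_on UNIV \<Phi>" and im: "\<Phi> ` A \<subseteq> A'" and N: "prob_space N"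
  shows "tight_element A' N (\<lambda>x. \<Phi> (W x))"
  unfolding tight_element_def
proof (intro conjI ballI allI impI)
  interpret prob_space N by fact
  have mW: "W \<in> borel_measurable N" and WA: "\<And>x. x \<in> space N \<Longrightarrow> W x \<in> A"
    using W by (auto simp: tight_element_def)
  show m\<Phi>: "(\<lambda>x. \<Phi> (W x)) \<in> borel_measurable N"
    by (rule measurable_compose[OF mW borel_measurable_continuous_onI[OF c]])
  show "\<Phi> (W x) \<in> A'" if "x \<in> space N" for x
    using WA[OF that] im by auto
  fix \<epsilon> :: real assume "0 < \<epsilon>"
  then obtain K where K: "compact K" "K \<subseteq> A" "1 - \<epsilon> \<le> measure N {x \<in> space N. W x \<in> K}"
    using W unfolding tight_element_def by metis
  have cK: "compact (\<Phi> ` K)"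
    by (rule compact_continuous_image[OF continuous_on_subset[OF c] K(1)]) auto
  have "{x \<in> space N. \<Phi> (W x) \<in> \<Phi> ` K} \<in> sets N"
    using measurable_sets[OF m\<Phi> borel_closed[OF compact_imp_closed[OF cK]]] by (simp add: vimage_def Int_def conj_commute)
  then have "measure N {x \<in> space N. W x \<in> K} \<le> measure N {x \<in> space N. \<Phi> (W x) \<in> \<Phi> ` K}"
    by (intro finite_measure_mono) auto
  then show "\<exists>K. compact K \<and> K \<subseteq> A' \<and> 1 - \<epsilon> \<le> measure N {x \<in> space N. \<Phi> (W x) \<in> K}"
    using cK K im by (intro exI[of _ "\<Phi> ` K"]) auto
qed

lemma tight_element_equicont:
  assumes W: "tight_element (linf T) N W" and N: "prob_space N" and e: "0 < \<epsilon>" "0 < \<eta>"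
  shows "\<exists>I \<pi>. finite I \<and> I \<subseteq> T \<and> \<pi> ` T \<subseteq> I \<and>
    ocover N {x. \<exists>t\<in>T. \<bar>bapp (W x) t - bapp (W x) (\<pi> t)\<bar> > \<epsilon>} \<eta>"
proof -
  interpret prob_space N by fact
  have mW: "W \<in> borel_measurable N"
    using W by (auto simp: tight_element_def)
  obtain K where K: "compact K" "1 - \<eta> \<le> measure N {x \<in> space N. W x \<in> K}"
    using W e unfolding tight_element_def by metis
  have sK: "{x \<in> space N. W x \<in> K} \<in> sets N"
    using measurable_sets[OF mW borel_closed[OF compact_imp_closed[OF K(1)]]] by (simp add: vimage_def Int_def conj_commute)
  obtain I \<pi> where I: "finite I" "I \<subseteq> T" "\<pi> ` T \<subseteq> I" "\<forall>z\<in>K. \<forall>t\<in>T. \<bar>bapp z t - bapp z (\<pi> t)\<bar> \<le> \<epsilon>"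
    using compact_retract[OF K(1) e(1), of T] by blast
  have "ocover N {x. \<exists>t\<in>T. \<bar>bapp (W x) t - bapp (W x) (\<pi> t)\<bar> > \<epsilon>} \<eta>"
  proof (rule ocoverI)
    show "space N - {x \<in> space N. W x \<in> K} \<in> sets N"
      using sK by auto
    show "measure N (space N - {x \<in> space N. W x \<in> K}) \<le> \<eta>"
      using prob_compl[OF sK] K(2) by simp
    show "{x. \<exists>t\<in>T. \<bar>bapp (W x) t - bapp (W x) (\<pi> t)\<bar> > \<epsilon>} \<inter> space N \<subseteq> space N - {x \<in> space N. W x \<in> K}"
      using I(4) by (force simp: not_less[symmetric])
  qed
  then show ?thesis
    using I by blast
qed

lemma ocover_pair:
  assumes N1: "prob_space N1" and N2: "prob_space N2"
  shows "ocover N1 A p \<Longrightarrow> ocover (N1 \<Otimes>\<^sub>M N2) {z. fst z \<in> A} p"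
    and "ocover N2 A' p \<Longrightarrow> ocover (N1 \<Otimes>\<^sub>M N2) {z. snd z \<in> A'} p"
proof -
  interpret N1: prob_space N1 by fact
  interpret N2: prob_space N2 by fact
  {
    assume "ocover N1 A p"
    then obtain B where B: "B \<in> sets N1" "A \<inter> space N1 \<subseteq> B" "measure N1 B \<le> p"
      by (auto simp: ocover_def)
    have "measure (N1 \<Otimes>\<^sub>M N2) (B \<times> space N2) = measure N1 B"
      using B by (simp add: measure_def N2.emeasure_pair_measure_Times N2.emeasure_space_1)
    then show "ocover (N1 \<Otimes>\<^sub>M N2) {z. fst z \<in> A} p"
      using B by (intro ocoverI[of "B \<times> space N2"]) (auto simp: space_pair_measure)
  }
  {
    assume "ocover N2 A' p"
    then obtain B where B: "B \<in> sets N2" "A' \<inter> space N2 \<subseteq> B" "measure N2 B \<le> p"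
      by (auto simp: ocover_def)
    have "measure (N1 \<Otimes>\<^sub>M N2) (space N1 \<times> B) = measure N2 B"
      using B by (simp add: measure_def N2.emeasure_pair_measure_Times N1.emeasure_space_1)
    then show "ocover (N1 \<Otimes>\<^sub>M N2) {z. snd z \<in> A'} p"
      using B by (intro ocoverI[of "space N1 \<times> B"]) (auto simp: space_pair_measure)
  }
qed

lemma integrable_pair_components:
  fixes f :: "'a \<Rightarrow> real" and g :: "'b \<Rightarrow> real"
  assumes N1: "prob_space N1" and N2: "prob_space N2"
  shows "integrable N1 f \<Longrightarrow> integrable (N1 \<Otimes>\<^sub>M N2) (\<lambda>p. f (fst p))"
    and "integrable N2 g \<Longrightarrow> integrable (N1 \<Otimes>\<^sub>M N2) (\<lambda>p. g (snd p))"
proof -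
  interpret N1: prob_space N1 by fact
  interpret N2: prob_space N2 by fact
  interpret pair_prob_space N1 N2 ..
  show "integrable (N1 \<Otimes>\<^sub>M N2) (\<lambda>p. f (fst p))" if "integrable N1 f"
    using that measurable_compose[OF measurable_fst borel_measurable_integrable[OF that], of N2]
    by (intro Fubini_integrable) (auto simp: N2.prob_space)
  show "integrable (N1 \<Otimes>\<^sub>M N2) (\<lambda>p. g (snd p))" if "integrable N2 g"
    using that measurable_compose[OF measurable_snd borel_measurable_integrable[OF that], of N1]
    by (intro Fubini_integrable) auto
qed

text \<open>The half-lines \<open>{..a}\<close> and \<open>{b..}\<close> are both closed. The first
  gives one inequality between the distribution functions; the complement of the second gives the
  reverse one with \<open>b > a\<close>, and right continuity lets \<open>b\<close> decrease to
  \<open>a\<close>.\<close>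

lemma real_distribution_eqI_closed:
  assumes \<mu>: "real_distribution \<mu>" and \<nu>: "real_distribution \<nu>"
    and le: "\<And>A. closed A \<Longrightarrow> measure \<mu> A \<le> measure \<nu> A"
  shows "\<mu> = \<nu>"
proof (rule cdf_unique[OF \<mu> \<nu>])
  interpret \<mu>: real_distribution \<mu> by fact
  interpret \<nu>: real_distribution \<nu> by fact
  show "cdf \<mu> = cdf \<nu>"
  proof (rule ext, rule antisym)
    fix a
    show "cdf \<mu> a \<le> cdf \<nu> a"
      unfolding cdf_def by (rule le) simp
    have gt: "cdf \<nu> a \<le> cdf \<mu> b" if "a < b" for b
    proof -
      have "measure \<mu> {b..} \<le> measure \<nu> {b..}"
        by (rule le) simp
      moreover have "measure \<mu> {..<b} = 1 - measure \<mu> {b..}" "measure \<nu> {..<b} = 1 - measure \<nu> {b..}"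
        using \<mu>.prob_compl[of "{b..}"] \<nu>.prob_compl[of "{b..}"] by (auto simp: Compl_eq_Diff_UNIV[symmetric])
      ultimately have "measure \<nu> {..<b} \<le> measure \<mu> {..<b}"
        by simp
      moreover have "cdf \<nu> a \<le> measure \<nu> {..<b}"
        unfolding cdf_def using that by (intro \<nu>.finite_measure_mono) auto
      moreover have "measure \<mu> {..<b} \<le> cdf \<mu> b"
        unfolding cdf_def by (intro \<mu>.finite_measure_mono) auto
      ultimately show ?thesis by linarith
    qed
    have "((cdf \<mu>) \<longlongrightarrow> cdf \<mu> a) (at_right a)"
      using \<mu>.cdf_is_right_cont[of a] by (simp add: continuous_within)
    moreover have "\<forall>\<^sub>F b in at_right a. cdf \<nu> a \<le> cdf \<mu> b"
      using gt by (auto simp: eventually_at_filter)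
    ultimately show "cdf \<nu> a \<le> cdf \<mu> a"
      by (intro tendsto_lowerbound) auto
  qed
qed

text \<open>
  The sum of two Borel measurable random elements of a nonseparable space need not be Borel
  measurable; the portmanteau theorem is therefore applied to it as to a nonmeasurable map.
\<close>

lemma distr_functional_pair:
  fixes Z1 :: "'a \<Rightarrow> 't bfun" and Z2 :: "'b \<Rightarrow> 't bfun" and Z :: "'v \<Rightarrow> 't bfun"
  assumes N1: "prob_space N1" and N2: "prob_space N2" and N: "prob_space N"
    and t1: "tight_element (linf T) N1 Z1" and t2: "tight_element (linf T) N2 Z2" and t: "tight_element (linf T) N Z"
    and g1: "zero_mean_gaussian_process T N1 (\<lambda>t x. bapp (Z1 x) t)"
    and g2: "zero_mean_gaussian_process T N2 (\<lambda>t x. bapp (Z2 x) t)"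
    and g: "zero_mean_gaussian_process T N (\<lambda>t x. bapp (Z x) t)"
    and cov: "\<And>s t. s \<in> T \<Longrightarrow> t \<in> T \<Longrightarrow> (\<integral>x. bapp (Z x) s * bapp (Z x) t \<partial>N) =
      (\<integral>x. bapp (Z1 x) s * bapp (Z1 x) t \<partial>N1) + (\<integral>x. bapp (Z2 x) s * bapp (Z2 x) t \<partial>N2)"
    and h: "continuous_on V h"
    and V: "\<And>x y. x \<in> space N1 \<Longrightarrow> y \<in> space N2 \<Longrightarrow> Z1 x + Z2 y \<in> V" "\<And>x. x \<in> space N \<Longrightarrow> Z x \<in> V"
    and meas: "(\<lambda>p. h (Z1 (fst p) + Z2 (snd p))) \<in> borel_measurable (N1 \<Otimes>\<^sub>M N2)"
  shows "(\<lambda>x. h (Z x)) \<in> borel_measurable N"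
    and "distr (N1 \<Otimes>\<^sub>M N2) borel (\<lambda>p. h (Z1 (fst p) + Z2 (snd p))) = distr N borel (\<lambda>x. h (Z x) :: real)"
proof -
  interpret N1: prob_space N1 by fact
  interpret N2: prob_space N2 by fact
  interpret N: prob_space N by fact
  interpret PP: pair_prob_space N1 N2 ..
  let ?P = "N1 \<Otimes>\<^sub>M N2"
  have PP: "prob_space ?P"
    by (rule PP.P.prob_space_axioms)
  define Y where "Y = (\<lambda>p. Z1 (fst p) + Z2 (snd p))"
  have mZ: "Z \<in> borel_measurable N"
    using t by (simp add: tight_element_def)
  have "Z \<in> measurable N (restrict_space borel V)"
    using mZ V(2) by (intro measurable_restrict_space2) auto
  then show mh: "(\<lambda>x. h (Z x)) \<in> borel_measurable N"
    by (rule measurable_compose[OF _ borel_measurable_continuous_on_restrict[OF h]])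
  note mom1 = zero_mean_gaussian_process_moments[OF N1 g1]
  note mom2 = zero_mean_gaussian_process_moments[OF N2 g2]
  have mp1: "(\<lambda>p. bapp (Z1 (fst p)) t) \<in> borel_measurable ?P" if "t \<in> T" for t
    by (rule measurable_compose[OF measurable_fst mom1(1)[OF that]])
  have mp2: "(\<lambda>p. bapp (Z2 (snd p)) t) \<in> borel_measurable ?P" if "t \<in> T" for t
    by (rule measurable_compose[OF measurable_snd mom2(1)[OF that]])
  \<comment> \<open>By independence the exponents of the two Gaussian characteristic functions add,
    and \<open>cov\<close> identifies the sum with the exponent for \<open>Z\<close>.\<close>
  have char: "(\<integral>p. iexp (\<Sum>t\<in>I. c t * bapp (Y p) t) \<partial>?P) = (\<integral>x. iexp (\<Sum>t\<in>I. c t * bapp (Z x) t) \<partial>N)"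
    if I: "finite I" "I \<subseteq> T" for I c
  proof -
    let ?f1 = "\<lambda>x. iexp (\<Sum>t\<in>I. c t * bapp (Z1 x) t)" and ?f2 = "\<lambda>y. iexp (\<Sum>t\<in>I. c t * bapp (Z2 y) t)"
    have s1: "(\<lambda>x. \<Sum>t\<in>I. c t * bapp (Z1 x) t) \<in> borel_measurable N1"
      using mom1(1) I(2) by (intro borel_measurable_sum borel_measurable_times) auto
    have s2: "(\<lambda>x. \<Sum>t\<in>I. c t * bapp (Z2 x) t) \<in> borel_measurable N2"
      using mom2(1) I(2) by (intro borel_measurable_sum borel_measurable_times) auto
    have m1: "?f1 \<in> borel_measurable N1"
      by (rule measurable_compose[OF s1]) simp
    have m2: "?f2 \<in> borel_measurable N2"
      by (rule measurable_compose[OF s2]) simp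
    have i1: "integrable N1 ?f1"
      using m1 by (intro N1.integrable_const_bound[where B=1]) auto
    have i2: "integrable N2 ?f2"
      using m2 by (intro N2.integrable_const_bound[where B=1]) auto
    have "(\<integral>p. iexp (\<Sum>t\<in>I. c t * bapp (Y p) t) \<partial>?P) = (\<integral>p. ?f1 (fst p) * ?f2 (snd p) \<partial>?P)"
      by (intro Bochner_Integration.integral_cong refl)
         (simp add: Y_def distrib_left sum.distrib flip: exp_add)
    also have "\<dots> = (\<integral>x. \<integral>y. ?f1 x * ?f2 y \<partial>N2 \<partial>N1)"
    proof -
      have "integrable ?P (\<lambda>p. ?f1 (fst p) * ?f2 (snd p))"
        using m1 m2 by (intro PP.P.integrable_const_bound[where B=1]) (auto simp: norm_mult)
      from PP.integral_fst'[OF this] show ?thesis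
        unfolding fst_conv snd_conv by (rule sym)
    qed
    also have "\<dots> = (\<integral>x. ?f1 x \<partial>N1) * (\<integral>y. ?f2 y \<partial>N2)"
      using i1 i2 by simp
    also have "\<dots> = complex_of_real (exp (- (\<Sum>s\<in>I. \<Sum>t\<in>I. c s * c t * (\<integral>x. bapp (Z1 x) s * bapp (Z1 x) t \<partial>N1)) / 2)
        * exp (- (\<Sum>s\<in>I. \<Sum>t\<in>I. c s * c t * (\<integral>x. bapp (Z2 x) s * bapp (Z2 x) t \<partial>N2)) / 2))"
      unfolding zero_mean_gaussian_process_charfun[OF N1 g1 I] zero_mean_gaussian_process_charfun[OF N2 g2 I] by simp
    also have "\<dots> = complex_of_real (exp (- (\<Sum>s\<in>I. \<Sum>t\<in>I. c s * c t * (\<integral>x. bapp (Z x) s * bapp (Z x) t \<partial>N)) / 2))"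
    proof -
      have "(\<Sum>s\<in>I. \<Sum>t\<in>I. c s * c t * (\<integral>x. bapp (Z x) s * bapp (Z x) t \<partial>N)) =
        (\<Sum>s\<in>I. \<Sum>t\<in>I. c s * c t * ((\<integral>x. bapp (Z1 x) s * bapp (Z1 x) t \<partial>N1) + (\<integral>x. bapp (Z2 x) s * bapp (Z2 x) t \<partial>N2)))"
        using I(2) cov by (intro sum.cong refl) auto
      also have "\<dots> = (\<Sum>s\<in>I. \<Sum>t\<in>I. c s * c t * (\<integral>x. bapp (Z1 x) s * bapp (Z1 x) t \<partial>N1)) +
          (\<Sum>s\<in>I. \<Sum>t\<in>I. c s * c t * (\<integral>x. bapp (Z2 x) s * bapp (Z2 x) t \<partial>N2))"
        by (simp add: distrib_left sum.distrib)
      finally show ?thesis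
        by (simp add: mult_exp_exp add_divide_distrib)
    qed
    also have "\<dots> = (\<integral>x. iexp (\<Sum>t\<in>I. c t * bapp (Z x) t) \<partial>N)"
      by (rule zero_mean_gaussian_process_charfun[OF N g I, symmetric])
    finally show ?thesis .
  qed
  have port: "ocover ?P {p. Y p \<in> C} (measure N {x \<in> space N. Z x \<in> C} + \<eta>)" if C: "closed C" "0 < \<eta>" for C \<eta>
  proof -
    \<comment> \<open>The portmanteau theorem is used for the constant sequence \<open>Y\<close>:
      its finite-dimensional distributions equal those of \<open>Z\<close>, and its equicontinuity
      comes from tightness of both summands.\<close>
    have "\<forall>\<^sub>F m::nat in sequentially. ocover ?P {p. Y p \<in> C} (measure N {x \<in> space N. Z x \<in> C} + \<eta>)"
    proof (rule portmanteau_closed[OF PP N _ t _ _ _ _ C])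
      show "Y p \<in> linf T" if "p \<in> space ?P" for p
        using t1 t2 that unfolding Y_def
        by (intro subspace_add subspace_linf) (auto simp: tight_element_def space_pair_measure)
      show "l2_bounded T N (\<lambda>_ x. bapp (Z x))"
        using zero_mean_gaussian_process_moments[OF N g] by (auto simp: l2_bounded_def)
      show "l2_bounded T ?P (\<lambda>_ p. bapp (Y p))"
        unfolding l2_bounded_def
      proof (intro ballI conjI allI exI)
        fix t assume t: "t \<in> T"
        show "(\<lambda>p. bapp (Y p) t) \<in> borel_measurable ?P"
          using mp1[OF t] mp2[OF t] by (simp add: Y_def)
        have int1: "integrable ?P (\<lambda>p. (bapp (Z1 (fst p)) t)\<^sup>2)"
          by (rule integrable_pair_components(1)[OF N1 N2 mom1(2)[OF t]])
        have int2: "integrable ?P (\<lambda>p. (bapp (Z2 (snd p)) t)\<^sup>2)"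
          by (rule integrable_pair_components(2)[OF N1 N2 mom2(2)[OF t]])
        show "integrable ?P (\<lambda>p. (bapp (Y p) t)\<^sup>2)"
        proof (rule Bochner_Integration.integrable_bound)
          show "integrable ?P (\<lambda>p. 2 * (bapp (Z1 (fst p)) t)\<^sup>2 + 2 * (bapp (Z2 (snd p)) t)\<^sup>2)"
            using int1 int2 by simp
          show "(\<lambda>p. (bapp (Y p) t)\<^sup>2) \<in> borel_measurable ?P"
            using mp1[OF t] mp2[OF t] by (simp add: Y_def)
          have "(a + b)\<^sup>2 \<le> 2 * a\<^sup>2 + 2 * b\<^sup>2" for a b :: real
            using sum_squares_bound[of a b] by (simp add: power2_sum)
          then show "AE p in ?P. norm ((bapp (Y p) t)\<^sup>2) \<le> norm (2 * (bapp (Z1 (fst p)) t)\<^sup>2 + 2 * (bapp (Z2 (snd p)) t)\<^sup>2)"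
            by (simp add: Y_def)
        qed
      qed auto
      have mI: "(\<lambda>p. \<Sum>t\<in>I. c t * bapp (Y p) t) \<in> borel_measurable ?P" if "I \<subseteq> T" for I and c :: "'t \<Rightarrow> real"
        using mp1 mp2 that by (intro borel_measurable_sum borel_measurable_times) (auto simp: Y_def)
      have mI': "(\<lambda>x. \<Sum>t\<in>I. c t * bapp (Z x) t) \<in> borel_measurable N" if "I \<subseteq> T" for I and c :: "'t \<Rightarrow> real"
        using zero_mean_gaussian_process_moments(1)[OF N g] that by (intro borel_measurable_sum borel_measurable_times) auto
      show "fidi_conv T ?P (\<lambda>_ p. bapp (Y p)) N (\<lambda>x. bapp (Z x))"
        unfolding fidi_conv_def
      proof (intro allI impI)
        fix I c b assume "finite I \<and> I \<subseteq> T"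
        then have I: "finite I" "I \<subseteq> T"
          by auto
        have "(\<integral>p. cos ((\<Sum>t\<in>I. c t * bapp (Y p) t) + b) \<partial>?P) = (\<integral>x. cos ((\<Sum>t\<in>I. c t * bapp (Z x) t) + b) \<partial>N)"
          unfolding integral_cos_shift[OF PP mI[OF I(2)]] integral_cos_shift[OF N mI'[OF I(2)]] char[OF I] ..
        then show "(\<lambda>m::nat. \<integral>p. cos ((\<Sum>t\<in>I. c t * bapp (Y p) t) + b) \<partial>?P)
            \<longlonglongrightarrow> (\<integral>x. cos ((\<Sum>t\<in>I. c t * bapp (Z x) t) + b) \<partial>N)"
          by simp
      qed
      show "asymp_equicont T ?P (\<lambda>_ p. bapp (Y p))"
        unfolding asymp_equicont_def
      proof (intro allI impI)
        fix \<epsilon> \<eta> :: real assume "0 < \<epsilon>" "0 < \<eta>"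
        then have e: "0 < \<epsilon> / 4" "0 < \<eta> / 2"
          by auto
        obtain I1 \<rho>1 where 1: "finite I1" "\<rho>1 ` T \<subseteq> I1"
          "ocover N1 {x. \<exists>t\<in>T. \<bar>bapp (Z1 x) t - bapp (Z1 x) (\<rho>1 t)\<bar> > \<epsilon> / 4} (\<eta> / 2)"
          using tight_element_equicont[OF t1 N1 e] by blast
        obtain I2 \<rho>2 where 2: "finite I2" "\<rho>2 ` T \<subseteq> I2"
          "ocover N2 {x. \<exists>t\<in>T. \<bar>bapp (Z2 x) t - bapp (Z2 x) (\<rho>2 t)\<bar> > \<epsilon> / 4} (\<eta> / 2)"
          using tight_element_equicont[OF t2 N2 e] by blast
        obtain I \<pi> where I: "finite I" "I \<subseteq> T" "\<pi> ` T \<subseteq> I"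
            "\<forall>t\<in>T. \<rho>1 (\<pi> t) = \<rho>1 t \<and> \<rho>2 (\<pi> t) = \<rho>2 t"
          using common_retract[OF 1(1,2) 2(1,2)] by blast
        let ?A1 = "{p. fst p \<in> {x. \<exists>t\<in>T. \<bar>bapp (Z1 x) t - bapp (Z1 x) (\<rho>1 t)\<bar> > \<epsilon> / 4}}"
        let ?A2 = "{p. snd p \<in> {x. \<exists>t\<in>T. \<bar>bapp (Z2 x) t - bapp (Z2 x) (\<rho>2 t)\<bar> > \<epsilon> / 4}}"
        have "ocover ?P (?A1 \<union> ?A2) (\<eta> / 2 + \<eta> / 2)"
          by (rule ocover_Un[OF PP ocover_pair(1)[OF N1 N2 1(3)] ocover_pair(2)[OF N1 N2 2(3)]])
        then have "ocover ?P {p. \<exists>t\<in>T. \<bar>bapp (Y p) t - bapp (Y p) (\<pi> t)\<bar> > \<epsilon>} \<eta>"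
        proof (rule ocover_mono)
          show "{p. \<exists>t\<in>T. \<bar>bapp (Y p) t - bapp (Y p) (\<pi> t)\<bar> > \<epsilon>} \<inter> space ?P \<subseteq> ?A1 \<union> ?A2"
          proof (rule ccontr)
            assume "\<not> ?thesis"
            then obtain p t where p: "p \<notin> ?A1" "p \<notin> ?A2" and t: "t \<in> T" "\<bar>bapp (Y p) t - bapp (Y p) (\<pi> t)\<bar> > \<epsilon>"
              by blast
            have a1: "\<forall>t\<in>T. \<bar>bapp (Z1 (fst p)) t - bapp (Z1 (fst p)) (\<rho>1 t)\<bar> \<le> \<epsilon> / 4"
              and a2: "\<forall>t\<in>T. \<bar>bapp (Z2 (snd p)) t - bapp (Z2 (snd p)) (\<rho>2 t)\<bar> \<le> \<epsilon> / 4"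
              using p unfolding mem_Collect_eq by (meson not_less)+
            have \<pi>: "\<pi> t \<in> T" "\<rho>1 (\<pi> t) = \<rho>1 t" "\<rho>2 (\<pi> t) = \<rho>2 t"
              using I(2,3,4) t(1) by auto
            have "\<bar>bapp (Z1 (fst p)) t - bapp (Z1 (fst p)) (\<pi> t)\<bar> \<le> 2 * (\<epsilon> / 4)"
              by (rule abs_diff_retract_le[where z="bapp (Z1 (fst p))" and \<rho>="\<rho>1", OF a1 t(1)]) (use \<pi> in auto)
            moreover have "\<bar>bapp (Z2 (snd p)) t - bapp (Z2 (snd p)) (\<pi> t)\<bar> \<le> 2 * (\<epsilon> / 4)"
              by (rule abs_diff_retract_le[where z="bapp (Z2 (snd p))" and \<rho>="\<rho>2", OF a2 t(1)]) (use \<pi> in auto)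
            ultimately show False
              using t(2) unfolding Y_def plus_bcontfun.rep_eq by linarith
          qed
        qed simp
        then show "\<exists>I \<pi>. finite I \<and> I \<subseteq> T \<and> \<pi> ` T \<subseteq> I \<and>
            (\<forall>\<^sub>F m::nat in sequentially. ocover ?P {p. \<exists>t\<in>T. \<bar>bapp (Y p) t - bapp (Y p) (\<pi> t)\<bar> > \<epsilon>} \<eta>)"
          using I(1,2,3) by (intro exI[of _ I] exI[of _ \<pi>]) simp
      qed
    qed
    then show ?thesis
      by simp
  qed
  have mY: "(\<lambda>p. h (Y p)) \<in> borel_measurable ?P"
    using meas by (simp add: Y_def)
  have "distr ?P borel (\<lambda>p. h (Y p)) = distr N borel (\<lambda>x. h (Z x))"
  proof (rule real_distribution_eqI_closed)
    show "real_distribution (distr ?P borel (\<lambda>p. h (Y p)))"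
      by (rule prob_space.real_distribution_distr[OF PP mY])
    show "real_distribution (distr N borel (\<lambda>x. h (Z x)))"
      by (rule N.real_distribution_distr[OF mh])
    fix A :: "real set" assume A: "closed A"
    \<comment> \<open>As \<open>h\<close> is continuous on \<open>V\<close> only, the preimage of
      \<open>A\<close> is cut out of \<open>V\<close> by a closed set of the whole space;
      \<open>Y\<close> and \<open>Z\<close> take values in \<open>V\<close>, so nothing is
      lost.\<close>
    obtain C where C: "closed C" "C \<inter> V = h -` A \<inter> V"
      using h A unfolding continuous_on_closed_invariant by blast
    have "measure ?P ((\<lambda>p. h (Y p)) -` A \<inter> space ?P) \<le> measure N ((\<lambda>x. h (Z x)) -` A \<inter> space N) + \<eta>" if "0 < \<eta>" for \<eta>
    proof (rule ocover_measurable[OF PP])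
      show "(\<lambda>p. h (Y p)) -` A \<inter> space ?P \<in> sets ?P"
        by (rule measurable_sets[OF mY]) (use A in auto)
      have "(\<lambda>x. h (Z x)) -` A \<inter> space N = {x \<in> space N. Z x \<in> C}"
        using C(2) V(2) by blast
      moreover have "((\<lambda>p. h (Y p)) -` A \<inter> space ?P) \<inter> space ?P \<subseteq> {p. Y p \<in> C}"
        using C(2) V(1) unfolding Y_def space_pair_measure by auto
      ultimately show "ocover ?P ((\<lambda>p. h (Y p)) -` A \<inter> space ?P) (measure N ((\<lambda>x. h (Z x)) -` A \<inter> space N) + \<eta>)"
        by (intro ocover_mono[OF port[OF C(1) that]]) auto
    qed
    then have "measure ?P ((\<lambda>p. h (Y p)) -` A \<inter> space ?P) \<le> measure N ((\<lambda>x. h (Z x)) -` A \<inter> space N)"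
      by (rule field_le_epsilon)
    then show "measure (distr ?P borel (\<lambda>p. h (Y p))) A \<le> measure (distr N borel (\<lambda>x. h (Z x))) A"
      using A by (simp add: measure_distr[OF mY] measure_distr[OF mh])
  qed
  then show "distr ?P borel (\<lambda>p. h (Z1 (fst p) + Z2 (snd p))) = distr N borel (\<lambda>x. h (Z x))"
    by (simp add: Y_def)
qed

text \<open>Cauchy's functional equation with a one-sided bound in place of continuity. The
  logarithm of \<open>H\<close>, corrected by a linear term, is an additive function
  \<open>G\<close> with \<open>G 1 = 0\<close> that is bounded above on the unit interval.\<close>

lemma multiplicative_exp:
  fixes H :: "real \<Rightarrow> real"
  assumes mult: "\<And>a b. 0 \<le> a \<Longrightarrow> 0 \<le> b \<Longrightarrow> H (a + b) = H a * H b"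
    and pos: "\<And>a. 0 \<le> a \<Longrightarrow> 0 < H a" and le1: "\<And>a. 0 \<le> a \<Longrightarrow> H a \<le> 1" and "0 \<le> a"
  shows "H a = exp (ln (H 1) * a)"
proof -
  define G where "G = (\<lambda>a. ln (H a) - ln (H 1) * a)"
  have add: "G (a + b) = G a + G b" if "0 \<le> a" "0 \<le> b" for a b
    using that pos[of a] pos[of b] by (simp add: G_def mult ln_mult algebra_simps)
  have G1: "G 1 = 0"
    by (simp add: G_def)
  have nG: "G (real n * a) = real n * G a" if "0 \<le> a" for n a
  proof (induction n)
    case 0
    show ?case using add[of 0 0] by simp
  next
    case (Suc n)
    have "G (real (Suc n) * a) = G (real n * a + a)"
      by (simp add: algebra_simps)
    also have "\<dots> = real (Suc n) * G a"
      using that Suc by (simp add: add algebra_simps)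
    finally show ?case .
  qed
  have up: "G a \<le> - ln (H 1)" if "0 \<le> a" "a \<le> 1" for a
  proof -
    have "ln (H a) \<le> 0"
      using pos[OF that(1)] le1[OF that(1)] by simp
    moreover have "(- ln (H 1)) * a \<le> (- ln (H 1)) * 1"
      using that le1[of 1] pos[of 1] by (intro mult_left_mono) auto
    ultimately show ?thesis
      by (simp add: G_def)
  qed
  \<comment> \<open>A positive value would grow without bound along multiples of \<open>a\<close>,
    but \<open>G\<close> at such a multiple equals \<open>G\<close> at its fractional part, where it
    is bounded above.\<close>
  have le0: "G a \<le> 0" if a: "0 \<le> a" for a
  proof (rule ccontr)
    assume "\<not> G a \<le> 0"
    then obtain n :: nat where n: "- ln (H 1) < real n * G a"
      using reals_Archimedean3[of "G a"] by auto
    let ?f = "real n * a - real (nat \<lfloor>real n * a\<rfloor>)"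
    have f: "0 \<le> ?f" "?f \<le> 1"
      using a by (auto simp: of_nat_nat) linarith+
    have "real n * G a = G (real n * a)"
      using nG[OF a] by simp
    also have "\<dots> = G (real (nat \<lfloor>real n * a\<rfloor>) * 1 + ?f)"
      by simp
    also have "\<dots> = G (real (nat \<lfloor>real n * a\<rfloor>) * 1) + G ?f"
      using f by (intro add) auto
    also have "\<dots> = G ?f"
      using nG[of 1] G1 by simp
    also have "\<dots> \<le> - ln (H 1)"
      using f by (rule up)
    finally show False
      using n by simp
  qed
  \<comment> \<open>Complementing \<open>a\<close> to an integer gives two nonpositive numbers with
    sum 0.\<close>
  have "G a = 0"
  proof -
    obtain n :: nat where n: "a \<le> real n"
      using real_arch_simple by blast
    have "G a + G (real n - a) = G (real n * 1)"
      using add[of a "real n - a"] n \<open>0 \<le> a\<close> by simp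
    also have "\<dots> = 0"
      using nG[of 1 n] G1 by simp
    finally show ?thesis
      using le0[OF \<open>0 \<le> a\<close>] le0[of "real n - a"] n by simp
  qed
  then show ?thesis
    using pos[OF \<open>0 \<le> a\<close>] by (simp add: G_def) (metis exp_ln)
qed

lemma gaussian_rv_charfun:
  assumes N: "prob_space N" and Y: "Y \<in> borel_measurable N" and \<kappa>: "0 \<le> \<kappa>"
    and char: "\<And>t. (\<integral>x. iexp (t * Y x) \<partial>N) = complex_of_real (exp (- \<kappa> * t\<^sup>2))"
  shows "gaussian_rv N Y" "(\<integral>x. Y x \<partial>N) = 0"
proof -
  interpret prob_space N by fact
  have chard: "char (distr N borel Y) t = complex_of_real (exp (- \<kappa> * t\<^sup>2))" for t
    unfolding char_def using char[of t] Y by (subst integral_distr) auto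
  have "gaussian_rv N Y \<and> (\<integral>x. Y x \<partial>N) = 0"
  proof (cases "\<kappa> = 0")
    case True
    have "char (return borel (0::real)) t = 1" for t
      unfolding char_def by (subst integral_return) auto
    then have "char (distr N borel Y) = char (return borel 0)"
      using chard True by auto
    moreover have "real_distribution (return borel (0::real))"
      by (simp add: real_distribution_def real_distribution_axioms_def prob_space_return)
    ultimately have d: "distr N borel Y = return borel 0"
      using Y by (intro Levy_uniqueness) auto
    have "AE y in return borel (0::real). y = 0"
      by (subst AE_return) auto
    then have "AE y in distr N borel Y. y = 0"
      by (simp only: d)
    then have ae: "AE x in N. Y x = 0"
      by (rule AE_distrD[OF Y])
    then have "(\<integral>x. Y x \<partial>N) = (\<integral>x. 0 \<partial>N)"
      using Y by (intro integral_cong_AE) auto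
    then show ?thesis
      using ae Y by (auto simp: gaussian_rv_def)
  next
    case False
    define \<sigma> where "\<sigma> = sqrt (2 * \<kappa>)"
    have \<sigma>: "0 < \<sigma>" "\<sigma>\<^sup>2 = 2 * \<kappa>"
      using False \<kappa> by (auto simp: \<sigma>_def)
    have mV: "(\<lambda>x. Y x / \<sigma>) \<in> borel_measurable N"
      using Y by simp
    have "char (distr N borel (\<lambda>x. Y x / \<sigma>)) t = char std_normal_distribution t" for t
    proof -
      have "char (distr N borel (\<lambda>x. Y x / \<sigma>)) t = (\<integral>x. iexp (t / \<sigma> * Y x) \<partial>N)"
        unfolding char_def using mV by (subst integral_distr) auto
      also have "\<dots> = complex_of_real (exp (- \<kappa> * (t / \<sigma>)\<^sup>2))"
        by (rule char)
      also have "- \<kappa> * (t / \<sigma>)\<^sup>2 = - (t\<^sup>2) / 2"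
        using False by (simp add: power_divide \<sigma>)
      finally show ?thesis
        by (simp add: char_std_normal_distribution)
    qed
    then have "distr N borel (\<lambda>x. Y x / \<sigma>) = std_normal_distribution"
      using mV by (intro Levy_uniqueness) (auto simp: real_dist_normal_dist)
    moreover have "distr N lborel (\<lambda>x. Y x / \<sigma>) = distr N borel (\<lambda>x. Y x / \<sigma>)"
      by (intro distr_cong) auto
    ultimately have "distributed N lborel (\<lambda>x. Y x / \<sigma>) std_normal_density"
      using mV by (simp add: distributed_def)
    then have D: "distributed N lborel Y (normal_density 0 \<sigma>)"
      using normal_standard_normal_convert[OF \<sigma>(1), of Y 0] by simp
    then show ?thesis
      using normal_distributed_expectation[OF \<sigma>(1) D] \<sigma>(1) Y by (auto simp: gaussian_rv_def)
  qed
  then show "gaussian_rv N Y" "(\<integral>x. Y x \<partial>N) = 0"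
    by auto
qed

lemma continuous_on_scaleR_bfun: "continuous_on UNIV (\<lambda>z::'t bfun. a *\<^sub>R z)"
  by (intro continuous_intros)

text \<open>
  If \<open>Z'\<close> is an independent copy of \<open>Z\<close> and \<open>a\<^sup>2 + b\<^sup>2 = 1\<close>, then \<open>a Z + b Z'\<close> has the law of \<open>Z\<close>. So the
  characteristic function \<open>\<psi>\<close> of a linear functional satisfies \<open>\<psi> t = \<psi> (a t) \<psi> (b t)\<close>, which makes it Gaussian.
\<close>

lemma gaussian_rv_linear_functional:
  fixes Z :: "'v \<Rightarrow> 't bfun" and h :: "'t bfun \<Rightarrow> real"
  assumes N: "prob_space N" and t: "tight_element (linf T) N Z"
    and g: "zero_mean_gaussian_process T N (\<lambda>t x. bapp (Z x) t)"
    and V: "subspace V" "\<And>x. x \<in> space N \<Longrightarrow> Z x \<in> V" and h: "continuous_on V h"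
    and lin: "\<And>a b y z. y \<in> V \<Longrightarrow> z \<in> V \<Longrightarrow> h (a *\<^sub>R y + b *\<^sub>R z) = a * h y + b * h z"
  shows "gaussian_rv N (\<lambda>x. h (Z x))" "(\<integral>x. h (Z x) \<partial>N) = 0"
proof -
  interpret prob_space N by fact
  interpret PP: pair_prob_space N N ..
  have mZ: "Z \<in> borel_measurable N"
    using t by (simp add: tight_element_def)
  have "Z \<in> measurable N (restrict_space borel V)"
    using mZ V(2) by (intro measurable_restrict_space2) auto
  then have mh: "(\<lambda>x. h (Z x)) \<in> borel_measurable N"
    by (rule measurable_compose[OF _ borel_measurable_continuous_on_restrict[OF h]])
  define \<psi> where "\<psi> = (\<lambda>t. \<integral>x. iexp (t * h (Z x)) \<partial>N)"
  have \<psi>_char: "\<psi> = char (distr N borel (\<lambda>x. h (Z x)))"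
    unfolding \<psi>_def char_def using mh by (intro ext) (subst integral_distr, auto)
  interpret D: real_distribution "distr N borel (\<lambda>x. h (Z x))"
    using mh by simp
  have rot: "\<psi> s = \<psi> (a * s) * \<psi> (b * s)" if ab: "a\<^sup>2 + b\<^sup>2 = 1" for a b s
  proof -
    have t': "tight_element (linf T) N (\<lambda>x. a *\<^sub>R Z x)" for a
      by (rule tight_element_image[OF t continuous_on_scaleR_bfun _ N]) (auto intro: subspace_scale subspace_linf)
    have g': "zero_mean_gaussian_process T N (\<lambda>t x. bapp (a *\<^sub>R Z x) t)" for a
      using zero_mean_gaussian_process_scale[OF N g, of "\<lambda>_. a"] by simp
    have lin': "h (a *\<^sub>R Z (fst p) + b *\<^sub>R Z (snd p)) = a * h (Z (fst p)) + b * h (Z (snd p))" if "p \<in> space (N \<Otimes>\<^sub>M N)" for p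
      using that V(2) by (intro lin) (auto simp: space_pair_measure)
    have m1: "(\<lambda>p. h (Z (fst p))) \<in> borel_measurable (N \<Otimes>\<^sub>M N)" and m2: "(\<lambda>p. h (Z (snd p))) \<in> borel_measurable (N \<Otimes>\<^sub>M N)"
      by (rule measurable_compose[OF measurable_fst mh], rule measurable_compose[OF measurable_snd mh])
    have meas: "(\<lambda>p. h (a *\<^sub>R Z (fst p) + b *\<^sub>R Z (snd p))) \<in> borel_measurable (N \<Otimes>\<^sub>M N)"
      using m1 m2 by (subst measurable_cong[OF lin']) auto
    have "distr (N \<Otimes>\<^sub>M N) borel (\<lambda>p. h (a *\<^sub>R Z (fst p) + b *\<^sub>R Z (snd p))) = distr N borel (\<lambda>x. h (Z x))"
    proof (rule distr_functional_pair(2)[OF N N N t' t' t g' g' g _ h _ _ meas])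
      fix s t :: 't
      have "(\<integral>x. bapp (a *\<^sub>R Z x) s * bapp (a *\<^sub>R Z x) t \<partial>N) = a\<^sup>2 * (\<integral>x. bapp (Z x) s * bapp (Z x) t \<partial>N)" for a
      proof -
        have "(\<lambda>x. bapp (a *\<^sub>R Z x) s * bapp (a *\<^sub>R Z x) t) = (\<lambda>x. a\<^sup>2 * (bapp (Z x) s * bapp (Z x) t))"
          by (auto simp: power2_eq_square)
        then show ?thesis by simp
      qed
      then show "(\<integral>x. bapp (Z x) s * bapp (Z x) t \<partial>N) =
          (\<integral>x. bapp (a *\<^sub>R Z x) s * bapp (a *\<^sub>R Z x) t \<partial>N) + (\<integral>x. bapp (b *\<^sub>R Z x) s * bapp (b *\<^sub>R Z x) t \<partial>N)"
        using ab by (simp flip: distrib_right)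
    qed (use V in \<open>auto intro: subspace_add subspace_scale\<close>)
    then have "\<psi> s = char (distr (N \<Otimes>\<^sub>M N) borel (\<lambda>p. h (a *\<^sub>R Z (fst p) + b *\<^sub>R Z (snd p)))) s"
      by (simp add: \<psi>_char)
    also have "\<dots> = (\<integral>p. iexp (s * h (a *\<^sub>R Z (fst p) + b *\<^sub>R Z (snd p))) \<partial>(N \<Otimes>\<^sub>M N))"
      unfolding char_def using meas by (subst integral_distr) auto
    also have "\<dots> = (\<integral>p. iexp (a * s * h (Z (fst p))) * iexp (b * s * h (Z (snd p))) \<partial>(N \<Otimes>\<^sub>M N))"
      by (intro Bochner_Integration.integral_cong refl) (simp add: lin' algebra_simps flip: exp_add)
    also have "\<dots> = (\<integral>x. \<integral>y. iexp (a * s * h (Z x)) * iexp (b * s * h (Z y)) \<partial>N \<partial>N)"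
    proof -
      have "integrable (N \<Otimes>\<^sub>M N) (\<lambda>p. iexp (a * s * h (Z (fst p))) * iexp (b * s * h (Z (snd p))))"
        using m1 m2 by (intro PP.P.integrable_const_bound[where B=1]) (auto simp: norm_mult)
      from PP.integral_fst'[OF this] show ?thesis
        unfolding fst_conv snd_conv by (rule sym)
    qed
    also have "\<dots> = \<psi> (a * s) * \<psi> (b * s)"
      by (simp add: \<psi>_def)
    finally show ?thesis .
  qed
  have \<psi>0: "\<psi> 0 = 1"
    unfolding \<psi>_char by (rule D.char_zero)
  \<comment> \<open>The rotation with coefficients -1 and 0 gives symmetry of the law, hence a real
    characteristic function.\<close>
  have even: "\<psi> (- s) = \<psi> s" for s
    using rot[of "-1" 0 s] \<psi>0 by simp
  have real: "\<psi> s = complex_of_real (Re (\<psi> s))" for s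
  proof -
    have "\<psi> (- s) = (\<integral>x. cnj (iexp (s * h (Z x))) \<partial>N)"
      unfolding \<psi>_def by (intro Bochner_Integration.integral_cong refl) (simp add: exp_cnj)
    also have "\<dots> = cnj (\<psi> s)"
      unfolding \<psi>_def by simp
    finally have "cnj (\<psi> s) = \<psi> s"
      using even by simp
    then show ?thesis
      by (metis Reals_cnj_iff complex_is_Real_iff of_real_Re)
  qed
  \<comment> \<open>In the variable \<open>t\<^sup>2\<close> the functional equation becomes
    multiplicativity, since the coefficients \<open>a\<close> and \<open>b\<close> satisfy
    \<open>a\<^sup>2 + b\<^sup>2 = 1\<close>.\<close>
  define H where "H = (\<lambda>a. Re (\<psi> (sqrt a)))"
  have Hmult: "H (a + b) = H a * H b" if "0 \<le> a" "0 \<le> b" for a b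
  proof (cases "a + b = 0")
    case True
    then have "a = 0" "b = 0"
      using that by auto
    then show ?thesis
      using \<psi>0 by (simp add: H_def)
  next
    case False
    then have pos: "0 < a + b"
      using that by auto
    let ?s = "sqrt (a + b)"
    have s: "0 < ?s"
      using pos by simp
    have "(sqrt a / ?s)\<^sup>2 + (sqrt b / ?s)\<^sup>2 = (a + b) / (a + b)"
      using that pos by (simp add: power_divide add_divide_distrib[symmetric])
    then have "\<psi> ?s = \<psi> (sqrt a / ?s * ?s) * \<psi> (sqrt b / ?s * ?s)"
      using pos by (intro rot) simp
    then have "\<psi> ?s = \<psi> (sqrt a) * \<psi> (sqrt b)"
      using s by simp
    also have "\<dots> = complex_of_real (Re (\<psi> (sqrt a)) * Re (\<psi> (sqrt b)))"
      using real[of "sqrt a"] real[of "sqrt b"] by simp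
    finally show ?thesis
      unfolding H_def by simp
  qed
  have Hnn: "0 \<le> H a" if "0 \<le> a" for a
    using Hmult[of "a / 2" "a / 2"] that by simp
  have "0 < H a" if a: "0 \<le> a" for a
  proof (rule ccontr)
    assume "\<not> 0 < H a"
    then have Ha: "H a = 0"
      using Hnn[OF a] by simp
    \<comment> \<open>A zero would propagate by halving to arguments tending to 0, contradicting
      continuity of the characteristic function at 0.\<close>
    have z: "H (a / 2 ^ n) = 0" for n
    proof (induction n)
      case (Suc n)
      have "H (a / 2 ^ n) = H (a / 2 ^ Suc n) * H (a / 2 ^ Suc n)"
        using Hmult[of "a / 2 ^ Suc n" "a / 2 ^ Suc n"] a by simp
      then show ?case using Suc by simp
    qed (use Ha in simp)
    have "(\<lambda>n. a * (1 / 2) ^ n) \<longlonglongrightarrow> a * 0"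
      by (intro tendsto_intros LIMSEQ_realpow_zero) auto
    then have "(\<lambda>n. sqrt (a / 2 ^ n)) \<longlonglongrightarrow> sqrt 0"
      by (intro tendsto_real_sqrt) (simp add: power_divide)
    then have "(\<lambda>n. \<psi> (sqrt (a / 2 ^ n))) \<longlonglongrightarrow> \<psi> 0"
      unfolding \<psi>_char using D.isCont_char[of 0] by (auto intro: isCont_tendsto_compose)
    then have "(\<lambda>n. H (a / 2 ^ n)) \<longlonglongrightarrow> 1"
      unfolding H_def using \<psi>0 by (auto dest: tendsto_Re)
    then show False
      unfolding z by (simp add: LIMSEQ_const_iff)
  qed
  moreover have "H a \<le> 1" for a
  proof -
    have "cmod (\<psi> (sqrt a)) \<le> 1"
      unfolding \<psi>_char by (rule D.cmod_char_le_1)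
    then show ?thesis
      unfolding H_def using complex_Re_le_cmod order_trans by blast
  qed
  ultimately have Hexp: "H a = exp (ln (H 1) * a)" "ln (H 1) \<le> 0" if "0 \<le> a" for a
    using multiplicative_exp[of H a] Hmult that by auto
  have \<psi>exp: "\<psi> s = complex_of_real (exp (- (- ln (H 1)) * s\<^sup>2))" for s
  proof -
    have "\<psi> s = \<psi> \<bar>s\<bar>"
      using even[of s] by (cases "0 \<le> s") auto
    also have "\<bar>s\<bar> = sqrt (s\<^sup>2)"
      by simp
    also have "\<psi> (sqrt (s\<^sup>2)) = complex_of_real (H (s\<^sup>2))"
      unfolding H_def by (rule real)
    finally show ?thesis
      using Hexp(1)[of "s\<^sup>2"] by simp
  qed
  show "gaussian_rv N (\<lambda>x. h (Z x))" "(\<integral>x. h (Z x) \<partial>N) = 0"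
    using gaussian_rv_charfun[OF N mh, of "- ln (H 1)"] Hexp(2)[of 0] \<psi>exp unfolding \<psi>_def by auto
qed

section \<open>Sections of the limit process and their images under the derivative\<close>

lemma bfun_eqI: "(\<And>t. bapp y t = bapp z t) \<Longrightarrow> y = z"
  by (metis bcontfun_eqI of_discrete_inverse)

lemma bounded_bapp: "bounded ((\<lambda>f. bapp z (p f)) ` A)"
  by (rule boundedI[of _ "norm z"]) (auto intro: order_trans[OF _ abs_bapp_le_norm])

lemma bapp_slice: "bapp (slice F z s) f = (if f \<in> F then bapp z (s, f) else 0)"
  unfolding slice_def by (rule bapp_to_linf[OF bounded_bapp])

lemma slice_in_linf: "slice F z s \<in> linf F"
  unfolding slice_def by (rule to_linf_in_linf[OF bounded_bapp])

lemma slice_lincomb: "slice F (a *\<^sub>R y + b *\<^sub>R z) s = a *\<^sub>R slice F y s + b *\<^sub>R slice F z s"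
  by (rule bfun_eqI) (simp add: bapp_slice)

lemma slice_add: "slice F (y + z) s = slice F y s + slice F z s"
  by (rule bfun_eqI) (simp add: bapp_slice)

lemma slice_diff: "slice F (y - z) s = slice F y s - slice F z s"
  by (rule bfun_eqI) (simp add: bapp_slice)

lemma norm_slice_le: "norm (slice F z s) \<le> norm z"
  by (rule norm_linf_le[OF slice_in_linf]) (auto simp: bapp_slice abs_bapp_le_norm)

lemma continuous_on_nonexpansive:
  fixes \<Phi> :: "'a::real_normed_vector \<Rightarrow> 'b::real_normed_vector"
  assumes "\<And>x y. norm (\<Phi> x - \<Phi> y) \<le> norm (x - y)"
  shows "continuous_on A \<Phi>"
proof (rule continuous_onI)
  fix x e assume "0 < (e::real)"
  then show "\<exists>d>0. \<forall>y\<in>A. dist y x < d \<longrightarrow> dist (\<Phi> y) (\<Phi> x) \<le> e"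
    using order_trans[OF assms less_imp_le] by (intro exI[of _ e]) (auto simp: dist_norm)
qed

lemma continuous_on_slice: "continuous_on A (\<lambda>z. slice F z s)"
  by (rule continuous_on_nonexpansive) (simp add: slice_diff[symmetric] norm_slice_le)

lemma gaussian_rv_cong:
  assumes "gaussian_rv N X" "\<And>x. x \<in> space N \<Longrightarrow> X x = Y x"
  shows "gaussian_rv N Y"
proof -
  have m: "Y \<in> borel_measurable N"
    using assms measurable_cong[of N X Y borel] by (simp add: gaussian_rv_def)
  have d: "distr N lborel Y = distr N lborel X"
    by (rule distr_cong) (use assms(2) in auto)
  obtain \<mu> where "(AE x in N. X x = \<mu>) \<or> (\<exists>\<sigma>>0. distributed N lborel X (normal_density \<mu> \<sigma>))"
    using assms(1) by (auto simp: gaussian_rv_def)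
  then have "(AE x in N. Y x = \<mu>) \<or> (\<exists>\<sigma>>0. distributed N lborel Y (normal_density \<mu> \<sigma>))"
  proof
    assume "AE x in N. X x = \<mu>"
    then have "AE x in N. Y x = \<mu>"
      by (rule AE_mp[OF _ AE_I2]) (use assms(2) in auto)
    then show ?thesis ..
  next
    assume "\<exists>\<sigma>>0. distributed N lborel X (normal_density \<mu> \<sigma>)"
    then show ?thesis
      using m d by (auto simp: distributed_def)
  qed
  then show ?thesis
    using m by (auto simp: gaussian_rv_def)
qed

lemma continuous_linear_functional:
  assumes L: "linear L" "continuous_on (span D0) L" and V: "\<And>z. z \<in> V \<Longrightarrow> slice F z s \<in> span D0"
  shows "continuous_on V (\<lambda>z. bapp (L (slice F z s)) e)"
proof -
  have "continuous_on V (\<lambda>z. L (slice F z s))"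
    by (rule continuous_on_compose2[OF L(2) continuous_on_slice]) (use V in auto)
  then show ?thesis
    by (rule continuous_on_compose2[OF continuous_on_bapp[of UNIV]]) auto
qed

text \<open>A finite linear combination of image coordinates is one linear functional of the whole
  path, obtained through the linear extension \<open>L\<close> of the derivative. It is continuous
  on the subspace of paths all of whose sections lie in the span of \<open>D0\<close>.\<close>

lemma kiefer_mueller_image_gaussian:
  fixes \<phi>' :: "('x \<Rightarrow> real) bfun \<Rightarrow> 'e bfun"
  assumes Z: "kiefer_mueller P F N Z" and \<phi>': "continuous_linear_on D0 \<phi>'"
    and D0: "\<And>x s. x \<in> space N \<Longrightarrow> s \<in> {0<..1} \<Longrightarrow> slice F (Z x) s \<in> D0"
  shows "zero_mean_gaussian_process ({0<..1} \<times> E) N (\<lambda>(s, e) x. bapp (\<phi>' (slice F (Z x) s)) e)"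
proof -
  let ?T = "{0<..1::real} \<times> F"
  have N: "prob_space N" and t: "tight_element (linf ?T) N Z"
    and g: "zero_mean_gaussian_process ?T N (\<lambda>t x. bapp (Z x) t)"
    using Z by (auto simp: kiefer_mueller_def)
  obtain L where L: "linear L" "continuous_on (span D0) L" "\<And>h. h \<in> D0 \<Longrightarrow> L h = \<phi>' h"
    using \<phi>' by (auto simp: continuous_linear_on_def)
  \<comment> \<open>The span makes this a subspace even if \<open>D0\<close> is not one.\<close>
  define V where "V = {z. \<forall>s\<in>{0<..1}. slice F z s \<in> span D0}"
  have V: "subspace V"
    unfolding subspace_def
  proof (intro conjI ballI allI)
    have "slice F 0 s = 0" for s
      by (rule bfun_eqI) (simp add: bapp_slice)
    then show "0 \<in> V"
      by (auto simp: V_def span_zero)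
    show "y + z \<in> V" if "y \<in> V" "z \<in> V" for y z
      using that by (auto simp: V_def slice_add span_add)
    show "a *\<^sub>R z \<in> V" if "z \<in> V" for a z
      using that slice_lincomb[of F a z 0 z] by (auto simp: V_def span_scale)
  qed
  have ZV: "Z x \<in> V" if "x \<in> space N" for x
    using D0[OF that] by (auto simp: V_def span_base)
  have main: "gaussian_rv N (\<lambda>x. \<Sum>t\<in>I. c t * bapp (\<phi>' (slice F (Z x) (fst t))) (snd t)) \<and>
      (\<integral>x. (\<Sum>t\<in>I. c t * bapp (\<phi>' (slice F (Z x) (fst t))) (snd t)) \<partial>N) = 0"
    if I: "finite I" "I \<subseteq> {0<..1} \<times> E" for I c
  proof -
    define h where "h = (\<lambda>z. \<Sum>t\<in>I. c t * bapp (L (slice F z (fst t))) (snd t))"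
    have fst: "fst t \<in> {0<..1}" if "t \<in> I" for t
      using I that by auto
    have ch: "continuous_on V h"
      unfolding h_def using fst
      by (intro continuous_intros continuous_linear_functional[OF L(1,2)]) (auto simp: V_def)
    have lin: "h (a *\<^sub>R y + b *\<^sub>R z) = a * h y + b * h z" for a b y z
      by (simp add: h_def slice_lincomb linear_add[OF L(1)] linear_scale[OF L(1)] sum.distrib sum_distrib_left algebra_simps)
    note G = gaussian_rv_linear_functional[OF N t g V ZV ch lin]
    have eq: "h (Z x) = (\<Sum>t\<in>I. c t * bapp (\<phi>' (slice F (Z x) (fst t))) (snd t))" if "x \<in> space N" for x
      unfolding h_def using L(3)[OF D0[OF that fst]] by (intro sum.cong) auto
    have "(\<integral>x. (\<Sum>t\<in>I. c t * bapp (\<phi>' (slice F (Z x) (fst t))) (snd t)) \<partial>N) = (\<integral>x. h (Z x) \<partial>N)"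
      using eq by (intro Bochner_Integration.integral_cong) auto
    then show ?thesis
      using gaussian_rv_cong[OF G(1) eq] G(2) by simp
  qed
  show ?thesis
    unfolding zero_mean_gaussian_process_def gaussian_process_def
  proof (intro conjI ballI allI impI)
    fix I c assume "finite I \<and> I \<subseteq> {0<..1::real} \<times> E"
    then show "gaussian_rv N (\<lambda>x. \<Sum>t\<in>I. c t * (case t of (s, e) \<Rightarrow> \<lambda>x. bapp (\<phi>' (slice F (Z x) s)) e) x)"
      using main[of I c] by (simp add: case_prod_unfold)
  next
    fix t assume "t \<in> {0<..1::real} \<times> E"
    then show "(\<integral>x. (case t of (s, e) \<Rightarrow> \<lambda>x. bapp (\<phi>' (slice F (Z x) s)) e) x \<partial>N) = 0"
      using main[of "{t}" "\<lambda>_. 1"] by (simp add: case_prod_unfold)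
  qed
qed

text \<open>
  For \<open>s1 \<le> s2\<close> the pair \<open>(Z s1, Z s2)\<close> has the law of \<open>(sqrt s1 W, sqrt s1 W + sqrt (s2 - s1) W')\<close> with
  independent Brownian bridges \<open>W\<close> and \<open>W'\<close>.
\<close>

lemma kiefer_mueller_image_covariance:
  fixes \<phi>' :: "('x \<Rightarrow> real) bfun \<Rightarrow> 'e bfun"
  assumes Z: "kiefer_mueller P F N Z" and \<phi>': "continuous_linear_on D0 \<phi>'"
    and D0: "\<And>x s. x \<in> space N \<Longrightarrow> s \<in> {0<..1} \<Longrightarrow> slice F (Z x) s \<in> D0"
    and W: "brownian_bridge P F N' W" and WD0: "\<And>x. x \<in> space N' \<Longrightarrow> W x \<in> D0"
    and s: "0 < s1" "s1 \<le> s2" "s2 \<le> 1"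
  shows "(\<integral>x. bapp (\<phi>' (slice F (Z x) s1)) e1 * bapp (\<phi>' (slice F (Z x) s2)) e2 \<partial>N) =
    s1 * (\<integral>x. bapp (\<phi>' (W x)) e1 * bapp (\<phi>' (W x)) e2 \<partial>N')"
proof -
  let ?T = "{0<..1::real} \<times> F" and ?T2 = "{s1, s2} \<times> F"
  have N: "prob_space N" and t: "tight_element (linf ?T) N Z"
    and g: "zero_mean_gaussian_process ?T N (\<lambda>t x. bapp (Z x) t)"
    and cov: "\<And>s t f h. s \<in> {0<..1} \<Longrightarrow> t \<in> {0<..1} \<Longrightarrow> f \<in> F \<Longrightarrow> h \<in> F \<Longrightarrow>
      (\<integral>x. bapp (Z x) (s, f) * bapp (Z x) (t, h) \<partial>N) = min s t * ((\<integral>y. f y * h y \<partial>P) - (\<integral>y. f y \<partial>P) * (\<integral>y. h y \<partial>P))"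
    using Z by (auto simp: kiefer_mueller_def)
  have N': "prob_space N'" and tW: "tight_element (linf F) N' W"
    and gW: "zero_mean_gaussian_process F N' (\<lambda>f x. bapp (W x) f)"
    and covW: "\<And>f h. f \<in> F \<Longrightarrow> h \<in> F \<Longrightarrow>
      (\<integral>x. bapp (W x) f * bapp (W x) h \<partial>N') = (\<integral>y. f y * h y \<partial>P) - (\<integral>y. f y \<partial>P) * (\<integral>y. h y \<partial>P)"
    using W by (auto simp: brownian_bridge_def)
  interpret N': prob_space N' by fact
  interpret PP: pair_prob_space N' N' ..
  obtain L where L: "linear L" "continuous_on (span D0) L" "\<And>h. h \<in> D0 \<Longrightarrow> L h = \<phi>' h"
    using \<phi>' by (auto simp: continuous_linear_on_def)
  have s01: "s1 \<in> {0<..1}" "s2 \<in> {0<..1}"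
    using s by auto
  \<comment> \<open>The coefficients of the first and second bridge at the times \<open>s1\<close>
    and \<open>s2\<close>: \<open>sqrt s1\<close> at both, and 0 followed by
    \<open>sqrt (s2 - s1)\<close>. They satisfy \<open>min u u' = \<gamma>1 u * \<gamma>1 u' +
    \<gamma>2 u * \<gamma>2 u'\<close> on these two times.\<close>
  define \<gamma>1 where "\<gamma>1 = (\<lambda>s::real. sqrt s1)"
  define \<gamma>2 where "\<gamma>2 = (\<lambda>s::real. if s = s1 then 0 else sqrt (s2 - s1))"
  have \<gamma>le: "\<bar>\<gamma>1 u\<bar> \<le> 1" "\<bar>\<gamma>2 u\<bar> \<le> 1" for u
    using s by (auto simp: \<gamma>1_def \<gamma>2_def)
  have \<gamma>22: "\<gamma>2 s1 = 0" "\<gamma>2 s2 = sqrt (s2 - s1)"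
    by (auto simp: \<gamma>2_def)
  define \<Phi> where "\<Phi> = (\<lambda>\<gamma> w. to_linf ?T2 (\<lambda>(u, f). \<gamma> u * bapp w f))"
  have bd: "bounded ((\<lambda>(u, f). \<gamma> u * bapp w f) ` ?T2)" if "\<And>u. \<bar>\<gamma> u\<bar> \<le> 1" for \<gamma> w
  proof (rule boundedI)
    fix y assume "y \<in> (\<lambda>(u, f). \<gamma> u * bapp w f) ` ?T2"
    then obtain u f where y: "y = \<gamma> u * bapp w f"
      by auto
    show "norm y \<le> 1 * norm w"
      unfolding y norm_mult using that[of u] abs_bapp_le_norm[of w f] by (intro mult_mono) auto
  qed
  have b\<Phi>: "bapp (\<Phi> \<gamma> w) (u, f) = (if (u, f) \<in> ?T2 then \<gamma> u * bapp w f else 0)"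
    and \<Phi>in: "\<Phi> \<gamma> w \<in> linf ?T2" if "\<And>u. \<bar>\<gamma> u\<bar> \<le> 1" for \<gamma> w u f
    unfolding \<Phi>_def using bapp_to_linf[OF bd[of \<gamma> w, OF that], of "(u, f)"] to_linf_in_linf[OF bd[of \<gamma> w, OF that]] by auto
  have c\<Phi>: "continuous_on UNIV (\<Phi> \<gamma>)" if \<gamma>: "\<And>u. \<bar>\<gamma> u\<bar> \<le> 1" for \<gamma>
  proof (rule continuous_on_nonexpansive)
    fix w v
    show "norm (\<Phi> \<gamma> w - \<Phi> \<gamma> v) \<le> norm (w - v)"
    proof (rule norm_linf_le)
      show "\<Phi> \<gamma> w - \<Phi> \<gamma> v \<in> linf ?T2"
        by (intro subspace_diff subspace_linf \<Phi>in \<gamma>)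
      fix t assume "t \<in> ?T2"
      then obtain u f where t: "t = (u, f)" "(u, f) \<in> ?T2"
        by auto
      have "bapp (\<Phi> \<gamma> w - \<Phi> \<gamma> v) t = \<gamma> u * (bapp w f - bapp v f)"
        using t by (simp add: b\<Phi>[OF \<gamma>] right_diff_distrib)
      then show "\<bar>bapp (\<Phi> \<gamma> w - \<Phi> \<gamma> v) t\<bar> \<le> norm (w - v)"
        using mult_mono[OF \<gamma>[of u] abs_bapp_diff_le[of w f v]] by (simp add: abs_mult)
    qed simp
  qed
  define \<Psi> where "\<Psi> = (\<lambda>z. to_linf ?T2 (\<lambda>t. bapp z t))"
  have b\<Psi>: "bapp (\<Psi> z) t = (if t \<in> ?T2 then bapp z t else 0)" and \<Psi>in: "\<Psi> z \<in> linf ?T2" for z t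
    unfolding \<Psi>_def by (rule bapp_to_linf[OF bounded_bapp], rule to_linf_in_linf[OF bounded_bapp])
  have c\<Psi>: "continuous_on UNIV \<Psi>"
  proof (rule continuous_on_nonexpansive)
    fix w v
    show "norm (\<Psi> w - \<Psi> v) \<le> norm (w - v)"
      by (rule norm_linf_le[of _ ?T2]) (auto simp: b\<Psi> \<Psi>in subspace_diff[OF subspace_linf] abs_bapp_diff_le)
  qed
  have tZ: "tight_element (linf ?T2) N (\<lambda>x. \<Psi> (Z x))"
    by (rule tight_element_image[OF t c\<Psi> _ N]) (use \<Psi>in in auto)
  have t12: "tight_element (linf ?T2) N' (\<lambda>x. \<Phi> \<gamma> (W x))" if "\<And>u. \<bar>\<gamma> u\<bar> \<le> 1" for \<gamma>
    by (rule tight_element_image[OF tW c\<Phi>[OF that] _ N']) (use \<Phi>in[OF that] in auto)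
  have cong: "zero_mean_gaussian_process ?T2 Q Y" if X: "zero_mean_gaussian_process ?T2 Q X" and eq: "\<And>t x. t \<in> ?T2 \<Longrightarrow> X t x = Y t x"
    for Q :: "'z measure" and X Y
    unfolding zero_mean_gaussian_process_def gaussian_process_def
  proof (intro conjI ballI allI impI)
    fix I c assume I: "finite I \<and> I \<subseteq> ?T2"
    have "\<forall>I c. finite I \<and> I \<subseteq> ?T2 \<longrightarrow> gaussian_rv Q (\<lambda>x. \<Sum>t\<in>I. c t * X t x)"
      using X by (simp add: zero_mean_gaussian_process_def gaussian_process_def)
    from this[rule_format, OF I, of c] show "gaussian_rv Q (\<lambda>x. \<Sum>t\<in>I. c t * Y t x)"
      by (rule gaussian_rv_cong) (use I eq in \<open>auto intro!: sum.cong\<close>)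
  next
    fix t assume t: "t \<in> ?T2"
    then have "(\<integral>x. X t x \<partial>Q) = 0"
      using X unfolding zero_mean_gaussian_process_def by blast
    then show "(\<integral>x. Y t x \<partial>Q) = 0"
      using eq[OF t] by simp
  qed
  have gZ: "zero_mean_gaussian_process ?T2 N (\<lambda>t x. bapp (\<Psi> (Z x)) t)"
    by (rule cong[OF zero_mean_gaussian_process_reindex[OF N g, of "\<lambda>t. t"]]) (use s01 b\<Psi> in auto)
  have r: "zero_mean_gaussian_process ?T2 N' (\<lambda>t x. bapp (W x) (snd t))"
    by (rule zero_mean_gaussian_process_reindex[OF N' gW]) auto
  have g12: "zero_mean_gaussian_process ?T2 N' (\<lambda>t x. bapp (\<Phi> \<gamma> (W x)) t)" if \<gamma>: "\<And>u. \<bar>\<gamma> u\<bar> \<le> 1" for \<gamma>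
  proof (rule cong[OF zero_mean_gaussian_process_scale[OF N' r, of "\<lambda>t. \<gamma> (fst t)"]])
    show "\<gamma> (fst t) * bapp (W x) (snd t) = bapp (\<Phi> \<gamma> (W x)) t" if "t \<in> ?T2" for t x
      using that b\<Phi>[OF \<gamma>] by (cases t) auto
  qed
  define a where "a = (\<lambda>z. bapp (L z) e1)"
  define b where "b = (\<lambda>z. bapp (L z) e2)"
  have ab_lin: "a (c *\<^sub>R y + d *\<^sub>R z) = c * a y + d * a z" "b (c *\<^sub>R y + d *\<^sub>R z) = c * b y + d * b z" for c d y z
    by (simp_all add: a_def b_def linear_add[OF L(1)] linear_scale[OF L(1)])
  define V where "V = {z. slice F z s1 \<in> span D0 \<and> slice F z s2 \<in> span D0}"
  \<comment> \<open>A product, hence not linear, but continuous on \<open>V\<close>, which is what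
    \<open>distr_functional_pair\<close> asks for.\<close>
  define h where "h = (\<lambda>z. a (slice F z s1) * b (slice F z s2))"
  have ch: "continuous_on V h"
    unfolding h_def a_def b_def
    by (intro continuous_intros continuous_linear_functional[OF L(1,2)]) (auto simp: V_def)
  have sl\<Phi>: "slice F (\<Phi> \<gamma> (W x)) u = \<gamma> u *\<^sub>R W x" if "\<And>u. \<bar>\<gamma> u\<bar> \<le> 1" "u \<in> {s1, s2}" "x \<in> space N'" for \<gamma> u x
  proof (rule bfun_eqI)
    fix f
    have "W x \<in> linf F"
      using tW that(3) by (simp add: tight_element_def)
    then show "bapp (slice F (\<Phi> \<gamma> (W x)) u) f = bapp (\<gamma> u *\<^sub>R W x) f"
      using that(2) by (auto simp: bapp_slice b\<Phi>[OF that(1)] linf_def)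
  qed
  have sl\<Psi>: "slice F (\<Psi> z) u = slice F z u" if "u \<in> {s1, s2}" for z u
    by (rule bfun_eqI) (use that in \<open>auto simp: bapp_slice b\<Psi>\<close>)
  have slY1: "slice F (\<Phi> \<gamma>1 (W x) + \<Phi> \<gamma>2 (W y)) s1 = sqrt s1 *\<^sub>R W x + 0 *\<^sub>R W y"
    and slY2: "slice F (\<Phi> \<gamma>1 (W x) + \<Phi> \<gamma>2 (W y)) s2 = sqrt s1 *\<^sub>R W x + sqrt (s2 - s1) *\<^sub>R W y"
    if "x \<in> space N'" "y \<in> space N'" for x y
    using that by (simp_all add: slice_add sl\<Phi>[OF \<gamma>le(1)] sl\<Phi>[OF \<gamma>le(2)] \<gamma>22) (simp_all add: \<gamma>1_def)
  \<comment> \<open>Expanding the product leaves \<open>s1\<close> times the wanted term and a mixed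
    term in two independent bridges.\<close>
  have hY: "h (\<Phi> \<gamma>1 (W x) + \<Phi> \<gamma>2 (W y)) = s1 * (a (W x) * b (W x)) + sqrt s1 * sqrt (s2 - s1) * (a (W x) * b (W y))"
    if "x \<in> space N'" "y \<in> space N'" for x y
    unfolding h_def slY1[OF that] slY2[OF that] ab_lin using s by (simp add: algebra_simps)
  have GW: "gaussian_rv N' (\<lambda>x. bapp (L (W x)) e)" "(\<integral>x. bapp (L (W x)) e \<partial>N') = 0" for e
  proof -
    have c: "continuous_on (span D0) (\<lambda>z. bapp (L z) e)"
      by (rule continuous_on_compose2[OF continuous_on_bapp[of UNIV] L(2)]) auto
    have l: "bapp (L (c *\<^sub>R y + d *\<^sub>R z)) e = c * bapp (L y) e + d * bapp (L z) e" for c d y z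
      by (simp add: linear_add[OF L(1)] linear_scale[OF L(1)])
    have W': "W x \<in> span D0" if "x \<in> space N'" for x
      by (rule span_base[OF WD0[OF that]])
    show "gaussian_rv N' (\<lambda>x. bapp (L (W x)) e)" "(\<integral>x. bapp (L (W x)) e \<partial>N') = 0"
      using gaussian_rv_linear_functional[OF N' tW gW subspace_span W' c l] by auto
  qed
  have ma: "(\<lambda>x. a (W x)) \<in> borel_measurable N'" and mb: "(\<lambda>x. b (W x)) \<in> borel_measurable N'"
    using GW(1) by (auto simp: a_def b_def gaussian_rv_def)
  have sqa: "integrable N' (\<lambda>x. (a (W x))\<^sup>2)" and sqb: "integrable N' (\<lambda>x. (b (W x))\<^sup>2)"
    unfolding a_def b_def by (rule gaussian_rv_moments(1)[OF N' GW])+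
  have ia: "integrable N' (\<lambda>x. a (W x))" and ib: "integrable N' (\<lambda>x. b (W x))"
    by (rule N'.square_integrable_imp_integrable[OF ma sqa], rule N'.square_integrable_imp_integrable[OF mb sqb])
  have iab: "integrable N' (\<lambda>x. a (W x) * b (W x))"
  proof (rule Bochner_Integration.integrable_bound[OF Bochner_Integration.integrable_add[OF sqa sqb]])
    show "(\<lambda>x. a (W x) * b (W x)) \<in> borel_measurable N'"
      using ma mb by simp
    have "\<bar>u * v\<bar> \<le> u\<^sup>2 + v\<^sup>2" for u v :: real
    proof -
      have "2 * (\<bar>u\<bar> * \<bar>v\<bar>) \<le> u\<^sup>2 + v\<^sup>2" "0 \<le> \<bar>u\<bar> * \<bar>v\<bar>"
        using sum_squares_bound[of "\<bar>u\<bar>" "\<bar>v\<bar>"] by simp_all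
      then show ?thesis
        unfolding abs_mult by linarith
    qed
    then show "AE x in N'. norm (a (W x) * b (W x)) \<le> norm ((a (W x))\<^sup>2 + (b (W x))\<^sup>2)"
      by simp
  qed
  have m1: "(\<lambda>p. a (W (fst p))) \<in> borel_measurable (N' \<Otimes>\<^sub>M N')" "(\<lambda>p. b (W (fst p))) \<in> borel_measurable (N' \<Otimes>\<^sub>M N')"
    "(\<lambda>p. b (W (snd p))) \<in> borel_measurable (N' \<Otimes>\<^sub>M N')"
    by (rule measurable_compose[OF measurable_fst ma], rule measurable_compose[OF measurable_fst mb],
        rule measurable_compose[OF measurable_snd mb])
  have meas: "(\<lambda>p. h (\<Phi> \<gamma>1 (W (fst p)) + \<Phi> \<gamma>2 (W (snd p)))) \<in> borel_measurable (N' \<Otimes>\<^sub>M N')"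
  proof (subst measurable_cong)
    show "h (\<Phi> \<gamma>1 (W (fst p)) + \<Phi> \<gamma>2 (W (snd p))) =
        s1 * (a (W (fst p)) * b (W (fst p))) + sqrt s1 * sqrt (s2 - s1) * (a (W (fst p)) * b (W (snd p)))"
      if "p \<in> space (N' \<Otimes>\<^sub>M N')" for p
      using that by (intro hY) (auto simp: space_pair_measure)
  qed (use m1 in simp)
  have VY: "\<Phi> \<gamma>1 (W x) + \<Phi> \<gamma>2 (W y) \<in> V" if "x \<in> space N'" "y \<in> space N'" for x y
    unfolding V_def mem_Collect_eq slY1[OF that] slY2[OF that]
    by (intro conjI span_add span_scale span_base WD0 that)
  have VZ: "\<Psi> (Z x) \<in> V" if "x \<in> space N" for x
    using D0[OF that s01(1)] D0[OF that s01(2)] by (simp add: V_def sl\<Psi> span_base)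
  have cov2: "(\<integral>x. bapp (\<Psi> (Z x)) t * bapp (\<Psi> (Z x)) t' \<partial>N) =
      (\<integral>x. bapp (\<Phi> \<gamma>1 (W x)) t * bapp (\<Phi> \<gamma>1 (W x)) t' \<partial>N') + (\<integral>x. bapp (\<Phi> \<gamma>2 (W x)) t * bapp (\<Phi> \<gamma>2 (W x)) t' \<partial>N')"
    if tt: "t \<in> ?T2" "t' \<in> ?T2" for t t'
  proof -
    obtain u f u' f' where t: "t = (u, f)" "t' = (u', f')" "u \<in> {s1, s2}" "u' \<in> {s1, s2}" "f \<in> F" "f' \<in> F"
      using tt by (cases t, cases t') auto
    have e: "(\<integral>x. bapp (\<Phi> \<gamma> (W x)) t * bapp (\<Phi> \<gamma> (W x)) t' \<partial>N') = \<gamma> u * \<gamma> u' * (\<integral>x. bapp (W x) f * bapp (W x) f' \<partial>N')"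
      if "\<And>u. \<bar>\<gamma> u\<bar> \<le> 1" for \<gamma>
    proof -
      have "bapp (\<Phi> \<gamma> (W x)) t * bapp (\<Phi> \<gamma> (W x)) t' = \<gamma> u * \<gamma> u' * (bapp (W x) f * bapp (W x) f')" for x
        using t b\<Phi>[OF that] by auto
      then show ?thesis by simp
    qed
    have "min u u' = \<gamma>1 u * \<gamma>1 u' + \<gamma>2 u * \<gamma>2 u'"
      using t(3,4) s by (auto simp: \<gamma>1_def \<gamma>2_def)
    moreover have "(\<integral>x. bapp (\<Psi> (Z x)) t * bapp (\<Psi> (Z x)) t' \<partial>N) = min u u' * (\<integral>x. bapp (W x) f * bapp (W x) f' \<partial>N')"
      using cov[of u u' f f'] t s01 by (auto simp: b\<Psi> covW)
    ultimately show ?thesis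
      unfolding e[OF \<gamma>le(1)] e[OF \<gamma>le(2)] by (simp add: distrib_right)
  qed
  note dist = distr_functional_pair[OF N' N' N t12[OF \<gamma>le(1)] t12[OF \<gamma>le(2)] tZ g12[OF \<gamma>le(1)] g12[OF \<gamma>le(2)] gZ cov2 ch VY VZ meas]
  have "(\<integral>x. bapp (\<phi>' (slice F (Z x) s1)) e1 * bapp (\<phi>' (slice F (Z x) s2)) e2 \<partial>N) = (\<integral>x. h (\<Psi> (Z x)) \<partial>N)"
    using L(3)[OF D0[OF _ s01(1)]] L(3)[OF D0[OF _ s01(2)]]
    by (intro Bochner_Integration.integral_cong) (auto simp: h_def a_def b_def sl\<Psi>)
  also have "\<dots> = (\<integral>y. y \<partial>distr N borel (\<lambda>x. h (\<Psi> (Z x))))"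
    using dist(1) by (subst integral_distr) auto
  also have "\<dots> = (\<integral>p. h (\<Phi> \<gamma>1 (W (fst p)) + \<Phi> \<gamma>2 (W (snd p))) \<partial>(N' \<Otimes>\<^sub>M N'))"
  proof -
    have "(\<integral>y. y \<partial>distr (N' \<Otimes>\<^sub>M N') borel (\<lambda>p. h (\<Phi> \<gamma>1 (W (fst p)) + \<Phi> \<gamma>2 (W (snd p)))))
        = (\<integral>p. h (\<Phi> \<gamma>1 (W (fst p)) + \<Phi> \<gamma>2 (W (snd p))) \<partial>(N' \<Otimes>\<^sub>M N'))"
      using meas by (subst integral_distr) auto
    moreover have "distr (N' \<Otimes>\<^sub>M N') borel (\<lambda>p. h (\<Phi> \<gamma>1 (W (fst p)) + \<Phi> \<gamma>2 (W (snd p)))) = distr N borel (\<lambda>x. h (\<Psi> (Z x)))"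
      by (rule dist(2))
    ultimately show ?thesis
      by (simp only:)
  qed
  also have "\<dots> = (\<integral>p. s1 * (a (W (fst p)) * b (W (fst p))) + sqrt s1 * sqrt (s2 - s1) * (a (W (fst p)) * b (W (snd p))) \<partial>(N' \<Otimes>\<^sub>M N'))"
    by (intro Bochner_Integration.integral_cong refl hY) (auto simp: space_pair_measure)
  also have "\<dots> = s1 * (\<integral>p. a (W (fst p)) * b (W (fst p)) \<partial>(N' \<Otimes>\<^sub>M N')) + sqrt s1 * sqrt (s2 - s1) * (\<integral>p. a (W (fst p)) * b (W (snd p)) \<partial>(N' \<Otimes>\<^sub>M N'))"
  proof -
    have "integrable (N' \<Otimes>\<^sub>M N') (\<lambda>p. a (W (fst p)) * b (W (fst p)))"
      by (rule integrable_pair_components(1)[OF N' N' iab])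
    moreover have "integrable (N' \<Otimes>\<^sub>M N') (\<lambda>p. a (W (fst p)) * b (W (snd p)))"
      using m1 ia ib by (intro PP.Fubini_integrable) (auto simp: abs_mult)
    ultimately show ?thesis
      by simp
  qed
  \<comment> \<open>The mixed term vanishes by Fubini, because the functional of the second bridge
    has mean zero.\<close>
  also have "(\<integral>p. a (W (fst p)) * b (W (snd p)) \<partial>(N' \<Otimes>\<^sub>M N')) = 0"
  proof -
    have "integrable (N' \<Otimes>\<^sub>M N') (\<lambda>p. a (W (fst p)) * b (W (snd p)))"
      using m1 ia ib by (intro PP.Fubini_integrable) (auto simp: abs_mult)
    from PP.integral_fst'[OF this] show ?thesis
      using GW(2)[of e2] by (simp add: b_def)
  qed
  also have "(\<integral>p. a (W (fst p)) * b (W (fst p)) \<partial>(N' \<Otimes>\<^sub>M N')) = (\<integral>x. a (W x) * b (W x) \<partial>N')"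
    using PP.integral_fst'[OF integrable_pair_components(1)[OF N' N' iab]] N'.prob_space by simp
  also have "(\<integral>x. a (W x) * b (W x) \<partial>N') = (\<integral>x. bapp (\<phi>' (W x)) e1 * bapp (\<phi>' (W x)) e2 \<partial>N')"
    using L(3)[OF WD0] by (intro Bochner_Integration.integral_cong) (auto simp: a_def b_def)
  finally show ?thesis
    by simp
qed

section \<open>Path regularity of the Kiefer-Mueller process\<close>

text \<open>The two conditions bound the size near \<open>s = 0\<close> and the modulus of
  continuity in \<open>s\<close>; avoiding them for every \<open>\<epsilon>\<close> means extending
  continuously to \<open>s = 0\<close> with value 0. Strict inequalities make the set open, being a
  union over uncountably many times, and hence its complement closed for the portmanteau
  bound.\<close>

definition irregular :: "('x \<Rightarrow> real) set \<Rightarrow> real \<Rightarrow> real \<Rightarrow> (real \<times> ('x \<Rightarrow> real)) bfun set" where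
  "irregular F \<epsilon> \<kappa> =
     {z. (\<exists>s. 0 < s \<and> s \<le> 1 \<and> s \<le> \<kappa> \<and> norm (slice F z s) > \<epsilon>) \<or>
         (\<exists>s t. 0 < s \<and> s \<le> t \<and> t \<le> 1 \<and> t - s \<le> \<kappa> \<and> norm (slice F z s - slice F z t) > \<epsilon>)}"

definition regular_path :: "('x \<Rightarrow> real) set \<Rightarrow> (real \<times> ('x \<Rightarrow> real)) bfun \<Rightarrow> bool" where
  "regular_path F z \<longleftrightarrow> (\<forall>\<epsilon>>0. \<exists>\<kappa>>0. z \<notin> irregular F \<epsilon> \<kappa>)"

lemma open_irregular: "open (irregular F \<epsilon> \<kappa>)"
proof -
  have 1: "open {z. norm (slice F z s) > \<epsilon>}" for s
    by (intro open_Collect_less continuous_intros continuous_on_slice)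
  have 2: "open {z. norm (slice F z s - slice F z t) > \<epsilon>}" for s t
    by (intro open_Collect_less continuous_intros continuous_on_slice)
  have "irregular F \<epsilon> \<kappa> = (\<Union>s\<in>{s. 0 < s \<and> s \<le> 1 \<and> s \<le> \<kappa>}. {z. norm (slice F z s) > \<epsilon>}) \<union>
    (\<Union>(s, t)\<in>{(s, t). 0 < s \<and> s \<le> t \<and> t \<le> 1 \<and> t - s \<le> \<kappa>}. {z. norm (slice F z s - slice F z t) > \<epsilon>})"
    by (auto simp: irregular_def)
  also have "open \<dots>"
    using 1 2 by (intro open_Un open_UN) auto
  finally show ?thesis .
qed

lemma irregular_mono: "\<kappa> \<le> \<kappa>' \<Longrightarrow> \<epsilon>' \<le> \<epsilon> \<Longrightarrow> irregular F \<epsilon> \<kappa> \<subseteq> irregular F \<epsilon>' \<kappa>'"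
  unfolding irregular_def by (intro Collect_mono) (meson le_less_trans order_trans)

context donsker_process
begin

lemma slice_rev_process: "s \<in> {0<..1} \<Longrightarrow> slice F (rev_process m x) s = rev_mean dev m s x"
  by (rule bfun_eqI) (use rev_mean_in_linf in \<open>auto simp: bapp_slice bapp_rev_process linf_def\<close>)

text \<open>Regularity is inherited from the approximating processes: they are irregular with small
  outer probability, and the portmanteau bound for the closed set of non-irregular paths carries
  this over to the limit.\<close>

lemma kiefer_mueller_regular:
  assumes Z: "kiefer_mueller P F N Z"
  shows "\<exists>A\<in>sets N. measure N A = 0 \<and> (\<forall>x\<in>space N - A. regular_path F (Z x))"
proof -
  have N: "prob_space N" and mZ: "Z \<in> borel_measurable N"
    using Z by (auto simp: kiefer_mueller_def tight_element_def)
  interpret N: prob_space N by fact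
  define D where "D = (\<lambda>\<epsilon> \<kappa>. {x \<in> space N. Z x \<in> irregular F \<epsilon> \<kappa>})"
  have sD: "D \<epsilon> \<kappa> \<in> sets N" for \<epsilon> \<kappa>
    using measurable_sets[OF mZ borel_open[OF open_irregular]] by (simp add: D_def vimage_def Int_def conj_commute)
  have small: "\<exists>\<kappa>>0. measure N (D \<epsilon> \<kappa>) \<le> 3 * \<eta>" if e: "0 < \<epsilon>" "0 < \<eta>" for \<epsilon> \<eta>
  proof -
    obtain \<delta> where \<delta>: "0 < \<delta>" and near: "\<forall>\<^sub>F m in sequentially.
        ocover S {x. \<exists>s\<in>{0<..\<delta>}. norm (rev_mean dev m s x) > \<epsilon>} \<eta>"
      using rev_mean_near_zero[OF e] by (elim exE conjE) (rule that)
    obtain \<kappa>0 :: real where \<kappa>0: "0 < \<kappa>0" and modu: "\<forall>\<^sub>F m in sequentially.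
        ocover S {x. \<exists>s t. 0 < s \<and> s \<le> t \<and> t \<le> 1 \<and> t - s \<le> \<kappa>0 \<and>
        norm (rev_mean dev m s x - rev_mean dev m t x) > \<epsilon>} \<eta>"
      using rev_mean_modulus[OF e] by (elim exE conjE) (rule that)
    define \<kappa> where "\<kappa> = min \<delta> \<kappa>0"
    have \<kappa>: "0 < \<kappa>" "\<kappa> \<le> \<delta>" "\<kappa> \<le> \<kappa>0"
      using \<delta> \<kappa>0 by (auto simp: \<kappa>_def)
    have C: "closed (- irregular F \<epsilon> \<kappa>)"
      using open_irregular by (simp add: closed_def)
    have "\<forall>\<^sub>F m in sequentially. 1 \<le> measure N (space N - D \<epsilon> \<kappa>) + 3 * \<eta>"
      using rev_process_portmanteau[OF Z C e(2)] near modu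
    proof eventually_elim
      case (elim m)
      let ?A1 = "{x. rev_process m x \<in> - irregular F \<epsilon> \<kappa>}"
      let ?A2 = "{x. \<exists>s\<in>{0<..\<delta>}. norm (rev_mean dev m s x) > \<epsilon>}"
      let ?A3 = "{x. \<exists>s t. 0 < s \<and> s \<le> t \<and> t \<le> 1 \<and> t - s \<le> \<kappa>0 \<and> norm (rev_mean dev m s x - rev_mean dev m t x) > \<epsilon>}"
      have oc: "ocover S (?A1 \<union> ?A2 \<union> ?A3) (measure N {y \<in> space N. Z y \<in> - irregular F \<epsilon> \<kappa>} + \<eta> + \<eta> + \<eta>)"
        by (intro ocover_Un P.prob_space_axioms elim)
      \<comment> \<open>The three events exhaust the sample space, so their bounds add up to at
        least 1; this bounds from below the probability that the limit path is not
        irregular.\<close>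
      have "x \<in> ?A1 \<union> ?A2 \<union> ?A3" for x
      proof (cases "rev_process m x \<in> irregular F \<epsilon> \<kappa>")
        case True
        then consider s where "0 < s" "s \<le> 1" "s \<le> \<kappa>" "norm (slice F (rev_process m x) s) > \<epsilon>"
          | s t where "0 < s" "s \<le> t" "t \<le> 1" "t - s \<le> \<kappa>" "norm (slice F (rev_process m x) s - slice F (rev_process m x) t) > \<epsilon>"
          unfolding irregular_def by blast
        then show ?thesis
        proof cases
          case 1
          then have "x \<in> ?A2"
            using \<kappa> by (auto simp: slice_rev_process intro!: bexI[of _ s])
          then show ?thesis by blast
        next
          case 2
          then have "x \<in> ?A3"
            using \<kappa> unfolding mem_Collect_eq by (intro exI[of _ s] exI[of _ t]) (simp add: slice_rev_process)
          then show ?thesis by blast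
        qed
      qed auto
      then have "ocover S UNIV (measure N {y \<in> space N. Z y \<in> - irregular F \<epsilon> \<kappa>} + \<eta> + \<eta> + \<eta>)"
        by (intro ocover_mono[OF oc]) auto
      then have "measure S (space S) \<le> measure N {y \<in> space N. Z y \<in> - irregular F \<epsilon> \<kappa>} + \<eta> + \<eta> + \<eta>"
        using sets.top[of S] by (intro ocover_measurable P.prob_space_axioms) (simp_all add: space_S)
      moreover have "{y \<in> space N. Z y \<in> - irregular F \<epsilon> \<kappa>} = space N - D \<epsilon> \<kappa>"
        by (auto simp: D_def)
      ultimately show ?case
        using P.prob_space by simp
    qed
    then have "1 \<le> measure N (space N - D \<epsilon> \<kappa>) + 3 * \<eta>"
      by simp
    then have "measure N (D \<epsilon> \<kappa>) \<le> 3 * \<eta>"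
      using N.prob_compl[OF sD[of \<epsilon> \<kappa>]] by simp
    then show ?thesis
      using \<kappa> by blast
  qed
  \<comment> \<open>By monotonicity of \<open>irregular\<close> countably many resolutions
    \<open>1 / Suc k\<close> and moduli \<open>1 / Suc j\<close> suffice, so the exceptional set is
    measurable.\<close>
  define A where "A = (\<Union>k::nat. \<Inter>j::nat. D (1 / Suc k) (1 / Suc j))"
  have sA: "A \<in> sets N"
    unfolding A_def using sD by (intro sets.countable_UN sets.countable_INT) auto
  have null: "(\<Inter>j::nat. D (1 / Suc k) (1 / Suc j)) \<in> null_sets N" for k
  proof -
    have m: "measure N (\<Inter>j::nat. D (1 / Suc k) (1 / Suc j)) \<le> 0 + \<eta>" if \<eta>: "0 < \<eta>" for \<eta>
    proof -
      obtain \<kappa> where \<kappa>: "0 < \<kappa>" "measure N (D (1 / Suc k) \<kappa>) \<le> 3 * (\<eta> / 3)"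
        using small[of "1 / Suc k" "\<eta> / 3"] \<eta> by auto
      obtain j where j: "1 / real (Suc j) < \<kappa>"
        using \<kappa>(1) nat_approx_posE by blast
      have "(\<Inter>j::nat. D (1 / Suc k) (1 / Suc j)) \<subseteq> D (1 / Suc k) \<kappa>"
        using irregular_mono[of "1 / Suc j" \<kappa> "1 / Suc k" "1 / Suc k" F] j by (auto simp: D_def)
      then have "measure N (\<Inter>j::nat. D (1 / Suc k) (1 / Suc j)) \<le> measure N (D (1 / Suc k) \<kappa>)"
        using sD by (intro N.finite_measure_mono)
      then show ?thesis
        using \<kappa>(2) by simp
    qed
    have "measure N (\<Inter>j::nat. D (1 / Suc k) (1 / Suc j)) \<le> 0"
      by (rule field_le_epsilon) (rule m)
    then have "measure N (\<Inter>j::nat. D (1 / Suc k) (1 / Suc j)) = 0"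
      by (simp add: measure_le_0_iff)
    moreover have "(\<Inter>j::nat. D (1 / Suc k) (1 / Suc j)) \<in> sets N"
      using sD by (intro sets.countable_INT) auto
    ultimately show ?thesis
      by (simp add: null_sets_def N.emeasure_eq_measure)
  qed
  have "A \<in> null_sets N"
    unfolding A_def by (intro null_sets_UN null)
  then have "measure N A = 0"
    by (simp add: null_sets_def measure_def)
  moreover have "regular_path F (Z x)" if x: "x \<in> space N - A" for x
    unfolding regular_path_def
  proof (intro allI impI)
    fix \<epsilon> :: real assume "0 < \<epsilon>"
    then obtain k where k: "1 / real (Suc k) < \<epsilon>"
      using nat_approx_posE by blast
    obtain j where "x \<notin> D (1 / Suc k) (1 / Suc j)"
      using x by (auto simp: A_def)
    then have "Z x \<notin> irregular F (1 / Suc k) (1 / Suc j)"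
      using x by (auto simp: D_def)
    then have "Z x \<notin> irregular F \<epsilon> (1 / Suc j)"
      using irregular_mono[of "1 / Suc j" "1 / Suc j" "1 / Suc k" \<epsilon> F] k by auto
    then show "\<exists>\<kappa>>0. Z x \<notin> irregular F \<epsilon> \<kappa>"
      by (intro exI[of _ "1 / Suc j"]) auto
  qed
  ultimately show ?thesis
    using sA by blast
qed

end

section \<open>The extended continuous mapping argument\<close>

definition diff_quot :: "('a::real_normed_vector \<Rightarrow> 'b::real_normed_vector) \<Rightarrow> 'a \<Rightarrow> nat \<Rightarrow> 'a \<Rightarrow> 'b" where
  "diff_quot \<phi> p m h = sqrt (real m) *\<^sub>R (\<phi> (p + (1 / sqrt (real m)) *\<^sub>R h) - \<phi> p)"

lemma regular_path_tendsto:
  assumes reg: "regular_path F z" and s: "\<And>i. s i \<in> {0<..1}" "s \<longlonglongrightarrow> s0"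
  shows "(\<lambda>i. slice F z (s i)) \<longlonglongrightarrow> (if s0 = 0 then 0 else slice F z s0)"
proof (cases "s0 = 0")
  case True
  show ?thesis
  proof (rule tendstoI)
    fix e :: real assume e: "0 < e"
    then obtain \<kappa> where \<kappa>: "0 < \<kappa>" "z \<notin> irregular F (e / 2) \<kappa>"
      using reg unfolding regular_path_def by (meson half_gt_zero)
    have "\<forall>\<^sub>F i in sequentially. s i < \<kappa>"
      using s(2) \<kappa>(1) True by (intro order_tendstoD) auto
    then show "\<forall>\<^sub>F i in sequentially. dist (slice F z (s i)) (if s0 = 0 then 0 else slice F z s0) < e"
    proof eventually_elim
      case (elim i)
      then have "norm (slice F z (s i)) \<le> e / 2"
        using \<kappa>(2) s(1)[of i] elim unfolding irregular_def mem_Collect_eq greaterThanAtMost_iff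
        by (meson less_imp_le not_less)
      then show ?case
        using True e by simp
    qed
  qed
next
  case False
  have "0 \<le> s0" "s0 \<le> 1"
    using LIMSEQ_le_const[OF s(2), of 0] LIMSEQ_le_const2[OF s(2), of 1] s(1)
    unfolding greaterThanAtMost_iff by (meson less_imp_le)+
  then have s0: "0 < s0" "s0 \<le> 1"
    using False by auto
  show ?thesis
  proof (rule tendstoI)
    fix e :: real assume e: "0 < e"
    then obtain \<kappa> where \<kappa>: "0 < \<kappa>" "z \<notin> irregular F (e / 2) \<kappa>"
      using reg unfolding regular_path_def by (meson half_gt_zero)
    have "\<forall>\<^sub>F i in sequentially. dist (s i) s0 < \<kappa>"
      using s(2) \<kappa>(1) by (rule tendstoD)
    then show "\<forall>\<^sub>F i in sequentially. dist (slice F z (s i)) (if s0 = 0 then 0 else slice F z s0) < e"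
    proof eventually_elim
      case (elim i)
      have m: "norm (slice F z u - slice F z v) \<le> e / 2" if "0 < u" "u \<le> v" "v \<le> 1" "v - u \<le> \<kappa>" for u v
        using \<kappa>(2) that unfolding irregular_def mem_Collect_eq by (meson not_less)
      have "norm (slice F z (s i) - slice F z s0) \<le> e / 2"
      proof (cases "s i \<le> s0")
        case True
        then show ?thesis
          using elim s(1)[of i] s0 by (intro m) (auto simp: dist_real_def)
      next
        case False
        then have "norm (slice F z s0 - slice F z (s i)) \<le> e / 2"
          using elim s(1)[of i] s0 by (intro m) (auto simp: dist_real_def)
        then show ?thesis
          by (simp add: norm_minus_commute)
      qed
      then show ?case
        using False e by (simp add: dist_norm)
    qed
  qed
qed

text \<open>Hadamard differentiability concerns a single convergent sequence of directions. If
  uniformity failed along times \<open>s j\<close>, a subsequence of them would converge in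
  \<open>[0, 1]\<close>; regularity of the path makes the sections along it converge to a point of
  \<open>D0\<close>, and differentiability along this sequence, with continuity of the derivative,
  gives a contradiction.\<close>

lemma hadamard_uniform:
  fixes \<phi> \<phi>' :: "('x \<Rightarrow> real) bfun \<Rightarrow> 'e bfun"
  assumes had: "hadamard_differentiable (linf F) (linf E) D\<phi> \<phi> p D0 \<phi>'" and D00: "0 \<in> D0"
    and m: "filterlim m at_top sequentially" and zj: "zj \<longlonglongrightarrow> z" and reg: "regular_path F z"
    and D0: "\<And>s. s \<in> {0<..1} \<Longrightarrow> slice F z s \<in> D0"
    and D\<phi>: "\<And>j s. s \<in> {0<..1} \<Longrightarrow> p + (1 / sqrt (real (m j))) *\<^sub>R slice F (zj j) s \<in> D\<phi>"
    and s: "\<And>j. s j \<in> {0<..1}"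
  shows "(\<lambda>j. norm (diff_quot \<phi> p (m j) (slice F (zj j) (s j)) - \<phi>' (slice F z (s j)))) \<longlonglongrightarrow> 0"
proof (rule ccontr)
  let ?d = "\<lambda>j. norm (diff_quot \<phi> p (m j) (slice F (zj j) (s j)) - \<phi>' (slice F z (s j)))"
  assume "\<not> ?d \<longlonglongrightarrow> 0"
  then obtain e where e: "0 < e" "\<not> (\<forall>\<^sub>F j in sequentially. dist (?d j) 0 < e)"
    unfolding tendsto_iff by blast
  then have "\<exists>\<^sub>F j in sequentially. e \<le> ?d j \<and> 1 \<le> m j"
  proof -
    have "\<exists>\<^sub>F j in sequentially. e \<le> ?d j"
      using e(2) by (simp add: frequently_def not_le)
    moreover have "\<forall>\<^sub>F j in sequentially. 1 \<le> m j"
      using m by (simp add: filterlim_at_top)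
    ultimately show ?thesis
      unfolding frequently_def by (auto elim: eventually_mono dest: eventually_conj) (smt (verit) eventually_elim2)
  qed
  then have "\<exists>\<^sub>\<infinity>j. e \<le> ?d j \<and> 1 \<le> m j"
    by (simp add: cofinite_eq_sequentially)
  then have inf: "infinite {j. e \<le> ?d j \<and> 1 \<le> m j}"
    by (simp add: INFM_iff_infinite)
  \<comment> \<open>The indices at which the error stays at least \<open>e\<close>; the second
    condition keeps \<open>1 / sqrt m\<close> nonzero.\<close>
  define r where "r = enumerate {j. e \<le> ?d j \<and> 1 \<le> m j}"
  have r: "strict_mono r" "\<And>i. e \<le> ?d (r i)" "\<And>i. 1 \<le> m (r i)"
    using inf enumerate_in_set[OF inf] strict_mono_enumerate[OF inf] by (auto simp: r_def)
  have "\<forall>i. (s \<circ> r) i \<in> {0..1}"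
    using s by (auto simp: less_imp_le)
  then obtain s0 r' where s0: "s0 \<in> {0..1}" "strict_mono r'" "((s \<circ> r) \<circ> r') \<longlonglongrightarrow> s0"
    using compact_imp_seq_compact[OF compact_Icc[of 0 "1::real"]] unfolding seq_compact_def by metis
  define q where "q = r \<circ> r'"
  have q: "strict_mono q"
    unfolding q_def using r(1) s0(2) by (rule strict_mono_o)
  have sq: "(\<lambda>i. s (q i)) \<longlonglongrightarrow> s0"
    using s0(3) by (simp add: q_def o_def)
  \<comment> \<open>At \<open>s0 = 0\<close> the sections tend to 0, and \<open>D00\<close> provides
    that this limit is an admissible direction.\<close>
  define h0 where "h0 = (if s0 = 0 then 0 else slice F z s0)"
  have h0: "h0 \<in> D0"
    using s0(1) D00 D0[of s0] by (auto simp: h0_def)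
  have lim1: "(\<lambda>i. slice F z (s (q i))) \<longlonglongrightarrow> h0"
    unfolding h0_def by (rule regular_path_tendsto[OF reg _ sq]) (rule s)
  have zq: "(\<lambda>i. zj (q i)) \<longlonglongrightarrow> z"
    using LIMSEQ_subseq_LIMSEQ[OF zj q] by (simp add: o_def)
  have lim2: "(\<lambda>i. slice F (zj (q i)) (s (q i))) \<longlonglongrightarrow> h0"
  proof -
    have "(\<lambda>i. norm (zj (q i) - z)) \<longlonglongrightarrow> 0"
      using zq by (simp add: tendsto_norm_zero_iff LIM_zero_iff)
    then have "(\<lambda>i. slice F (zj (q i)) (s (q i)) - slice F z (s (q i))) \<longlonglongrightarrow> 0"
      by (rule Lim_null_comparison[rotated]) (auto simp: slice_diff[symmetric] norm_slice_le)
    from tendsto_add[OF this lim1] show ?thesis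
      by simp
  qed
  define t where "t = (\<lambda>i. 1 / sqrt (real (m (q i))))"
  have mq: "filterlim (\<lambda>i. m (q i)) at_top sequentially"
    by (rule filterlim_compose[OF m filterlim_subseq[OF q]])
  have t0: "t \<longlonglongrightarrow> 0"
    unfolding t_def
    by (intro real_tendsto_divide_at_top[OF tendsto_const] filterlim_compose[OF sqrt_at_top]
        filterlim_compose[OF filterlim_real_sequentially mq])
  have tn: "t i \<noteq> 0" for i
    using r(3)[of "r' i"] by (simp add: t_def q_def)
  have "(\<lambda>i. norm ((1 / t i) *\<^sub>R (\<phi> (p + t i *\<^sub>R slice F (zj (q i)) (s (q i))) - \<phi> p) - \<phi>' h0)) \<longlonglongrightarrow> 0"
  proof -
    have H: "\<forall>(t :: nat \<Rightarrow> real) h h0.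
        (\<forall>n. t n \<noteq> 0) \<and> t \<longlonglongrightarrow> 0 \<and> (\<forall>n. h n \<in> linf F) \<and> h \<longlonglongrightarrow> h0 \<and> h0 \<in> D0 \<and>
        (\<forall>n. p + t n *\<^sub>R h n \<in> D\<phi>) \<longrightarrow>
        (\<lambda>n. norm ((1 / t n) *\<^sub>R (\<phi> (p + t n *\<^sub>R h n) - \<phi> p) - \<phi>' h0)) \<longlonglongrightarrow> 0"
      using had by (simp add: hadamard_differentiable_def)
    have "(\<forall>n. t n \<noteq> 0) \<and> t \<longlonglongrightarrow> 0 \<and> (\<forall>n. slice F (zj (q n)) (s (q n)) \<in> linf F) \<and>
        (\<lambda>i. slice F (zj (q i)) (s (q i))) \<longlonglongrightarrow> h0 \<and> h0 \<in> D0 \<and> (\<forall>n. p + t n *\<^sub>R slice F (zj (q n)) (s (q n)) \<in> D\<phi>)"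
      using tn t0 lim2 h0 by (simp add: slice_in_linf) (simp add: t_def D\<phi>[OF s])
    from H[THEN spec, of t, THEN spec, of "\<lambda>i. slice F (zj (q i)) (s (q i))", THEN spec, of h0, THEN mp, OF this]
    show ?thesis .
  qed
  then have "(\<lambda>i. norm (diff_quot \<phi> p (m (q i)) (slice F (zj (q i)) (s (q i))) - \<phi>' h0)) \<longlonglongrightarrow> 0"
    by (simp add: diff_quot_def t_def)
  then have a: "(\<lambda>i. diff_quot \<phi> p (m (q i)) (slice F (zj (q i)) (s (q i))) - \<phi>' h0) \<longlonglongrightarrow> 0"
    by (simp add: tendsto_norm_zero_iff)
  obtain L where L: "linear L" "continuous_on (span D0) L" "\<And>h. h \<in> D0 \<Longrightarrow> L h = \<phi>' h"
    using had by (auto simp: hadamard_differentiable_def continuous_linear_on_def)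
  have "(\<lambda>i. L (slice F z (s (q i)))) \<longlonglongrightarrow> L h0"
    by (rule continuous_on_tendsto_compose[OF L(2) lim1]) (use h0 D0[OF s] in \<open>auto intro!: always_eventually intro: span_base\<close>)
  then have "(\<lambda>i. \<phi>' (slice F z (s (q i)))) \<longlonglongrightarrow> \<phi>' h0"
    using L(3)[OF D0[OF s]] L(3)[OF h0] by simp
  then have "(\<lambda>i. \<phi>' (slice F z (s (q i))) - \<phi>' h0) \<longlonglongrightarrow> 0"
    by (simp add: LIM_zero)
  from tendsto_diff[OF a this]
  have "(\<lambda>i. diff_quot \<phi> p (m (q i)) (slice F (zj (q i)) (s (q i))) - \<phi>' (slice F z (s (q i)))) \<longlonglongrightarrow> 0"
    by simp
  then have "(\<lambda>i. ?d (q i)) \<longlonglongrightarrow> 0"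
    by (rule tendsto_norm_zero)
  then have "\<forall>\<^sub>F i in sequentially. ?d (q i) < e"
    using e(1) by (rule order_tendstoD)
  then obtain i where "?d (q i) < e"
    using eventually_happens[of _ sequentially] by auto
  then show False
    using r(2)[of "r' i"] by (simp add: q_def)
qed

definition image_sup :: "('x \<Rightarrow> real) set \<Rightarrow> 'e set \<Rightarrow> (('x \<Rightarrow> real) bfun \<Rightarrow> 'e bfun)
     \<Rightarrow> (real \<times> ('x \<Rightarrow> real)) bfun \<Rightarrow> ennreal" where
  "image_sup F E \<phi>' z = (SUP (s, e)\<in>{0<..1} \<times> E. ennreal \<bar>bapp (\<phi>' (slice F z s)) e\<bar>)"

lemma ocover_outer_measure:
  assumes "prob_space M" "outer_measure_of M A < ennreal p" "A \<subseteq> space M"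
  shows "ocover M A p"
proof -
  interpret prob_space M by fact
  obtain B where B: "B \<in> sets M" "A \<subseteq> B" "emeasure M B < ennreal p"
    using assms(2) unfolding outer_measure_of_def INF_less_iff by auto
  then have "measure M B \<le> p"
    by (simp add: emeasure_eq_measure ennreal_less_iff)
  then show ?thesis
    using B by (intro ocoverI) auto
qed

locale hadamard_setup = donsker_process P F B
  for P :: "'x measure" and F :: "('x \<Rightarrow> real) set" and B :: real +
  fixes E :: "'e set" and D\<phi> D0 :: "('x \<Rightarrow> real) bfun set" and \<phi> \<phi>' :: "('x \<Rightarrow> real) bfun \<Rightarrow> 'e bfun"
    and N :: "'v measure" and Z :: "'v \<Rightarrow> (real \<times> ('x \<Rightarrow> real)) bfun"
  assumes hadamard: "hadamard_differentiable (linf F) (linf E) D\<phi> \<phi> (true_dist F P) D0 \<phi>'"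
    and zero_D0: "0 \<in> D0"
    and kiefer: "kiefer_mueller P F N Z"
    and slice_D0: "x \<in> space N \<Longrightarrow> s \<in> {0<..1} \<Longrightarrow> slice F (Z x) s \<in> D0"
begin

lemma prob_space_N: "prob_space N"
  using kiefer by (simp add: kiefer_mueller_def)

lemma Z_measurable: "Z \<in> borel_measurable N"
  using kiefer by (simp add: kiefer_mueller_def tight_element_def)

lemma continuous_linear: "continuous_linear_on D0 \<phi>'"
  using hadamard by (simp add: hadamard_differentiable_def)

lemma image_in_linf: "h \<in> D0 \<Longrightarrow> \<phi>' h \<in> linf E"
  using hadamard by (auto simp: hadamard_differentiable_def)

lemma image_sup_le:
  assumes "\<And>s. s \<in> {0<..1} \<Longrightarrow> norm (\<phi>' (slice F z s)) \<le> v"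
  shows "image_sup F E \<phi>' z \<le> ennreal v"
  unfolding image_sup_def
proof (rule SUP_least)
  fix t assume "t \<in> {0<..1::real} \<times> E"
  then obtain s e where t: "t = (s, e)" "s \<in> {0<..1}"
    by auto
  have "\<bar>bapp (\<phi>' (slice F z s)) e\<bar> \<le> v"
    using abs_bapp_le_norm[of "\<phi>' (slice F z s)" e] assms[OF t(2)] by linarith
  then show "(case t of (s, e) \<Rightarrow> ennreal \<bar>bapp (\<phi>' (slice F z s)) e\<bar>) \<le> ennreal v"
    using t by (simp add: ennreal_leI)
qed

lemma norm_le_image_sup:
  assumes x: "slice F z s \<in> D0" and s: "s \<in> {0<..1}"
  shows "ennreal (norm (\<phi>' (slice F z s))) \<le> image_sup F E \<phi>' z"
proof (cases "image_sup F E \<phi>' z")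
  case (real r)
  have "norm (\<phi>' (slice F z s)) \<le> r"
  proof (rule norm_linf_le[OF image_in_linf[OF x]])
    fix e assume "e \<in> E"
    then have "ennreal \<bar>bapp (\<phi>' (slice F z s)) e\<bar> \<le> image_sup F E \<phi>' z"
      unfolding image_sup_def using s by (intro SUP_upper2[of "(s, e)"]) auto
    then show "\<bar>bapp (\<phi>' (slice F z s)) e\<bar> \<le> r"
      using real by (simp add: ennreal_le_iff)
  qed (use real in simp)
  then show ?thesis
    using real by (simp add: ennreal_leI)
qed simp

text \<open>The supremum is over an uncountable set but lower semicontinuous: each superlevel set is
  a union of sets relatively open in \<open>V\<close>. Extending these to open sets
  \<open>G s e\<close> of the whole space makes Borel measurability of \<open>Z\<close>
  sufficient.\<close>

lemma image_sup_measurable: "(\<lambda>x. image_sup F E \<phi>' (Z x)) \<in> borel_measurable N"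
proof (rule borel_measurableI_greater)
  fix a :: ennreal
  obtain L where L: "linear L" "continuous_on (span D0) L" "\<And>h. h \<in> D0 \<Longrightarrow> L h = \<phi>' h"
    using continuous_linear by (auto simp: continuous_linear_on_def)
  define V where "V = {z. \<forall>s\<in>{0<..1}. slice F z s \<in> span D0}"
  have ex: "\<exists>U. open U \<and> U \<inter> V = {z. a < ennreal \<bar>bapp (L (slice F z s)) e\<bar>} \<inter> V" if "s \<in> {0<..1}" for s e
  proof -
    have "continuous_on V (\<lambda>z. ennreal \<bar>bapp (L (slice F z s)) e\<bar>)"
      by (intro continuous_on_ennreal continuous_on_rabs continuous_linear_functional[OF L(1,2)]) (use that in \<open>auto simp: V_def\<close>)
    then have "\<exists>U. open U \<and> U \<inter> V = (\<lambda>z. ennreal \<bar>bapp (L (slice F z s)) e\<bar>) -` {a<..} \<inter> V"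
      unfolding continuous_on_open_invariant by (rule allE[of _ "{a<..}"]) (simp only: open_greaterThan simp_thms)
    then show ?thesis
      by (simp only: vimage_def greaterThan_iff)
  qed
  define G where "G = (\<lambda>s e. SOME U. open U \<and> U \<inter> V = {z. a < ennreal \<bar>bapp (L (slice F z s)) e\<bar>} \<inter> V)"
  have G: "open (G s e)" "G s e \<inter> V = {z. a < ennreal \<bar>bapp (L (slice F z s)) e\<bar>} \<inter> V" if "s \<in> {0<..1}" for s e
    using someI_ex[OF ex[OF that, of e]] unfolding G_def by (rule conjunct1, rule conjunct2)
  have ZV: "Z x \<in> V" if "x \<in> space N" for x
    using slice_D0[OF that] by (auto simp: V_def span_base)
  have "(a < image_sup F E \<phi>' (Z x)) = (Z x \<in> (\<Union>(s, e)\<in>{0<..1} \<times> E. G s e))" if x: "x \<in> space N" for x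
  proof -
    have eq: "(Z x \<in> G s e) = (a < ennreal \<bar>bapp (\<phi>' (slice F (Z x) s)) e\<bar>)" if "s \<in> {0<..1}" for s e
    proof -
      have "(Z x \<in> G s e) = (Z x \<in> G s e \<inter> V)"
        using ZV[OF x] by blast
      also have "\<dots> = (a < ennreal \<bar>bapp (L (slice F (Z x) s)) e\<bar>)"
        unfolding G(2)[OF that] using ZV[OF x] by blast
      also have "L (slice F (Z x) s) = \<phi>' (slice F (Z x) s)"
        by (rule L(3)[OF slice_D0[OF x that]])
      finally show ?thesis .
    qed
    have "(a < image_sup F E \<phi>' (Z x)) = (\<exists>t\<in>{0<..1} \<times> E. a < ennreal \<bar>bapp (\<phi>' (slice F (Z x) (fst t))) (snd t)\<bar>)"
      by (simp add: image_sup_def less_SUP_iff case_prod_beta)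
    also have "\<dots> = (\<exists>t\<in>{0<..1} \<times> E. Z x \<in> G (fst t) (snd t))"
      by (intro bex_cong refl eq[symmetric]) auto
    finally show ?thesis
      by (simp add: case_prod_beta)
  qed
  then have "{x \<in> space N. a < image_sup F E \<phi>' (Z x)} = Z -` (\<Union>(s, e)\<in>{0<..1} \<times> E. G s e) \<inter> space N"
    by auto
  moreover have "open (\<Union>(s, e)\<in>{0<..1} \<times> E. G s e)"
    using G(1) by auto
  ultimately show "{x \<in> space N. a < image_sup F E \<phi>' (Z x)} \<in> sets N"
    using measurable_sets[OF Z_measurable borel_open] by auto
qed

abbreviation dq :: "nat \<Rightarrow> ('x \<Rightarrow> real) bfun \<Rightarrow> 'e bfun" where
  "dq \<equiv> diff_quot \<phi> (true_dist F P)"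

definition admissible :: "nat \<Rightarrow> (real \<times> ('x \<Rightarrow> real)) bfun set" where
  "admissible m = {z. \<forall>s\<in>{0<..1}. true_dist F P + (1 / sqrt (real m)) *\<^sub>R slice F z s \<in> D\<phi>}"

text \<open>Closures of the tails of \<open>A\<close> replace a sequence of sets by one fixed closed
  set, to which the portmanteau bound applies. A regular path lying in all of these closures is a
  limit of points of \<open>A (m k) (1 / Suc k)\<close> with \<open>m k\<close> tending to infinity,
  so it belongs to \<open>L\<close> by \<open>lim\<close>; hence the closures decrease, up to a null
  set, into \<open>L\<close>.\<close>

lemma extended_continuous_mapping:
  fixes A :: "nat \<Rightarrow> real \<Rightarrow> (real \<times> ('x \<Rightarrow> real)) bfun set"
  assumes mono: "\<And>m d d'. d \<le> d' \<Longrightarrow> A m d \<subseteq> A m d'"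
    and L: "{x \<in> space N. Z x \<in> L} \<in> sets N"
    and lim: "\<And>x m zj. x \<in> space N \<Longrightarrow> regular_path F (Z x) \<Longrightarrow> filterlim m at_top sequentially \<Longrightarrow>
      zj \<longlonglongrightarrow> Z x \<Longrightarrow> (\<And>k. zj k \<in> A (m k) (1 / Suc k)) \<Longrightarrow> Z x \<in> L"
    and \<eta>: "0 < \<eta>"
  shows "\<exists>\<delta>>0. \<forall>\<^sub>F m in sequentially. ocover S {x. rev_process m x \<in> A m \<delta>} (measure N {x \<in> space N. Z x \<in> L} + \<eta>)"
proof -
  interpret N: prob_space N by (rule prob_space_N)
  define C where "C = (\<lambda>k::nat. closure (\<Union>m\<in>{k..}. A m (1 / Suc k)))"
  define D where "D = (\<lambda>k. {x \<in> space N. Z x \<in> C k})"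
  have sD: "D k \<in> sets N" for k
    using measurable_sets[OF Z_measurable borel_closed[OF closed_closure]] unfolding D_def C_def
    by (simp add: vimage_def Int_def conj_commute)
  obtain A0 where A0: "A0 \<in> sets N" "measure N A0 = 0" "\<And>x. x \<in> space N - A0 \<Longrightarrow> regular_path F (Z x)"
    using kiefer_mueller_regular[OF kiefer] by blast
  have "decseq D"
  proof (rule antimonoI)
    fix k l :: nat assume kl: "k \<le> l"
    have "1 / real (Suc l) \<le> 1 / real (Suc k)"
      using kl by (intro divide_left_mono) auto
    then have "(\<Union>m\<in>{l..}. A m (1 / Suc l)) \<subseteq> (\<Union>m\<in>{k..}. A m (1 / Suc k))"
      using mono[of "1 / real (Suc l)" "1 / real (Suc k)"] kl by fastforce
    then show "D l \<subseteq> D k"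
      unfolding D_def C_def using closure_mono by blast
  qed
  then have "(\<lambda>k. measure N (D k)) \<longlonglongrightarrow> measure N (\<Inter>k. D k)"
    using sD by (intro N.finite_Lim_measure_decseq) auto
  moreover have "measure N (\<Inter>k. D k) \<le> measure N {x \<in> space N. Z x \<in> L}"
  proof -
    have "(\<Inter>k. D k) \<subseteq> {x \<in> space N. Z x \<in> L} \<union> A0"
    proof
      fix x assume x: "x \<in> (\<Inter>k. D k)"
      then have xN: "x \<in> space N" and xC: "\<And>k. Z x \<in> C k"
        by (auto simp: D_def)
      show "x \<in> {x \<in> space N. Z x \<in> L} \<union> A0"
      proof (cases "x \<in> A0")
        case False
        have "\<exists>m z. k \<le> m \<and> z \<in> A m (1 / Suc k) \<and> dist z (Z x) < 1 / Suc k" for k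
        proof -
          have "Z x \<in> closure (\<Union>m\<in>{k..}. A m (1 / Suc k))"
            using xC[of k] by (simp add: C_def)
          then obtain z where "z \<in> (\<Union>m\<in>{k..}. A m (1 / Suc k))" "dist z (Z x) < 1 / Suc k"
            unfolding closure_approachable by (auto simp del: of_nat_Suc elim!: allE[of _ "1 / real (Suc k)"])
          then show ?thesis by auto
        qed
        then obtain m zj where mz: "\<And>k. k \<le> m k" "\<And>k. zj k \<in> A (m k) (1 / Suc k)" "\<And>k. dist (zj k) (Z x) < 1 / Suc k"
          by metis
        have "filterlim m at_top sequentially"
          by (rule filterlim_at_top_mono[OF filterlim_ident]) (auto simp: mz)
        moreover have "zj \<longlonglongrightarrow> Z x"
        proof -
          have "(\<lambda>k. 1 / real (Suc k)) \<longlonglongrightarrow> 0"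
            by (rule LIMSEQ_Suc[OF lim_const_over_n])
          moreover have "norm (dist (zj k) (Z x)) \<le> 1 / real (Suc k)" for k
            using mz(3)[of k] by simp
          ultimately have "(\<lambda>k. dist (zj k) (Z x)) \<longlonglongrightarrow> 0"
            by (intro Lim_null_comparison[of "\<lambda>k. dist (zj k) (Z x)"] always_eventually allI)
          then show ?thesis
            by (rule tendsto_dist_iff[THEN iffD2])
        qed
        moreover have "regular_path F (Z x)"
          using A0(3) xN False by auto
        ultimately have "Z x \<in> L"
          by (intro lim[of x m zj] xN mz(2))
        then show ?thesis
          using xN by auto
      qed auto
    qed
    then have "measure N (\<Inter>k. D k) \<le> measure N ({x \<in> space N. Z x \<in> L} \<union> A0)"
      using L A0 by (intro N.finite_measure_mono) auto
    also have "\<dots> \<le> measure N {x \<in> space N. Z x \<in> L} + measure N A0"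
      using L A0 by (intro measure_Un_le) auto
    finally show ?thesis
      using A0 by simp
  qed
  ultimately have "\<forall>\<^sub>F k in sequentially. measure N (D k) < measure N {x \<in> space N. Z x \<in> L} + \<eta> / 2"
    using \<eta> by (intro order_tendstoD(2)) auto
  then obtain k where k: "measure N (D k) < measure N {x \<in> space N. Z x \<in> L} + \<eta> / 2"
    using eventually_happens[of _ sequentially] by auto
  have "\<forall>\<^sub>F m in sequentially. ocover S {x. rev_process m x \<in> C k} (measure N (D k) + \<eta> / 2)"
    unfolding D_def using \<eta> by (intro rev_process_portmanteau[OF kiefer]) (auto simp: C_def)
  then have "\<forall>\<^sub>F m in sequentially. k \<le> m \<and> ocover S {x. rev_process m x \<in> C k} (measure N (D k) + \<eta> / 2)"
    by (intro eventually_conj eventually_ge_at_top)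
  then have "\<forall>\<^sub>F m in sequentially. ocover S {x. rev_process m x \<in> A m (1 / Suc k)} (measure N {x \<in> space N. Z x \<in> L} + \<eta>)"
  proof eventually_elim
    case (elim m)
    have "A m (1 / Suc k) \<subseteq> C k"
      unfolding C_def using elim by (intro order_trans[OF _ closure_subset]) auto
    then have sub: "{x. rev_process m x \<in> A m (1 / Suc k)} \<inter> space S \<subseteq> {x. rev_process m x \<in> C k}"
      by blast
    show ?case
      by (rule ocover_mono[OF conjunct2[OF elim] sub]) (use k in linarith)
  qed
  then show ?thesis
    by (intro exI[of _ "1 / real (Suc k)"] conjI) simp_all
qed

text \<open>The time at which the difference quotient is large varies along the sequence; the
  uniform form of differentiability transfers the bound to the derivative at the same varying
  times.\<close>

lemma upper_tail:
  assumes \<eta>: "0 < \<eta>"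
  shows "\<exists>\<delta>>0. \<forall>\<^sub>F m in sequentially. ocover S
    {x. rev_process m x \<in> admissible m \<and> (\<exists>s\<in>{0<..1}. v - \<delta> \<le> norm (dq m (slice F (rev_process m x) s)))}
    (measure N {x \<in> space N. ennreal v \<le> image_sup F E \<phi>' (Z x)} + \<eta>)"
proof -
  let ?A = "\<lambda>m d. {z. z \<in> admissible m \<and> (\<exists>s\<in>{0<..1}. v - d \<le> norm (dq m (slice F z s)))}"
  have "\<exists>\<delta>>0. \<forall>\<^sub>F m in sequentially. ocover S {x. rev_process m x \<in> ?A m \<delta>}
      (measure N {x \<in> space N. Z x \<in> {z. ennreal v \<le> image_sup F E \<phi>' z}} + \<eta>)"
  proof (rule extended_continuous_mapping[OF _ _ _ \<eta>])
    show "?A m d \<subseteq> ?A m d'" if "d \<le> d'" for m d d'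
      using that by (auto elim!: bexI[rotated])
    show "{x \<in> space N. Z x \<in> {z. ennreal v \<le> image_sup F E \<phi>' z}} \<in> sets N"
      unfolding mem_Collect_eq by (intro borel_measurable_le borel_measurable_const image_sup_measurable)
    fix x m zj
    assume x: "x \<in> space N" "regular_path F (Z x)" and m: "filterlim m at_top sequentially"
      and zj: "zj \<longlonglongrightarrow> Z x" and A: "\<And>k. zj k \<in> ?A (m k) (1 / real (Suc k))"
    have ex: "\<exists>s. s \<in> {0<..1} \<and> v - 1 / real (Suc k) \<le> norm (dq (m k) (slice F (zj k) s))" for k
      using A[of k] unfolding mem_Collect_eq Bex_def by (rule conjunct2)
    define s where "s = (\<lambda>k. SOME s. s \<in> {0<..1} \<and> v - 1 / real (Suc k) \<le> norm (dq (m k) (slice F (zj k) s)))"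
    have s: "s k \<in> {0<..1}" "v - 1 / real (Suc k) \<le> norm (dq (m k) (slice F (zj k) (s k)))" for k
      using someI_ex[OF ex[of k]] unfolding s_def by (rule conjunct1, rule conjunct2)
    have lim: "(\<lambda>k. norm (dq (m k) (slice F (zj k) (s k)) - \<phi>' (slice F (Z x) (s k)))) \<longlonglongrightarrow> 0"
      using A by (intro hadamard_uniform[OF hadamard zero_D0 m zj x(2) slice_D0[OF x(1)] _ s(1)]) (auto simp: admissible_def)
    have "ennreal v \<le> image_sup F E \<phi>' (Z x) + ennreal e" if "0 < e" for e
    proof -
      have "(\<lambda>k. 1 / real (Suc k) + norm (dq (m k) (slice F (zj k) (s k)) - \<phi>' (slice F (Z x) (s k)))) \<longlonglongrightarrow> 0 + 0"
        by (intro tendsto_add lim LIMSEQ_Suc[OF lim_const_over_n])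
      then have "\<forall>\<^sub>F k in sequentially. 1 / real (Suc k) + norm (dq (m k) (slice F (zj k) (s k)) - \<phi>' (slice F (Z x) (s k))) < e"
        using that by (intro order_tendstoD(2)) auto
      then obtain k where k: "1 / real (Suc k) + norm (dq (m k) (slice F (zj k) (s k)) - \<phi>' (slice F (Z x) (s k))) < e"
        using eventually_happens[of _ sequentially] by auto
      have "v \<le> norm (\<phi>' (slice F (Z x) (s k))) + e"
        using k s(2)[of k] norm_triangle_ineq2[of "dq (m k) (slice F (zj k) (s k))" "\<phi>' (slice F (Z x) (s k))"] by linarith
      then have "ennreal v \<le> ennreal (norm (\<phi>' (slice F (Z x) (s k)))) + ennreal e"
        using that by (simp add: ennreal_leI flip: ennreal_plus)
      also have "\<dots> \<le> image_sup F E \<phi>' (Z x) + ennreal e"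
        by (intro add_right_mono norm_le_image_sup slice_D0 x s)
      finally show ?thesis .
    qed
    then show "Z x \<in> {z. ennreal v \<le> image_sup F E \<phi>' z}"
      by (auto intro: ennreal_le_epsilon)
  qed
  then show ?thesis by simp
qed

text \<open>Here the bound holds at every time, so the limit can be taken with \<open>s\<close>
  fixed.\<close>

lemma lower_tail:
  assumes \<eta>: "0 < \<eta>" and v: "0 \<le> v"
  shows "\<exists>\<delta>>0. \<forall>\<^sub>F m in sequentially. ocover S
    {x. rev_process m x \<in> admissible m \<and> (\<forall>s\<in>{0<..1}. norm (dq m (slice F (rev_process m x) s)) \<le> v + \<delta>)}
    (measure N {x \<in> space N. image_sup F E \<phi>' (Z x) \<le> ennreal v} + \<eta>)"
proof -
  let ?A = "\<lambda>m d. {z. z \<in> admissible m \<and> (\<forall>s\<in>{0<..1}. norm (dq m (slice F z s)) \<le> v + d)}"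
  have "\<exists>\<delta>>0. \<forall>\<^sub>F m in sequentially. ocover S {x. rev_process m x \<in> ?A m \<delta>}
      (measure N {x \<in> space N. Z x \<in> {z. image_sup F E \<phi>' z \<le> ennreal v}} + \<eta>)"
  proof (rule extended_continuous_mapping[OF _ _ _ \<eta>])
    show "?A m d \<subseteq> ?A m d'" if "d \<le> d'" for m d d'
      using that by fastforce
    show "{x \<in> space N. Z x \<in> {z. image_sup F E \<phi>' z \<le> ennreal v}} \<in> sets N"
      using image_sup_measurable by measurable
    fix x m zj
    assume x: "x \<in> space N" "regular_path F (Z x)" and m: "filterlim m at_top sequentially"
      and zj: "zj \<longlonglongrightarrow> Z x" and A: "\<And>k. zj k \<in> ?A (m k) (1 / real (Suc k))"
    have "norm (\<phi>' (slice F (Z x) s)) \<le> v" if s: "s \<in> {0<..1}" for s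
    proof -
      have "(\<lambda>k. norm (dq (m k) (slice F (zj k) s) - \<phi>' (slice F (Z x) s))) \<longlonglongrightarrow> 0"
        using A by (intro hadamard_uniform[OF hadamard zero_D0 m zj x(2) slice_D0[OF x(1)] _ s]) (auto simp: admissible_def)
      then have "(\<lambda>k. v + 1 / real (Suc k) + norm (dq (m k) (slice F (zj k) s) - \<phi>' (slice F (Z x) s))) \<longlonglongrightarrow> v + 0 + 0"
        by (intro tendsto_add tendsto_const LIMSEQ_Suc[OF lim_const_over_n])
      then have lim: "(\<lambda>k. v + 1 / real (Suc k) + norm (dq (m k) (slice F (zj k) s) - \<phi>' (slice F (Z x) s))) \<longlonglongrightarrow> v"
        by simp
      show ?thesis
      proof (rule LIMSEQ_le_const[OF lim], intro exI allI impI)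
        show "norm (\<phi>' (slice F (Z x) s)) \<le> v + 1 / real (Suc k) + norm (dq (m k) (slice F (zj k) s) - \<phi>' (slice F (Z x) s))" for k
        proof -
          have "norm (dq (m k) (slice F (zj k) s)) \<le> v + 1 / real (Suc k)"
            using A[of k] s by blast
          then show ?thesis
            using norm_triangle_ineq2[of "\<phi>' (slice F (Z x) s)" "dq (m k) (slice F (zj k) s)"]
            unfolding norm_minus_commute[of "\<phi>' (slice F (Z x) s)"] by linarith
        qed
      qed
    qed
    then show "Z x \<in> {z. image_sup F E \<phi>' z \<le> ennreal v}"
      using image_sup_le by auto
  qed
  then show ?thesis by simp
qed

end

section \<open>Tails of the deviation of the estimators\<close>

context hadamard_setup
begin

text \<open>Undoing the scaling: \<open>P\<close> plus \<open>1 / sqrt m\<close> times a section of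
  the reversed process is an empirical distribution, so the difference quotients are the scaled
  deviations of the plug-in estimator.\<close>

lemma rev_process_admissible:
  assumes m: "1 \<le> m" and D: "\<And>n. 1 \<le> n \<Longrightarrow> emp_dist F x n \<in> D\<phi>"
  shows "rev_process m x \<in> admissible m"
    and "s \<in> {0<..1} \<Longrightarrow> norm (dq m (slice F (rev_process m x) s)) =
      sqrt (real m) * norm (\<phi> (emp_dist F x (rev_index m s)) - \<phi> (true_dist F P))"
proof -
  have emp: "true_dist F P + (1 / sqrt (real m)) *\<^sub>R slice F (rev_process m x) s = emp_dist F x (rev_index m s)"
    and n1: "1 \<le> rev_index m s" if s: "s \<in> {0<..1}" for s
  proof -
    show n1: "1 \<le> rev_index m s"
      using rev_index_ge_self[of s m] s m by simp
    have "(1 / sqrt (real m)) *\<^sub>R slice F (rev_process m x) s = (1 / real (rev_index m s)) *\<^sub>R partial_sum dev x (rev_index m s)"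
      using m by (simp add: slice_rev_process[OF s] rev_mean_def)
    then show "true_dist F P + (1 / sqrt (real m)) *\<^sub>R slice F (rev_process m x) s = emp_dist F x (rev_index m s)"
      using emp_dist_diff[OF bounded_mean n1, of x] by (simp add: algebra_simps)
  qed
  show "rev_process m x \<in> admissible m"
    unfolding admissible_def using emp D[OF n1] by simp
  show "norm (dq m (slice F (rev_process m x) s)) =
      sqrt (real m) * norm (\<phi> (emp_dist F x (rev_index m s)) - \<phi> (true_dist F P))" if "s \<in> {0<..1}"
    using emp[OF that] by (simp add: diff_quot_def)
qed

text \<open>A continuous linear map on the span is bounded on norm-bounded sets, and the sections of
  one path are bounded by the norm of the path.\<close>

lemma image_sup_finite:
  assumes x: "x \<in> space N"
  shows "image_sup F E \<phi>' (Z x) < \<infinity>"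
proof -
  obtain L where L: "linear L" "continuous_on (span D0) L" "\<And>h. h \<in> D0 \<Longrightarrow> L h = \<phi>' h"
    using continuous_linear by (auto simp: continuous_linear_on_def)
  have "0 \<in> span D0"
    by (rule span_zero)
  then obtain \<delta> where \<delta>: "0 < \<delta>" "\<And>h. h \<in> span D0 \<Longrightarrow> dist h 0 < \<delta> \<Longrightarrow> dist (L h) (L 0) < 1"
    using L(2) zero_less_one[where 'a=real] unfolding continuous_on_iff by meson
  define r where "r = norm (Z x)"
  have r: "0 \<le> r"
    by (simp add: r_def)
  have "norm (\<phi>' (slice F (Z x) s)) \<le> 2 * (r + 1) / \<delta>" if s: "s \<in> {0<..1}" for s
  proof -
    \<comment> \<open>The scaling brings the section strictly into the ball of radius
      \<open>\<delta>\<close>; adding 1 to \<open>r\<close> keeps the denominator positive for the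
      zero path.\<close>
    let ?h = "slice F (Z x) s" and ?c = "\<delta> / (2 * (r + 1))"
    have n: "0 < r + 1" "r < 2 * (r + 1)" "2 * (r + 1) \<noteq> 0"
      using r by auto
    then have c: "0 < ?c"
      using \<delta>(1) by simp
    have "norm (?c *\<^sub>R ?h) = ?c * norm ?h"
      by (simp only: norm_scaleR abs_of_pos[OF c])
    also have "\<dots> \<le> ?c * r"
      by (rule mult_left_mono[OF norm_slice_le[of F "Z x" s, folded r_def] less_imp_le[OF c]])
    also have "\<dots> < ?c * (2 * (r + 1))"
      by (rule mult_strict_left_mono[OF n(2) c])
    also have "\<dots> = \<delta>"
      by (rule nonzero_eq_divide_eq[THEN iffD1, OF n(3) refl])
    finally have "norm (L (?c *\<^sub>R ?h)) < 1"
      using \<delta>(2)[OF span_mul[OF span_base[OF slice_D0[OF x s]]], of ?c] linear_0[OF L(1)] by simp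
    then have "?c * norm (\<phi>' ?h) < 1"
      using L(3)[OF slice_D0[OF x s]] by (simp only: linear_scale[OF L(1)] norm_scaleR abs_of_pos[OF c])
    then have "norm (\<phi>' ?h) < 1 / ?c"
      by (subst pos_less_divide_eq[OF c], subst mult.commute)
    also have "1 / ?c = 2 * (r + 1) / \<delta>"
      by (simp only: divide_divide_eq_right mult_1)
    finally show ?thesis
      by (rule less_imp_le)
  qed
  then have "image_sup F E \<phi>' (Z x) \<le> ennreal (2 * (r + 1) / \<delta>)"
    by (rule image_sup_le)
  then show ?thesis
    unfolding infinity_ennreal_def by (rule le_less_trans[OF _ ennreal_less_top])
qed

lemma image_sup_tail:
  assumes "0 < \<eta>"
  shows "\<exists>v. measure N {x \<in> space N. ennreal v \<le> image_sup F E \<phi>' (Z x)} < \<eta>"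
proof -
  interpret N: prob_space N by (rule prob_space_N)
  let ?D = "\<lambda>k::nat. {x \<in> space N. ennreal (real k) \<le> image_sup F E \<phi>' (Z x)}"
  have D: "?D k \<in> sets N" for k
    by (intro borel_measurable_le borel_measurable_const image_sup_measurable)
  have decD: "decseq ?D"
  proof (rule antimonoI)
    fix k l :: nat assume "k \<le> l"
    then have "ennreal (real k) \<le> ennreal (real l)"
      by (intro ennreal_leI) simp
    then show "?D l \<subseteq> ?D k"
      by (intro Collect_mono impI conjI) (elim conjE, assumption, elim conjE, rule order_trans)
  qed
  have "range ?D \<subseteq> sets N"
    by (rule image_subsetI) (rule D)
  then have "(\<lambda>k. measure N (?D k)) \<longlonglongrightarrow> measure N (\<Inter>k. ?D k)"
    by (rule N.finite_Lim_measure_decseq[OF _ decD])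
  moreover have "(\<Inter>k. ?D k) = {}"
  proof -
    have "x \<notin> (\<Inter>k. ?D k)" for x
    proof
      assume x: "x \<in> (\<Inter>k. ?D k)"
      then have "image_sup F E \<phi>' (Z x) < top"
        using image_sup_finite[of x] unfolding infinity_ennreal_def by blast
      then obtain k where "image_sup F E \<phi>' (Z x) < of_nat k"
        using ennreal_Ex_less_of_nat by blast
      moreover have "ennreal (real k) \<le> image_sup F E \<phi>' (Z x)"
        using x by blast
      ultimately show False
        by (simp add: ennreal_of_nat_eq_real_of_nat)
    qed
    then show ?thesis by blast
  qed
  ultimately have "(\<lambda>k. measure N (?D k)) \<longlonglongrightarrow> 0"
    by (simp only: measure_empty)
  then have "\<forall>\<^sub>F k in sequentially. measure N (?D k) < \<eta>"
    using assms by (rule order_tendstoD(2))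
  then obtain k where "measure N (?D k) < \<eta>"
    using eventually_happens[of _ sequentially] trivial_limit_sequentially by blast
  then show ?thesis
    by blast
qed

end

text \<open>Both claims on last times are instances: the plug-in estimator is the case in which the
  remainder is 0.\<close>

locale sampled_estimator = hadamard_setup P F B E D\<phi> D0 \<phi> \<phi>' N Z
  for P :: "'x measure" and F :: "('x \<Rightarrow> real) set" and B :: real and E :: "'e set"
    and D\<phi> D0 :: "('x \<Rightarrow> real) bfun set" and \<phi> \<phi>' :: "('x \<Rightarrow> real) bfun \<Rightarrow> 'e bfun"
    and N :: "'v measure" and Z :: "'v \<Rightarrow> (real \<times> ('x \<Rightarrow> real)) bfun" +
  fixes M :: "'w measure" and X :: "nat \<Rightarrow> 'w \<Rightarrow> 'x"
    and est R :: "nat \<Rightarrow> 'w \<Rightarrow> 'e bfun"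
  assumes prob_space_M: "prob_space M"
    and sequence_measurable: "(\<lambda>\<omega> i. X i \<omega>) \<in> measurable M (PiM UNIV (\<lambda>_. P))"
    and sequence_distr: "distr M (PiM UNIV (\<lambda>_. P)) (\<lambda>\<omega> i. X i \<omega>) = PiM UNIV (\<lambda>_. P)"
    and emp_dist_in: "1 \<le> n \<Longrightarrow> \<omega> \<in> space M \<Longrightarrow> emp_dist F (\<lambda>i. X i \<omega>) n \<in> D\<phi>"
    and est_eq: "1 \<le> n \<Longrightarrow> \<omega> \<in> space M \<Longrightarrow> est n \<omega> = \<phi> (emp_dist F (\<lambda>i. X i \<omega>) n) + R n \<omega>"
    and remainder: "outer_prob_tendsto_0 M
      (\<lambda>m \<omega>. ennreal (sqrt (real m)) * (SUP n\<in>{m..}. ennreal (norm (R n \<omega>))))"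
begin

abbreviation \<phi>P :: "'e bfun" where
  "\<phi>P \<equiv> \<phi> (true_dist F P)"

lemma remainder_small:
  assumes "0 < \<delta>" "0 < \<eta>"
  shows "\<forall>\<^sub>F m in sequentially. ocover M {\<omega>. \<exists>n\<ge>m. sqrt (real m) * norm (R n \<omega>) > \<delta>} \<eta>"
proof -
  let ?Y = "\<lambda>m \<omega>. ennreal (sqrt (real m)) * (SUP n\<in>{m..}. ennreal (norm (R n \<omega>)))"
  have "(\<lambda>m. outer_measure_of M {\<omega> \<in> space M. ?Y m \<omega> > ennreal \<delta>}) \<longlonglongrightarrow> 0"
    using remainder assms(1) by (simp add: outer_prob_tendsto_0_def)
  then have "\<forall>\<^sub>F m in sequentially. outer_measure_of M {\<omega> \<in> space M. ?Y m \<omega> > ennreal \<delta>} < ennreal \<eta>"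
    using assms(2) by (intro order_tendstoD(2)[of _ 0]) auto
  then show ?thesis
  proof eventually_elim
    case (elim m)
    show ?case
    proof (rule ocover_mono[OF ocover_outer_measure[OF prob_space_M elim]])
      show "{\<omega>. \<exists>n\<ge>m. sqrt (real m) * norm (R n \<omega>) > \<delta>} \<inter> space M \<subseteq> {\<omega> \<in> space M. ?Y m \<omega> > ennreal \<delta>}"
      proof
        fix \<omega> assume "\<omega> \<in> {\<omega>. \<exists>n\<ge>m. sqrt (real m) * norm (R n \<omega>) > \<delta>} \<inter> space M"
        then obtain n where n: "n \<ge> m" "sqrt (real m) * norm (R n \<omega>) > \<delta>" and \<omega>: "\<omega> \<in> space M"
          by auto
        have "ennreal \<delta> < ennreal (sqrt (real m) * norm (R n \<omega>))"
          using n assms(1) by (intro ennreal_lessI) auto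
        also have "\<dots> = ennreal (sqrt (real m)) * ennreal (norm (R n \<omega>))"
          by (simp add: ennreal_mult)
        also have "\<dots> \<le> ?Y m \<omega>"
          using n by (intro mult_left_mono SUP_upper2[of n]) auto
        finally show "\<omega> \<in> {\<omega> \<in> space M. ?Y m \<omega> > ennreal \<delta>}"
          using \<omega> by simp
      qed
    qed auto
  qed
qed

lemma scaled_deviation:
  assumes "1 \<le> n" "\<omega> \<in> space M"
  shows "\<bar>sqrt (real m) * norm (est n \<omega> - \<phi>P) - sqrt (real m) * norm (\<phi> (emp_dist F (\<lambda>i. X i \<omega>) n) - \<phi>P)\<bar>
    \<le> sqrt (real m) * norm (R n \<omega>)"
proof -
  have "est n \<omega> - \<phi>P - (\<phi> (emp_dist F (\<lambda>i. X i \<omega>) n) - \<phi>P) = R n \<omega>"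
    using est_eq[OF assms] by simp
  then have "\<bar>norm (est n \<omega> - \<phi>P) - norm (\<phi> (emp_dist F (\<lambda>i. X i \<omega>) n) - \<phi>P)\<bar> \<le> norm (R n \<omega>)"
    using norm_triangle_ineq3[of "est n \<omega> - \<phi>P" "\<phi> (emp_dist F (\<lambda>i. X i \<omega>) n) - \<phi>P"] by simp
  then have "sqrt (real m) * \<bar>norm (est n \<omega> - \<phi>P) - norm (\<phi> (emp_dist F (\<lambda>i. X i \<omega>) n) - \<phi>P)\<bar> \<le> sqrt (real m) * norm (R n \<omega>)"
    by (intro mult_left_mono) auto
  then show ?thesis
    by (simp add: abs_mult right_diff_distrib[symmetric])
qed

text \<open>Every \<open>n \<ge> m\<close> is the index of some \<open>s\<close> in
  \<open>{0<..1}\<close>, so the supremum over later sample sizes is one over reversed times; the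
  margin \<open>\<delta>\<close> in \<open>upper_tail\<close> absorbs the remainder.\<close>

lemma deviation_upper_tail:
  assumes \<eta>: "0 < \<eta>"
  shows "\<forall>\<^sub>F m in sequentially. ocover M {\<omega>. \<exists>n\<ge>m. v \<le> sqrt (real m) * norm (est n \<omega> - \<phi>P)}
    (measure N {x \<in> space N. ennreal v \<le> image_sup F E \<phi>' (Z x)} + \<eta>)"
proof -
  let ?p = "measure N {x \<in> space N. ennreal v \<le> image_sup F E \<phi>' (Z x)}"
  let ?A = "\<lambda>m d. {x. rev_process m x \<in> admissible m \<and> (\<exists>s\<in>{0<..1}. v - d \<le> norm (dq m (slice F (rev_process m x) s)))}"
  have \<eta>2: "0 < \<eta> / 2"
    using \<eta> by simp
  obtain \<delta> where \<delta>: "0 < \<delta>" and up: "\<forall>\<^sub>F m in sequentially. ocover S (?A m \<delta>) (?p + \<eta> / 2)"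
    using upper_tail[OF \<eta>2, of v] by (elim exE conjE) (rule that)
  show ?thesis
    using up remainder_small[OF \<delta> \<eta>2] eventually_ge_at_top[of 1]
  proof eventually_elim
    case (elim m)
    note oc = ocover_Un[OF prob_space_M ocover_vimage[OF sequence_measurable sequence_distr elim(1) prob_space_M] elim(2)]
    show ?case
    proof (rule ocover_mono[OF oc])
      show "{\<omega>. \<exists>n\<ge>m. v \<le> sqrt (real m) * norm (est n \<omega> - \<phi>P)} \<inter> space M \<subseteq>
          {\<omega>. (\<lambda>i. X i \<omega>) \<in> ?A m \<delta>} \<union> {\<omega>. \<exists>n\<ge>m. sqrt (real m) * norm (R n \<omega>) > \<delta>}"
      proof
        fix \<omega> assume "\<omega> \<in> {\<omega>. \<exists>n\<ge>m. v \<le> sqrt (real m) * norm (est n \<omega> - \<phi>P)} \<inter> space M"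
        then obtain n where n: "n \<ge> m" "v \<le> sqrt (real m) * norm (est n \<omega> - \<phi>P)" and \<omega>: "\<omega> \<in> space M"
          by blast
        show "\<omega> \<in> {\<omega>. (\<lambda>i. X i \<omega>) \<in> ?A m \<delta>} \<union> {\<omega>. \<exists>n\<ge>m. sqrt (real m) * norm (R n \<omega>) > \<delta>}"
        proof (cases "sqrt (real m) * norm (R n \<omega>) > \<delta>")
          case True
          then show ?thesis
            using n by blast
        next
          case False
          obtain s where s: "s \<in> {0<..1}" "rev_index m s = n"
            using rev_index_surj[OF elim(3) n(1)] by (elim bexE) (rule that)
          have "n \<ge> 1"
            using n elim(3) by simp
          from scaled_deviation[OF this \<omega>, of m]
          have "v - \<delta> \<le> sqrt (real m) * norm (\<phi> (emp_dist F (\<lambda>i. X i \<omega>) n) - \<phi>P)"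
            using n(2) False by linarith
          also have "\<dots> = norm (dq m (slice F (rev_process m (\<lambda>i. X i \<omega>)) s))"
            using rev_process_admissible(2)[OF elim(3) emp_dist_in[OF _ \<omega>] s(1)] s(2) by simp
          finally have "(\<lambda>i. X i \<omega>) \<in> ?A m \<delta>"
            using rev_process_admissible(1)[OF elim(3) emp_dist_in[OF _ \<omega>]] s(1) by blast
          then show ?thesis
            by blast
        qed
      qed
    qed simp
  qed
qed

text \<open>Every reversed time has an index of at least \<open>m\<close>, so a bound for all later
  sample sizes holds at all reversed times, after enlarging \<open>v\<close> by the
  \<open>\<delta>\<close> that the remainder may cost.\<close>

lemma deviation_lower_tail:
  assumes \<eta>: "0 < \<eta>" and v: "0 \<le> v"
  shows "\<forall>\<^sub>F m in sequentially. ocover M {\<omega>. \<forall>n\<ge>m. sqrt (real m) * norm (est n \<omega> - \<phi>P) \<le> v}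
    (measure N {x \<in> space N. image_sup F E \<phi>' (Z x) \<le> ennreal v} + \<eta>)"
proof -
  let ?p = "measure N {x \<in> space N. image_sup F E \<phi>' (Z x) \<le> ennreal v}"
  let ?A = "\<lambda>m d. {x. rev_process m x \<in> admissible m \<and> (\<forall>s\<in>{0<..1}. norm (dq m (slice F (rev_process m x) s)) \<le> v + d)}"
  have \<eta>2: "0 < \<eta> / 2"
    using \<eta> by simp
  obtain \<delta> where \<delta>: "0 < \<delta>" and low: "\<forall>\<^sub>F m in sequentially. ocover S (?A m \<delta>) (?p + \<eta> / 2)"
    using lower_tail[OF \<eta>2 v] by (elim exE conjE) (rule that)
  show ?thesis
    using low remainder_small[OF \<delta> \<eta>2] eventually_ge_at_top[of 1]
  proof eventually_elim
    case (elim m)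
    note oc = ocover_Un[OF prob_space_M ocover_vimage[OF sequence_measurable sequence_distr elim(1) prob_space_M] elim(2)]
    show ?case
    proof (rule ocover_mono[OF oc])
      show "{\<omega>. \<forall>n\<ge>m. sqrt (real m) * norm (est n \<omega> - \<phi>P) \<le> v} \<inter> space M \<subseteq>
          {\<omega>. (\<lambda>i. X i \<omega>) \<in> ?A m \<delta>} \<union> {\<omega>. \<exists>n\<ge>m. sqrt (real m) * norm (R n \<omega>) > \<delta>}"
      proof
        fix \<omega> assume "\<omega> \<in> {\<omega>. \<forall>n\<ge>m. sqrt (real m) * norm (est n \<omega> - \<phi>P) \<le> v} \<inter> space M"
        then have n: "\<And>n. n \<ge> m \<Longrightarrow> sqrt (real m) * norm (est n \<omega> - \<phi>P) \<le> v" and \<omega>: "\<omega> \<in> space M"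
          by blast+
        show "\<omega> \<in> {\<omega>. (\<lambda>i. X i \<omega>) \<in> ?A m \<delta>} \<union> {\<omega>. \<exists>n\<ge>m. sqrt (real m) * norm (R n \<omega>) > \<delta>}"
        proof (cases "\<exists>n\<ge>m. sqrt (real m) * norm (R n \<omega>) > \<delta>")
          case True
          then show ?thesis
            by blast
        next
          case False
          have "norm (dq m (slice F (rev_process m (\<lambda>i. X i \<omega>)) s)) \<le> v + \<delta>" if s: "s \<in> {0<..1}" for s
          proof -
            have nm: "m \<le> rev_index m s" "1 \<le> rev_index m s"
              using rev_index_ge_self[of s m] s elim(3) by simp_all
            have "sqrt (real m) * norm (R (rev_index m s) \<omega>) \<le> \<delta>"
              using False nm(1) not_less by blast
            then show ?thesis
              using scaled_deviation[OF nm(2) \<omega>, of m] n[OF nm(1)]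
                rev_process_admissible(2)[OF elim(3) emp_dist_in[OF _ \<omega>] s] by linarith
          qed
          then have "(\<lambda>i. X i \<omega>) \<in> ?A m \<delta>"
            using rev_process_admissible(1)[OF elim(3) emp_dist_in[OF _ \<omega>]] by blast
          then show ?thesis
            by blast
        qed
      qed
    qed simp
  qed
qed

text \<open>The upper tail bound forces the estimators towards the plug-in value at rate
  \<open>1 / sqrt m\<close>, while outer almost sure convergence forces them towards
  \<open>\<theta>\<close>. With positive probability both happen at one sample point, which is
  impossible at distance \<open>2 * d\<close>.\<close>

lemma limit_unique:
  assumes "outer_as_tendsto M est \<theta>"
  shows "\<theta> = \<phi>P"
proof (rule ccontr)
  interpret M: prob_space M by (rule prob_space_M)
  assume "\<theta> \<noteq> \<phi>P"
  define d where "d = dist \<theta> \<phi>P / 2"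
  have d: "0 < d"
    using \<open>\<theta> \<noteq> \<phi>P\<close> by (simp add: d_def)
  obtain \<Delta> where \<Delta>: "\<And>n. measurable_cover M (\<lambda>\<omega>. ennreal (dist (est n \<omega>) \<theta>)) (\<Delta> n)"
    and lim: "AE \<omega> in M. (\<lambda>n. \<Delta> n \<omega>) \<longlonglongrightarrow> 0"
    using assms unfolding outer_as_tendsto_def by (elim exE conjE) (rule that, auto)
  have m\<Delta>: "\<Delta> n \<in> borel_measurable M" for n
    using \<Delta>[of n] by (simp add: measurable_cover_def)
  let ?G = "\<lambda>n. {\<omega> \<in> space M. ennreal d \<le> \<Delta> n \<omega>}"
  have G: "?G n \<in> sets M" for n
    by (intro borel_measurable_le borel_measurable_const m\<Delta>)
  \<comment> \<open>Almost sure convergence of the measurable covers gives convergence in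
    probability, by dominated convergence.\<close>
  have "(\<lambda>n. \<integral>\<omega>. indicator (?G n) \<omega> \<partial>M) \<longlonglongrightarrow> (\<integral>\<omega>. 0 \<partial>M :: real)"
  proof (rule integral_dominated_convergence[where w="\<lambda>_. 1"])
    show "AE \<omega> in M. (\<lambda>n. indicator (?G n) \<omega>) \<longlonglongrightarrow> (0::real)"
      using lim
    proof eventually_elim
      case (elim \<omega>)
      then have "\<forall>\<^sub>F n in sequentially. \<Delta> n \<omega> < ennreal d"
        using d by (intro order_tendstoD(2)[of _ 0]) auto
      then have "\<forall>\<^sub>F n in sequentially. indicator (?G n) \<omega> = (0::real)"
        by eventually_elim (auto simp: indicator_def not_le)
      then show ?case
        by (rule tendsto_eventually)
    qed
  qed (use G in \<open>auto simp: indicator_def\<close>)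
  then have "(\<lambda>n. measure M (?G n)) \<longlonglongrightarrow> 0"
    using G by simp
  then have near: "\<forall>\<^sub>F n in sequentially. measure M (?G n) < 1 / 4"
    by (rule order_tendstoD(2)) simp
  obtain v where v: "measure N {x \<in> space N. ennreal v \<le> image_sup F E \<phi>' (Z x)} < 1 / 4"
    using image_sup_tail[of "1 / 4"] by auto
  have "filterlim (\<lambda>m. sqrt (real m) * d) at_top sequentially"
    using d by real_asymp
  then have large: "\<forall>\<^sub>F m in sequentially. v \<le> sqrt (real m) * d"
    by (auto simp: filterlim_at_top)
  have "0 < (1 / 4 :: real)"
    by simp
  from deviation_upper_tail[OF this, of v] near large
  have "\<forall>\<^sub>F m in sequentially. False"
  proof eventually_elim
    case (elim m)
    have "ocover M (?G m) (1 / 4)"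
      by (rule ocoverI[OF G]) (use elim(2) in auto)
    note oc = ocover_Un[OF prob_space_M elim(1) this]
    obtain \<omega> where \<omega>: "\<omega> \<in> space M"
      and out: "\<omega> \<notin> {\<omega>. \<exists>n\<ge>m. v \<le> sqrt (real m) * norm (est n \<omega> - \<phi>P)} \<union> ?G m"
      using ocover_nonfull[OF oc _ prob_space_M] v by auto
    have "ennreal (dist (est m \<omega>) \<theta>) \<le> \<Delta> m \<omega>"
      using \<Delta>[of m] \<omega> by (simp add: measurable_cover_def)
    also have "\<dots> < ennreal d"
      using out \<omega> by (simp add: not_le)
    finally have "dist (est m \<omega>) \<theta> < d"
      by (simp add: ennreal_less_iff)
    then have "d \<le> norm (est m \<omega> - \<phi>P)"
      using dist_triangle2[of \<theta> \<phi>P "est m \<omega>"] unfolding d_def by (simp add: dist_commute flip: dist_norm)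
    then have "sqrt (real m) * d \<le> sqrt (real m) * norm (est m \<omega> - \<phi>P)"
      by (rule mult_left_mono) simp
    then show False
      using out elim(3) by (auto intro: order_trans)
  qed
  then show False
    by simp
qed

end

section \<open>Weak convergence of nonnegative extended real random elements\<close>

text \<open>The upper half of convergence of outer expectations to \<open>l\<close>, expressed by
  majorants. Outer expectation is only subadditive, so sums are handled on this half alone; the
  lower half is the same statement for \<open>- g\<close>.\<close>

definition dominated_in_mean ::
  "'w measure \<Rightarrow> ('i \<Rightarrow> 'w \<Rightarrow> 'b) \<Rightarrow> 'i filter \<Rightarrow> ('b \<Rightarrow> real) \<Rightarrow> real \<Rightarrow> bool" where
  "dominated_in_mean M Y G g l \<longleftrightarrow> (\<forall>\<eta>>0. \<forall>\<^sub>F i in G.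
     \<exists>U. integrable M U \<and> (\<forall>\<omega>\<in>space M. g (Y i \<omega>) \<le> U \<omega>) \<and> (\<integral>\<omega>. U \<omega> \<partial>M) \<le> l + \<eta>)"

lemma dominated_in_mean_const: "prob_space M \<Longrightarrow> dominated_in_mean M Y G (\<lambda>_. c) c"
  unfolding dominated_in_mean_def
proof (intro allI impI always_eventually)
  fix i and \<eta> :: real assume "prob_space M" "0 < \<eta>"
  then interpret prob_space M by simp
  show "\<exists>U. integrable M U \<and> (\<forall>\<omega>\<in>space M. c \<le> U \<omega>) \<and> (\<integral>\<omega>. U \<omega> \<partial>M) \<le> c + \<eta>"
    using \<open>0 < \<eta>\<close> by (intro exI[of _ "\<lambda>_. c"]) (simp add: prob_space)
qed

lemma dominated_in_mean_add:
  assumes "dominated_in_mean M Y G g l" "dominated_in_mean M Y G h k"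
  shows "dominated_in_mean M Y G (\<lambda>z. g z + h z) (l + k)"
  unfolding dominated_in_mean_def
proof (intro allI impI)
  fix \<eta> :: real assume "0 < \<eta>"
  then have \<eta>: "0 < \<eta> / 2"
    by simp
  have "\<forall>\<^sub>F i in G. \<exists>U. integrable M U \<and> (\<forall>\<omega>\<in>space M. g (Y i \<omega>) \<le> U \<omega>) \<and> (\<integral>\<omega>. U \<omega> \<partial>M) \<le> l + \<eta> / 2"
    "\<forall>\<^sub>F i in G. \<exists>U. integrable M U \<and> (\<forall>\<omega>\<in>space M. h (Y i \<omega>) \<le> U \<omega>) \<and> (\<integral>\<omega>. U \<omega> \<partial>M) \<le> k + \<eta> / 2"
    using assms \<eta> unfolding dominated_in_mean_def by blast+
  then show "\<forall>\<^sub>F i in G. \<exists>U. integrable M U \<and> (\<forall>\<omega>\<in>space M. g (Y i \<omega>) + h (Y i \<omega>) \<le> U \<omega>) \<and> (\<integral>\<omega>. U \<omega> \<partial>M) \<le> l + k + \<eta>"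
  proof eventually_elim
    case (elim i)
    obtain U where U: "integrable M U" "\<And>\<omega>. \<omega> \<in> space M \<Longrightarrow> g (Y i \<omega>) \<le> U \<omega>" "(\<integral>\<omega>. U \<omega> \<partial>M) \<le> l + \<eta> / 2"
      using elim(1) by blast
    obtain V where V: "integrable M V" "\<And>\<omega>. \<omega> \<in> space M \<Longrightarrow> h (Y i \<omega>) \<le> V \<omega>" "(\<integral>\<omega>. V \<omega> \<partial>M) \<le> k + \<eta> / 2"
      using elim(2) by blast
    show ?case
      using U V by (intro exI[of _ "\<lambda>\<omega>. U \<omega> + V \<omega>"]) (auto intro!: add_mono)
  qed
qed

lemma dominated_in_mean_sum:
  assumes "prob_space M" "finite I" "\<And>j. j \<in> I \<Longrightarrow> dominated_in_mean M Y G (g j) (l j)"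
  shows "dominated_in_mean M Y G (\<lambda>z. \<Sum>j\<in>I. g j z) (\<Sum>j\<in>I. l j)"
  using assms(2,3)
proof (induction I)
  case empty
  then show ?case
    using dominated_in_mean_const[OF assms(1), of Y G 0] by simp
next
  case (insert j I)
  then show ?case
    using dominated_in_mean_add[of M Y G "g j" "l j"] by simp
qed

lemma dominated_in_mean_approx:
  assumes M: "prob_space M"
    and approx: "\<And>\<eta>. 0 < \<eta> \<Longrightarrow> \<exists>h k. dominated_in_mean M Y G h k \<and> (\<forall>z. g z \<le> h z + \<eta>) \<and> k \<le> l + \<eta>"
  shows "dominated_in_mean M Y G g l"
  unfolding dominated_in_mean_def
proof (intro allI impI)
  fix \<eta> :: real assume "0 < \<eta>"
  interpret prob_space M by fact
  have \<eta>: "0 < \<eta> / 3"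
    using \<open>0 < \<eta>\<close> by simp
  obtain h k where hk: "dominated_in_mean M Y G h k" "\<And>z. g z \<le> h z + \<eta> / 3" "k \<le> l + \<eta> / 3"
    using approx[OF \<eta>] by blast
  have "\<forall>\<^sub>F i in G. \<exists>U. integrable M U \<and> (\<forall>\<omega>\<in>space M. h (Y i \<omega>) \<le> U \<omega>) \<and> (\<integral>\<omega>. U \<omega> \<partial>M) \<le> k + \<eta> / 3"
    using hk(1) \<eta> unfolding dominated_in_mean_def by blast
  then show "\<forall>\<^sub>F i in G. \<exists>U. integrable M U \<and> (\<forall>\<omega>\<in>space M. g (Y i \<omega>) \<le> U \<omega>) \<and> (\<integral>\<omega>. U \<omega> \<partial>M) \<le> l + \<eta>"
  proof eventually_elim
    case (elim i)
    then obtain U where U: "integrable M U" "\<And>\<omega>. \<omega> \<in> space M \<Longrightarrow> h (Y i \<omega>) \<le> U \<omega>" "(\<integral>\<omega>. U \<omega> \<partial>M) \<le> k + \<eta> / 3"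
      by blast
    show ?case
    proof (intro exI[of _ "\<lambda>\<omega>. U \<omega> + \<eta> / 3"] conjI ballI)
      show "g (Y i \<omega>) \<le> U \<omega> + \<eta> / 3" if "\<omega> \<in> space M" for \<omega>
        using hk(2)[of "Y i \<omega>"] U(2)[OF that] by linarith
      have "(\<integral>\<omega>. U \<omega> + \<eta> / 3 \<partial>M) = (\<integral>\<omega>. U \<omega> \<partial>M) + \<eta> / 3"
        using U(1) by (simp add: prob_space)
      then show "(\<integral>\<omega>. U \<omega> + \<eta> / 3 \<partial>M) \<le> l + \<eta>"
        using U(3) hk(3) by linarith
    qed (use U(1) in simp)
  qed
qed

text \<open>A majorant of \<open>g\<close> plus a majorant of \<open>- g\<close> is nonnegative, so
  the second hypothesis bounds the integrals of all majorants of \<open>g\<close> from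
  below.\<close>

lemma outer_expectation_tendsto:
  assumes M: "prob_space M" and bnd: "\<And>z. \<bar>g z\<bar> \<le> C"
    and up: "dominated_in_mean M Y G g l" and low: "dominated_in_mean M Y G (\<lambda>z. - g z) (- l)"
  shows "((\<lambda>i. outer_expectation M (\<lambda>\<omega>. g (Y i \<omega>))) \<longlongrightarrow> l) G"
proof (rule tendstoI)
  fix e :: real assume "0 < e"
  interpret prob_space M by fact
  have e: "0 < e / 2"
    using \<open>0 < e\<close> by simp
  have "\<forall>\<^sub>F i in G. \<exists>U. integrable M U \<and> (\<forall>\<omega>\<in>space M. g (Y i \<omega>) \<le> U \<omega>) \<and> (\<integral>\<omega>. U \<omega> \<partial>M) \<le> l + e / 2"
    "\<forall>\<^sub>F i in G. \<exists>U. integrable M U \<and> (\<forall>\<omega>\<in>space M. - g (Y i \<omega>) \<le> U \<omega>) \<and> (\<integral>\<omega>. U \<omega> \<partial>M) \<le> - l + e / 2"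
    using up low e unfolding dominated_in_mean_def by blast+
  then show "\<forall>\<^sub>F i in G. dist (outer_expectation M (\<lambda>\<omega>. g (Y i \<omega>))) l < e"
  proof eventually_elim
    case (elim i)
    let ?A = "{(\<integral>\<omega>. U \<omega> \<partial>M) | U. integrable M U \<and> (\<forall>\<omega>\<in>space M. g (Y i \<omega>) \<le> U \<omega>)}"
    obtain U where U: "integrable M U" "\<And>\<omega>. \<omega> \<in> space M \<Longrightarrow> g (Y i \<omega>) \<le> U \<omega>" "(\<integral>\<omega>. U \<omega> \<partial>M) \<le> l + e / 2"
      using elim(1) by blast
    obtain V where V: "integrable M V" "\<And>\<omega>. \<omega> \<in> space M \<Longrightarrow> - g (Y i \<omega>) \<le> V \<omega>" "(\<integral>\<omega>. V \<omega> \<partial>M) \<le> - l + e / 2"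
      using elim(2) by blast
    have lb: "l - e / 2 \<le> x" if x: "x \<in> ?A" for x
    proof -
      obtain W where W: "x = (\<integral>\<omega>. W \<omega> \<partial>M)" "integrable M W" "\<And>\<omega>. \<omega> \<in> space M \<Longrightarrow> g (Y i \<omega>) \<le> W \<omega>"
        using x by blast
      have "0 \<le> (\<integral>\<omega>. V \<omega> + W \<omega> \<partial>M)"
      proof (rule Bochner_Integration.integral_nonneg)
        show "0 \<le> V \<omega> + W \<omega>" if "\<omega> \<in> space M" for \<omega>
          using V(2)[OF that] W(3)[OF that] by linarith
      qed
      also have "\<dots> = (\<integral>\<omega>. V \<omega> \<partial>M) + x"
        using V(1) W(1,2) by simp
      finally show ?thesis
        using V(3) by linarith
    qed
    have UA: "(\<integral>\<omega>. U \<omega> \<partial>M) \<in> ?A"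
      using U by blast
    have "l - e / 2 \<le> Inf ?A"
      using UA by (intro cInf_greatest lb) blast+
    moreover have "Inf ?A \<le> (\<integral>\<omega>. U \<omega> \<partial>M)"
      by (rule cInf_lower[OF UA bdd_belowI[OF lb]])
    ultimately show ?case
      using U(3) e unfolding outer_expectation_def dist_real_def by linarith
  qed
qed

text \<open>For \<open>c \<ge> 0\<close> a cover of the upper ray event serves as majorant; for
  \<open>c < 0\<close> it is one minus a cover of the lower ray event, times \<open>c\<close>. The
  two limits agree because \<open>L\<close> has no atom at \<open>b\<close>.\<close>

lemma dominated_in_mean_ray:
  fixes Y :: "'i \<Rightarrow> 'w \<Rightarrow> ennreal" and L :: "'v \<Rightarrow> ennreal"
  assumes M: "prob_space M" and N: "prob_space N" and L: "L \<in> borel_measurable N"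
    and up: "\<And>\<eta>. 0 < \<eta> \<Longrightarrow> \<forall>\<^sub>F i in G. ocover M {\<omega>. b \<le> Y i \<omega>} (measure N {x \<in> space N. b \<le> L x} + \<eta>)"
    and low: "\<And>\<eta>. 0 < \<eta> \<Longrightarrow> \<forall>\<^sub>F i in G. ocover M {\<omega>. Y i \<omega> \<le> b} (measure N {x \<in> space N. L x \<le> b} + \<eta>)"
    and cont: "measure N {x \<in> space N. L x = b} = 0"
  shows "dominated_in_mean M Y G (\<lambda>z. c * indicator {b..} z) (c * measure N {x \<in> space N. b \<le> L x})"
  unfolding dominated_in_mean_def
proof (intro allI impI)
  fix \<eta> :: real assume \<eta>: "0 < \<eta>"
  interpret M: prob_space M by fact
  interpret N: prob_space N by fact
  let ?p = "measure N {x \<in> space N. b \<le> L x}" and ?q = "measure N {x \<in> space N. L x \<le> b}"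
  show "\<forall>\<^sub>F i in G. \<exists>U. integrable M U \<and> (\<forall>\<omega>\<in>space M. c * indicator {b..} (Y i \<omega>) \<le> U \<omega>) \<and>
    (\<integral>\<omega>. U \<omega> \<partial>M) \<le> c * ?p + \<eta>"
  proof (cases "0 \<le> c")
    case True
    define d where "d = \<eta> / (c + 1)"
    have d: "0 < d" "c * d \<le> \<eta>"
      using True \<eta> by (auto simp: d_def field_simps)
    show ?thesis
      using up[OF d(1)]
    proof eventually_elim
      case (elim i)
      then obtain B where B: "B \<in> sets M" "{\<omega>. b \<le> Y i \<omega>} \<inter> space M \<subseteq> B" "measure M B \<le> ?p + d"
        by (auto simp: ocover_def)
      have "c * measure M B \<le> c * (?p + d)"
        using B(3) True by (rule mult_left_mono)
      then have "c * measure M B \<le> c * ?p + \<eta>"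
        using d(2) by (simp add: distrib_left)
      moreover have "c * indicator {b..} (Y i \<omega>) \<le> c * indicator B \<omega>" if "\<omega> \<in> space M" for \<omega>
        using B(2) that True by (intro mult_left_mono) (auto simp: indicator_def)
      ultimately show ?case
        using B(1) by (intro exI[of _ "\<lambda>\<omega>. c * indicator B \<omega>"]) (auto simp: M.emeasure_eq_measure)
    qed
  next
    case False
    define d where "d = \<eta> / (1 - c)"
    have d: "0 < d" "- c * d \<le> \<eta>"
      using False \<eta> by (auto simp: d_def field_simps)
    have "?p = 1 - ?q"
    proof -
      have sets: "{x \<in> space N. b \<le> L x} \<in> sets N" "{x \<in> space N. L x \<le> b} \<in> sets N" "{x \<in> space N. L x = b} \<in> sets N"
        by (intro borel_measurable_le borel_measurable_eq borel_measurable_const L)+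
      have "N.prob (space N) = N.prob ({x \<in> space N. L x \<le> b} \<union> {x \<in> space N. b \<le> L x})"
        by (intro arg_cong[of _ _ N.prob]) auto
      also have "\<dots> = ?q + N.prob ({x \<in> space N. b \<le> L x} - {x \<in> space N. L x \<le> b})"
        by (intro N.finite_measure_Union' sets)
      also have "N.prob ({x \<in> space N. b \<le> L x} - {x \<in> space N. L x \<le> b}) = N.prob ({x \<in> space N. b \<le> L x} - {x \<in> space N. L x = b})"
        by (intro arg_cong[of _ _ N.prob]) auto
      also have "\<dots> = ?p"
        using cont by (subst N.finite_measure_Diff[OF sets(1,3)]) auto
      finally show ?thesis
        by (simp add: N.prob_space)
    qed
    show ?thesis
      using low[OF d(1)]
    proof eventually_elim
      case (elim i)
      then obtain B where B: "B \<in> sets M" "{\<omega>. Y i \<omega> \<le> b} \<inter> space M \<subseteq> B" "measure M B \<le> ?q + d"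
        by (auto simp: ocover_def)
      have "- c * measure M B \<le> - c * (?q + d)"
        using B(3) False by (intro mult_left_mono) auto
      then have "- (c * measure M B) \<le> - (c * ?q) - c * d"
        by (simp add: distrib_left)
      moreover have "c * ?p = c - c * ?q"
        by (simp add: \<open>?p = 1 - ?q\<close> right_diff_distrib)
      moreover have "- (c * d) \<le> \<eta>"
        using d(2) by simp
      ultimately have "c - c * measure M B \<le> c * ?p + \<eta>"
        by linarith
      moreover have "c * indicator {b..} (Y i \<omega>) \<le> c - c * indicator B \<omega>" if "\<omega> \<in> space M" for \<omega>
      proof (cases "Y i \<omega> \<le> b")
        case True
        then have "\<omega> \<in> B"
          using B(2) that by blast
        then show ?thesis
          using False by (simp add: indicator_def)
      next
        case 2: False
        then show ?thesis
          using False by (auto simp: indicator_def)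
      qed
      moreover have "(\<integral>\<omega>. c - c * indicator B \<omega> \<partial>M) = c - c * measure M B"
        using B(1) by (subst Bochner_Integration.integral_diff) (auto simp: M.emeasure_eq_measure M.prob_space)
      ultimately show ?case
        using B(1) by (intro exI[of _ "\<lambda>\<omega>. c - c * indicator B \<omega>"]) (auto simp: M.emeasure_eq_measure)
    qed
  qed
qed

text \<open>A probability law has countably many atoms, an interval has uncountably many
  points.\<close>

lemma ex_continuity_point:
  fixes L :: "'v \<Rightarrow> ennreal"
  assumes N: "prob_space N" and L: "L \<in> borel_measurable N" and uv: "0 \<le> u" "u < v"
  shows "\<exists>b. u < b \<and> b < v \<and> measure N {x \<in> space N. L x = ennreal b} = 0"
proof (rule ccontr)
  assume neg: "\<nexists>b. u < b \<and> b < v \<and> measure N {x \<in> space N. L x = ennreal b} = 0"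
  interpret N: prob_space N by fact
  interpret D: prob_space "distr N borel L"
    using L by (rule N.prob_space_distr)
  have m: "measure (distr N borel L) {z} = measure N {x \<in> space N. L x = z}" for z
    using L by (subst measure_distr) (auto intro!: arg_cong[of _ _ "measure N"])
  have "ennreal ` {u<..<v} \<subseteq> {z. measure (distr N borel L) {z} \<noteq> 0}"
    using neg m by auto
  then have "countable (ennreal ` {u<..<v})"
    using D.countable_support countable_subset by blast
  moreover have "inj_on ennreal {u<..<v}"
    using uv by (intro inj_onI) (auto simp: ennreal_inj)
  ultimately have "countable {u<..<v}"
    by (rule countable_image_inj_on)
  then show False
    using uncountable_open_interval[of u v] uv by simp
qed

text \<open>The jumps at the grid points not exceeding \<open>z\<close> telescope; the constant
  \<open>g 0\<close> fits since the grid starts at 0.\<close>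

lemma step_function_value:
  fixes a :: "nat \<Rightarrow> real" and g :: "ennreal \<Rightarrow> real"
  assumes a: "mono a" "a 0 = 0"
  shows "\<exists>n\<le>k. ennreal (a n) \<le> z \<and> (n < k \<longrightarrow> z < ennreal (a (Suc n))) \<and>
    g 0 + (\<Sum>j<k. (g (ennreal (a (Suc j))) - g (ennreal (a j))) * indicator {ennreal (a (Suc j))..} z) = g (ennreal (a n))"
proof (induction k)
  case 0
  then show ?case
    using a(2) by (intro exI[of _ 0]) simp
next
  case (Suc k)
  then obtain n where n: "n \<le> k" "ennreal (a n) \<le> z" "n < k \<longrightarrow> z < ennreal (a (Suc n))"
    and eq: "g 0 + (\<Sum>j<k. (g (ennreal (a (Suc j))) - g (ennreal (a j))) * indicator {ennreal (a (Suc j))..} z) = g (ennreal (a n))"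
    by (elim exE conjE) (rule that)
  show ?case
  proof (cases "z < ennreal (a (Suc k))")
    case True
    then show ?thesis
      using n eq by (intro exI[of _ n]) (auto simp: indicator_def less_Suc_eq)
  next
    case False
    have "n = k"
    proof (rule ccontr)
      assume "n \<noteq> k"
      then have "z < ennreal (a (Suc n))"
        using n by simp
      also have "\<dots> \<le> ennreal (a (Suc k))"
        using n(1) by (intro ennreal_leI monoD[OF a(1)]) simp
      finally show False
        using False by simp
    qed
    then show ?thesis
      using False eq by (intro exI[of _ "Suc k"]) (auto simp: indicator_def)
  qed
qed

text \<open>Continuity at \<open>top\<close> makes \<open>g\<close> nearly constant beyond some
  finite \<open>K\<close>, and below it uniform continuity on a compact interval applies. The jumps
  are placed where \<open>L\<close> has no atoms.\<close>

lemma step_approximation: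
  fixes g :: "ennreal \<Rightarrow> real" and L :: "'v \<Rightarrow> ennreal"
  assumes N: "prob_space N" and L: "L \<in> borel_measurable N" and g: "continuous_on UNIV g" and \<eta>: "0 < \<eta>"
  shows "\<exists>k b c. (\<forall>j<k. 0 < b j \<and> measure N {x \<in> space N. L x = ennreal (b j)} = 0) \<and>
    (\<forall>z. \<bar>g z - (g 0 + (\<Sum>j<(k::nat). c j * indicator {ennreal (b j)..} z))\<bar> \<le> \<eta>)"
proof -
  have "isCont g top"
    using g by (simp add: continuous_on_eq_continuous_at)
  then have "\<forall>\<^sub>F z in nhds top. dist (g z) (g top) < \<eta> / 2"
    unfolding continuous_within tendsto_at_iff_tendsto_nhds using \<eta> by (intro tendstoD) auto
  then obtain t where t: "t < top" "\<And>z. t < z \<Longrightarrow> dist (g z) (g top) < \<eta> / 2"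
    using eventually_nhds_top[of "0::ennreal"] by auto
  obtain K where K: "0 < K" "t < ennreal K"
  proof -
    obtain r where r: "0 \<le> r" "t = ennreal r"
      using t(1) by (cases t) auto
    then have "t < ennreal (r + 1)"
      by (simp add: ennreal_less_iff)
    then show ?thesis
      using r(1) by (intro that[of "r + 1"]) auto
  qed
  have far: "\<bar>g z - g w\<bar> \<le> \<eta>" if "ennreal K \<le> z" "ennreal K \<le> w" for z w
    using t(2)[OF less_le_trans[OF K(2) that(1)]] t(2)[OF less_le_trans[OF K(2) that(2)]]
    unfolding dist_real_def by linarith
  have "uniformly_continuous_on {0..K + 1} (\<lambda>r. g (ennreal r))"
    by (intro compact_uniformly_continuous continuous_on_compose2[OF g] continuous_on_ennreal continuous_intros) auto
  then obtain \<delta>0 where \<delta>0: "0 < \<delta>0" "\<And>r s. r \<in> {0..K + 1} \<Longrightarrow> s \<in> {0..K + 1} \<Longrightarrow> dist s r < \<delta>0 \<Longrightarrow> dist (g (ennreal s)) (g (ennreal r)) < \<eta>"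
    using \<eta> unfolding uniformly_continuous_on_def by meson
  \<comment> \<open>Keeping \<open>\<delta>\<close> at most 1 ensures that a grid cell that begins
    below \<open>K\<close> ends within \<open>{0..K + 1}\<close>.\<close>
  define \<delta> where "\<delta> = min \<delta>0 1"
  have \<delta>: "0 < \<delta>" "\<delta> \<le> 1" "\<delta> \<le> \<delta>0"
    using \<delta>0(1) by (auto simp: \<delta>_def)
  \<comment> \<open>One point from each of consecutive intervals of length
    \<open>\<delta> / 2\<close>: the points increase, and neighbours, including 0 and the first
    point, are less than \<open>\<delta>\<close> apart.\<close>
  have "\<exists>b. real (Suc j) * (\<delta> / 2) < b \<and> b < real (Suc (Suc j)) * (\<delta> / 2) \<and> measure N {x \<in> space N. L x = ennreal b} = 0" for j
    using \<delta>(1) by (intro ex_continuity_point[OF N L]) auto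
  then obtain b where b: "\<And>j. real (Suc j) * (\<delta> / 2) < b j" "\<And>j. b j < real (Suc (Suc j)) * (\<delta> / 2)"
    "\<And>j. measure N {x \<in> space N. L x = ennreal (b j)} = 0"
    by metis
  define a where "a = (\<lambda>j. case j of 0 \<Rightarrow> 0 | Suc i \<Rightarrow> b i)"
  have a0: "a 0 = 0" and aS: "a (Suc j) = b j" for j
    by (simp_all add: a_def)
  have bpos: "0 < b j" for j
    by (rule le_less_trans[OF _ b(1)]) (use \<delta>(1) in simp)
  have step: "a j \<le> a (Suc j) \<and> a (Suc j) < a j + \<delta>" for j
  proof (cases j)
    case 0
    then show ?thesis
      using bpos[of 0] b(2)[of 0] by (simp add: a0 aS)
  next
    case (Suc i)
    have "real (Suc (Suc (Suc i))) * (\<delta> / 2) = real (Suc i) * (\<delta> / 2) + \<delta>"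
      by (simp add: field_simps)
    then show ?thesis
      using b(1)[of i] b(2)[of i] b(1)[of "Suc i"] b(2)[of "Suc i"] unfolding Suc aS by linarith
  qed
  then have mono: "mono a"
    by (intro incseq_SucI) auto
  have anonneg: "0 \<le> a j" for j
    using monoD[OF mono, of 0 j] a0 by simp
  obtain k :: nat where k: "2 * K / \<delta> < real k"
    using reals_Archimedean2 by blast
  have "0 < k"
    using k K(1) \<delta>(1) by (metis divide_nonneg_pos gr0I less_eq_real_def mult_nonneg_nonneg not_less of_nat_0 zero_le_numeral)
  have "K < real k * (\<delta> / 2)"
    using k \<delta>(1) by (simp add: field_simps)
  also have "\<dots> \<le> a k"
    using \<open>0 < k\<close> b(1)[of "k - 1"] aS[of "k - 1"] by simp
  finally have ak: "K \<le> a k"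
    by simp
  let ?c = "\<lambda>j. g (ennreal (a (Suc j))) - g (ennreal (a j))"
  have "\<bar>g z - (g 0 + (\<Sum>j<k. ?c j * indicator {ennreal (b j)..} z))\<bar> \<le> \<eta>" for z
  proof -
    obtain n where n: "n \<le> k" "ennreal (a n) \<le> z" "n < k \<longrightarrow> z < ennreal (a (Suc n))"
      and eq: "g 0 + (\<Sum>j<k. ?c j * indicator {ennreal (a (Suc j))..} z) = g (ennreal (a n))"
      using step_function_value[OF mono a0, of k z g] by (elim exE conjE) (rule that)
    have "\<bar>g z - g (ennreal (a n))\<bar> \<le> \<eta>"
    proof (cases "K \<le> a n")
      case True
      then have "ennreal K \<le> ennreal (a n)"
        by (rule ennreal_leI)
      then show ?thesis
        using n(2) by (intro far) auto
    next
      case False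
      then have "n < k"
        using n(1) ak by (cases "n = k") auto
      then have z: "z < ennreal (a (Suc n))"
        using n(3) by simp
      then obtain r where r: "0 \<le> r" "z = ennreal r"
        by (cases z) auto
      have "a n \<le> r" "r < a (Suc n)"
        using n(2) z r anonneg by (auto simp: ennreal_le_iff ennreal_less_iff)
      then have "dist (g (ennreal r)) (g (ennreal (a n))) < \<eta>"
        using step[of n] False \<delta> anonneg[of n] r(1) by (intro \<delta>0(2)) (auto simp: dist_real_def)
      then show ?thesis
        using r(2) by (simp add: dist_real_def)
    qed
    then show ?thesis
      using eq unfolding aS by simp
  qed
  then show ?thesis
    using bpos b(3) by (intro exI[of _ k] exI[of _ b] exI[of _ ?c]) simp
qed

lemma dominated_in_mean_continuous:
  fixes Y :: "'i \<Rightarrow> 'w \<Rightarrow> ennreal" and L :: "'v \<Rightarrow> ennreal" and g :: "ennreal \<Rightarrow> real"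
  assumes M: "prob_space M" and N: "prob_space N" and L: "L \<in> borel_measurable N"
    and up: "\<And>y \<eta>. 0 < y \<Longrightarrow> 0 < \<eta> \<Longrightarrow>
      \<forall>\<^sub>F i in G. ocover M {\<omega>. ennreal y \<le> Y i \<omega>} (measure N {x \<in> space N. ennreal y \<le> L x} + \<eta>)"
    and low: "\<And>y \<eta>. 0 < y \<Longrightarrow> 0 < \<eta> \<Longrightarrow>
      \<forall>\<^sub>F i in G. ocover M {\<omega>. Y i \<omega> \<le> ennreal y} (measure N {x \<in> space N. L x \<le> ennreal y} + \<eta>)"
    and g: "continuous_on UNIV g" "\<And>z. \<bar>g z\<bar> \<le> C"
  shows "dominated_in_mean M Y G g (\<integral>x. g (L x) \<partial>N)"
proof (rule dominated_in_mean_approx[OF M])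
  fix \<eta> :: real assume "0 < \<eta>"
  interpret N: prob_space N by fact
  obtain k b c where b: "\<And>j. j < (k::nat) \<Longrightarrow> 0 < b j" "\<And>j. j < k \<Longrightarrow> measure N {x \<in> space N. L x = ennreal (b j)} = 0"
    and appr: "\<And>z. \<bar>g z - (g 0 + (\<Sum>j<k. c j * indicator {ennreal (b j)..} z))\<bar> \<le> \<eta>"
    using step_approximation[OF N L g(1) \<open>0 < \<eta>\<close>] by blast
  let ?h = "\<lambda>z. g 0 + (\<Sum>j<k. c j * indicator {ennreal (b j)..} z)"
  let ?k = "g 0 + (\<Sum>j<k. c j * measure N {x \<in> space N. ennreal (b j) \<le> L x})"
  have dom: "dominated_in_mean M Y G ?h ?k"
    by (intro dominated_in_mean_add dominated_in_mean_const dominated_in_mean_sum M finite_lessThan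
        dominated_in_mean_ray[OF M N L] up low b) (auto intro: b)
  have sets: "{x \<in> space N. ennreal (b j) \<le> L x} \<in> sets N" for j
    by (intro borel_measurable_le borel_measurable_const L)
  have ind: "indicator {ennreal (b j)..} (L x) = indicator {x \<in> space N. ennreal (b j) \<le> L x} x" if "x \<in> space N" for j x
    using that by (simp add: indicator_def)
  have "(\<lambda>x. g (L x)) \<in> borel_measurable N"
    by (rule measurable_compose[OF L borel_measurable_continuous_onI[OF g(1)]])
  then have intg: "integrable N (\<lambda>x. g (L x))"
    by (rule N.integrable_const_bound[of _ C, rotated]) (simp add: g(2))
  have int1: "integrable N (\<lambda>x. c j * indicator {x \<in> space N. ennreal (b j) \<le> L x} x)" for j
    using sets by (auto simp: N.emeasure_eq_measure)
  have int0: "integrable N (\<lambda>x. \<Sum>j<k. c j * indicator {x \<in> space N. ennreal (b j) \<le> L x} x)"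
    by (rule Bochner_Integration.integrable_sum) (rule int1)
  have int: "integrable N (\<lambda>x. g 0 + (\<Sum>j<k. c j * indicator {x \<in> space N. ennreal (b j) \<le> L x} x))"
    by (rule Bochner_Integration.integrable_add[OF _ int0]) simp
  have "(\<integral>x. (\<Sum>j<k. c j * indicator {x \<in> space N. ennreal (b j) \<le> L x} x) \<partial>N) =
      (\<Sum>j<k. \<integral>x. c j * indicator {x \<in> space N. ennreal (b j) \<le> L x} x \<partial>N)"
    by (rule Bochner_Integration.integral_sum) (rule int1)
  also have "\<dots> = (\<Sum>j<k. c j * measure N {x \<in> space N. ennreal (b j) \<le> L x})"
    using sets by (intro sum.cong) simp_all
  finally have "?k = (\<integral>x. g 0 + (\<Sum>j<k. c j * indicator {x \<in> space N. ennreal (b j) \<le> L x} x) \<partial>N)"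
    by (subst Bochner_Integration.integral_add[OF _ int0]) (simp_all only: integrable_const lebesgue_integral_const N.prob_space scaleR_one N.finite_measure_axioms finite_measure.integrable_const)
  also have "\<dots> \<le> (\<integral>x. g (L x) + \<eta> \<partial>N)"
  proof (rule integral_mono[OF int])
    show "integrable N (\<lambda>x. g (L x) + \<eta>)"
      using intg by simp
    show "g 0 + (\<Sum>j<k. c j * indicator {x \<in> space N. ennreal (b j) \<le> L x} x) \<le> g (L x) + \<eta>" if "x \<in> space N" for x
      using appr[of "L x"] unfolding ind[OF that] by linarith
  qed
  also have "\<dots> = (\<integral>x. g (L x) \<partial>N) + \<eta>"
    using intg by (simp add: N.prob_space)
  finally have "?k \<le> (\<integral>x. g (L x) \<partial>N) + \<eta>" .
  moreover have "g z \<le> ?h z + \<eta>" for z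
    using appr[of z] by linarith
  ultimately show "\<exists>h k. dominated_in_mean M Y G h k \<and> (\<forall>z. g z \<le> h z + \<eta>) \<and> k \<le> (\<integral>x. g (L x) \<partial>N) + \<eta>"
    using dom by blast
qed

text \<open>A bounded continuous \<open>g\<close> is uniformly close to a step function with jumps
  at continuity points, and the step function is a sum of rays; the argument is run for
  \<open>g\<close> and for \<open>- g\<close>.\<close>

lemma weak_conv_HJ_ennrealI:
  fixes Y :: "'i \<Rightarrow> 'w \<Rightarrow> ennreal" and L :: "'v \<Rightarrow> ennreal"
  assumes M: "prob_space M" and N: "prob_space N" and L: "L \<in> borel_measurable N"
    and up: "\<And>y \<eta>. 0 < y \<Longrightarrow> 0 < \<eta> \<Longrightarrow>
      \<forall>\<^sub>F i in G. ocover M {\<omega>. ennreal y \<le> Y i \<omega>} (measure N {x \<in> space N. ennreal y \<le> L x} + \<eta>)"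
    and low: "\<And>y \<eta>. 0 < y \<Longrightarrow> 0 < \<eta> \<Longrightarrow>
      \<forall>\<^sub>F i in G. ocover M {\<omega>. Y i \<omega> \<le> ennreal y} (measure N {x \<in> space N. L x \<le> ennreal y} + \<eta>)"
  shows "weak_conv_HJ UNIV M Y G N L"
  unfolding weak_conv_HJ_def
proof (intro conjI allI impI)
  show "L \<in> measurable N (restrict_space borel UNIV)"
    using L by (simp add: measurable_restrict_space2_iff)
  fix g :: "ennreal \<Rightarrow> real" assume g: "continuous_on UNIV g \<and> bounded (g ` UNIV)"
  then obtain C where C: "\<And>z. \<bar>g z\<bar> \<le> C"
    by (auto simp: bounded_iff)
  have mg: "continuous_on UNIV (\<lambda>z. - g z)" "\<And>z. \<bar>- g z\<bar> \<le> C"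
    using g C by (auto intro: continuous_on_minus)
  show "((\<lambda>i. outer_expectation M (\<lambda>\<omega>. g (Y i \<omega>))) \<longlongrightarrow> (\<integral>x. g (L x) \<partial>N)) G"
    using dominated_in_mean_continuous[OF M N L up low conjunct1[OF g] C] dominated_in_mean_continuous[OF M N L up low mg]
    by (intro outer_expectation_tendsto[OF M C]) auto
qed simp

section \<open>The last time of a deviation\<close>

lemma last_time_ge_imp:
  assumes "0 < t" "ennreal t \<le> last_time est \<theta> \<epsilon>"
  shows "\<exists>n\<ge>nat \<lceil>t\<rceil>. norm (est n - \<theta>) > \<epsilon>"
proof (rule ccontr)
  assume neg: "\<not> (\<exists>n\<ge>nat \<lceil>t\<rceil>. norm (est n - \<theta>) > \<epsilon>)"
  \<comment> \<open>If no deviation occurs from the ceiling of \<open>t\<close> on, all deviation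
    times are at most one less than this ceiling, which is strictly below \<open>t\<close>.\<close>
  have "last_time est \<theta> \<epsilon> \<le> ennreal (real (nat \<lceil>t\<rceil> - 1))"
    unfolding last_time_def
  proof (rule SUP_least)
    fix n assume "n \<in> {n. 1 \<le> n \<and> norm (est n - \<theta>) > \<epsilon>}"
    then have "n < nat \<lceil>t\<rceil>"
      using neg not_le by blast
    then show "of_nat n \<le> ennreal (real (nat \<lceil>t\<rceil> - 1))"
      unfolding ennreal_of_nat_eq_real_of_nat by (intro ennreal_leI) simp
  qed
  with assms(2) have "ennreal t \<le> ennreal (real (nat \<lceil>t\<rceil> - 1))"
    by (rule order_trans)
  then have "t \<le> real (nat \<lceil>t\<rceil> - 1)"
    by (simp add: ennreal_le_iff)
  moreover have "0 \<le> \<lceil>t\<rceil> - 1"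
    using assms(1) by simp
  then obtain k where "\<lceil>t\<rceil> - 1 = int k"
    using zero_le_imp_eq_int by blast
  then have "\<lceil>t\<rceil> = int (Suc k)"
    by simp
  then have "real (nat \<lceil>t\<rceil> - 1) = real_of_int \<lceil>t\<rceil> - 1"
    by simp
  ultimately show False
    using ceiling_correct[of t] by linarith
qed

lemma last_time_le_imp:
  assumes "0 \<le> t" "last_time est \<theta> \<epsilon> \<le> ennreal t" "t < real n"
  shows "norm (est n - \<theta>) \<le> \<epsilon>"
proof (rule ccontr)
  assume "\<not> norm (est n - \<theta>) \<le> \<epsilon>"
  then have "of_nat n \<le> last_time est \<theta> \<epsilon>"
    unfolding last_time_def using assms(1,3) by (intro SUP_upper) auto
  also note assms(2)
  finally have "ennreal (real n) \<le> ennreal t"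
    by (simp add: ennreal_of_nat_eq_real_of_nat)
  then show False
    using assms(1,3) by (simp add: ennreal_le_iff)
qed

lemma ennreal_sqrt_le_iff: "0 \<le> y \<Longrightarrow> ennreal (sqrt y) \<le> z \<longleftrightarrow> ennreal y \<le> z\<^sup>2"
proof (cases z)
  case (real r)
  assume "0 \<le> y"
  then show ?thesis
    using real by (simp add: ennreal_power ennreal_le_iff real_sqrt_le_iff' real_le_lsqrt sqrt_le_D)
qed (simp add: power2_eq_square ennreal_top_mult)

lemma ennreal_le_sqrt_iff: "0 \<le> y \<Longrightarrow> z \<le> ennreal (sqrt y) \<longleftrightarrow> z\<^sup>2 \<le> ennreal y"
proof (cases z)
  case (real r)
  assume "0 \<le> y"
  moreover have "r \<le> sqrt y \<longleftrightarrow> r\<^sup>2 \<le> y"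
    using real_sqrt_le_iff[of "r\<^sup>2" y] real(1) by simp
  ultimately show ?thesis
    using real by (simp add: ennreal_power ennreal_le_iff)
qed (simp add: power2_eq_square ennreal_top_mult top_unique)

text \<open>Right continuity of the distribution function; it will absorb the excess
  \<open>\<epsilon>\<^sup>2\<close> caused by rounding the last time to an integer.\<close>

lemma measure_le_right_continuous:
  fixes L :: "'v \<Rightarrow> ennreal"
  assumes N: "prob_space N" and L: "L \<in> borel_measurable N" and "0 \<le> y" "0 < \<eta>"
  shows "\<exists>y'>y. measure N {x \<in> space N. L x \<le> ennreal y'} \<le> measure N {x \<in> space N. L x \<le> ennreal y} + \<eta>"
proof -
  interpret N: prob_space N by fact
  let ?D = "\<lambda>k. {x \<in> space N. L x \<le> ennreal (y + 1 / real (Suc k))}"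
  have D: "range ?D \<subseteq> sets N"
    by (intro image_subsetI borel_measurable_le borel_measurable_const L)
  have dec: "decseq ?D"
  proof (rule antimonoI)
    fix k l :: nat assume "k \<le> l"
    then have "ennreal (y + 1 / real (Suc l)) \<le> ennreal (y + 1 / real (Suc k))"
      by (intro ennreal_leI add_left_mono divide_left_mono) auto
    then show "?D l \<subseteq> ?D k"
      using order_trans by blast
  qed
  have "(\<Inter>k. ?D k) = {x \<in> space N. L x \<le> ennreal y}"
  proof (intro set_eqI iffI)
    fix x assume "x \<in> (\<Inter>k. ?D k)"
    then have x: "x \<in> space N" "\<And>k. L x \<le> ennreal (y + 1 / real (Suc k))"
      by blast+
    have "(\<lambda>k. ennreal (y + 1 / real (Suc k))) \<longlonglongrightarrow> ennreal (y + 0)"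
      by (intro tendsto_ennrealI tendsto_add tendsto_const LIMSEQ_Suc[OF lim_const_over_n])
    then have "L x \<le> ennreal (y + 0)"
      by (rule LIMSEQ_le_const) (use x(2) in blast)
    then show "x \<in> {x \<in> space N. L x \<le> ennreal y}"
      using x(1) by simp
  next
    fix x assume x: "x \<in> {x \<in> space N. L x \<le> ennreal y}"
    have "ennreal y \<le> ennreal (y + 1 / real (Suc k))" for k
      by (intro ennreal_leI) simp
    then show "x \<in> (\<Inter>k. ?D k)"
      using x order_trans by blast
  qed
  then have "(\<lambda>k. measure N (?D k)) \<longlonglongrightarrow> measure N {x \<in> space N. L x \<le> ennreal y}"
    using N.finite_Lim_measure_decseq[OF D dec] by (simp only:)
  then have "\<forall>\<^sub>F k in sequentially. measure N (?D k) < measure N {x \<in> space N. L x \<le> ennreal y} + \<eta>"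
    using assms(4) by (intro order_tendstoD(2)) auto
  then obtain k where "measure N (?D k) < measure N {x \<in> space N. L x \<le> ennreal y} + \<eta>"
    using eventually_happens[of _ sequentially] trivial_limit_sequentially by blast
  then show ?thesis
    by (intro exI[of _ "y + 1 / real (Suc k)"]) auto
qed

context hadamard_setup
begin

lemma sq_sup_eq: "sq_sup F E \<phi>' z = (image_sup F E \<phi>' z)\<^sup>2"
  by (simp add: sq_sup_def image_sup_def)

lemma sq_sup_measurable: "(\<lambda>x. sq_sup F E \<phi>' (Z x)) \<in> borel_measurable N"
  unfolding sq_sup_eq using image_sup_measurable by measurable

end

context sampled_estimator
begin

text \<open>With \<open>m\<close> the ceiling of \<open>y / \<epsilon>\<^sup>2\<close>, a deviation
  above \<open>\<epsilon>\<close> at some \<open>n \<ge> m\<close> is above \<open>sqrt y\<close>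
  after multiplication by \<open>sqrt m\<close>, since
  \<open>\<epsilon> * sqrt m \<ge> sqrt y\<close>.\<close>

lemma scaled_last_time_ge:
  assumes "0 < y" "0 < \<epsilon>" "ennreal y \<le> ennreal (\<epsilon>\<^sup>2) * last_time (\<lambda>n. est n \<omega>) \<phi>P \<epsilon>"
  shows "\<exists>n\<ge>nat \<lceil>y / \<epsilon>\<^sup>2\<rceil>. sqrt y \<le> sqrt (real (nat \<lceil>y / \<epsilon>\<^sup>2\<rceil>)) * norm (est n \<omega> - \<phi>P)"
proof -
  let ?T = "last_time (\<lambda>n. est n \<omega>) \<phi>P \<epsilon>"
  have e2: "0 < \<epsilon>\<^sup>2"
    using assms(2) by simp
  have "ennreal (y / \<epsilon>\<^sup>2) \<le> ?T"
  proof (cases ?T)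
    case (real r)
    then have "ennreal y \<le> ennreal (\<epsilon>\<^sup>2 * r)"
      using assms(3) by (simp add: ennreal_mult)
    then have "y \<le> \<epsilon>\<^sup>2 * r"
      using real(1) e2 by (simp add: ennreal_le_iff)
    then have "y / \<epsilon>\<^sup>2 \<le> r"
      using e2 by (simp add: field_simps)
    then show ?thesis
      using real(2) by (simp add: ennreal_leI)
  qed simp
  then obtain n where n: "n \<ge> nat \<lceil>y / \<epsilon>\<^sup>2\<rceil>" "norm (est n \<omega> - \<phi>P) > \<epsilon>"
    using last_time_ge_imp[of "y / \<epsilon>\<^sup>2" "\<lambda>n. est n \<omega>"] assms(1) e2 by auto
  have "y / \<epsilon>\<^sup>2 \<le> real (nat \<lceil>y / \<epsilon>\<^sup>2\<rceil>)"
    by (rule real_nat_ceiling_ge)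
  then have "sqrt (y / \<epsilon>\<^sup>2) \<le> sqrt (real (nat \<lceil>y / \<epsilon>\<^sup>2\<rceil>))"
    by (rule real_sqrt_le_mono)
  then have "sqrt (y / \<epsilon>\<^sup>2) * \<epsilon> \<le> sqrt (real (nat \<lceil>y / \<epsilon>\<^sup>2\<rceil>)) * norm (est n \<omega> - \<phi>P)"
    using n(2) assms(2) by (intro mult_mono) auto
  moreover have "sqrt (y / \<epsilon>\<^sup>2) * \<epsilon> = sqrt y"
    using assms(2) by (simp add: real_sqrt_divide)
  ultimately show ?thesis
    using n(1) by auto
qed

text \<open>Here \<open>m\<close> is the least integer above \<open>y / \<epsilon>\<^sup>2\<close>.
  From \<open>m\<close> on all deviations are at most \<open>\<epsilon>\<close>, and
  \<open>m * \<epsilon>\<^sup>2 \<le> y + \<epsilon>\<^sup>2\<close> gives the slightly enlarged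
  bound.\<close>

lemma scaled_last_time_le:
  assumes "0 \<le> y" "0 < \<epsilon>" "ennreal (\<epsilon>\<^sup>2) * last_time (\<lambda>n. est n \<omega>) \<phi>P \<epsilon> \<le> ennreal y"
    and n: "nat \<lfloor>y / \<epsilon>\<^sup>2\<rfloor> + 1 \<le> n"
  shows "sqrt (real (nat \<lfloor>y / \<epsilon>\<^sup>2\<rfloor> + 1)) * norm (est n \<omega> - \<phi>P) \<le> sqrt (y + \<epsilon>\<^sup>2)"
proof -
  let ?T = "last_time (\<lambda>n. est n \<omega>) \<phi>P \<epsilon>"
  have e2: "0 < \<epsilon>\<^sup>2"
    using assms(2) by simp
  have y0: "0 \<le> y / \<epsilon>\<^sup>2"
    using assms(1) e2 by simp
  have "?T \<le> ennreal (y / \<epsilon>\<^sup>2)"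
  proof (cases ?T)
    case (real r)
    then have "ennreal (\<epsilon>\<^sup>2 * r) \<le> ennreal y"
      using assms(3) by (simp add: ennreal_mult)
    then have "\<epsilon>\<^sup>2 * r \<le> y"
      using assms(1) by (simp add: ennreal_le_iff)
    then have "r \<le> y / \<epsilon>\<^sup>2"
      using e2 by (simp add: field_simps)
    then show ?thesis
      using real(2) by (simp add: ennreal_leI)
  next
    case top
    then show ?thesis
      using assms(3) e2 by (simp add: ennreal_mult_top top_unique)
  qed
  moreover have fl: "real (nat \<lfloor>y / \<epsilon>\<^sup>2\<rfloor>) \<le> y / \<epsilon>\<^sup>2" "y / \<epsilon>\<^sup>2 < real (nat \<lfloor>y / \<epsilon>\<^sup>2\<rfloor>) + 1"
    using y0 by linarith+
  moreover have "y / \<epsilon>\<^sup>2 < real n"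
    using n fl(2) by linarith
  ultimately have le: "norm (est n \<omega> - \<phi>P) \<le> \<epsilon>"
    using y0 by (intro last_time_le_imp[of "y / \<epsilon>\<^sup>2" "\<lambda>n. est n \<omega>"])
  have "sqrt (real (nat \<lfloor>y / \<epsilon>\<^sup>2\<rfloor> + 1)) \<le> sqrt (y / \<epsilon>\<^sup>2 + 1)"
    using fl(1) by (intro real_sqrt_le_mono) simp
  then have "sqrt (real (nat \<lfloor>y / \<epsilon>\<^sup>2\<rfloor> + 1)) * norm (est n \<omega> - \<phi>P) \<le> sqrt (y / \<epsilon>\<^sup>2 + 1) * \<epsilon>"
    using le y0 by (intro mult_mono) auto
  also have "y / \<epsilon>\<^sup>2 + 1 = (y + \<epsilon>\<^sup>2) / \<epsilon>\<^sup>2"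
    using e2 by (simp add: field_simps)
  also have "sqrt ((y + \<epsilon>\<^sup>2) / \<epsilon>\<^sup>2) * \<epsilon> = sqrt (y + \<epsilon>\<^sup>2)"
    using assms(2) by (simp add: real_sqrt_divide)
  finally show ?thesis .
qed

lemma weak_conv_scaled_last_time:
  "weak_conv_HJ UNIV M (\<lambda>\<epsilon> \<omega>. ennreal (\<epsilon>\<^sup>2) * last_time (\<lambda>n. est n \<omega>) \<phi>P \<epsilon>)
    (at_right 0) N (\<lambda>x. sq_sup F E \<phi>' (Z x))"
proof (rule weak_conv_HJ_ennrealI[OF prob_space_M prob_space_N sq_sup_measurable])
  fix y \<eta> :: real assume y: "0 < y" and \<eta>: "0 < \<eta>"
  let ?Y = "\<lambda>\<epsilon> \<omega>. ennreal (\<epsilon>\<^sup>2) * last_time (\<lambda>n. est n \<omega>) \<phi>P \<epsilon>"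
  have pos: "\<forall>\<^sub>F \<epsilon> in at_right 0. (0::real) < \<epsilon>"
    by (simp add: eventually_at_filter)
  have inf: "filterlim (\<lambda>\<epsilon>. y / \<epsilon>\<^sup>2) at_top (at_right 0)"
    using y by real_asymp
  have m0: "filterlim (\<lambda>\<epsilon>. nat \<lfloor>y / \<epsilon>\<^sup>2\<rfloor>) sequentially (at_right 0)"
    by (rule filterlim_compose[OF filterlim_nat_sequentially filterlim_compose[OF filterlim_floor_sequentially inf]])
  have m1: "filterlim (\<lambda>\<epsilon>. nat \<lceil>y / \<epsilon>\<^sup>2\<rceil>) sequentially (at_right 0)"
    by (rule filterlim_at_top_mono[OF m0]) (intro always_eventually allI nat_mono floor_le_ceiling)
  have m2: "filterlim (\<lambda>\<epsilon>. nat \<lfloor>y / \<epsilon>\<^sup>2\<rfloor> + 1) sequentially (at_right 0)"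
    by (rule filterlim_at_top_mono[OF m0]) simp
  show "\<forall>\<^sub>F \<epsilon> in at_right 0. ocover M {\<omega>. ennreal y \<le> ?Y \<epsilon> \<omega>}
      (measure N {x \<in> space N. ennreal y \<le> sq_sup F E \<phi>' (Z x)} + \<eta>)"
    using eventually_compose_filterlim[OF deviation_upper_tail[OF \<eta>, of "sqrt y"] m1] pos
  proof eventually_elim
    case (elim \<epsilon>)
    show ?case
    proof (rule ocover_mono[OF elim(1)])
      show "{\<omega>. ennreal y \<le> ?Y \<epsilon> \<omega>} \<inter> space M \<subseteq>
          {\<omega>. \<exists>n\<ge>nat \<lceil>y / \<epsilon>\<^sup>2\<rceil>. sqrt y \<le> sqrt (real (nat \<lceil>y / \<epsilon>\<^sup>2\<rceil>)) * norm (est n \<omega> - \<phi>P)}"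
        using scaled_last_time_ge[OF y elim(2)] by blast
    qed (use y in \<open>simp add: ennreal_sqrt_le_iff sq_sup_eq\<close>)
  qed
  have \<eta>2: "0 < \<eta> / 2"
    using \<eta> by simp
  \<comment> \<open>A level slightly above \<open>y\<close>: it eventually exceeds
    \<open>y + \<epsilon>\<^sup>2\<close> and costs only \<open>\<eta> / 2\<close> in
    probability.\<close>
  obtain y' where y': "y < y'"
    "measure N {x \<in> space N. sq_sup F E \<phi>' (Z x) \<le> ennreal y'} \<le> measure N {x \<in> space N. sq_sup F E \<phi>' (Z x) \<le> ennreal y} + \<eta> / 2"
    using measure_le_right_continuous[OF prob_space_N sq_sup_measurable less_imp_le[OF y] \<eta>2] by blast
  have "((\<lambda>\<epsilon>. y + \<epsilon>\<^sup>2) \<longlongrightarrow> y + 0\<^sup>2) (at_right (0::real))"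
    by (intro tendsto_intros)
  then have near: "\<forall>\<^sub>F \<epsilon> in at_right 0. y + \<epsilon>\<^sup>2 < y'"
    using y'(1) by (intro order_tendstoD(2)) auto
  have v0: "0 \<le> sqrt y'"
    using y y' by simp
  show "\<forall>\<^sub>F \<epsilon> in at_right 0. ocover M {\<omega>. ?Y \<epsilon> \<omega> \<le> ennreal y}
      (measure N {x \<in> space N. sq_sup F E \<phi>' (Z x) \<le> ennreal y} + \<eta>)"
    using eventually_compose_filterlim[OF deviation_lower_tail[OF \<eta>2 v0] m2] pos near
  proof eventually_elim
    case (elim \<epsilon>)
    show ?case
    proof (rule ocover_mono[OF elim(1)])
      have "sqrt (y + \<epsilon>\<^sup>2) \<le> sqrt y'"
        using elim(3) by simp
      then show "{\<omega>. ?Y \<epsilon> \<omega> \<le> ennreal y} \<inter> space M \<subseteq>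
          {\<omega>. \<forall>n\<ge>nat \<lfloor>y / \<epsilon>\<^sup>2\<rfloor> + 1. sqrt (real (nat \<lfloor>y / \<epsilon>\<^sup>2\<rfloor> + 1)) * norm (est n \<omega> - \<phi>P) \<le> sqrt y'}"
        using scaled_last_time_le[OF less_imp_le[OF y] elim(2)] order_trans by blast
      have "0 \<le> y'"
        using y y'(1) by simp
      then show "measure N {x \<in> space N. image_sup F E \<phi>' (Z x) \<le> ennreal (sqrt y')} + \<eta> / 2
          \<le> measure N {x \<in> space N. sq_sup F E \<phi>' (Z x) \<le> ennreal y} + \<eta>"
        using y'(2) by (simp add: ennreal_le_sqrt_iff sq_sup_eq)
    qed
  qed
qed

end

theorem theorem1:
  fixes M :: "'w measure"
    and X :: "nat \<Rightarrow> 'w \<Rightarrow> 'x::metric_space"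
    and P :: "'x measure"
    and F :: "('x \<Rightarrow> real) set"
    and E :: "'e set"
    and D\<phi> D0 :: "('x \<Rightarrow> real) bfun set"
    and \<phi> \<phi>' :: "('x \<Rightarrow> real) bfun \<Rightarrow> 'e bfun"
    and N :: "'v measure"
    and Z :: "'v \<Rightarrow> (real \<times> ('x \<Rightarrow> real)) bfun"
  assumes "prob_space M"
    and "prob_space.indep_vars M (\<lambda>_. borel) X UNIV"
    and "\<And>i. distr M borel (X i) = P"
    and "\<And>f. f \<in> F \<Longrightarrow> f \<in> borel_measurable P \<and> integrable P (\<lambda>x. (f x)\<^sup>2)"
    and "bounded ((\<lambda>f. \<integral>y. f y \<partial>P) ` F)"
    and "donsker P F"
    and "bdd_above {\<bar>f x - (\<integral>y. f y \<partial>P)\<bar> | x f. f \<in> F}"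
    and "hadamard_differentiable (linf F) (linf E) D\<phi> \<phi> (true_dist F P) D0 \<phi>'"
    and "0 \<in> D0"
    and "\<And>n \<omega>. 1 \<le> n \<Longrightarrow> \<omega> \<in> space M \<Longrightarrow> emp_dist F (\<lambda>i. X i \<omega>) n \<in> D\<phi>"
    and "kiefer_mueller P F N Z"
    and "\<And>x s. x \<in> space N \<Longrightarrow> s \<in> {0<..1} \<Longrightarrow> slice F (Z x) s \<in> D0"
  shows
    "weak_conv_HJ UNIV M
       (\<lambda>\<epsilon> \<omega>. ennreal (\<epsilon>\<^sup>2) *
          last_time (\<lambda>n. \<phi> (emp_dist F (\<lambda>i. X i \<omega>) n)) (\<phi> (true_dist F P)) \<epsilon>)
       (at_right 0) N (\<lambda>x. sq_sup F E \<phi>' (Z x))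
     \<and>
     (\<forall>(est :: nat \<Rightarrow> 'w \<Rightarrow> 'e bfun) \<theta> R.
        (\<forall>n\<ge>1. \<forall>\<omega>\<in>space M. est n \<omega> \<in> linf E \<and> R n \<omega> \<in> linf E \<and>
           est n \<omega> = \<phi> (emp_dist F (\<lambda>i. X i \<omega>) n) + R n \<omega>) \<and>
        \<theta> \<in> linf E \<and>
        outer_as_tendsto M est \<theta> \<and>
        outer_prob_tendsto_0 M
          (\<lambda>m \<omega>. ennreal (sqrt (real m)) * (SUP n\<in>{m..}. ennreal (norm (R n \<omega>)))) \<longrightarrow>
        weak_conv_HJ UNIV M
          (\<lambda>\<epsilon> \<omega>. ennreal (\<epsilon>\<^sup>2) * last_time (\<lambda>n. est n \<omega>) \<theta> \<epsilon>)
          (at_right 0) N (\<lambda>x. sq_sup F E \<phi>' (Z x)))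
     \<and>
     zero_mean_gaussian_process ({0<..1} \<times> E) N (\<lambda>(s, e) x. bapp (\<phi>' (slice F (Z x) s)) e)
     \<and>
     (subspace D0 \<longrightarrow>
        (\<forall>(N' :: 'u measure) W. brownian_bridge P F N' W \<and> (\<forall>x\<in>space N'. W x \<in> D0) \<longrightarrow>
           (\<forall>s1\<in>{0<..1}. \<forall>s2\<in>{0<..1}. \<forall>e1\<in>E. \<forall>e2\<in>E.
              (\<integral>x. bapp (\<phi>' (slice F (Z x) s1)) e1 * bapp (\<phi>' (slice F (Z x) s2)) e2 \<partial>N) =
              min s1 s2 * (\<integral>x. bapp (\<phi>' (W x)) e1 * bapp (\<phi>' (W x)) e2 \<partial>N'))))"
proof -
  interpret M: prob_space M by fact
  have rv: "X i \<in> measurable M borel" for i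
    using assms(2) by (simp add: M.indep_vars_def)
  have P: "distr M borel (X i) = P" for i
    by fact
  have sets_P: "sets P = sets borel" and space_P: "space P = UNIV"
    unfolding P[of 0, symmetric] by (rule sets_distr, simp only: space_distr space_borel)
  have "prob_space P"
    using M.prob_space_distr[OF rv[of 0]] unfolding P .
  then interpret prob_P: prob_space P .
  have F_int: "integrable P f" if "f \<in> F" for f
    by (rule prob_P.square_integrable_imp_integrable[OF conjunct1[OF assms(4)[OF that]] conjunct2[OF assms(4)[OF that]]])
  obtain B0 where B0: "\<And>f x. f \<in> F \<Longrightarrow> \<bar>f x - (\<integral>y. f y \<partial>P)\<bar> \<le> B0"
    using assms(7) unfolding bdd_above_def by blast
  \<comment> \<open>The maximum with 0 secures \<open>0 \<le> B\<close> also for empty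
    \<open>F\<close>, when the bound \<open>B0\<close> could be negative.\<close>
  define B where "B = max B0 0"
  have B: "0 \<le> B" "\<And>f x. f \<in> F \<Longrightarrow> \<bar>f x - (\<integral>y. f y \<partial>P)\<bar> \<le> B"
    unfolding B_def by (simp, rule order_trans[OF B0 max.cobounded1])
  have had: "hadamard_setup P F B E D\<phi> D0 \<phi> \<phi>' N Z"
  proof unfold_locales
    show "space P = UNIV" by (rule space_P)
    show "f \<in> borel_measurable P" "integrable P f" "\<bar>f x - (\<integral>y. f y \<partial>P)\<bar> \<le> B" if "f \<in> F" for f x
      using assms(4)[OF that] F_int[OF that] B(2)[OF that] by blast+
  qed (fact assms B)+
  have sequence_measurable: "(\<lambda>\<omega> i. X i \<omega>) \<in> measurable M (PiM UNIV (\<lambda>_. P))"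
    by (rule measurable_PiM_single') (use rv in \<open>auto simp: space_P measurable_cong_sets[OF refl sets_P]\<close>)
  have "distr M (PiM UNIV (\<lambda>_. borel)) (\<lambda>\<omega>. \<lambda>i\<in>UNIV. X i \<omega>) = PiM UNIV (\<lambda>i. distr M borel (X i))"
    by (rule M.indep_vars_iff_distr_eq_PiM[THEN iffD1, OF UNIV_not_empty rv assms(2)])
  moreover have "distr M (PiM UNIV (\<lambda>_. borel)) (\<lambda>\<omega>. \<lambda>i\<in>UNIV. X i \<omega>) = distr M (PiM UNIV (\<lambda>_. P)) (\<lambda>\<omega> i. X i \<omega>)"
    by (rule distr_cong) (auto intro!: sets_PiM_cong simp: sets_P)
  ultimately have sequence_distr: "distr M (PiM UNIV (\<lambda>_. P)) (\<lambda>\<omega> i. X i \<omega>) = PiM UNIV (\<lambda>_. P)"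
    by (simp add: P)
  interpret hadamard_setup P F B E D\<phi> D0 \<phi> \<phi>' N Z
    by (rule had)
  have sampled: "sampled_estimator P F B E D\<phi> D0 \<phi> \<phi>' N Z M X est R"
    if "\<And>n \<omega>. 1 \<le> n \<Longrightarrow> \<omega> \<in> space M \<Longrightarrow> est n \<omega> = \<phi> (emp_dist F (\<lambda>i. X i \<omega>) n) + R n \<omega>"
      and "outer_prob_tendsto_0 M (\<lambda>m \<omega>. ennreal (sqrt (real m)) * (SUP n\<in>{m..}. ennreal (norm (R n \<omega>))))"
    for est R :: "nat \<Rightarrow> 'w \<Rightarrow> 'e bfun"
    by (intro sampled_estimator.intro sampled_estimator_axioms.intro had assms(1) sequence_measurable sequence_distr assms(10) that)
  show ?thesis
  proof (intro conjI allI impI ballI)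
    \<comment> \<open>The first claim is the sampled estimator with zero remainder.\<close>
    let ?R = "\<lambda>n \<omega>. 0 :: 'e bfun"
    have "outer_prob_tendsto_0 M (\<lambda>m \<omega>. ennreal (sqrt (real m)) * (SUP n\<in>{m..}. ennreal (norm (?R n \<omega>))))"
      by (simp add: outer_prob_tendsto_0_def outer_measure_of_eq)
    then interpret sampled_estimator P F B E D\<phi> D0 \<phi> \<phi>' N Z M X "\<lambda>n \<omega>. \<phi> (emp_dist F (\<lambda>i. X i \<omega>) n)" ?R
      by (intro sampled) auto
    show "weak_conv_HJ UNIV M (\<lambda>\<epsilon> \<omega>. ennreal (\<epsilon>\<^sup>2) *
          last_time (\<lambda>n. \<phi> (emp_dist F (\<lambda>i. X i \<omega>) n)) (\<phi> (true_dist F P)) \<epsilon>)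
       (at_right 0) N (\<lambda>x. sq_sup F E \<phi>' (Z x))"
      by (rule weak_conv_scaled_last_time)
  next
    fix est R :: "nat \<Rightarrow> 'w \<Rightarrow> 'e bfun" and \<theta>
    assume *: "(\<forall>n\<ge>1. \<forall>\<omega>\<in>space M. est n \<omega> \<in> linf E \<and> R n \<omega> \<in> linf E \<and>
           est n \<omega> = \<phi> (emp_dist F (\<lambda>i. X i \<omega>) n) + R n \<omega>) \<and>
        \<theta> \<in> linf E \<and> outer_as_tendsto M est \<theta> \<and>
        outer_prob_tendsto_0 M (\<lambda>m \<omega>. ennreal (sqrt (real m)) * (SUP n\<in>{m..}. ennreal (norm (R n \<omega>))))"
    interpret sampled_estimator P F B E D\<phi> D0 \<phi> \<phi>' N Z M X est R
      by (rule sampled) (use * in auto)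
    have "\<theta> = \<phi>P"
      using * by (intro limit_unique) blast
    then show "weak_conv_HJ UNIV M (\<lambda>\<epsilon> \<omega>. ennreal (\<epsilon>\<^sup>2) * last_time (\<lambda>n. est n \<omega>) \<theta> \<epsilon>)
        (at_right 0) N (\<lambda>x. sq_sup F E \<phi>' (Z x))"
      using weak_conv_scaled_last_time by simp
  next
    show "zero_mean_gaussian_process ({0<..1} \<times> E) N (\<lambda>(s, e) x. bapp (\<phi>' (slice F (Z x) s)) e)"
      by (rule kiefer_mueller_image_gaussian[OF kiefer continuous_linear slice_D0])
  next
    fix N' :: "'u measure" and W s1 s2 e1 e2
    assume W: "brownian_bridge P F N' W \<and> (\<forall>x\<in>space N'. W x \<in> D0)"
      and s: "s1 \<in> {0<..1::real}" "s2 \<in> {0<..1::real}"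
    \<comment> \<open>The ordered case; the other one follows by exchanging the two factors under
      both integrals.\<close>
    have cov: "(\<integral>x. bapp (\<phi>' (slice F (Z x) s)) e * bapp (\<phi>' (slice F (Z x) t)) e' \<partial>N) =
        s * (\<integral>x. bapp (\<phi>' (W x)) e * bapp (\<phi>' (W x)) e' \<partial>N')"
      if "s \<in> {0<..1}" "t \<in> {0<..1}" "s \<le> t" for s t e e'
      by (rule kiefer_mueller_image_covariance[OF kiefer continuous_linear slice_D0]) (use W that in auto)
    show "(\<integral>x. bapp (\<phi>' (slice F (Z x) s1)) e1 * bapp (\<phi>' (slice F (Z x) s2)) e2 \<partial>N) =
      min s1 s2 * (\<integral>x. bapp (\<phi>' (W x)) e1 * bapp (\<phi>' (W x)) e2 \<partial>N')"
    proof (cases "s1 \<le> s2")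
      case True
      then show ?thesis
        using cov[OF s, of e1 e2] by simp
    next
      case False
      then show ?thesis
        using cov[OF s(2,1), of e2 e1] by (simp add: mult.commute)
    qed
  qed
qed

end
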